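(* Let $E\subset\mathbb R^2$ be compact with $\dim_{\mathcal H}(E)>5/3$. Then: (i) the set of areas of triangles determined by triples of points of $E$, $$\left\{\tfrac12\left|\det\left[x-z,\,y-z\right]\right| : x,y,z\in E\right\}\subset\mathbb R,$$ contains an open interval; and (ii) the set of radii of circles determined by triples of points of $E$ (i.e., the circumradii of the triangles with vertices $x,y,z\in E$, $x,y,z$ non-collinear) contains an open interval.
   Context: $\dim_{\mathcal H}$ denotes Hausdorff dimension. For $u,v\in\mathbb R^2$, $\det[u,v]$ is the determinant of the $2\times2$ matrix with columns $u,v$. *)

theory Defs
  imports "HOL-Analysis.Analysis"
begin

definition hausdorff_pre :: "real \<Rightarrow> real \<Rightarrow> 'a::metric_space set \<Rightarrow> ennreal" where
  "hausdorff_pre s \<delta> E =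
     (INF U \<in> {U :: nat \<Rightarrow> 'a set. E \<subseteq> (\<Union>i. U i) \<and> (\<forall>i. bounded (U i) \<and> diameter (U i) \<le> \<delta>)}.
        (\<Sum>i. ennreal (diameter (U i) powr s)))"

definition hausdorff_measure :: "real \<Rightarrow> 'a::metric_space set \<Rightarrow> ennreal" where
  "hausdorff_measure s E = (SUP \<delta> \<in> {0<..}. hausdorff_pre s \<delta> E)"

definition hausdorff_dim :: "'a::metric_space set \<Rightarrow> real" where
  "hausdorff_dim E = Inf {s. 0 < s \<and> hausdorff_measure s E = 0}"

definition det2 :: "real^2 \<Rightarrow> real^2 \<Rightarrow> real" where
  "det2 u v = det (\<chi> i j. if j = 1 then u $ i else v $ i :: real^2^2)"

end

theory Submission
  imports Defs
begin

text \<open>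
  Around points of \<open>E\<close> that are not collinear and near which \<open>E\<close> is not null in dimension
  \<open>s > 5/3\<close>, choose for every \<open>N\<close> finitely supported weights with \<open>w(B) \<le> C \<rho>\<^sup>s\<close> for sets \<open>B\<close> of
  diameter \<open>\<rho> \<ge> 2\<^sup>-\<^sup>N\<close> (Frostman). A configuration of a prescribed radius or area is a common point of
  three curves, or of a point and a line, in a dual plane. Thicken these to width \<open>\<delta> = 2\<^sup>-\<^sup>n\<close> and let \<open>F\<^sub>n(t)\<close>
  be the integral over the dual plane of the product of the weighted sums, for the prescribed value \<open>t\<close>.

  Replacing \<open>\<delta>\<close> by \<open>\<delta>/2\<close> changes a sum of tubes by a sum of profiles with vanishing mean. Transversality and
  integration by parts bound the correlation of two such profiles by \<open>min (1/\<delta>) (\<delta>/|p - q|\<^sup>2)\<close>, so the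
  change has \<open>L\<^sup>2\<close> norm at most a constant times \<open>\<delta>\<^bsup>(s-1)/2\<^esup>\<close>, whereas the sum itself is bounded by \<open>\<delta>\<^bsup>s-2\<^esup>\<close> and a sum of spots
  has \<open>L\<^sup>2\<close> norm at most \<open>\<delta>\<^bsup>(s-2)/2\<^esup>\<close>. Hence \<open>|F\<^sub>n - F\<^sub>n\<^sub>+\<^sub>1|\<close> is at most a constant times \<open>\<delta>\<^bsup>(3s-5)/2\<^esup>\<close> for circles
  and \<open>\<delta>\<^bsup>(2s-3)/2\<^esup>\<close> for areas, which is summable. By pigeonhole \<open>F\<^sub>N\<close> is bounded below at some \<open>t\<close>; as
  \<open>F\<^sub>n\<close> for a fixed coarse \<open>n\<close> is Lipschitz uniformly in the weights, \<open>F\<^sub>N > 0\<close> on a fixed interval for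
  infinitely many \<open>N\<close>. Each value there is attained up to an error of order \<open>2\<^sup>-\<^sup>N\<close>, hence exactly, by compactness.
\<close>

section \<open>Hausdorff null sets\<close>

text \<open>The two dual planes. For circles, the dual point is a centre; a point p of
  \<open>E\<close> contributes the circle of radius r about p, reduced to the arc that is a graph
  over the first axis. For areas, one vertex is kept fixed as origin; then det [p, q] = t reads q2 =
  (p2/p1) q1 + t/p1, so p contributes the point (p2/p1, t/p1) and q the line b = q2 - a q1. Why 5/3:
  in a product of three tube sums one factor is the change of scale, one is bounded in mean square,
  and the third is paid for in sup norm, so (s - 1)/2 gained must beat 2 - s lost. With a spot sum
  and a single tube sum only (2 - s)/2 is lost, and 3/2 would do. The gain comes from curves
  crossing at definite angles. Spots have no such cancellation; their change of scale is therefore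
  moved onto the tubes, which is possible exactly because a hat function is an average of translated
  hats of half the width. No limit measure occurs: the weights have resolution 2^-N, all constants
  are independent of N, and a limit is taken only for the points of \<open>E\<close> at the very
  end.\<close>

definition hnull :: "real \<Rightarrow> 'a::metric_space set \<Rightarrow> bool" where
  "hnull s A \<longleftrightarrow> (\<forall>\<epsilon>>0. \<exists>U :: nat \<Rightarrow> 'a set. A \<subseteq> (\<Union>i. U i) \<and> (\<forall>i. bounded (U i)) \<and>
     (\<Sum>i. ennreal (diameter (U i) powr s)) \<le> ennreal \<epsilon>)"

lemma hnull_subset: "hnull s B \<Longrightarrow> A \<subseteq> B \<Longrightarrow> hnull s A"
  unfolding hnull_def by (metis order_trans[of A B])

text \<open>A mesh bound comes for free: in a cover whose sum is at most
  \<open>\<delta> powr s\<close> each single term is that small, so with \<open>s > 0\<close> no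
  member has diameter above \<delta>.\<close>

lemma hnull_imp_hausdorff_measure_0:
  assumes "s > 0" "hnull s A"
  shows "hausdorff_measure s A = 0"
proof -
  have "hausdorff_pre s \<delta> A \<le> 0" if "\<delta> > 0" for \<delta>
  proof (rule ennreal_le_epsilon)
    fix e :: real assume "e > 0"
    define \<epsilon> where "\<epsilon> = min e (\<delta> powr s)"
    have "\<epsilon> > 0" using \<open>e > 0\<close> that by (simp add: \<epsilon>_def)
    then obtain U :: "nat \<Rightarrow> 'a set" where U: "A \<subseteq> (\<Union>i. U i)" "\<And>i. bounded (U i)" 
      "(\<Sum>i. ennreal (diameter (U i) powr s)) \<le> ennreal \<epsilon>"
      using assms(2) unfolding hnull_def by blast
    have "diameter (U i) \<le> \<delta>" for i
    proof -
      have "ennreal (diameter (U i) powr s) \<le> ennreal \<epsilon>"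
        using order_trans[OF sum_le_suminf[of "\<lambda>i. ennreal (diameter (U i) powr s)" "{i}"] U(3)] by simp
      then have "diameter (U i) powr s \<le> \<delta> powr s" using \<open>\<epsilon> > 0\<close> by (simp add: \<epsilon>_def)
      then show ?thesis using powr_less_mono2[of s \<delta> "diameter (U i)"] that assms(1) by linarith
    qed
    then have "hausdorff_pre s \<delta> A \<le> (\<Sum>i. ennreal (diameter (U i) powr s))"
      unfolding hausdorff_pre_def using U by (intro INF_lower) auto
    also have "\<dots> \<le> ennreal e" using U(3) by (rule order_trans) (simp add: \<epsilon>_def ennreal_leI)
    finally show "hausdorff_pre s \<delta> A \<le> 0 + ennreal e" by simp
  qed
  then have "hausdorff_measure s A \<le> 0" unfolding hausdorff_measure_def by (intro SUP_least) simp
  then show ?thesis by simp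
qed

lemma hnull_UN:
  fixes A :: "nat \<Rightarrow> 'a::metric_space set"
  assumes "\<And>i. hnull s (A i)"
  shows "hnull s (\<Union>i. A i)"
  unfolding hnull_def
proof (intro allI impI)
  fix \<epsilon> :: real assume "\<epsilon> > 0"
  have "\<exists>U :: nat \<Rightarrow> 'a set. A i \<subseteq> (\<Union>j. U j) \<and> (\<forall>j. bounded (U j)) \<and>
     (\<Sum>j. ennreal (diameter (U j) powr s)) \<le> ennreal (\<epsilon> * (1/2) ^ Suc i)" for i
  proof -
    have "\<epsilon> * (1/2) ^ Suc i > 0" using \<open>\<epsilon> > 0\<close> by simp
    then show ?thesis by (rule assms[of i, unfolded hnull_def, rule_format])
  qed
  then have "\<exists>U :: nat \<Rightarrow> nat \<Rightarrow> 'a set. \<forall>i. A i \<subseteq> (\<Union>j. U i j) \<and> (\<forall>j. bounded (U i j)) \<and>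
     (\<Sum>j. ennreal (diameter (U i j) powr s)) \<le> ennreal (\<epsilon> * (1/2) ^ Suc i)"
    by (intro choice allI)
  then obtain U :: "nat \<Rightarrow> nat \<Rightarrow> 'a set" where U0: "\<forall>i. A i \<subseteq> (\<Union>j. U i j) \<and> (\<forall>j. bounded (U i j)) \<and>
     (\<Sum>j. ennreal (diameter (U i j) powr s)) \<le> ennreal (\<epsilon> * (1/2) ^ Suc i)" ..
  have U: "A i \<subseteq> (\<Union>j. U i j)" "bounded (U i j)"
     "(\<Sum>j. ennreal (diameter (U i j) powr s)) \<le> ennreal (\<epsilon> * (1/2) ^ Suc i)" for i j
    by (simp_all only: U0)
  define V where "V n = U (fst (prod_decode n)) (snd (prod_decode n))" for n
  have "(\<Union>i. A i) \<subseteq> (\<Union>n. V n)"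
  proof
    fix x assume "x \<in> (\<Union>i. A i)"
    then obtain i j where "x \<in> U i j" using U(1) by blast
    then have "x \<in> V (prod_encode (i, j))" by (simp add: V_def)
    then show "x \<in> (\<Union>n. V n)" by blast
  qed
  moreover have "(\<Sum>n. ennreal (diameter (V n) powr s)) \<le> ennreal \<epsilon>"
  proof -
    have "(\<Sum>n. ennreal (diameter (V n) powr s)) = (\<Sum>i. \<Sum>j. ennreal (diameter (U i j) powr s))"
      unfolding V_def
      by (rule suminf_ennreal_2dimen[where f = "\<lambda>p. ennreal (diameter (U (fst p) (snd p)) powr s)"]) simp
    also have "\<dots> \<le> (\<Sum>i. ennreal (\<epsilon> * (1/2) ^ Suc i))" by (intro suminf_le U(3) summableI)
    also have "\<dots> = ennreal (\<Sum>i. \<epsilon> * (1/2) ^ Suc i)"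
      using \<open>\<epsilon> > 0\<close> sums_summable[OF sums_mult[OF power_half_series, of \<epsilon>]] by (intro suminf_ennreal2) auto
    also have "(\<Sum>i. \<epsilon> * (1/2) ^ Suc i) = \<epsilon>"
      using sums_unique[OF sums_mult[OF power_half_series, of \<epsilon>]] by simp
    finally show ?thesis .
  qed
  moreover have "\<forall>i. bounded (V i)" using U(2) by (simp add: V_def)
  ultimately show "\<exists>U :: nat \<Rightarrow> 'a set. (\<Union>i. A i) \<subseteq> (\<Union>i. U i) \<and> (\<forall>i. bounded (U i)) \<and>
     (\<Sum>i. ennreal (diameter (U i) powr s)) \<le> ennreal \<epsilon>"
    by (intro exI[of _ V] conjI)
qed

lemma hnull_empty: "hnull s {}"
  unfolding hnull_def by (auto intro!: exI[of _ "\<lambda>_. {}"])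

lemma hnull_Un: "hnull s A \<Longrightarrow> hnull s B \<Longrightarrow> hnull s (A \<union> B)"
  using hnull_UN[of s "\<lambda>i. if i = 0 then A else B"] by (rule hnull_subset) (auto split: if_splits)

lemma hnull_Union:
  assumes "countable F" "\<And>A. A \<in> F \<Longrightarrow> hnull s A"
  shows "hnull s (\<Union>F)"
proof (cases "F = {}")
  case True
  then show ?thesis by (simp add: hnull_empty)
next
  case False
  then have "hnull s (\<Union>i. from_nat_into F i)"
    by (intro hnull_UN assms(2) from_nat_into)
  then show ?thesis using range_from_nat_into[OF False assms(1)] by simp
qed

text \<open>A finite cover becomes a sequence by padding with empty sets, whose terms vanish. The
  index type is left free so that a cover can be indexed by its own dyadic classes.\<close>

lemma not_hnull_cover_sum:
  assumes "\<not> hnull s A"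
  shows "\<exists>\<epsilon>>0. \<forall>(\<C> :: 'i set) U. finite \<C> \<longrightarrow> A \<subseteq> (\<Union>i\<in>\<C>. U i) \<longrightarrow> (\<forall>i\<in>\<C>. bounded (U i)) \<longrightarrow>
      \<epsilon> \<le> (\<Sum>i\<in>\<C>. diameter (U i) powr s)"
proof -
  obtain \<epsilon> where \<epsilon>: "\<epsilon> > 0" and n: "\<And>U :: nat \<Rightarrow> 'a set. A \<subseteq> (\<Union>i. U i) \<Longrightarrow> (\<forall>i. bounded (U i)) \<Longrightarrow>
     \<not> (\<Sum>i. ennreal (diameter (U i) powr s)) \<le> ennreal \<epsilon>"
    using assms unfolding hnull_def by blast
  have "\<epsilon> \<le> (\<Sum>i\<in>\<C>. diameter (U i) powr s)"
    if C: "finite \<C>" "A \<subseteq> (\<Union>i\<in>\<C>. U i)" "\<And>i. i \<in> \<C> \<Longrightarrow> bounded (U i)" for \<C> :: "'i set" and U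
  proof -
    obtain f where f: "bij_betw f {..<card \<C>} \<C>"
      using ex_bij_betw_nat_finite[OF C(1)] by (auto simp: atLeast0LessThan)
    define V where "V i = (if i < card \<C> then U (f i) else {})" for i
    have "A \<subseteq> (\<Union>i. V i)"
    proof
      fix x assume "x \<in> A"
      then obtain c where c: "c \<in> \<C>" "x \<in> U c" using C(2) by blast
      then obtain i where "i < card \<C>" "f i = c" using f unfolding bij_betw_def by (metis imageE lessThan_iff)
      then show "x \<in> (\<Union>i. V i)" using c by (auto simp: V_def intro!: exI[of _ i])
    qed
    moreover have "bounded (V i)" for i using C(3) f by (auto simp: V_def bij_betw_def)
    ultimately have "\<not> (\<Sum>i. ennreal (diameter (V i) powr s)) \<le> ennreal \<epsilon>" using n by blast
    also have "(\<Sum>i. ennreal (diameter (V i) powr s)) = (\<Sum>i<card \<C>. ennreal (diameter (V i) powr s))"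
      by (rule suminf_finite) (auto simp: V_def)
    also have "\<dots> = ennreal (\<Sum>i<card \<C>. diameter (U (f i)) powr s)"
      by (subst sum_ennreal) (auto simp: V_def)
    also have "(\<Sum>i<card \<C>. diameter (U (f i)) powr s) = (\<Sum>i\<in>\<C>. diameter (U i) powr s)"
      by (rule sum.reindex_bij_betw[OF f])
    finally have "\<not> (\<Sum>i\<in>\<C>. diameter (U i) powr s) \<le> \<epsilon>" using ennreal_leI by blast
    then show ?thesis by simp
  qed
  then show ?thesis using \<epsilon> by (intro exI[of _ \<epsilon>] conjI allI impI) blast+
qed

text \<open>N pieces of a segment cost N times a multiple of (1/N)^s, which tends to 0 because
  \<open>s > 1\<close>. This is what forces a non-null set to contain a genuine triangle.\<close>

lemma hnull_collinear:
  fixes A :: "'a::euclidean_space set"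
  assumes "s > 1" "collinear A" "bounded A"
  shows "hnull s A"
proof (cases "A = {}")
  case True
  then show ?thesis by (simp add: hnull_empty)
next
  case False
  then obtain x0 where x0: "x0 \<in> A" by blast
  obtain u where u: "\<And>x y. x \<in> A \<Longrightarrow> y \<in> A \<Longrightarrow> \<exists>c. x - y = c *\<^sub>R u"
    using assms(2) unfolding collinear_def by blast
  obtain B where B: "\<And>x. x \<in> A \<Longrightarrow> dist x0 x \<le> B" using bounded_any_center[of A x0] assms(3) by auto
  have "B \<ge> 0" using B[OF x0] by simp
  \<comment> \<open>For \<open>u = 0\<close> this is the zero vector, which is why only
    \<open>norm v \<le> 1\<close> is claimed.\<close>
  define v where "v = u /\<^sub>R norm u"
  have v: "norm v \<le> 1" by (cases "u = 0") (simp_all add: v_def)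
  have Av: "\<exists>c. \<bar>c\<bar> \<le> B \<and> x = x0 + c *\<^sub>R v" if "x \<in> A" for x
  proof (cases "u = 0")
    case True
    then show ?thesis using u[OF that x0] \<open>B \<ge> 0\<close> by (intro exI[of _ 0]) auto
  next
    case False
    obtain c where c: "x - x0 = c *\<^sub>R u" using u[OF \<open>x \<in> A\<close> x0] by blast
    have "x = x0 + (c * norm u) *\<^sub>R v" using c False by (simp add: v_def algebra_simps)
    moreover have "\<bar>c * norm u\<bar> \<le> B" using B[OF \<open>x \<in> A\<close>] c by (simp add: dist_norm norm_minus_commute[of x0] abs_mult)
    ultimately show ?thesis by blast
  qed
  show ?thesis unfolding hnull_def
  proof (intro allI impI)
    fix \<epsilon> :: real assume \<epsilon>: "\<epsilon> > 0"
    have "(\<lambda>N. (2 * B + 1) powr s * (real N powr (1 - s))) \<longlonglongrightarrow> (2 * B + 1) powr s * 0"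
      by (intro tendsto_mult tendsto_const tendsto_neg_powr filterlim_real_sequentially) (use assms in auto)
    then have "\<forall>\<^sub>F N in sequentially. (2 * B + 1) powr s * (real N powr (1 - s)) < \<epsilon>"
      using \<epsilon> by (intro order_tendstoD) auto
    then have "\<forall>\<^sub>F N in sequentially. (2 * B + 1) powr s * (real N powr (1 - s)) < \<epsilon> \<and> N > 0"
      by (intro eventually_conj eventually_gt_at_top)
    then obtain N where N: "(2 * B + 1) powr s * (real N powr (1 - s)) < \<epsilon>" "N > 0"
      by (auto simp: eventually_sequentially)
    \<comment> \<open>One more than the length \<open>2 * B\<close>: this keeps \<open>h\<close>
      positive when \<open>B = 0\<close> and gives the right endpoint an index strictly below
      \<open>N\<close>.\<close>
    define h where "h = (2 * B + 1) / N"
    have h: "h > 0" using N \<open>B \<ge> 0\<close> by (simp add: h_def)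
    define U where "U i = (if i < N then (\<lambda>c. x0 + c *\<^sub>R v) ` {-B + i * h..-B + Suc i * h} else {})" for i :: nat
    have bd: "bounded (U i)" for i
      unfolding U_def by (auto intro!: compact_imp_bounded compact_continuous_image continuous_intros)
    have "diameter (U i) \<le> h" for i
    proof (rule diameter_le)
      show "U i \<noteq> {} \<or> 0 \<le> h" using h by simp
      fix x y assume xU: "x \<in> U i" and yU: "y \<in> U i"
      have U_D: "\<exists>c. z = x0 + c *\<^sub>R v \<and> -B + i * h \<le> c \<and> c \<le> -B + Suc i * h" if "z \<in> U i" for z
        using that by (cases "i < N") (auto simp only: U_def if_True if_False image_iff atLeastAtMost_iff empty_iff)
      obtain c d where cd: "x = x0 + c *\<^sub>R v" "y = x0 + d *\<^sub>R v" 
        "-B + i * h \<le> c" "-B + i * h \<le> d" "c \<le> -B + Suc i * h" "d \<le> -B + Suc i * h"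
        using U_D[OF xU] U_D[OF yU] by blast
      have "norm (x - y) = \<bar>c - d\<bar> * norm v" using cd by (simp flip: scaleR_diff_left)
      also have "\<dots> \<le> \<bar>c - d\<bar> * 1" using v by (intro mult_left_mono) auto
      also have "\<bar>c - d\<bar> * 1 \<le> h" using cd by (simp add: algebra_simps abs_le_iff)
      finally show "norm (x - y) \<le> h" .
    qed
    then have dU: "diameter (U i) powr s \<le> h powr s" for i
      using diameter_ge_0[OF bd] assms(1) by (intro powr_mono2) auto
    have "A \<subseteq> (\<Union>i. U i)"
    proof
      fix x assume "x \<in> A"
      then obtain c where c: "\<bar>c\<bar> \<le> B" "x = x0 + c *\<^sub>R v" using Av by blast
      define i where "i = nat \<lfloor>(c + B) / h\<rfloor>"
      have nn: "(c + B) / h \<ge> 0" using c h by simp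
      have i1: "real i \<le> (c + B) / h" "(c + B) / h < real i + 1" using nn unfolding i_def by linarith+
      then have i2: "i * h \<le> c + B" "c + B < (i + 1) * h" using h by (auto simp: field_simps)
      have "i * h < N * h" using i2 c N \<open>B \<ge> 0\<close> by (simp add: h_def)
      then have "i < N" using h by simp
      then have "x \<in> U i" using c i2 by (auto simp: U_def algebra_simps intro!: image_eqI[of _ _ c])
      then show "x \<in> (\<Union>i. U i)" by blast
    qed
    moreover have "(\<Sum>i. ennreal (diameter (U i) powr s)) \<le> ennreal \<epsilon>"
    proof -
      have "(\<Sum>i. ennreal (diameter (U i) powr s)) = (\<Sum>i<N. ennreal (diameter (U i) powr s))"
        by (rule suminf_finite) (auto simp: U_def)
      also have "\<dots> = ennreal (\<Sum>i<N. diameter (U i) powr s)" by (simp add: sum_ennreal)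
      also have "\<dots> \<le> ennreal (\<Sum>i<N. h powr s)" by (intro ennreal_leI sum_mono dU)
      also have "(\<Sum>i<N. h powr s) = (2 * B + 1) powr s * (real N powr (1 - s))"
        using N \<open>B \<ge> 0\<close> by (simp add: h_def powr_divide powr_diff)
      also have "ennreal \<dots> \<le> ennreal \<epsilon>" using N by (intro ennreal_leI) simp
      finally show ?thesis .
    qed
    ultimately show "\<exists>U :: nat \<Rightarrow> 'a set. A \<subseteq> (\<Union>i. U i) \<and> (\<forall>i. bounded (U i)) \<and>
     (\<Sum>i. ennreal (diameter (U i) powr s)) \<le> ennreal \<epsilon>" using bd by (intro exI[of _ U] conjI allI)
  qed
qed

text \<open>Points with a null neighbourhood are covered by countably many null pieces (Lindelof),
  so they form a null set. The remaining points are not null, hence not on one line, and any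
  noncollinear triple among them will do.\<close>

lemma noncollinear_fat_points:
  fixes E :: "'a::euclidean_space set"
  assumes "s > 1" "bounded E" "\<not> hnull s E"
  obtains x y z where "x \<in> E" "y \<in> E" "z \<in> E" "\<not> collinear {x, y, z}"
    "\<And>u \<eta>. u \<in> {x, y, z} \<Longrightarrow> \<eta> > 0 \<Longrightarrow> \<not> hnull s (E \<inter> ball u \<eta>)"
proof -
  define S where "S = {x \<in> E. \<forall>\<eta>>0. \<not> hnull s (E \<inter> ball x \<eta>)}"
  have "hnull s (E - S)"
  proof -
    define F where "F = {ball x \<eta> | x \<eta>. hnull s (E \<inter> ball x \<eta>)}"
    have op: "open B" if "B \<in> F" for B using that unfolding F_def by blast
    obtain F' where F': "F' \<subseteq> F" "countable F'" "\<Union>F' = \<Union>F"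
      by (rule Lindelof[OF op])
    have "E - S \<subseteq> \<Union>F"
    proof
      fix x assume "x \<in> E - S"
      then obtain \<eta> where "\<eta> > 0" "hnull s (E \<inter> ball x \<eta>)" by (auto simp: S_def)
      then have "x \<in> ball x \<eta>" "ball x \<eta> \<in> F" by (auto simp: F_def)
      then show "x \<in> \<Union>F" by blast
    qed
    then have "E - S \<subseteq> \<Union>((\<lambda>B. E \<inter> B) ` F')" using F'(3) by auto
    moreover have "hnull s (\<Union>((\<lambda>B. E \<inter> B) ` F'))"
    proof (rule hnull_Union)
      show "countable ((\<lambda>B. E \<inter> B) ` F')" using F'(2) by simp
      fix A assume "A \<in> (\<lambda>B. E \<inter> B) ` F'"
      then obtain B where "B \<in> F" "A = E \<inter> B" using F'(1) by blast
      then show "hnull s A" by (auto simp: F_def)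
    qed
    ultimately show ?thesis by (rule hnull_subset[rotated])
  qed
  moreover have "\<not> hnull s (S \<union> (E - S))"
    using assms(3) hnull_subset[of s "S \<union> (E - S)" E] by blast
  ultimately have "\<not> hnull s S" using hnull_Un[of s S "E - S"] by blast
  moreover have "bounded S" using assms(2) by (rule bounded_subset) (auto simp: S_def)
  ultimately have nc: "\<not> collinear S" using hnull_collinear[OF assms(1), of S] by blast
  then have "S \<noteq> {}" by (metis collinear_empty)
  then obtain x where x: "x \<in> S" by blast
  have "S \<noteq> {x}" using nc by (metis collinear_sing)
  then obtain y where xy: "x \<in> S" "y \<in> S" "x \<noteq> y" using x by blast
  have "\<not> collinear (insert x (insert y S))" using nc xy by (simp add: insert_absorb)
  then obtain z where "z \<in> S" "\<not> collinear {x, y, z}" using collinear_triples[OF xy(3)] by blast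
  moreover have S: "u \<in> E" "\<eta> > 0 \<Longrightarrow> \<not> hnull s (E \<inter> ball u \<eta>)" if "u \<in> S" for u \<eta>
    using that by (auto simp: S_def)
  ultimately show ?thesis using xy by (intro that[of x y z]) (blast intro: S)+
qed

section \<open>Discrete Frostman weights\<close>

text \<open>The induction climbs from the finest scale upwards and rescales a class only if it exceeds its
  capacity, so that every point keeps a saturated class; the saturated classes then form a cover.\<close>
lemma tight_weights:
  fixes code :: "nat \<Rightarrow> 'p \<Rightarrow> 'c" and cap :: "nat \<Rightarrow> real"
  assumes fin: "finite X" and inj: "inj_on (code N) X" and cap: "\<And>k. cap k > 0"
    and nest: "\<And>k x y. code (Suc k) x = code (Suc k) y \<Longrightarrow> code k x = code k y"
    and j: "j \<le> N"
  shows "\<exists>w. (\<forall>x. 0 \<le> w x) \<and>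
    (\<forall>k. N - j \<le> k \<and> k \<le> N \<longrightarrow> (\<forall>x\<in>X. sum w {y\<in>X. code k y = code k x} \<le> cap k)) \<and>
    (\<forall>x\<in>X. \<exists>k. N - j \<le> k \<and> k \<le> N \<and> sum w {y\<in>X. code k y = code k x} = cap k)"
  using j
proof (induction j)
  case 0
  have "{y\<in>X. code N y = code N x} = {x}" if "x \<in> X" for x
  proof (intro set_eqI iffI)
    fix y assume "y \<in> {y\<in>X. code N y = code N x}"
    then show "y \<in> {x}" using inj_onD[OF inj, of y x] that by simp
  qed (use that in simp)
  then have c: "(\<Sum>y\<in>{y\<in>X. code N y = code N x}. cap N) = cap N" if "x \<in> X" for x using that by simp
  show ?case
  proof (intro exI[of _ "\<lambda>_. cap N"] conjI allI ballI impI)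
    show "0 \<le> cap N" using cap by (rule less_imp_le)
  next
    fix k x assume "N - 0 \<le> k \<and> k \<le> N" "x \<in> X"
    then show "(\<Sum>y\<in>{y\<in>X. code k y = code k x}. cap N) \<le> cap k" using c[of x] by (metis diff_zero le_antisym order_refl)
  next
    fix x assume "x \<in> X"
    then show "\<exists>k. N - 0 \<le> k \<and> k \<le> N \<and> (\<Sum>y\<in>{y\<in>X. code k y = code k x}. cap N) = cap k"
      using c[of x] by (intro exI[of _ N]) simp
  qed
next
  case (Suc j)
  define l where "l = N - Suc j"
  have l: "N - j = Suc l" using Suc.prems by (simp add: l_def)
  obtain w where w: "(\<forall>x. 0 \<le> w x) \<and>
    (\<forall>k. Suc l \<le> k \<and> k \<le> N \<longrightarrow> (\<forall>x\<in>X. sum w {y\<in>X. code k y = code k x} \<le> cap k)) \<and>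
    (\<forall>x\<in>X. \<exists>k. Suc l \<le> k \<and> k \<le> N \<and> sum w {y\<in>X. code k y = code k x} = cap k)"
    using Suc.IH[OF Suc_leD[OF Suc.prems], unfolded l] by (elim exE) (rule that)
  have w0: "\<And>x. 0 \<le> w x" using w by (elim conjE) simp
  have w1: "sum w {y\<in>X. code k y = code k x} \<le> cap k" if "Suc l \<le> k" "k \<le> N" "x \<in> X" for k x
    using w that by (elim conjE) simp
  have w2: "\<exists>k. Suc l \<le> k \<and> k \<le> N \<and> sum w {y\<in>X. code k y = code k x} = cap k" if "x \<in> X" for x
    using w that by (elim conjE) simp
  define W where "W x = sum w {y\<in>X. code l y = code l x}" for x
  have W0: "W x \<ge> 0" for x unfolding W_def by (intro sum_nonneg w0)
  define f where "f x = (if W x \<le> cap l then 1 else cap l / W x)" for x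
  have f: "0 \<le> f x" "f x \<le> 1" for x using cap[of l] W0[of x] by (auto simp: f_def)
  have nest': "code l x = code l y" if "code k x = code k y" "l \<le> k" for k x y
    using that(2,1)
  proof (induction rule: dec_induct)
    case base
    then show ?case .
  next
    case (step n)
    then show ?case using nest[of n x y] by simp
  qed
  have fW: "W y = W x" "f y = f x" if "code l y = code l x" for x y using that by (auto simp: f_def W_def)
  \<comment> \<open>A class of a finer level lies inside one class of level \<open>l\<close>, where
    \<open>f\<close> is constant, so its mass is multiplied by a single factor.\<close>
  have sum': "(\<Sum>y | y \<in> X \<and> code k y = code k x. f y * w y) = f x * sum w {y\<in>X. code k y = code k x}"
    if "l \<le> k" for k x
  proof -
    have "f y * w y = f x * w y" if "code k y = code k x" for y
      using fW(2)[OF nest'[OF that \<open>l \<le> k\<close>]] by simp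
    then show ?thesis unfolding sum_distrib_left by (intro sum.cong) simp_all
  qed
  have le: "(\<Sum>y | y \<in> X \<and> code k y = code k x. f y * w y) \<le> sum w {y\<in>X. code k y = code k x}" for k x
    using f w0 by (intro sum_mono) (simp add: mult_left_le_one_le)
  have at_l: "(\<Sum>y | y \<in> X \<and> code l y = code l x. f y * w y) = (if W x \<le> cap l then W x else cap l)" for x
    unfolding sum'[OF order_refl] W_def[symmetric] using cap[of l] W0[of x] by (simp add: f_def)
  show ?case
  proof (intro exI[of _ "\<lambda>y. f y * w y"] conjI allI ballI impI)
    show "0 \<le> f x * w x" for x using f w0 by simp
  next
    fix k x assume k: "N - Suc j \<le> k \<and> k \<le> N" and x: "x \<in> X"
    show "(\<Sum>y | y \<in> X \<and> code k y = code k x. f y * w y) \<le> cap k"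
    proof (cases "k = l")
      case True
      then show ?thesis using at_l[of x] by simp
    next
      case False
      then have "Suc l \<le> k" using k by (simp add: l_def)
      then show ?thesis using w1[of k x] k x le[of k x] by linarith
    qed
  next
    fix x assume x: "x \<in> X"
    show "\<exists>k. N - Suc j \<le> k \<and> k \<le> N \<and> (\<Sum>y | y \<in> X \<and> code k y = code k x. f y * w y) = cap k"
    \<comment> \<open>Within capacity the factor is 1 and the saturated finer class of
      \<open>x\<close> keeps its mass; above capacity the rescaled class of level \<open>l\<close>
      becomes saturated itself.\<close>
    proof (cases "W x \<le> cap l")
      case True
      then have "f x = 1" by (simp add: f_def)
      obtain k where k: "Suc l \<le> k" "k \<le> N" "sum w {y\<in>X. code k y = code k x} = cap k" using w2[OF x] by blast
      then show ?thesis using sum'[of k x] \<open>f x = 1\<close> by (intro exI[of _ k]) (simp add: l_def[symmetric])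
    next
      case False
      then show ?thesis using at_l[of x] Suc.prems by (intro exI[of _ l]) (simp add: l_def)
    qed
  qed
qed

section \<open>Dyadic squares and Frostman weights\<close>

definition dyadic :: "nat \<Rightarrow> real^2 \<Rightarrow> int \<times> int" where
  "dyadic k x = (\<lfloor>2 ^ k * x $ 1\<rfloor>, \<lfloor>2 ^ k * x $ 2\<rfloor>)"

lemma dyadic_Suc: "dyadic (Suc k) x = dyadic (Suc k) y \<Longrightarrow> dyadic k x = dyadic k y"
proof -
  have "\<lfloor>2 ^ k * a\<rfloor> = \<lfloor>2 ^ Suc k * a\<rfloor> div 2" for a :: real
    using floor_divide_real_eq_div[of 2 "2 ^ Suc k * a"] by simp
  then show "dyadic (Suc k) x = dyadic (Suc k) y \<Longrightarrow> dyadic k x = dyadic k y"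
    unfolding dyadic_def by (metis fst_conv snd_conv)
qed

lemma dyadic_mono:
  assumes "k \<le> l" "dyadic l x = dyadic l y"
  shows "dyadic k x = dyadic k y"
  using assms
proof (induction l rule: dec_induct)
  case (step n)
  then show ?case using dyadic_Suc[of n x y] by simp
qed simp

lemma dist_real2: "dist x y = sqrt ((x $ 1 - y $ 1)\<^sup>2 + (x $ 2 - y $ 2)\<^sup>2)" for x y :: "real^2"
  by (simp add: dist_vec_def L2_set_def sum_2 dist_real_def)

lemma dist_real2_le: "dist x y \<le> \<bar>x $ 1 - y $ 1\<bar> + \<bar>x $ 2 - y $ 2\<bar>" for x y :: "real^2"
  unfolding dist_real2 by (rule sqrt_sum_squares_le_sum_abs)

lemma dyadic_eq_imp_dist:
  assumes "dyadic k x = dyadic k y"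
  shows "dist x y \<le> 2 * (1/2) ^ k"
proof -
  have "\<bar>a - b\<bar> \<le> (1/2) ^ k" if "\<lfloor>2 ^ k * a\<rfloor> = \<lfloor>2 ^ k * b\<rfloor>" for a b :: real
  proof -
    have "\<bar>2 ^ k * a - 2 ^ k * b\<bar> \<le> 1" using that by linarith
    then have "2 ^ k * \<bar>a - b\<bar> \<le> 1" by (simp add: abs_mult flip: right_diff_distrib)
    then show ?thesis by (simp add: power_one_over field_simps)
  qed
  then have "\<bar>x $ 1 - y $ 1\<bar> \<le> (1/2) ^ k" "\<bar>x $ 2 - y $ 2\<bar> \<le> (1/2) ^ k"
    using assms by (auto simp: dyadic_def)
  then show ?thesis using dist_real2_le[of x y] by linarith
qed

lemma finite_dyadic_image:
  assumes "bounded F"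
  shows "finite (dyadic k ` F)"
proof -
  obtain B where B: "\<And>x. x \<in> F \<Longrightarrow> norm x \<le> B" using assms by (auto simp: bounded_iff)
  define Z where "Z = \<lceil>2 ^ k * B\<rceil> + 1"
  have "\<lfloor>2 ^ k * x $ i\<rfloor> \<in> {-Z..Z}" if "x \<in> F" for x i
  proof -
    have "\<bar>x $ i\<bar> \<le> B" using B[OF that] component_le_norm_cart[of x i] by linarith
    then have "\<bar>2 ^ k * x $ i\<bar> \<le> 2 ^ k * B" by (simp add: abs_mult)
    then show ?thesis unfolding Z_def atLeastAtMost_iff by linarith
  qed
  then have "dyadic k ` F \<subseteq> {-Z..Z} \<times> {-Z..Z}" by (auto simp: dyadic_def)
  then show ?thesis by (rule finite_subset) simp
qed

text \<open>The largest saturated squares are disjoint and cover \<open>F\<close>. Their capacities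
  add up to the total mass, and since \<open>F\<close> is not null these capacities cannot be small
  in sum. Conversely a set of diameter \<rho> meets at most nine squares of comparable side, each
  within its capacity.\<close>

lemma discrete_frostman:
  fixes F :: "(real^2) set"
  assumes s: "s > 0" and nn: "\<not> hnull s F" and F: "F \<subseteq> cball x\<^sub>0 (1/2)"
  obtains c C where "c > 0" "C > 0"
    "\<And>N :: nat. \<exists>P w. finite P \<and> P \<subseteq> F \<and> (\<forall>p. 0 \<le> w p) \<and> c \<le> sum w P \<and>
       (\<forall>T \<rho>. T \<subseteq> P \<longrightarrow> (1/2) ^ N \<le> \<rho> \<longrightarrow> (\<forall>p\<in>T. \<forall>q\<in>T. dist p q \<le> \<rho>) \<longrightarrow> sum w T \<le> C * \<rho> powr s)"
proof -
  obtain \<epsilon> where \<epsilon>: "\<epsilon> > 0" and cover: "\<forall>(\<C> :: (real^2) set set) U. finite \<C> \<longrightarrow> F \<subseteq> (\<Union>i\<in>\<C>. U i) \<longrightarrow>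
      (\<forall>i\<in>\<C>. bounded (U i)) \<longrightarrow> \<epsilon> \<le> (\<Sum>i\<in>\<C>. diameter (U i) powr s)"
    using not_hnull_cover_sum[OF nn, where 'i = "(real^2) set"] by (elim exE conjE)
  define cap where "cap k = ((1/2) ^ k) powr s" for k :: nat
  have cap: "cap k > 0" for k by (simp add: cap_def)
  show ?thesis
  \<comment> \<open>A square of level k has diameter at most 2 * 2^-k, which costs
    \<open>2 powr s\<close> in the lower bound. In the upper bound 9 counts neighbouring squares,
    and \<open>2 powr s\<close> comes from choosing the side up to
    \<open>2 * \<rho>\<close>.\<close>
  proof (rule that[of "\<epsilon> / 2 powr s" "9 * 2 powr s"])
    show "\<epsilon> / 2 powr s > 0" using \<epsilon> by simp
    show "0 < 9 * 2 powr s" by simp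
    fix N :: nat
    have bF: "bounded F" using F by (rule bounded_subset[OF bounded_cball])
    \<comment> \<open>One representative per occupied square of the finest level, so that the code
      of level \<open>N\<close> is injective as \<open>tight_weights\<close> demands.\<close>
    obtain X where X: "X \<subseteq> F" "inj_on (dyadic N) X" "dyadic N ` X = dyadic N ` F"
      using subset_image_inj[of "dyadic N ` F" "dyadic N" F] by auto
    have fin: "finite X" 
      by (rule finite_imageD[OF _ X(2)]) (simp add: X(3) finite_dyadic_image[OF bF])
    have "\<exists>w. (\<forall>x. 0 \<le> w x) \<and>
        (\<forall>k. N - N \<le> k \<and> k \<le> N \<longrightarrow> (\<forall>x\<in>X. sum w {y\<in>X. dyadic k y = dyadic k x} \<le> cap k)) \<and>
        (\<forall>x\<in>X. \<exists>k. N - N \<le> k \<and> k \<le> N \<and> sum w {y\<in>X. dyadic k y = dyadic k x} = cap k)"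
      by (rule tight_weights[where code = dyadic and N = N and cap = cap, OF fin X(2) cap _ order_refl]) (rule dyadic_Suc)
    then obtain w :: "real^2 \<Rightarrow> real" where w: "(\<forall>x. 0 \<le> w x) \<and>
        (\<forall>k. N - N \<le> k \<and> k \<le> N \<longrightarrow> (\<forall>x\<in>X. sum w {y\<in>X. dyadic k y = dyadic k x} \<le> cap k)) \<and>
        (\<forall>x\<in>X. \<exists>k. N - N \<le> k \<and> k \<le> N \<and> sum w {y\<in>X. dyadic k y = dyadic k x} = cap k)" ..
    have w0: "\<And>x. 0 \<le> w x" using w by (elim conjE) simp
    have w1: "sum w {y\<in>X. dyadic k y = dyadic k x} \<le> cap k" if "k \<le> N" "x \<in> X" for k x
      using w that by (elim conjE) simp
    have w2: "\<exists>k. k \<le> N \<and> sum w {y\<in>X. dyadic k y = dyadic k x} = cap k" if "x \<in> X" for x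
      using w that by (elim conjE) simp
    \<comment> \<open>The least level means the largest saturated square around
      \<open>x\<close>.\<close>
    define K where "K x = (LEAST k. k \<le> N \<and> sum w {y\<in>X. dyadic k y = dyadic k x} = cap k)" for x
    have K: "K x \<le> N" "sum w {y\<in>X. dyadic (K x) y = dyadic (K x) x} = cap (K x)" if "x \<in> X" for x
      using LeastI_ex[OF w2[OF that]] by (auto simp: K_def)
    have K_le: "K x \<le> k" if "k \<le> N" "sum w {y\<in>X. dyadic k y = dyadic k x} = cap k" for x k
      unfolding K_def by (rule Least_le) (use that in auto)
    define cl where "cl x = {y\<in>X. dyadic (K x) y = dyadic (K x) x}" for x
    \<comment> \<open>If two such squares meet, the finer lies in the coarser. The coarser is then a
      saturated square of both points, and minimality makes the levels equal.\<close>
    have cl_eq: "cl x = cl y" if "x \<in> X" "y \<in> X" "z \<in> cl x" "z \<in> cl y" "K x \<le> K y" for x y z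
    proof -
      have xz: "dyadic (K x) z = dyadic (K x) x" using that by (simp add: cl_def)
      have "dyadic (K x) z = dyadic (K x) y" using that dyadic_mono[OF that(5), of z y] by (simp add: cl_def)
      then have xy: "dyadic (K x) x = dyadic (K x) y" using xz by simp
      have "K y \<le> K x" by (rule K_le) (use K[OF that(1)] xy in simp_all)
      then have "K x = K y" using that by simp
      then show ?thesis using xy by (simp add: cl_def)
    qed
    define \<C> where "\<C> = cl ` X"
    have disj: "A \<inter> B = {}" if AB: "A \<in> \<C>" "B \<in> \<C>" "A \<noteq> B" for A B
    proof -
      obtain x y where xy: "x \<in> X" "y \<in> X" "A = cl x" "B = cl y" using AB by (auto simp: \<C>_def)
      have "z \<notin> cl y" if "z \<in> cl x" for z
        using cl_eq[OF xy(1,2) that] cl_eq[OF xy(2,1) _ that] AB(3) xy(3,4) linear[of "K x" "K y"] by auto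
      then show ?thesis using xy by blast
    qed
    define r where "r A = (SOME x. x \<in> X \<and> A = cl x)" for A
    have r: "r A \<in> X" "A = cl (r A)" if "A \<in> \<C>" for A
      using someI_ex[of "\<lambda>x. x \<in> X \<and> A = cl x"] that by (auto simp: \<C>_def r_def)
    \<comment> \<open>The whole square of the plane rather than its points in \<open>X\<close>: a
      point of \<open>F\<close> shares its finest square with some point of \<open>X\<close>, hence
      also the larger saturated square of that point.\<close>
    define U where "U A = {p. dyadic (K (r A)) p = dyadic (K (r A)) (r A)}" for A
    have self: "x \<in> cl x" if "x \<in> X" for x using that by (simp add: cl_def)
    have UX: "\<Union>\<C> = X"
    proof
      show "\<Union>\<C> \<subseteq> X" unfolding \<C>_def cl_def by blast
      show "X \<subseteq> \<Union>\<C>" unfolding \<C>_def using self by blast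
    qed
    have finC: "finite \<C>" using fin by (simp add: \<C>_def)
    have dU: "dist p q \<le> 2 * (1/2) ^ K (r A)" if "p \<in> U A" "q \<in> U A" for p q A
      using that by (intro dyadic_eq_imp_dist) (simp add: U_def)
    have bU: "bounded (U A)" for A
    proof -
      have "r A \<in> U A" by (simp add: U_def)
      then have "U A \<subseteq> cball (r A) (2 * (1/2) ^ K (r A))" unfolding cball_def using dU[of "r A" A] by blast
      then show ?thesis by (rule bounded_subset[OF bounded_cball])
    qed
    have diU: "diameter (U A) powr s \<le> 2 powr s * cap (K (r A))" for A
    proof -
      have "diameter (U A) \<le> 2 * (1/2) ^ K (r A)" 
      proof (rule diameter_le)
        show "norm (p - q) \<le> 2 * (1/2) ^ K (r A)" if "p \<in> U A" "q \<in> U A" for p q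
          using dU[OF that] by (simp only: dist_norm)
      qed simp
      then have "diameter (U A) powr s \<le> (2 * (1/2) ^ K (r A)) powr s"
        using s diameter_ge_0[OF bU] by (intro powr_mono2) auto
      then show ?thesis by (simp add: powr_mult cap_def)
    qed
    have "F \<subseteq> (\<Union>A\<in>\<C>. U A)"
    proof
      fix p assume "p \<in> F"
      then have "dyadic N p \<in> dyadic N ` X" unfolding X(3) by (rule imageI)
      then obtain x where x: "x \<in> X" "dyadic N p = dyadic N x" by (elim imageE) (rule that)
      have C: "cl x \<in> \<C>" using x by (simp add: \<C>_def)
      have "x \<in> cl (r (cl x))" by (subst r(2)[OF C, symmetric]) (rule self[OF x(1)])
      then have "dyadic (K (r (cl x))) x = dyadic (K (r (cl x))) (r (cl x))"
        unfolding cl_def[of "r (cl x)"] by blast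
      moreover have "dyadic (K (r (cl x))) p = dyadic (K (r (cl x))) x"
        by (rule dyadic_mono[OF K(1)[OF r(1)[OF C]] x(2)])
      ultimately have "p \<in> U (cl x)" unfolding U_def by simp
      then show "p \<in> (\<Union>A\<in>\<C>. U A)" by (rule UN_I[OF C])
    qed
    then have "\<epsilon> \<le> (\<Sum>A\<in>\<C>. diameter (U A) powr s)" 
      by (intro cover[rule_format, OF finC] bU)
    also have "\<dots> \<le> (\<Sum>A\<in>\<C>. 2 powr s * cap (K (r A)))" by (intro sum_mono diU)
    also have "\<dots> = (\<Sum>A\<in>\<C>. 2 powr s * sum w A)"
    proof (intro sum.cong refl arg_cong2[where f = times])
      fix A assume A: "A \<in> \<C>"
      have "cap (K (r A)) = sum w (cl (r A))" unfolding cl_def by (rule K(2)[OF r(1)[OF A], symmetric])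
      also have "\<dots> = sum w A" by (rule arg_cong[where f = "sum w"]) (rule r(2)[OF A, symmetric])
      finally show "cap (K (r A)) = sum w A" .
    qed
    also have "\<dots> = 2 powr s * sum w X"
    proof -
      have "sum w (\<Union>\<C>) = (\<Sum>A\<in>\<C>. sum w A)"
      proof -
        have "\<forall>A\<in>\<C>. finite A" unfolding \<C>_def cl_def using fin by simp
        moreover have "\<forall>A\<in>\<C>. \<forall>B\<in>\<C>. A \<noteq> B \<longrightarrow> A \<inter> B = {}" by (intro ballI impI disj)
        ultimately show ?thesis using sum.Union_disjoint[of \<C> w] by (simp only: comp_def)
      qed
      then show ?thesis by (simp add: UX sum_distrib_left)
    qed
    finally have tot: "\<epsilon> / 2 powr s \<le> sum w X" by (simp add: field_simps)
    have "sum w T \<le> 9 * 2 powr s * \<rho> powr s"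
      if T: "T \<subseteq> X" "(1/2) ^ N \<le> \<rho>" "\<forall>p\<in>T. \<forall>q\<in>T. dist p q \<le> \<rho>" for T \<rho>
    proof (cases "T = {}")
      case True
      then show ?thesis by simp
    next
      case False
      then obtain t where t: "t \<in> T" by blast
      \<comment> \<open>The largest such \<open>k\<close> gives the dyadic side just above the
        diameter of \<open>T\<close>; level 0 qualifies because \<open>F\<close> lies in a ball of
        radius 1/2, and the cap at \<open>N\<close> is where the capacities end.\<close>
      define Q where "Q k \<longleftrightarrow> k \<le> N \<and> (\<forall>p\<in>T. \<forall>q\<in>T. dist p q \<le> (1/2) ^ k)" for k :: nat
      have Q0: "Q 0"
      proof -
        have "dist p q \<le> 1" if "p \<in> T" "q \<in> T" for p q
        proof -
          have "p \<in> cball x\<^sub>0 (1/2)" "q \<in> cball x\<^sub>0 (1/2)" using that T(1) X(1) F by blast+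
          then have "dist x\<^sub>0 p \<le> 1/2" "dist x\<^sub>0 q \<le> 1/2" by simp_all
          then show ?thesis using dist_triangle[of p q x\<^sub>0] by (simp add: dist_commute)
        qed
        then show ?thesis by (simp add: Q_def)
      qed
      define k where "k = Greatest Q"
      have Qk: "Q k" unfolding k_def by (rule GreatestI_nat[of Q 0 N, OF Q0]) (simp add: Q_def)
      have k2: "(1/2) ^ k \<le> 2 * \<rho>"
      proof (cases "k = N")
        case True
        have "0 < (1/2 :: real) ^ N" by simp
        then show ?thesis unfolding True using T(2) by linarith
      next
        case False
        have "\<not> Q (Suc k)"
        proof
          assume "Q (Suc k)"
          then have "Suc k \<le> Greatest Q" by (rule Greatest_le_nat[where b = N]) (simp add: Q_def)
          then show False by (simp add: k_def)
        qed
        then obtain p q where "p \<in> T" "q \<in> T" "(1/2) ^ Suc k < dist p q"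
        proof -
          have "Suc k \<le> N" using False Qk unfolding Q_def by simp
          then have "\<not> (\<forall>p\<in>T. \<forall>q\<in>T. dist p q \<le> (1/2) ^ Suc k)" using \<open>\<not> Q (Suc k)\<close> unfolding Q_def by blast
          then obtain p q where "p \<in> T" "q \<in> T" "\<not> dist p q \<le> (1/2) ^ Suc k" by blast
        then show ?thesis using that[of p q] by linarith
        qed
        moreover from this have "dist p q \<le> \<rho>" using T(3) by blast
        ultimately show ?thesis by simp
      qed
      define i j where "i = \<lfloor>2 ^ k * t $ 1\<rfloor>" and "j = \<lfloor>2 ^ k * t $ 2\<rfloor>"
      define Z where "Z = {i - 1, i, i + 1} \<times> {j - 1, j, j + 1}"
      have near: "dyadic k p \<in> Z" if "p \<in> T" for p
      proof -
        have nl: "\<lfloor>2 ^ k * p $ l\<rfloor> \<in> {\<lfloor>2 ^ k * t $ l\<rfloor> - 1, \<lfloor>2 ^ k * t $ l\<rfloor>, \<lfloor>2 ^ k * t $ l\<rfloor> + 1}" for l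
        proof -
          have "\<bar>p $ l - t $ l\<bar> \<le> (1/2) ^ k" 
          proof -
            have "dist p t \<le> (1/2) ^ k" using Qk that t unfolding Q_def by blast
            then show ?thesis using dist_vec_nth_le[of p l t] unfolding dist_real_def by linarith
          qed
          then have "2 ^ k * \<bar>p $ l - t $ l\<bar> \<le> 1" by (simp add: power_one_over field_simps)
          then have "\<bar>2 ^ k * p $ l - 2 ^ k * t $ l\<bar> \<le> 1" by (simp add: abs_mult flip: right_diff_distrib)
          then have "\<lfloor>2 ^ k * p $ l\<rfloor> \<le> \<lfloor>2 ^ k * t $ l\<rfloor> + 1" "\<lfloor>2 ^ k * t $ l\<rfloor> - 1 \<le> \<lfloor>2 ^ k * p $ l\<rfloor>" by linarith+
          moreover have "m \<in> {n - 1, n, n + 1}" if "m \<le> n + 1" "n - 1 \<le> m" for m n :: int using that by auto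
          ultimately show ?thesis by blast
        qed
        show ?thesis unfolding dyadic_def Z_def i_def j_def using nl[of 1] nl[of 2] by (rule SigmaI)
      qed
      have "sum w T \<le> sum w (\<Union>z\<in>Z. {y\<in>X. dyadic k y = z})"
      proof (rule sum_mono2)
        show "finite (\<Union>z\<in>Z. {y\<in>X. dyadic k y = z})" using fin by (simp add: Z_def)
        show "T \<subseteq> (\<Union>z\<in>Z. {y\<in>X. dyadic k y = z})" using near T(1) by blast
      qed (rule w0)
      also have "\<dots> = (\<Sum>z\<in>Z. sum w {y\<in>X. dyadic k y = z})"
      proof (rule sum.UNION_disjoint)
        show "finite Z" by (simp add: Z_def)
        show "\<forall>z\<in>Z. finite {y\<in>X. dyadic k y = z}" using fin by simp
      qed blast
      also have "\<dots> \<le> (\<Sum>z\<in>Z. cap k)"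
      proof (rule sum_mono)
        fix z
        show "sum w {y\<in>X. dyadic k y = z} \<le> cap k"
        proof (cases "\<exists>x\<in>X. dyadic k x = z")
          case True
          then obtain x where x: "x \<in> X" "z = dyadic k x" by blast
          have "k \<le> N" using Qk unfolding Q_def by blast
          then show ?thesis unfolding x(2) using w1[of k x] x(1) by blast
        next
          case False
          then have "{y\<in>X. dyadic k y = z} = {}" by blast
          then show ?thesis using cap[of k] by (simp del: Collect_empty_eq)
        qed
      qed
      also have "\<dots> = 9 * cap k" by (simp add: Z_def card_cartesian_product)
      also have "\<dots> \<le> 9 * (2 * \<rho>) powr s"
        unfolding cap_def using k2 s by (intro mult_left_mono powr_mono2) auto
      also have "\<dots> = 9 * 2 powr s * \<rho> powr s"
      proof -
        have "0 < (1/2 :: real) ^ k" by simp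
        then have "\<rho> > 0" using k2 by linarith
        then show ?thesis by (simp add: powr_mult)
      qed
      finally show ?thesis .
    qed
    then have FR: "\<forall>T \<rho>. T \<subseteq> X \<longrightarrow> (1/2) ^ N \<le> \<rho> \<longrightarrow> (\<forall>p\<in>T. \<forall>q\<in>T. dist p q \<le> \<rho>) \<longrightarrow> sum w T \<le> 9 * 2 powr s * \<rho> powr s"
      by (intro allI impI)
    show "\<exists>P w. finite P \<and> P \<subseteq> F \<and> (\<forall>p. 0 \<le> w p) \<and> \<epsilon> / 2 powr s \<le> sum w P \<and>
       (\<forall>T \<rho>. T \<subseteq> P \<longrightarrow> (1/2) ^ N \<le> \<rho> \<longrightarrow> (\<forall>p\<in>T. \<forall>q\<in>T. dist p q \<le> \<rho>) \<longrightarrow> sum w T \<le> 9 * 2 powr s * \<rho> powr s)"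
      by (intro exI[of _ X] exI[of _ w] conjI allI fin X(1) w0 tot FR)
  qed
qed

section \<open>Oscillation of thin tubes\<close>

lemma pos_part_sq_deriv: "((\<lambda>x::real. (max 0 x)^2) has_real_derivative 2 * max 0 x) (at x)"
proof (cases "x = 0")
  case True
  have "((\<lambda>h::real. (max 0 h)^2 / h) \<longlongrightarrow> 0) (at 0)"
  proof (rule Lim_null_comparison)
    show "\<forall>\<^sub>F h in at 0. norm ((max 0 h)^2 / h :: real) \<le> \<bar>h\<bar>"
      by (rule always_eventually) (auto simp: max_def power2_eq_square)
    show "((\<lambda>h::real. \<bar>h\<bar>) \<longlongrightarrow> 0) (at 0)"
      by (intro tendsto_rabs_zero tendsto_ident_at)
  qed
  then show ?thesis using True by (simp add: DERIV_def)
next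
  case False
  show ?thesis
  proof (cases "x > 0")
    case True
    have "((\<lambda>x::real. x^2) has_real_derivative 2 * x) (at x)"
      by (auto intro!: derivative_eq_intros)
    then have "((\<lambda>x::real. (max 0 x)^2) has_real_derivative 2 * x) (at x)"
      by (rule DERIV_cong_ev[THEN iffD1, rotated -1])
         (use True in \<open>auto intro!: eventually_mono[OF eventually_nhds_in_open[of "{0<..}"]]\<close>)
    then show ?thesis using True by simp
  next
    case f: False
    have "((\<lambda>x::real. 0) has_real_derivative 0) (at x)" by simp
    then have "((\<lambda>x::real. (max 0 x)^2) has_real_derivative 0) (at x)"
      by (rule DERIV_cong_ev[THEN iffD1, rotated -1])
         (use f False in \<open>auto intro!: eventually_mono[OF eventually_nhds_in_open[of "{..<0}"]]\<close>)
    then show ?thesis using f by simp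
  qed
qed

text \<open>The hat function of unit mass supported on [-d, d]. Being piecewise linear, it has an
  explicit primitive and satisfies an exact relation between the widths \<open>d\<close> and
  \<open>d/2\<close>.\<close>

definition bump :: "real \<Rightarrow> real \<Rightarrow> real" where
  "bump d x = max 0 (1 - \<bar>x\<bar> / d) / d"

text \<open>Half the second difference of the squared positive part; the primitive of
  \<open>bump d\<close> that rises from 0 to 1. Positive parts make it continuously differentiable
  without a case distinction.\<close>

definition bump_int :: "real \<Rightarrow> real \<Rightarrow> real" where
  "bump_int d x = ((max 0 (x / d + 1))\<^sup>2 - 2 * (max 0 (x / d))\<^sup>2 + (max 0 (x / d - 1))\<^sup>2) / 2"

lemma bump_int_deriv:
  assumes "d > 0"
  shows "(bump_int d has_real_derivative bump d x) (at x)"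
proof -
  have *: "((\<lambda>x. (max 0 (x / d + c))\<^sup>2) has_real_derivative 2 * max 0 (x / d + c) * (1 / d)) (at x)" for c
    by (rule DERIV_chain2[OF pos_part_sq_deriv]) (use assms in \<open>auto intro!: derivative_eq_intros\<close>)
  have "((\<lambda>x. ((max 0 (x / d + 1))\<^sup>2 - 2 * (max 0 (x / d + 0))\<^sup>2 + (max 0 (x / d + (-1)))\<^sup>2) / 2) has_real_derivative
      (2 * max 0 (x / d + 1) * (1 / d) - 2 * (2 * max 0 (x / d + 0) * (1 / d)) + 2 * max 0 (x / d + (-1)) * (1 / d)) / 2) (at x)"
    by (intro DERIV_cdivide DERIV_add DERIV_diff DERIV_cmult *)
  moreover have "(2 * max 0 (x / d + 1) * (1 / d) - 2 * (2 * max 0 (x / d + 0) * (1 / d)) + 2 * max 0 (x / d + (-1)) * (1 / d)) / 2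
     = bump d x"
  proof -
    have "max 0 (1 - \<bar>y\<bar>) = max 0 (y + 1) - 2 * max 0 y + max 0 (y - 1)" for y :: real by auto
    from this[of "\<bar>x\<bar> / d"] this[of "x / d"] have e: "max 0 (1 - \<bar>x / d\<bar>) = max 0 (x / d + 1) - 2 * max 0 (x / d) + max 0 (x / d - 1)" by blast
    have "\<bar>x\<bar> / d = \<bar>x / d\<bar>" using assms by simp
    then have "bump d x = (max 0 (x / d + 1) - 2 * max 0 (x / d) + max 0 (x / d - 1)) / d"
      unfolding bump_def using e by metis
    then show ?thesis by (simp add: add_divide_distrib diff_divide_distrib)
  qed
  ultimately show ?thesis by (simp add: bump_int_def[abs_def])
qed

lemma bump_nonneg: "d > 0 \<Longrightarrow> 0 \<le> bump d x"
  and bump_le: "d > 0 \<Longrightarrow> bump d x \<le> 1 / d"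
  and bump_zero: "d > 0 \<Longrightarrow> d \<le> \<bar>x\<bar> \<Longrightarrow> bump d x = 0"
  and bump_lower: "d > 0 \<Longrightarrow> \<bar>x\<bar> \<le> d / 2 \<Longrightarrow> 1 / (2 * d) \<le> bump d x"
  by (auto simp: bump_def max_def field_simps)

lemma bump_lipschitz:
  assumes "d > 0"
  shows "\<bar>bump d x - bump d y\<bar> \<le> \<bar>x - y\<bar> / d\<^sup>2"
proof -
  have "\<bar>max 0 (1 - \<bar>x\<bar> / d) - max 0 (1 - \<bar>y\<bar> / d)\<bar> \<le> \<bar>\<bar>x\<bar> / d - \<bar>y\<bar> / d\<bar>"
    by (simp add: max_def abs_if)
  also have "\<dots> = \<bar>\<bar>x\<bar> - \<bar>y\<bar>\<bar> / d" using assms by (simp add: diff_divide_distrib[symmetric])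
  also have "\<dots> \<le> \<bar>x - y\<bar> / d" using assms by (intro divide_right_mono) auto
  finally have *: "\<bar>max 0 (1 - \<bar>x\<bar> / d) - max 0 (1 - \<bar>y\<bar> / d)\<bar> \<le> \<bar>x - y\<bar> / d" .
  have "\<bar>bump d x - bump d y\<bar> = \<bar>max 0 (1 - \<bar>x\<bar> / d) - max 0 (1 - \<bar>y\<bar> / d)\<bar> / d"
    using assms by (simp add: bump_def diff_divide_distrib[symmetric])
  also have "\<dots> \<le> \<bar>x - y\<bar> / d / d" using * assms by (intro divide_right_mono) auto
  finally show ?thesis by (simp add: power2_eq_square)
qed

lemma continuous_bump [continuous_intros]:
  "d > 0 \<Longrightarrow> continuous_on S f \<Longrightarrow> continuous_on S (\<lambda>x. bump d (f x))"
  unfolding bump_def by (intro continuous_intros) auto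

text \<open>The coefficients 1/2, 1/4, 1/4 sum to 1, so this is an average of translates; after a
  change of variables the translations can be carried by another factor of an integral.\<close>

lemma bump_refine:
  assumes "d > 0"
  shows "bump d x = bump (d/2) x / 2 + bump (d/2) (x + d/2) / 4 + bump (d/2) (x - d/2) / 4"
proof -
  have r: "max 0 (1 - \<bar>y\<bar>) = max 0 (1 - \<bar>2*y\<bar>) + max 0 (1 - \<bar>2*y + 1\<bar>) / 2 + max 0 (1 - \<bar>2*y - 1\<bar>) / 2" for y :: real
  proof -
    consider "y \<le> -1" | "-1 < y" "y \<le> -1/2" | "-1/2 < y" "y < 0" | "0 \<le> y" "y < 1/2" | "1/2 \<le> y" "y < 1" | "1 \<le> y"
      by linarith
    then show ?thesis by cases (simp_all add: max_def abs_if field_simps)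
  qed
  have e: "\<bar>x\<bar> / d = \<bar>x / d\<bar>" "\<bar>x\<bar> / (d/2) = \<bar>2 * (x/d)\<bar>" "\<bar>x + d/2\<bar> / (d/2) = \<bar>2 * (x/d) + 1\<bar>"
     "\<bar>x - d/2\<bar> / (d/2) = \<bar>2 * (x/d) - 1\<bar>"
  proof -
    have "2 * (x/d) = x / (d/2)" "2 * (x/d) + 1 = (x + d/2) / (d/2)" "2 * (x/d) - 1 = (x - d/2) / (d/2)"
      using assms by (simp_all add: add_divide_distrib diff_divide_distrib)
    then show "\<bar>x\<bar> / d = \<bar>x / d\<bar>" "\<bar>x\<bar> / (d/2) = \<bar>2 * (x/d)\<bar>" "\<bar>x + d/2\<bar> / (d/2) = \<bar>2 * (x/d) + 1\<bar>"
     "\<bar>x - d/2\<bar> / (d/2) = \<bar>2 * (x/d) - 1\<bar>"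
      using assms by (simp_all only: abs_divide)
  qed
  show ?thesis unfolding bump_def e using r[of "x/d"] by (simp add: add_divide_distrib)
qed

lemma bump_int_eq:
  assumes "d > 0"
  shows "x \<le> - d \<Longrightarrow> bump_int d x = 0" "d \<le> x \<Longrightarrow> bump_int d x = 1"
    "0 \<le> bump_int d x" "bump_int d x \<le> 1"
proof -
  show l: "bump_int d x = 0" if "x \<le> - d" for x
  proof -
    have "x / d \<le> -1" using that assms by (simp add: field_simps)
    then show ?thesis by (simp add: bump_int_def)
  qed
  show r: "bump_int d x = 1" if "d \<le> x" for x
  proof -
    have "x / d \<ge> 1" using that assms by (simp add: field_simps)
    then show ?thesis by (simp add: bump_int_def power2_eq_square algebra_simps)
  qed
  have mono: "bump_int d x \<le> bump_int d y" if "x \<le> y" for x y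
    by (rule DERIV_nonneg_imp_nondecreasing[OF that]) (use bump_int_deriv bump_nonneg assms in blast)
  show "0 \<le> bump_int d x" using mono[of "min x (-d)" x] l[of "min x (-d)"] by auto
  show "bump_int d x \<le> 1" using mono[of x "max x d"] r[of "max x d"] by auto
qed

text \<open>The weight \<open>(a - A) * (B - a)\<close> kills the boundary terms of the integration by parts.\<close>
lemma oscillatory_cutoff_integral:
  fixes H H1 H2 \<Psi> \<psi> :: "real \<Rightarrow> real"
  assumes AB: "A < B" and mu: "\<mu> > 0" and D: "D \<ge> 0" and M: "M \<ge> 0" and \<Lambda>: "\<Lambda> \<ge> 0"
    and dH: "\<And>a. a \<in> {A..B} \<Longrightarrow> (H has_real_derivative H1 a) (at a)"
    and dH1: "\<And>a. a \<in> {A..B} \<Longrightarrow> (H1 has_real_derivative H2 a) (at a)"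
    and H1: "\<And>a. a \<in> {A..B} \<Longrightarrow> \<mu> \<le> \<bar>H1 a\<bar>"
    and H2: "\<And>a. a \<in> {A..B} \<Longrightarrow> \<bar>H2 a\<bar> \<le> \<Lambda>"
    and d\<Psi>: "\<And>x. (\<Psi> has_real_derivative \<psi> x) (at x)"
    and cont: "continuous_on UNIV \<psi>"
    and bd: "\<And>x. \<bar>\<Psi> x\<bar> \<le> M"
    and supp: "\<And>x. D \<le> \<bar>x\<bar> \<Longrightarrow> \<Psi> x = 0"
  shows "\<bar>integral {A..B} (\<lambda>a. (a - A) * (B - a) * \<psi> (H a))\<bar>
      \<le> M * ((B - A) / \<mu> + (B - A)\<^sup>2 * \<Lambda> / \<mu>\<^sup>2) * (4 * D / \<mu>)"
proof -
  define \<omega> where "\<omega> a = (a - A) * (B - a)" for a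
  define Q where "Q a = ((B - a) - (a - A)) / H1 a - \<omega> a * H2 a / (H1 a)\<^sup>2" for a
  define C where "C = (B - A) / \<mu> + (B - A)\<^sup>2 * \<Lambda> / \<mu>\<^sup>2"
  have C0: "C \<ge> 0" unfolding C_def using AB mu \<Lambda> by auto
  have H1n: "H1 a \<noteq> 0" if "a \<in> {A..B}" for a using H1[OF that] mu by auto
  have der: "((\<lambda>a. \<omega> a / H1 a * \<Psi> (H a)) has_real_derivative \<omega> a * \<psi> (H a) + Q a * \<Psi> (H a)) (at a)"
    if a: "a \<in> {A..B}" for a
  proof -
    have "((\<lambda>a. \<Psi> (H a)) has_real_derivative \<psi> (H a) * H1 a) (at a)"
      by (rule DERIV_chain2[OF d\<Psi> dH[OF a]])
    moreover have "(\<omega> has_real_derivative ((B - a) - (a - A))) (at a)"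
      unfolding \<omega>_def[abs_def] by (auto intro!: derivative_eq_intros)
    then have "((\<lambda>a. \<omega> a / H1 a) has_real_derivative (((B - a) - (a - A)) * H1 a - \<omega> a * H2 a) / (H1 a * H1 a)) (at a)"
      by (rule DERIV_divide[OF _ dH1[OF a] H1n[OF a]])
    ultimately have "((\<lambda>a. \<omega> a / H1 a * \<Psi> (H a)) has_real_derivative
       (((B - a) - (a - A)) * H1 a - \<omega> a * H2 a) / (H1 a * H1 a) * \<Psi> (H a) + \<psi> (H a) * H1 a * (\<omega> a / H1 a)) (at a)"
      by (rule DERIV_mult[rotated])
    moreover have "(((B - a) - (a - A)) * H1 a - \<omega> a * H2 a) / (H1 a * H1 a) = Q a"
      unfolding Q_def using H1n[OF a] by (simp add: field_simps power2_eq_square)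
    moreover have "\<psi> (H a) * H1 a * (\<omega> a / H1 a) = \<omega> a * \<psi> (H a)" using H1n[OF a] by simp
    ultimately show ?thesis by (simp only: add.commute)
  qed
  have der': "((\<lambda>a. \<omega> a / H1 a * \<Psi> (H a)) has_real_derivative \<omega> a * \<psi> (H a) + Q a * \<Psi> (H a)) (at a within {A..B})"
    if "a \<in> {A..B}" for a by (rule DERIV_subset[OF der[OF that]]) simp
  have "((\<lambda>a. \<omega> a * \<psi> (H a) + Q a * \<Psi> (H a)) has_integral
      (\<omega> B / H1 B * \<Psi> (H B) - \<omega> A / H1 A * \<Psi> (H A))) {A..B}"
    using AB by (intro fundamental_theorem_of_calculus)
      (use der' in \<open>auto simp only: has_real_derivative_iff_has_vector_derivative[symmetric]\<close>)
  then have FTC: "((\<lambda>a. \<omega> a * \<psi> (H a) + Q a * \<Psi> (H a)) has_integral 0) {A..B}"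
    by (simp add: \<omega>_def)
  have contH: "continuous_on {A..B} H" 
    by (rule DERIV_continuous_on) (rule DERIV_subset[OF dH], auto)
  have "continuous_on {A..B} (\<lambda>a. \<omega> a * \<psi> (H a))"
    unfolding \<omega>_def by (intro continuous_intros continuous_on_compose2[OF cont contH]) auto
  then have int1: "(\<lambda>a. \<omega> a * \<psi> (H a)) integrable_on {A..B}"
    by (rule integrable_continuous_real)
  have int2: "((\<lambda>a. Q a * \<Psi> (H a)) has_integral (0 - integral {A..B} (\<lambda>a. \<omega> a * \<psi> (H a)))) {A..B}"
    using has_integral_diff[OF FTC integrable_integral[OF int1]] by simp
  have Qb: "\<bar>Q a * \<Psi> (H a)\<bar> \<le> C * M" if a: "a \<in> {A..B}" for a
  proof -
    have "\<bar>(B - a) - (a - A)\<bar> \<le> B - A" using a by auto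
    then have "\<bar>((B - a) - (a - A)) / H1 a\<bar> \<le> (B - A) / \<mu>"
      unfolding abs_divide using H1[OF a] mu AB by (intro frac_le) auto
    moreover have "\<bar>\<omega> a * H2 a / (H1 a)\<^sup>2\<bar> \<le> (B - A)\<^sup>2 * \<Lambda> / \<mu>\<^sup>2"
    proof -
      have "\<bar>\<omega> a\<bar> \<le> (B - A)\<^sup>2"
        unfolding \<omega>_def power2_eq_square abs_mult using a by (intro mult_mono) auto
      then have "\<bar>\<omega> a * H2 a\<bar> \<le> (B - A)\<^sup>2 * \<Lambda>"
        unfolding abs_mult using H2[OF a] by (intro mult_mono) auto
      moreover have "\<mu>\<^sup>2 \<le> \<bar>(H1 a)\<^sup>2\<bar>" using H1[OF a] mu by (simp add: abs_le_square_iff[symmetric])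
      ultimately show ?thesis unfolding abs_divide using mu \<Lambda> by (intro frac_le) auto
    qed
    ultimately have "\<bar>Q a\<bar> \<le> C" unfolding Q_def C_def by linarith
    then show ?thesis unfolding abs_mult using bd[of "H a"] by (intro mult_mono) auto
  qed
  have Heq: "integral {A..B} (\<lambda>a. \<omega> a * \<psi> (H a)) = - integral {A..B} (\<lambda>a. Q a * \<Psi> (H a))"
    using integral_unique[OF int2] by simp
  \<comment> \<open>The remaining integrand lives where \<open>\<bar>H a\<bar> < D\<close>. As
    \<open>H\<close> moves at speed at least \<mu>, any two such points are within
    \<open>2 * D / \<mu>\<close> of each other, so an interval of length
    \<open>4 * D / \<mu>\<close> contains them all.\<close>
  have "\<bar>integral {A..B} (\<lambda>a. Q a * \<Psi> (H a))\<bar> \<le> C * M * (4 * D / \<mu>)"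
  proof (cases "\<exists>a0\<in>{A..B}. \<bar>H a0\<bar> < D")
    case False
    then have "integral {A..B} (\<lambda>a. Q a * \<Psi> (H a)) = integral {A..B} (\<lambda>a. 0)"
      by (intro integral_cong) (use supp in \<open>simp add: not_less\<close>)
    then show ?thesis using C0 M D mu by simp
  next
    case True
    then obtain a0 where a0: "a0 \<in> {A..B}" "\<bar>H a0\<bar> < D" by blast
    define l where "l = 2 * D / \<mu>"
    have l0: "l \<ge> 0" using D mu by (simp add: l_def)
    have z: "Q a * \<Psi> (H a) = 0" if a: "a \<in> {A..B}" "a \<notin> {a0 - l..a0 + l}" for a
    proof -
      have "D \<le> \<bar>H a\<bar>"
      proof (rule ccontr)
        assume "\<not> D \<le> \<bar>H a\<bar>"
        then have lt: "\<bar>H a - H a0\<bar> < 2 * D" using a0 by linarith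
        have ex: "\<exists>z. z \<in> {A..B} \<and> \<bar>H a - H a0\<bar> = \<bar>a - a0\<bar> * \<bar>H1 z\<bar>"
        proof (cases "a < a0")
          case True
          then obtain z where "z > a" "z < a0" "H a0 - H a = (a0 - a) * H1 z"
            using MVT2[of a a0 H H1] a a0 dH by auto
          then have "\<bar>H a - H a0\<bar> = \<bar>a - a0\<bar> * \<bar>H1 z\<bar>" "z \<in> {A..B}"
            using a a0 by (auto simp: abs_mult abs_minus_commute[of "H a"] abs_minus_commute[of a])
          then show ?thesis by blast
        next
          case False
          have "a \<noteq> a0" using a l0 by auto
          with False obtain z where "z > a0" "z < a" "H a - H a0 = (a - a0) * H1 z"
            using MVT2[of a0 a H H1] a a0 dH by auto
          then have "\<bar>H a - H a0\<bar> = \<bar>a - a0\<bar> * \<bar>H1 z\<bar>" "z \<in> {A..B}"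
            using a a0 by (auto simp: abs_mult)
          then show ?thesis by blast
        qed
        then obtain z where z: "z \<in> {A..B}" "\<bar>H a - H a0\<bar> = \<bar>a - a0\<bar> * \<bar>H1 z\<bar>" by blast
        have "\<bar>a - a0\<bar> * \<mu> \<le> \<bar>a - a0\<bar> * \<bar>H1 z\<bar>" using H1[OF z(1)] by (intro mult_left_mono) auto
        then have "\<bar>a - a0\<bar> * \<mu> < 2 * D" using lt z by linarith
        then have "\<bar>a - a0\<bar> < l" unfolding l_def using mu by (simp add: field_simps)
        then show False using a by auto
      qed
      then show ?thesis using supp by simp
    qed
    define p q where "p = max A (a0 - l)" and "q = min B (a0 + l)"
    have pq: "{p..q} \<subseteq> {A..B}" "p \<le> q" "{p..q} = {A..B} \<inter> {a0 - l..a0 + l}" unfolding p_def q_def using a0 l0 by auto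
    have "integral {A..B} (\<lambda>a. Q a * \<Psi> (H a)) = integral {A..B} (\<lambda>a. if a \<in> {a0 - l..a0 + l} then Q a * \<Psi> (H a) else 0)"
      by (rule integral_cong) (use z in meson)
    also have "\<dots> = integral ({A..B} \<inter> {a0 - l..a0 + l}) (\<lambda>a. Q a * \<Psi> (H a))"
      by (subst integral_restrict_Int) (simp add: Int_commute)
    finally have "integral {p..q} (\<lambda>a. Q a * \<Psi> (H a)) = integral {A..B} (\<lambda>a. Q a * \<Psi> (H a))"
      unfolding pq(3) by simp
    moreover have "(\<lambda>a. Q a * \<Psi> (H a)) integrable_on {p..q}"
      using int2 pq(1) integrable_on_subinterval has_integral_integrable by blast
    then have "((\<lambda>a. Q a * \<Psi> (H a)) has_integral integral {p..q} (\<lambda>a. Q a * \<Psi> (H a))) (cbox p q)" 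
      by (simp add: integrable_integral)
    then have "\<bar>integral {p..q} (\<lambda>a. Q a * \<Psi> (H a))\<bar> \<le> C * M * Henstock_Kurzweil_Integration.content (cbox p q)"
      using Qb pq(1) C0 M has_integral_bound[of "C*M" "\<lambda>a. Q a * \<Psi> (H a)" _ p q] by (auto simp: real_norm_def)
    moreover have "Henstock_Kurzweil_Integration.content (cbox p q) \<le> 4 * D / \<mu>" 
      using pq(2) unfolding p_def q_def l_def by (simp add: content_real)
    then have "C * M * Henstock_Kurzweil_Integration.content (cbox p q) \<le> C * M * (4 * D / \<mu>)" using C0 M by (intro mult_left_mono) auto
    ultimately show ?thesis by simp
  qed
  then show ?thesis using Heq unfolding \<omega>_def C_def by (simp add: mult.commute)
qed

section \<open>Mean-square bounds for sums of tubes\<close>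

text \<open>The Frostman condition read in coordinates \<open>x\<close>, \<open>y\<close> that need
  not be Euclidean ones. It is required only from the scale \<open>\<delta>\<^sub>0\<close> upwards,
  the resolution of finitely supported weights.\<close>

definition spread :: "'p set \<Rightarrow> ('p \<Rightarrow> real) \<Rightarrow> ('p \<Rightarrow> real) \<Rightarrow> ('p \<Rightarrow> real) \<Rightarrow> real \<Rightarrow> real \<Rightarrow> real \<Rightarrow> bool" where
  "spread P w x y s C \<delta>\<^sub>0 \<longleftrightarrow> finite P \<and> (\<forall>p\<in>P. 0 \<le> w p) \<and>
     (\<forall>\<alpha> \<beta> \<rho>. \<delta>\<^sub>0 \<le> \<rho> \<longrightarrow> sum w {p\<in>P. \<bar>x p - \<alpha>\<bar> \<le> \<rho> \<and> \<bar>y p - \<beta>\<bar> \<le> \<rho>} \<le> C * \<rho> powr s)"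

text \<open>Sum over dyadic square shells about (\<alpha>, \<beta>): shell j carries mass at most
  \<open>C * (2 ^ j * \<delta>) powr s\<close>, and the kernel there is at most
  \<open>4 * K / (4 ^ j * \<delta>)\<close>. The ratio of the resulting geometric series is
  \<open>2 powr (s - 2)\<close>, which is below 1 as \<open>s < 2\<close>.\<close>

lemma spread_kernel_sum:
  fixes k :: "'p \<Rightarrow> real"
  assumes sp: "spread P w x y s C \<delta>\<^sub>0" and s: "s < 2" and d: "0 < \<delta>" "\<delta>\<^sub>0 \<le> \<delta>" and K: "K \<ge> 0" and C: "C \<ge> 0"
    and k1: "\<And>p. p \<in> P \<Longrightarrow> k p \<le> K / \<delta>"
    and k2: "\<And>p. p \<in> P \<Longrightarrow> k p * (max \<bar>x p - \<alpha>\<bar> \<bar>y p - \<beta>\<bar>)\<^sup>2 \<le> K * \<delta>"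
  shows "(\<Sum>p\<in>P. w p * k p) \<le> 4 * K * C / (1 - 2 powr (s - 2)) * \<delta> powr (s - 1)"
proof -
  have fin: "finite P" and w0: "\<And>p. p \<in> P \<Longrightarrow> 0 \<le> w p" using sp by (auto simp: spread_def)
  define t where "t p = max \<bar>x p - \<alpha>\<bar> \<bar>y p - \<beta>\<bar>" for p
  have t0: "t p \<ge> 0" for p by (simp add: t_def le_max_iff_disj)
  have "\<exists>J::nat. \<forall>p\<in>P. t p \<le> 2 ^ J * \<delta>"
  proof -
    obtain J :: nat where J: "(\<Sum>p\<in>P. t p) / \<delta> < 2 ^ J"
      using real_arch_pow[of 2 "(\<Sum>p\<in>P. t p) / \<delta>"] by auto
    have "t p \<le> 2 ^ J * \<delta>" if "p \<in> P" for p
    proof -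
      have "t p \<le> (\<Sum>p\<in>P. t p)" using that fin t0 by (intro member_le_sum) auto
      also have "\<dots> \<le> 2 ^ J * \<delta>" using J d by (simp add: field_simps)
      finally show ?thesis .
    qed
    then show ?thesis by blast
  qed
  then obtain J :: nat where J: "\<And>p. p \<in> P \<Longrightarrow> t p \<le> 2 ^ J * \<delta>" by blast
  have main: "k p \<le> (\<Sum>j\<le>J. 4 * K / (4 ^ j * \<delta>) * (if t p \<le> 2 ^ j * \<delta> then 1 else 0))" if p: "p \<in> P" for p
  proof -
    \<comment> \<open>Minimality gives \<open>t p > 2 ^ (j - 1) * \<delta>\<close> unless
      \<open>j = 0\<close>; this halving is the source of the factor 4.\<close>
    define j where "j = (LEAST j. t p \<le> 2 ^ j * \<delta>)"
    have j: "t p \<le> 2 ^ j * \<delta>" unfolding j_def by (rule LeastI[of _ J]) (rule J[OF p])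
    have jJ: "j \<le> J" unfolding j_def by (rule Least_le) (rule J[OF p])
    have "k p \<le> 4 * K / (4 ^ j * \<delta>)"
    proof (cases j)
      case 0
      have "K / \<delta> \<le> 4 * K / \<delta>" using K d by (intro divide_right_mono) auto
      then show ?thesis using k1[OF p] 0 by simp
    next
      case (Suc i)
      have "\<not> t p \<le> 2 ^ i * \<delta>" using not_less_Least[of i "\<lambda>j. t p \<le> 2 ^ j * \<delta>"] Suc by (simp add: j_def)
      then have lt: "2 ^ i * \<delta> \<le> t p" by simp
      have "(2 ^ i * \<delta>)\<^sup>2 \<le> (t p)\<^sup>2" by (rule power_mono[OF lt]) (use d in simp)
      moreover have "(2 ^ i * \<delta>)\<^sup>2 = 4 ^ i * \<delta> * \<delta>"
      proof -
        have "(2::real) ^ i * 2 ^ i = 4 ^ i" by (simp flip: power_mult_distrib)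
        then show ?thesis by (simp add: power2_eq_square)
      qed
      ultimately have tp: "4 ^ i * \<delta> * \<delta> \<le> (t p)\<^sup>2" by simp
      have "k p * (4 ^ i * \<delta>) * \<delta> \<le> K * \<delta>"
      proof (cases "k p \<ge> 0")
        case True
        then show ?thesis using mult_left_mono[OF tp True] k2[OF p] by (simp add: t_def mult.assoc)
      next
        case False
        then have "k p * (4 ^ i * \<delta>) * \<delta> \<le> 0" using d by (simp add: mult_nonpos_nonneg)
        then show ?thesis using K d by (meson mult_nonneg_nonneg less_imp_le order_trans)
      qed
      then have "k p * (4 ^ i * \<delta>) \<le> K" using d by simp
      then show ?thesis using d Suc by (simp add: field_simps)
    qed
    also have "\<dots> = 4 * K / (4 ^ j * \<delta>) * (if t p \<le> 2 ^ j * \<delta> then 1 else 0)" using j by simp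
    also have "\<dots> \<le> (\<Sum>j\<le>J. 4 * K / (4 ^ j * \<delta>) * (if t p \<le> 2 ^ j * \<delta> then 1 else 0))"
      by (rule member_le_sum) (use jJ K d in auto)
    finally show ?thesis .
  qed
  define q :: real where "q = 2 powr (s - 2)"
  have q: "0 < q" "q < 1" using s by (auto simp: q_def powr_less_one)
  have "(\<Sum>p\<in>P. w p * k p) \<le> (\<Sum>p\<in>P. w p * (\<Sum>j\<le>J. 4 * K / (4 ^ j * \<delta>) * (if t p \<le> 2 ^ j * \<delta> then 1 else 0)))"
    by (intro sum_mono mult_left_mono main w0)
  also have "\<dots> = (\<Sum>j\<le>J. 4 * K / (4 ^ j * \<delta>) * (\<Sum>p\<in>P. w p * (if t p \<le> 2 ^ j * \<delta> then 1 else 0)))"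
    unfolding sum_distrib_left by (subst sum.swap) (intro sum.cong refl, simp add: mult_ac)
  also have "\<dots> \<le> (\<Sum>j\<le>J. 4 * K * C * \<delta> powr (s - 1) * q ^ j)"
  proof (rule sum_mono)
    fix j
    have le: "\<delta>\<^sub>0 \<le> 2 ^ j * \<delta>" 
    proof -
      have "1 * \<delta> \<le> 2 ^ j * \<delta>" using d by (intro mult_right_mono) auto
      then show ?thesis using d(2) by linarith
    qed
    have "(\<Sum>p\<in>P. w p * (if t p \<le> 2 ^ j * \<delta> then 1 else 0)) = sum w {p\<in>P. \<bar>x p - \<alpha>\<bar> \<le> 2 ^ j * \<delta> \<and> \<bar>y p - \<beta>\<bar> \<le> 2 ^ j * \<delta>}"
      using fin by (simp add: sum.inter_filter[symmetric] t_def if_distrib cong: if_cong)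
    also have "\<dots> \<le> C * (2 ^ j * \<delta>) powr s" using sp le unfolding spread_def by blast
    finally have le2: "(\<Sum>p\<in>P. w p * (if t p \<le> 2 ^ j * \<delta> then 1 else 0)) \<le> C * (2 ^ j * \<delta>) powr s" .
    have e: "(2 ^ j * \<delta>) powr s = 4 ^ j * q ^ j * \<delta> * \<delta> powr (s - 1)"
    proof -
      have "(2 ^ j * \<delta>) powr s = (2 ^ j) powr s * \<delta> powr s" using d by (simp add: powr_mult)
      also have "(2 ^ j :: real) powr s = (4 * q) ^ j"
      proof -
        have "4 * q = 2 powr s" unfolding q_def by (simp add: powr_diff)
        then show ?thesis by (simp add: powr_realpow[symmetric] powr_powr mult.commute)
      qed
      also have "\<delta> powr s = \<delta> * \<delta> powr (s - 1)" using d by (simp add: powr_diff)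
      finally show ?thesis by (simp add: power_mult_distrib)
    qed
    have "4 * K / (4 ^ j * \<delta>) * (\<Sum>p\<in>P. w p * (if t p \<le> 2 ^ j * \<delta> then 1 else 0)) 
       \<le> 4 * K / (4 ^ j * \<delta>) * (C * (2 ^ j * \<delta>) powr s)"
      by (intro mult_left_mono le2) (use K d in auto)
    also have "\<dots> = 4 * K * C * \<delta> powr (s - 1) * q ^ j" unfolding e using d by simp
    finally show "4 * K / (4 ^ j * \<delta>) * (\<Sum>p\<in>P. w p * (if t p \<le> 2 ^ j * \<delta> then 1 else 0)) 
       \<le> 4 * K * C * \<delta> powr (s - 1) * q ^ j" .
  qed
  also have "\<dots> = 4 * K * C * \<delta> powr (s - 1) * (\<Sum>j\<le>J. q ^ j)" by (simp add: sum_distrib_left)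
  also have "\<dots> \<le> 4 * K * C * \<delta> powr (s - 1) * (1 / (1 - q))"
  proof (intro mult_left_mono)
    show "(\<Sum>j\<le>J. q ^ j) \<le> 1 / (1 - q)"
      using q sum_le_suminf[of "\<lambda>j. q ^ j" "{..J}"] suminf_geometric[of q] by (simp add: summable_geometric)
  qed (use K C in auto)
  finally show ?thesis by (simp add: q_def)
qed

lemma integral_reflect_shift:
  fixes f :: "real \<Rightarrow> real"
  assumes cont: "continuous_on UNIV f" and z: "\<And>x. D \<le> \<bar>x\<bar> \<Longrightarrow> f x = 0" and k: "\<bar>k\<bar> + D \<le> R"
  shows "integral {-R..R} (\<lambda>b. f (k - b)) = integral {-D..D} f"
proof -
  have "(f has_integral integral {-D..D} f) {-D..D}"
    by (intro integrable_integral integrable_continuous_real continuous_on_subset[OF cont]) auto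
  then have "(f has_integral integral {-D..D} f) {k - R..k + R}"
    by (rule has_integral_on_superset) (use z k in auto)
  then have "((\<lambda>x. f ((-1) *\<^sub>R x + k)) has_integral ((1 / (\<bar>-1\<bar> ^ DIM(real))) *\<^sub>R integral {-D..D} f))
     ((\<lambda>x. (1 / (-1)) *\<^sub>R x + - ((1 / (-1)) *\<^sub>R k)) ` cbox (k - R) (k + R))"
    by (intro has_integral_affinity) auto
  moreover have "(\<lambda>x. (1 / (-1)) *\<^sub>R x + - ((1 / (-1)) *\<^sub>R k)) ` cbox (k - R) (k + R) = {-R..R}"
  proof (intro set_eqI iffI)
    fix x assume "x \<in> {-R..R}"
    then show "x \<in> (\<lambda>x. (1 / (-1)) *\<^sub>R x + - ((1 / (-1)) *\<^sub>R k)) ` cbox (k - R) (k + R)"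
      by (intro image_eqI[of _ _ "k - x"]) auto
  qed auto
  ultimately show ?thesis by (simp add: integral_unique)
qed

text \<open>The three regimes of the pair estimate added up: 1 stands for the trivial bound,
  \<open>16 * D\<^sup>2\<close> for a vertical offset below \<open>4 * D * \<delta>\<close>, and
  \<open>4 * \<Lambda>\<^sup>2\<close> for an offset of size at most
  \<open>2 * \<Lambda> * \<bar>\<tau>\<bar>\<close>, where the gain comes from integration by
  parts.\<close>

definition tube_const :: "real \<Rightarrow> real \<Rightarrow> real \<Rightarrow> real \<Rightarrow> real \<Rightarrow> real" where
  "tube_const l \<kappa> \<Lambda> M D =
     2 * D * M\<^sup>2 * l ^ 3 * (1 + 16 * D\<^sup>2) + 4 * \<Lambda>\<^sup>2 * (2 * D * M\<^sup>2 * (l / \<kappa> + l\<^sup>2 * \<Lambda> / \<kappa>\<^sup>2) * (4 * D / \<kappa>))"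

text \<open>\<open>K\<close> is the correlation of two thin profiles along curves whose vertical gap
  is \<open>v - G a\<close>. As \<psi> has a compactly supported primitive and the gap changes at
  speed at least \<open>\<kappa> * \<bar>\<tau>\<bar>\<close>, averaging over \<open>a\<close>
  cancels most of it. Both bounds together are the kernel hypotheses of
  \<open>spread_kernel_sum\<close>.\<close>

lemma tube_pair_bound:
  fixes G G1 G2 \<Psi> \<psi> \<phi> :: "real \<Rightarrow> real" and v \<tau> :: real
  assumes AB: "A < B" and \<kappa>: "0 < \<kappa>" and \<Lambda>: "1 \<le> \<Lambda>" and D: "0 < D" and M: "0 < M" and d: "0 < \<delta>"
    and dG: "\<And>a. a \<in> {A..B} \<Longrightarrow> (G has_real_derivative G1 a) (at a)"
    and dG1: "\<And>a. a \<in> {A..B} \<Longrightarrow> (G1 has_real_derivative G2 a) (at a)"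
    and G: "\<And>a. a \<in> {A..B} \<Longrightarrow> \<bar>G a\<bar> \<le> \<Lambda> * \<bar>\<tau>\<bar>"
    and G1: "\<And>a. a \<in> {A..B} \<Longrightarrow> \<kappa> * \<bar>\<tau>\<bar> \<le> \<bar>G1 a\<bar>"
    and G2: "\<And>a. a \<in> {A..B} \<Longrightarrow> \<bar>G2 a\<bar> \<le> \<Lambda> * \<bar>\<tau>\<bar>"
    and d\<Psi>: "\<And>x. (\<Psi> has_real_derivative \<psi> x) (at x)"
    and cont: "continuous_on UNIV \<psi>" "continuous_on UNIV \<phi>"
    and bd: "\<And>x. \<bar>\<Psi> x\<bar> \<le> M" "\<And>x. \<bar>\<psi> x\<bar> \<le> M / \<delta>" "\<And>x. \<bar>\<phi> x\<bar> \<le> M / \<delta>"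
    and supp: "\<And>x. D * \<delta> \<le> \<bar>x\<bar> \<Longrightarrow> \<Psi> x = 0" "\<And>x. D * \<delta> \<le> \<bar>x\<bar> \<Longrightarrow> \<psi> x = 0"
  defines "K \<equiv> integral {A..B} (\<lambda>a. (a - A) * (B - a) * integral {- (D * \<delta>)..D * \<delta>} (\<lambda>x. \<psi> (x + v - G a) * \<phi> x))"
  shows "\<bar>K\<bar> \<le> tube_const (B - A) \<kappa> \<Lambda> M D / \<delta>"
    and "\<bar>K\<bar> * (max \<bar>\<tau>\<bar> \<bar>v\<bar>)\<^sup>2 \<le> tube_const (B - A) \<kappa> \<Lambda> M D * \<delta>"
proof -
  define R where "R = D * \<delta>"
  have R: "R > 0" using D d by (simp add: R_def)
  have contG: "continuous_on {A..B} G"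
    by (rule DERIV_continuous_on) (rule DERIV_subset[OF dG], auto)
  define I where "I x = integral {A..B} (\<lambda>a. (a - A) * (B - a) * \<psi> (x + v - G a))" for x
  have c2: "continuous_on (cbox (A, -R) (B, R)) (\<lambda>(a, x). (a - A) * (B - a) * (\<psi> (x + v - G a) * \<phi> x))"
    unfolding split_beta
    by (intro continuous_intros continuous_on_compose2[OF cont(1)] continuous_on_compose2[OF cont(2)] continuous_on_compose2[OF contG])
       (auto simp: mem_box cbox_Pair_eq)
  \<comment> \<open>The order of integration is exchanged so that the oscillation in
    \<open>a\<close> can be used for each fixed \<open>x\<close>, while \<phi> enters only through
    its size.\<close>
  have "K = integral {A..B} (\<lambda>a. integral {-R..R} (\<lambda>x. (a - A) * (B - a) * (\<psi> (x + v - G a) * \<phi> x)))"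
    unfolding K_def R_def by simp
  also have "\<dots> = integral {-R..R} (\<lambda>x. integral {A..B} (\<lambda>a. (a - A) * (B - a) * (\<psi> (x + v - G a) * \<phi> x)))"
    using integral_swap_continuous[OF c2] by (simp add: cbox_interval)
  also have "\<dots> = integral {-R..R} (\<lambda>x. I x * \<phi> x)"
    unfolding I_def by (intro integral_cong) (simp add: integral_mult_left[symmetric] mult.assoc del: integral_mult_left)
  finally have K: "K = integral {-R..R} (\<lambda>x. I x * \<phi> x)" .
  have cI: "continuous_on {-R..R} I"
  proof -
    have "continuous_on ({-R..R} \<times> cbox A B) (\<lambda>(x, a). (a - A) * (B - a) * \<psi> (x + v - G a))"
      unfolding split_beta
      by (intro continuous_intros continuous_on_compose2[OF cont(1)] continuous_on_compose2[OF contG]) auto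
    then show ?thesis unfolding I_def by (intro integral_continuous_on_param[of _ A B, unfolded cbox_interval]) (simp add: cbox_interval)
  qed
  have outer: "\<bar>K\<bar> \<le> 2 * D * M * X" if X: "X \<ge> 0" "\<And>x. x \<in> {-R..R} \<Longrightarrow> \<bar>I x\<bar> \<le> X" for X
  proof -
    have "((\<lambda>x. I x * \<phi> x) has_integral K) (cbox (-R) R)"
      unfolding K cbox_interval
      by (intro integrable_integral integrable_continuous_real continuous_intros cI continuous_on_subset[OF cont(2)]) auto
    moreover have "norm (I x * \<phi> x) \<le> X * (M / \<delta>)" if "x \<in> cbox (-R) R" for x
      unfolding real_norm_def abs_mult using X that bd(3) by (intro mult_mono) auto
    ultimately have "norm K \<le> X * (M / \<delta>) * Henstock_Kurzweil_Integration.content (cbox (-R) R)"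
      using X M d by (intro has_integral_bound) auto
    then have "\<bar>K\<bar> \<le> X * (M / \<delta>) * Henstock_Kurzweil_Integration.content (cbox (-R) R)" by simp
    also have "\<dots> = 2 * D * M * X" using R d by (simp add: content_real R_def field_simps)
    finally show ?thesis .
  qed
  have I1: "\<bar>I x\<bar> \<le> (B - A) ^ 3 * M / \<delta>" for x
  proof -
    have "((\<lambda>a. (a - A) * (B - a) * \<psi> (x + v - G a)) has_integral I x) (cbox A B)"
      unfolding I_def cbox_interval
      by (intro integrable_integral integrable_continuous_real continuous_intros continuous_on_compose2[OF cont(1)] contG) auto
    moreover have "\<bar>(a - A) * (B - a) * \<psi> (x + v - G a)\<bar> \<le> (B - A)\<^sup>2 * (M / \<delta>)" if "a \<in> {A..B}" for a
    proof -
      have "\<bar>(a - A) * (B - a)\<bar> \<le> (B - A)\<^sup>2"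
        unfolding power2_eq_square abs_mult using that by (intro mult_mono) auto
      then show ?thesis unfolding abs_mult[of "(a - A) * (B - a)"] using bd(2) by (intro mult_mono) auto
    qed
    ultimately have "\<bar>I x\<bar> \<le> (B - A)\<^sup>2 * (M / \<delta>) * Henstock_Kurzweil_Integration.content (cbox A B)"
      using has_integral_bound[of "(B - A)\<^sup>2 * (M / \<delta>)" "\<lambda>a. (a - A) * (B - a) * \<psi> (x + v - G a)" "I x" A B] M d AB
      by (auto simp: cbox_interval)
    also have "\<dots> = (B - A) ^ 3 * M / \<delta>" using AB by (simp add: content_real power2_eq_square power3_eq_cube)
    finally show ?thesis .
  qed
  define K1 where "K1 = 2 * D * M\<^sup>2 * (B - A) ^ 3"
  define C2 where "C2 = (B - A) / \<kappa> + (B - A)\<^sup>2 * \<Lambda> / \<kappa>\<^sup>2"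
  define K2 where "K2 = 2 * D * M\<^sup>2 * C2 * (4 * D / \<kappa>)"
  have C20: "C2 \<ge> 0" using AB \<kappa> \<Lambda> by (simp add: C2_def)
  have K10: "K1 \<ge> 0" using AB D by (simp add: K1_def)
  have K20: "K2 \<ge> 0" using C20 D \<kappa> by (simp add: K2_def)
  have tc: "tube_const (B - A) \<kappa> \<Lambda> M D = K1 * (1 + 16 * D\<^sup>2) + 4 * \<Lambda>\<^sup>2 * K2"
    unfolding tube_const_def K1_def K2_def C2_def by simp
  have k1: "\<bar>K\<bar> \<le> K1 / \<delta>"
    using outer[of "(B - A) ^ 3 * M / \<delta>"] I1 AB M d by (simp add: K1_def power2_eq_square mult_ac)
  have "K1 / \<delta> \<le> (K1 * (1 + 16 * D\<^sup>2) + 4 * \<Lambda>\<^sup>2 * K2) / \<delta>"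
    using K10 K20 d by (intro divide_right_mono) (auto simp: algebra_simps)
  then show "\<bar>K\<bar> \<le> tube_const (B - A) \<kappa> \<Lambda> M D / \<delta>" using k1 tc by simp
  have k2: "\<bar>K\<bar> * \<tau>\<^sup>2 \<le> K2 * \<delta>"
  proof (cases "\<tau> = 0")
    case True
    then show ?thesis using K20 d by simp
  next
    case False
    have mu: "0 < \<kappa> * \<bar>\<tau>\<bar>" using \<kappa> False by simp
    have "\<bar>I x\<bar> \<le> M * ((B - A) / (\<kappa> * \<bar>\<tau>\<bar>) + (B - A)\<^sup>2 * (\<Lambda> * \<bar>\<tau>\<bar>) / (\<kappa> * \<bar>\<tau>\<bar>)\<^sup>2) * (4 * (D * \<delta>) / (\<kappa> * \<bar>\<tau>\<bar>))" for x
      unfolding I_def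
    proof (rule oscillatory_cutoff_integral[OF AB mu, where H = "\<lambda>a. x + v - G a" and ?H1.0 = "\<lambda>a. - G1 a" and ?H2.0 = "\<lambda>a. - G2 a" and \<Psi> = \<Psi> and \<psi> = \<psi>])
      show "((\<lambda>a. x + v - G a) has_real_derivative - G1 a) (at a)" if "a \<in> {A..B}" for a
        using DERIV_diff[OF DERIV_const[of "x + v"] dG[OF that]] by simp
      show "((\<lambda>a. - G1 a) has_real_derivative - G2 a) (at a)" if "a \<in> {A..B}" for a
        using DERIV_minus[OF dG1[OF that]] .
    qed (use D d M \<Lambda> G1 G2 d\<Psi> cont bd supp in auto)
    also have "M * ((B - A) / (\<kappa> * \<bar>\<tau>\<bar>) + (B - A)\<^sup>2 * (\<Lambda> * \<bar>\<tau>\<bar>) / (\<kappa> * \<bar>\<tau>\<bar>)\<^sup>2) * (4 * (D * \<delta>) / (\<kappa> * \<bar>\<tau>\<bar>))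
      = M * C2 * (4 * D / \<kappa>) * \<delta> / \<tau>\<^sup>2"
      (is "?L = ?R")
    proof -
      have "(B - A) / (\<kappa> * \<bar>\<tau>\<bar>) + (B - A)\<^sup>2 * (\<Lambda> * \<bar>\<tau>\<bar>) / (\<kappa> * \<bar>\<tau>\<bar>)\<^sup>2 = C2 / \<bar>\<tau>\<bar>"
        unfolding C2_def using False \<kappa> by (simp add: power2_eq_square add_divide_distrib)
      then have "?L = M * (C2 / \<bar>\<tau>\<bar>) * (4 * (D * \<delta>) / (\<kappa> * \<bar>\<tau>\<bar>))" by simp
      also have "\<dots> = M * C2 * (4 * D / \<kappa>) * \<delta> / \<bar>\<tau>\<bar>\<^sup>2" using False \<kappa> by (simp add: power2_eq_square divide_simps)
      finally show ?thesis by simp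
    qed
    finally have I2: "\<bar>I x\<bar> \<le> ?R" for x .
    have "\<bar>K\<bar> \<le> 2 * D * M * ?R" by (rule outer) (use C20 M D \<kappa> d I2 in auto)
    also have "\<dots> = K2 * \<delta> / \<tau>\<^sup>2" by (simp add: K2_def power2_eq_square[of M])
    finally show ?thesis using False by (simp add: field_simps)
  qed
  show "\<bar>K\<bar> * (max \<bar>\<tau>\<bar> \<bar>v\<bar>)\<^sup>2 \<le> tube_const (B - A) \<kappa> \<Lambda> M D * \<delta>"
  \<comment> \<open>Integration by parts controls only the separation \<open>\<tau>\<close>. A
    comparable \<open>v\<close> is dominated by it; a much larger \<open>v\<close> leaves either two
    nearly coincident tubes or disjoint ones.\<close>
  proof (cases "\<bar>v\<bar> \<le> 2 * \<Lambda> * \<bar>\<tau>\<bar>")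
    case True
    have "1 * \<bar>\<tau>\<bar> \<le> (2 * \<Lambda>) * \<bar>\<tau>\<bar>" using \<Lambda> by (intro mult_right_mono) auto
    then have "max \<bar>\<tau>\<bar> \<bar>v\<bar> \<le> 2 * \<Lambda> * \<bar>\<tau>\<bar>" using True by simp
    then have "(max \<bar>\<tau>\<bar> \<bar>v\<bar>)\<^sup>2 \<le> (2 * \<Lambda> * \<bar>\<tau>\<bar>)\<^sup>2" by (intro power_mono) auto
    then have "\<bar>K\<bar> * (max \<bar>\<tau>\<bar> \<bar>v\<bar>)\<^sup>2 \<le> \<bar>K\<bar> * (2 * \<Lambda> * \<bar>\<tau>\<bar>)\<^sup>2" by (intro mult_left_mono) auto
    also have "\<dots> = 4 * \<Lambda>\<^sup>2 * (\<bar>K\<bar> * \<tau>\<^sup>2)" by (simp add: power_mult_distrib)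
    also have "\<dots> \<le> 4 * \<Lambda>\<^sup>2 * (K2 * \<delta>)" using k2 by (intro mult_left_mono) auto
    also have "\<dots> \<le> tube_const (B - A) \<kappa> \<Lambda> M D * \<delta>" unfolding tc using K10 d by (simp add: algebra_simps)
    finally show ?thesis .
  next
    case False
    have "1 * \<bar>\<tau>\<bar> \<le> (2 * \<Lambda>) * \<bar>\<tau>\<bar>" using \<Lambda> by (intro mult_right_mono) auto
    then have mx: "max \<bar>\<tau>\<bar> \<bar>v\<bar> = \<bar>v\<bar>" using False by auto
    show ?thesis
    proof (cases "\<bar>v\<bar> \<le> 4 * R")
      case True
      then have "(max \<bar>\<tau>\<bar> \<bar>v\<bar>)\<^sup>2 \<le> (4 * R)\<^sup>2" unfolding mx by (intro power_mono) auto
      then have "\<bar>K\<bar> * (max \<bar>\<tau>\<bar> \<bar>v\<bar>)\<^sup>2 \<le> K1 / \<delta> * (4 * R)\<^sup>2" using k1 by (intro mult_mono) (use K10 d in auto)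
      also have "\<dots> = K1 * (16 * D\<^sup>2) * \<delta>" using d by (simp add: R_def power2_eq_square)
      also have "\<dots> \<le> tube_const (B - A) \<kappa> \<Lambda> M D * \<delta>" unfolding tc using K10 K20 d by (simp add: algebra_simps)
      finally show ?thesis .
    next
      case F2: False
      \<comment> \<open>Here the gap \<open>G a\<close> uses up at most half of
        \<open>\<bar>v\<bar>\<close>, and the other half exceeds \<open>2 * R\<close>, so after
        subtracting \<open>\<bar>x\<bar> \<le> R\<close> the argument is outside the
        support.\<close>
      have "\<psi> (x + v - G a) = 0" if "x \<in> {-R..R}" "a \<in> {A..B}" for x a
      proof -
        have "R \<le> \<bar>x + v - G a\<bar>" using that G[OF that(2)] False F2 R by auto
        then show ?thesis using supp(2) by (simp add: R_def)
      qed
      then have "integral {-R..R} (\<lambda>x. \<psi> (x + v - G a) * \<phi> x) = integral {-R..R} (\<lambda>x. 0)" if "a \<in> {A..B}" for a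
        using that by (intro integral_cong) simp
      then have "K = integral {A..B} (\<lambda>a. 0)" unfolding K_def R_def[symmetric]
        by (intro integral_cong) simp
      then have "K = 0" by simp
      then show ?thesis using K10 K20 d tc by simp
    qed
  qed
qed

text \<open>Expanding the square reduces the claim to correlations of pairs, which are summed by
  \<open>spread_kernel_sum\<close> for each fixed first point. The profile may vary with the point:
  for areas it depends on the slope of the line.\<close>

lemma tube_L2_bound:
  fixes g g1 g2 :: "real \<Rightarrow> 'p \<Rightarrow> real" and \<Psi> \<psi> :: "'p \<Rightarrow> real \<Rightarrow> real"
  assumes sp: "spread P w x y s C \<delta>\<^sub>0" and s: "s < 2" and d: "0 < \<delta>" "\<delta>\<^sub>0 \<le> \<delta>" and C: "C \<ge> 0"
    and AB: "A < A'" "A' \<le> B'" "B' < B" and \<kappa>: "0 < \<kappa>" and \<Lambda>: "1 \<le> \<Lambda>" and D: "0 < D" and M: "0 < M"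
    and dg: "\<And>a p. a \<in> {A..B} \<Longrightarrow> p \<in> P \<Longrightarrow> ((\<lambda>a. g a p) has_real_derivative g1 a p) (at a)"
    and dg1: "\<And>a p. a \<in> {A..B} \<Longrightarrow> p \<in> P \<Longrightarrow> ((\<lambda>a. g1 a p) has_real_derivative g2 a p) (at a)"
    and g: "\<And>a p q. a \<in> {A..B} \<Longrightarrow> p \<in> P \<Longrightarrow> q \<in> P \<Longrightarrow> \<bar>g a p - g a q\<bar> \<le> \<Lambda> * \<bar>x p - x q\<bar>"
    and g1: "\<And>a p q. a \<in> {A..B} \<Longrightarrow> p \<in> P \<Longrightarrow> q \<in> P \<Longrightarrow> \<kappa> * \<bar>x p - x q\<bar> \<le> \<bar>g1 a p - g1 a q\<bar>"
    and g2: "\<And>a p q. a \<in> {A..B} \<Longrightarrow> p \<in> P \<Longrightarrow> q \<in> P \<Longrightarrow> \<bar>g2 a p - g2 a q\<bar> \<le> \<Lambda> * \<bar>x p - x q\<bar>"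
    and d\<Psi>: "\<And>p t. p \<in> P \<Longrightarrow> (\<Psi> p has_real_derivative \<psi> p t) (at t)"
    and cont: "\<And>p. p \<in> P \<Longrightarrow> continuous_on UNIV (\<psi> p)"
    and bd: "\<And>p t. p \<in> P \<Longrightarrow> \<bar>\<Psi> p t\<bar> \<le> M" "\<And>p t. p \<in> P \<Longrightarrow> \<bar>\<psi> p t\<bar> \<le> M / \<delta>"
    and supp: "\<And>p t. p \<in> P \<Longrightarrow> D * \<delta> \<le> \<bar>t\<bar> \<Longrightarrow> \<Psi> p t = 0" "\<And>p t. p \<in> P \<Longrightarrow> D * \<delta> \<le> \<bar>t\<bar> \<Longrightarrow> \<psi> p t = 0"
  shows "integral (cbox (A', J1) (B', J2)) (\<lambda>(a, b). (\<Sum>p\<in>P. w p * \<psi> p (y p - g a p - b))\<^sup>2)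
    \<le> 4 * tube_const (B - A) \<kappa> \<Lambda> M D * C / ((1 - 2 powr (s - 2)) * ((A' - A) * (B - B'))) * sum w P * \<delta> powr (s - 1)"
proof -
  have fin: "finite P" and w0: "\<And>p. p \<in> P \<Longrightarrow> 0 \<le> w p" using sp by (auto simp: spread_def)
  define T where "T = tube_const (B - A) \<kappa> \<Lambda> M D"
  have T0: "T \<ge> 0" unfolding T_def tube_const_def using AB \<kappa> \<Lambda> D by (intro add_nonneg_nonneg mult_nonneg_nonneg) auto
  define m where "m = (A' - A) * (B - B')"
  have m: "m > 0" using AB by (simp add: m_def)
  define \<omega> where "\<omega> a = (a - A) * (B - a)" for a
  have \<omega>m: "m \<le> \<omega> a" if "a \<in> {A'..B'}" for a unfolding m_def \<omega>_def using that AB by (intro mult_mono) auto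
  have \<omega>0: "0 \<le> \<omega> a" if "a \<in> {A..B}" for a unfolding \<omega>_def using that by auto
  define U where "U a b = (\<Sum>p\<in>P. w p * \<psi> p (y p - g a p - b))" for a b
  have cg: "continuous_on {A..B} (\<lambda>a. g a p)" if "p \<in> P" for p
    by (rule DERIV_continuous_on) (rule DERIV_subset[OF dg[OF _ that]], auto)
  have cU: "continuous_on ({A..B} \<times> UNIV) (\<lambda>(a, b). U a b)"
    unfolding U_def split_beta
    by (intro continuous_intros continuous_on_compose2[OF cont] continuous_on_compose2[OF cg]) auto
  define R where "R = D * \<delta>"
  have R: "R > 0" using D d by (simp add: R_def)
  define \<Theta> where "\<Theta> p q a = integral {-R..R} (\<lambda>t. \<psi> p (t + (y p - y q) - (g a p - g a q)) * \<psi> q t)" for p q a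
  have c\<Theta>: "continuous_on {A..B} (\<Theta> p q)" if "p \<in> P" "q \<in> P" for p q
  proof -
    have "continuous_on ({A..B} \<times> cbox (-R) R) (\<lambda>(a, t). \<psi> p (t + (y p - y q) - (g a p - g a q)) * \<psi> q t)"
      unfolding split_beta using that
      by (intro continuous_intros continuous_on_compose2[OF cont] continuous_on_compose2[OF cg]) auto
    then show ?thesis unfolding \<Theta>_def cbox_interval[symmetric] by (rule integral_continuous_on_param)
  qed
  \<comment> \<open>The integrand is a square, so the range of \<open>b\<close> may grow until it
    contains all tubes. Then the integral of each product is translation invariant and depends only
    on the gap of the two curves.\<close>
  have inner: "integral {J1..J2} (\<lambda>b. (U a b)\<^sup>2) \<le> (\<Sum>p\<in>P. \<Sum>q\<in>P. w p * w q * \<Theta> p q a)" if a: "a \<in> {A..B}" for a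
  proof -
    define Z where "Z = \<bar>J1\<bar> + \<bar>J2\<bar> + (\<Sum>p\<in>P. \<bar>y p - g a p\<bar>) + R"
    have Z: "\<bar>y q - g a q\<bar> + R \<le> Z" if "q \<in> P" for q
      using member_le_sum[OF that _ fin, of "\<lambda>p. \<bar>y p - g a p\<bar>"] by (simp add: Z_def)
    have cUa: "continuous_on S (\<lambda>b. U a b)" for S
      unfolding U_def by (intro continuous_intros continuous_on_compose2[OF cont]) auto
    have "integral {J1..J2} (\<lambda>b. (U a b)\<^sup>2) \<le> integral {-Z..Z} (\<lambda>b. (U a b)\<^sup>2)"
    proof (rule integral_subset_le)
      have "0 \<le> (\<Sum>p\<in>P. \<bar>y p - g a p\<bar>)" by (simp add: sum_nonneg)
      then have "-Z \<le> J1" "J2 \<le> Z" using R unfolding Z_def by linarith+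
      then show "{J1..J2} \<subseteq> {-Z..Z}" by auto
    qed (auto intro!: integrable_continuous_real continuous_intros cUa)
    also have "\<dots> = integral {-Z..Z} (\<lambda>b. \<Sum>p\<in>P. \<Sum>q\<in>P. w p * w q * (\<psi> p (y p - g a p - b) * \<psi> q (y q - g a q - b)))"
      unfolding U_def power2_eq_square sum_product by (simp add: mult_ac)
    also have "\<dots> = (\<Sum>p\<in>P. \<Sum>q\<in>P. w p * w q * integral {-Z..Z} (\<lambda>b. \<psi> p (y p - g a p - b) * \<psi> q (y q - g a q - b)))"
    proof -
      have i: "(\<lambda>b. w p * w q * (\<psi> p (y p - g a p - b) * \<psi> q (y q - g a q - b))) integrable_on {-Z..Z}" if "p \<in> P" "q \<in> P" for p q
        using that by (intro integrable_continuous_real continuous_intros continuous_on_compose2[OF cont]) auto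
      have "integral {-Z..Z} (\<lambda>b. \<Sum>p\<in>P. \<Sum>q\<in>P. w p * w q * (\<psi> p (y p - g a p - b) * \<psi> q (y q - g a q - b)))
        = (\<Sum>p\<in>P. integral {-Z..Z} (\<lambda>b. \<Sum>q\<in>P. w p * w q * (\<psi> p (y p - g a p - b) * \<psi> q (y q - g a q - b))))"
        by (rule integral_sum[OF fin]) (intro integrable_sum[OF fin] i)
      also have "\<dots> = (\<Sum>p\<in>P. \<Sum>q\<in>P. integral {-Z..Z} (\<lambda>b. w p * w q * (\<psi> p (y p - g a p - b) * \<psi> q (y q - g a q - b))))"
        by (intro sum.cong refl integral_sum[OF fin] i)
      finally show ?thesis by simp
    qed
    also have "\<dots> = (\<Sum>p\<in>P. \<Sum>q\<in>P. w p * w q * \<Theta> p q a)"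
    proof (intro sum.cong refl arg_cong2[where f = times])
      fix p q assume pq: "p \<in> P" "q \<in> P"
      have "integral {-Z..Z} (\<lambda>b. (\<lambda>t. \<psi> p (t + (y p - y q) - (g a p - g a q)) * \<psi> q t) (y q - g a q - b)) = \<Theta> p q a"
        unfolding \<Theta>_def
      proof (rule integral_reflect_shift)
        show "continuous_on UNIV (\<lambda>t. \<psi> p (t + (y p - y q) - (g a p - g a q)) * \<psi> q t)"
          using pq by (intro continuous_intros continuous_on_compose2[OF cont]) auto
      qed (use Z pq supp in \<open>auto simp: R_def\<close>)
      then show "integral {-Z..Z} (\<lambda>b. \<psi> p (y p - g a p - b) * \<psi> q (y q - g a q - b)) = \<Theta> p q a"
        by (simp add: algebra_simps)
    qed
    finally show ?thesis .
  qed
  define S where "S a = (\<Sum>p\<in>P. \<Sum>q\<in>P. w p * w q * \<Theta> p q a)" for a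
  have cS: "continuous_on {A..B} S" unfolding S_def using c\<Theta> by (intro continuous_intros) auto
  have S0: "0 \<le> S a" if "a \<in> {A..B}" for a
    using inner[OF that] integral_nonneg[of "\<lambda>b. (U a b)\<^sup>2" "{J1..J2}"] unfolding S_def
    by (smt (verit, best) not_integrable_integral zero_le_power2)
  have sub: "{A'..B'} \<subseteq> {A..B}" using AB by auto
  have cU2: "continuous_on (cbox (A', J1) (B', J2)) (\<lambda>(a, b). (U a b)\<^sup>2)"
  proof -
    have "cbox (A', J1) (B', J2) \<subseteq> {A..B} \<times> UNIV" using sub by (auto simp: cbox_Pair_eq)
    from continuous_on_power[OF continuous_on_subset[OF cU this], of 2] show ?thesis by (simp add: split_beta)
  qed
  have "integral (cbox (A', J1) (B', J2)) (\<lambda>(a, b). (U a b)\<^sup>2) = integral {A'..B'} (\<lambda>a. integral {J1..J2} (\<lambda>b. (U a b)\<^sup>2))"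
    using integral_prod_continuous[OF cU2] by (simp add: cbox_interval)
  \<comment> \<open>The cutoff weight is inserted here: divided by its minimum \<open>m\<close> on
    the inner interval it is at least 1 there, and \<open>S\<close> is nonnegative, being an upper
    bound for integrals of squares.\<close>
  also have "\<dots> \<le> integral {A'..B'} (\<lambda>a. \<omega> a / m * S a)"
  proof (rule integral_le)
    show "(\<lambda>a. integral {J1..J2} (\<lambda>b. (U a b)\<^sup>2)) integrable_on {A'..B'}"
      using integral_integrable_2dim[OF cU2] by (simp add: cbox_interval)
    show "(\<lambda>a. \<omega> a / m * S a) integrable_on {A'..B'}"
      unfolding \<omega>_def by (intro integrable_continuous_real continuous_intros continuous_on_subset[OF cS sub]) (use m in auto)
    fix a assume a: "a \<in> {A'..B'}"
    then have aA: "a \<in> {A..B}" using sub by auto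
    have "1 * S a \<le> \<omega> a / m * S a" using \<omega>m[OF a] m S0[OF aA] by (intro mult_right_mono) auto
    then show "integral {J1..J2} (\<lambda>b. (U a b)\<^sup>2) \<le> \<omega> a / m * S a" using inner[OF aA] by (simp add: S_def)
  qed
  also have "\<dots> \<le> integral {A..B} (\<lambda>a. \<omega> a / m * S a)"
    by (rule integral_subset_le[OF sub])
       (use m S0 \<omega>0 sub in \<open>auto simp: \<omega>_def intro!: integrable_continuous_real continuous_intros continuous_on_subset[OF cS]\<close>)
  also have "\<dots> = integral {A..B} (\<lambda>a. \<Sum>p\<in>P. \<Sum>q\<in>P. w p * w q / m * (\<omega> a * \<Theta> p q a))"
    unfolding S_def sum_distrib_left by (simp add: mult_ac)
  also have "\<dots> = (\<Sum>p\<in>P. \<Sum>q\<in>P. w p * w q / m * integral {A..B} (\<lambda>a. \<omega> a * \<Theta> p q a))"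
  proof -
    have i: "(\<lambda>a. w p * w q / m * (\<omega> a * \<Theta> p q a)) integrable_on {A..B}" if "p \<in> P" "q \<in> P" for p q
      using that m unfolding \<omega>_def by (intro integrable_continuous_real continuous_intros c\<Theta>) auto
    have "integral {A..B} (\<lambda>a. \<Sum>p\<in>P. \<Sum>q\<in>P. w p * w q / m * (\<omega> a * \<Theta> p q a))
      = (\<Sum>p\<in>P. integral {A..B} (\<lambda>a. \<Sum>q\<in>P. w p * w q / m * (\<omega> a * \<Theta> p q a)))"
      by (rule integral_sum[OF fin]) (intro integrable_sum[OF fin] i)
    also have "\<dots> = (\<Sum>p\<in>P. \<Sum>q\<in>P. integral {A..B} (\<lambda>a. w p * w q / m * (\<omega> a * \<Theta> p q a)))"
      by (intro sum.cong refl integral_sum[OF fin] i)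
    finally show ?thesis by (simp only: integral_mult_right)
  qed
  also have "\<dots> = (\<Sum>p\<in>P. w p / m * (\<Sum>q\<in>P. w q * integral {A..B} (\<lambda>a. \<omega> a * \<Theta> p q a)))"
    by (simp add: sum_distrib_left mult_ac)
  also have "\<dots> \<le> (\<Sum>p\<in>P. w p / m * (4 * T * C / (1 - 2 powr (s - 2)) * \<delta> powr (s - 1)))"
  proof (intro sum_mono mult_left_mono)
    fix p assume p: "p \<in> P"
    show "(\<Sum>q\<in>P. w q * integral {A..B} (\<lambda>a. \<omega> a * \<Theta> p q a)) \<le> 4 * T * C / (1 - 2 powr (s - 2)) * \<delta> powr (s - 1)"
    proof (rule spread_kernel_sum[OF sp s d T0 C, where \<alpha> = "x p" and \<beta> = "y p"])
      fix q assume q: "q \<in> P"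
      have AB': "A < B" using AB by simp
      have K: "\<bar>integral {A..B} (\<lambda>a. \<omega> a * \<Theta> p q a)\<bar> \<le> T / \<delta> \<and> 
         \<bar>integral {A..B} (\<lambda>a. \<omega> a * \<Theta> p q a)\<bar> * (max \<bar>x p - x q\<bar> \<bar>y p - y q\<bar>)\<^sup>2 \<le> T * \<delta>"
        unfolding \<omega>_def \<Theta>_def R_def T_def
        using tube_pair_bound[where G = "\<lambda>a. g a p - g a q" and ?G1.0 = "\<lambda>a. g1 a p - g1 a q" and ?G2.0 = "\<lambda>a. g2 a p - g2 a q"
          and \<Psi> = "\<Psi> p" and \<psi> = "\<psi> p" and \<phi> = "\<psi> q" and \<tau> = "x p - x q" and v = "y p - y q", OF AB' \<kappa> \<Lambda> D M d(1)
          DERIV_diff[OF dg[OF _ p] dg[OF _ q]] DERIV_diff[OF dg1[OF _ p] dg1[OF _ q]] g[OF _ p q] g1[OF _ p q] g2[OF _ p q]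
          d\<Psi>[OF p] cont[OF p] cont[OF q] bd(1)[OF p] bd(2)[OF p] bd(2)[OF q] supp(1)[OF p] supp(2)[OF p]] by simp
      then show "integral {A..B} (\<lambda>a. \<omega> a * \<Theta> p q a) \<le> T / \<delta>" by linarith
      have "integral {A..B} (\<lambda>a. \<omega> a * \<Theta> p q a) * (max \<bar>x q - x p\<bar> \<bar>y q - y p\<bar>)\<^sup>2 \<le> 
        \<bar>integral {A..B} (\<lambda>a. \<omega> a * \<Theta> p q a)\<bar> * (max \<bar>x q - x p\<bar> \<bar>y q - y p\<bar>)\<^sup>2" by (intro mult_right_mono) auto
      then show "integral {A..B} (\<lambda>a. \<omega> a * \<Theta> p q a) * (max \<bar>x q - x p\<bar> \<bar>y q - y p\<bar>)\<^sup>2 \<le> T * \<delta>"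
        using K by (simp add: abs_minus_commute)
    qed
  qed (use w0 m in auto)
  also have "\<dots> = sum w P / m * (4 * T * C / (1 - 2 powr (s - 2)) * \<delta> powr (s - 1))"
    by (simp only: sum_distrib_right sum_divide_distrib)
  also have "\<dots> = 4 * T * C / ((1 - 2 powr (s - 2)) * m) * sum w P * \<delta> powr (s - 1)"
    by (simp add: mult_ac)
  finally show ?thesis by (simp add: U_def T_def m_def)
qed

section \<open>Passing from one scale to the next\<close>

text \<open>Bins of width \<open>h\<close> number at most \<open>(B - A + h) / h\<close>; if each
  bin weighed less than its share, the total would fall below \<open>m\<close>. The centre is itself
  one of the values, so it inherits what is known about them.\<close>

lemma weighted_pigeonhole:
  fixes w t :: "'i \<Rightarrow> real"
  assumes fin: "finite \<Omega>" and m: "0 < m" "m \<le> sum w \<Omega>"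
    and t: "\<And>i. i \<in> \<Omega> \<Longrightarrow> A \<le> t i \<and> t i \<le> B" and h: "h > 0" and w0: "\<And>i. i \<in> \<Omega> \<Longrightarrow> 0 \<le> w i"
  shows "\<exists>j\<in>\<Omega>. m * h / (B - A + h) \<le> sum w {i\<in>\<Omega>. \<bar>t i - t j\<bar> \<le> h}"
proof (rule ccontr)
  define v where "v = m * h / (B - A + h)"
  assume "\<not> ?thesis"
  then have lt: "sum w {i\<in>\<Omega>. \<bar>t i - t j\<bar> \<le> h} < v" if "j \<in> \<Omega>" for j
    using that by (force simp: v_def)
  have ne: "\<Omega> \<noteq> {}" using m by auto
  then have AB: "A \<le> B" using t by fastforce
  define bin where "bin i = nat \<lfloor>(t i - A) / h\<rfloor>" for i
  have close: "\<bar>t i - t j\<bar> \<le> h" if "i \<in> \<Omega>" "j \<in> \<Omega>" "bin i = bin j" for i j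
  proof -
    have p: "(t i - A) / h \<ge> 0" "(t j - A) / h \<ge> 0" using t that h by simp_all
    then have "\<lfloor>(t i - A) / h\<rfloor> = \<lfloor>(t j - A) / h\<rfloor>" using that(3) by (simp add: bin_def eq_nat_nat_iff)
    then have "\<bar>(t i - A) / h - (t j - A) / h\<bar> \<le> 1" by linarith
    then have "\<bar>(t i - t j) / h\<bar> \<le> 1" by (simp add: diff_divide_distrib)
    then show ?thesis using h by (simp add: abs_divide)
  qed
  have sub: "bin ` \<Omega> \<subseteq> {..nat \<lfloor>(B - A) / h\<rfloor>}"
    using t h by (auto simp: bin_def intro!: nat_mono floor_mono divide_right_mono)
  have fb: "finite (bin ` \<Omega>)" using fin by simp
  have "card (bin ` \<Omega>) \<le> nat \<lfloor>(B - A) / h\<rfloor> + 1" using card_mono[OF _ sub] by simp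
  then have "real (card (bin ` \<Omega>)) \<le> real (nat \<lfloor>(B - A) / h\<rfloor>) + 1" by linarith
  also have "\<dots> \<le> (B - A) / h + 1" using AB h by simp
  also have "\<dots> = (B - A + h) / h" using h by (simp add: add_divide_distrib)
  finally have card: "real (card (bin ` \<Omega>)) \<le> (B - A + h) / h" .
  have v0: "v > 0" using m h AB by (simp add: v_def)
  have "sum w \<Omega> = (\<Sum>k\<in>bin ` \<Omega>. sum w {i\<in>\<Omega>. bin i = k})" by (rule sum.image_gen[OF fin])
  also have "\<dots> < (\<Sum>k\<in>bin ` \<Omega>. v)"
  proof (rule sum_strict_mono[OF fb])
    show "bin ` \<Omega> \<noteq> {}" using ne by simp
    fix k assume "k \<in> bin ` \<Omega>"
    then obtain j where j: "j \<in> \<Omega>" "k = bin j" by (elim imageE) (rule that)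
    have "sum w {i\<in>\<Omega>. bin i = k} \<le> sum w {i\<in>\<Omega>. \<bar>t i - t j\<bar> \<le> h}"
    proof (rule sum_mono2)
      show "finite {i\<in>\<Omega>. \<bar>t i - t j\<bar> \<le> h}" using fin by simp
      show "{i\<in>\<Omega>. bin i = k} \<subseteq> {i\<in>\<Omega>. \<bar>t i - t j\<bar> \<le> h}" 
      proof
        fix i assume "i \<in> {i\<in>\<Omega>. bin i = k}"
        then show "i \<in> {i\<in>\<Omega>. \<bar>t i - t j\<bar> \<le> h}" using close[of i j] j by simp
      qed
    qed (use w0 in simp)
    then show "sum w {i\<in>\<Omega>. bin i = k} < v" using lt[OF j(1)] by linarith
  qed
  also have "\<dots> = real (card (bin ` \<Omega>)) * v" by simp
  also have "\<dots> \<le> (B - A + h) / h * v" using card v0 by (intro mult_right_mono) auto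
  also have "\<dots> = m" using h AB by (simp add: v_def)
  finally show False using m by simp
qed

text \<open>The first index of \<open>F\<close> selects the weights, the second the scale. The point
  where \<open>F N N\<close> is large moves with \<open>N\<close>, so a convergent subsequence of
  these points is taken. Around its limit the Lipschitz constant of one coarse scale
  \<open>n\<close>, which does not depend on \<open>N\<close>, fixes the length of the
  interval.\<close>

lemma multiscale_positive_interval:
  fixes F :: "nat \<Rightarrow> nat \<Rightarrow> real \<Rightarrow> real"
  assumes q: "0 \<le> q" "q < 1" and K: "K \<ge> 0"
    and step: "\<And>N n t. n\<^sub>0 \<le> n \<Longrightarrow> n < N \<Longrightarrow> t \<in> {\<alpha>..\<beta>} \<Longrightarrow> \<bar>F N n t - F N (Suc n) t\<bar> \<le> K * q ^ n"
    and lip: "\<And>n. \<exists>L\<ge>0. \<forall>N\<ge>n. \<forall>t\<in>{\<alpha>..\<beta>}. \<forall>t'\<in>{\<alpha>..\<beta>}. \<bar>F N n t - F N n t'\<bar> \<le> L * \<bar>t - t'\<bar>"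
    and pos: "\<And>N. n\<^sub>0 \<le> N \<Longrightarrow> \<exists>t\<in>{\<alpha>'..\<beta>'}. c \<le> F N N t"
    and c: "c > 0" and ab: "\<alpha> < \<alpha>'" "\<beta>' < \<beta>"
  shows "\<exists>a b. a < b \<and> {a<..<b} \<subseteq> {\<alpha>..\<beta>} \<and> (\<forall>t\<in>{a<..<b}. \<exists>\<^sub>\<infinity>N. F N N t > 0)"
proof -
  have tel: "\<bar>F N n t - F N N t\<bar> \<le> K / (1 - q) * q ^ n" if n: "n\<^sub>0 \<le> n" "n \<le> N" and t: "t \<in> {\<alpha>..\<beta>}" for N n t
    using n(2,1)
  proof (induction n rule: inc_induct)
    case base
    then show ?case using K q by simp
  next
    case (step n)
    have "\<bar>F N n t - F N N t\<bar> \<le> \<bar>F N n t - F N (Suc n) t\<bar> + \<bar>F N (Suc n) t - F N N t\<bar>" by linarith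
    also have "\<dots> \<le> K * q ^ n + K / (1 - q) * q ^ Suc n"
      using step assms(4)[of n N t] t by (intro add_mono) auto
    also have "\<dots> = K / (1 - q) * q ^ n" using q by (simp add: field_simps)
    finally show ?case .
  qed
  have "(\<lambda>n. K / (1 - q) * q ^ n) \<longlonglongrightarrow> K / (1 - q) * 0"
    using q by (intro tendsto_mult tendsto_const LIMSEQ_power_zero) auto
  then have "\<forall>\<^sub>F n in sequentially. K / (1 - q) * q ^ n < c / 8"
    using c by (intro order_tendstoD) auto
  then have "\<forall>\<^sub>F n in sequentially. K / (1 - q) * q ^ n < c / 8 \<and> n\<^sub>0 \<le> n"
    by (intro eventually_conj eventually_ge_at_top)
  then obtain n where n: "K / (1 - q) * q ^ n < c / 8" "n\<^sub>0 \<le> n" by (auto simp: eventually_sequentially)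
  obtain L where L: "L \<ge> 0" "\<And>N t t'. N \<ge> n \<Longrightarrow> t \<in> {\<alpha>..\<beta>} \<Longrightarrow> t' \<in> {\<alpha>..\<beta>} \<Longrightarrow> \<bar>F N n t - F N n t'\<bar> \<le> L * \<bar>t - t'\<bar>"
    using lip[of n] by blast
  obtain T where T: "\<And>N. n \<le> N \<Longrightarrow> T N \<in> {\<alpha>'..\<beta>'} \<and> c \<le> F N N (T N)"
  proof -
    have "\<forall>N. \<exists>t. n \<le> N \<longrightarrow> t \<in> {\<alpha>'..\<beta>'} \<and> c \<le> F N N t"
    proof
      fix N
      show "\<exists>t. n \<le> N \<longrightarrow> t \<in> {\<alpha>'..\<beta>'} \<and> c \<le> F N N t"
      proof (cases "n \<le> N")
        case True
        then obtain t where "t \<in> {\<alpha>'..\<beta>'}" "c \<le> F N N t" using pos[of N] n(2) by (meson order_trans)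
        then show ?thesis by blast
      qed simp
    qed
    then obtain T where T: "\<forall>N. n \<le> N \<longrightarrow> T N \<in> {\<alpha>'..\<beta>'} \<and> c \<le> F N N (T N)"
      by (drule_tac choice) (elim exE)
    show ?thesis by (rule that[of T]) (use T in blast)
  qed
  have Tn: "\<forall>N. T (N + n) \<in> {\<alpha>'..\<beta>'}" using T by simp
  obtain l r where l: "l \<in> {\<alpha>'..\<beta>'}" "strict_mono (r :: nat \<Rightarrow> nat)" "((\<lambda>N. T (N + n)) \<circ> r) \<longlonglongrightarrow> l"
    by (rule seq_compactE[OF compact_imp_seq_compact[OF compact_Icc] Tn])
  \<comment> \<open>The Lipschitz loss is at most c/4 and passing between the scales
    \<open>n\<close> and \<open>N\<close> costs c/8 twice, so c/2 remains. The other terms keep the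
    interval inside [\<alpha>, \<beta>].\<close>
  define h where "h = min (c / (4 * (L + 1))) (min (\<alpha>' - \<alpha>) (\<beta> - \<beta>'))"
  have h: "h > 0" "h \<le> \<alpha>' - \<alpha>" "h \<le> \<beta> - \<beta>'" "h \<le> c / (4 * (L + 1))" using c L(1) ab by (auto simp: h_def)
  have Lh: "L * h \<le> c / 4"
  proof -
    have "L * h \<le> (L + 1) * (c / (4 * (L + 1)))" using h L(1) by (intro mult_mono) auto
    moreover have "(L + 1) * (c / (4 * (L + 1))) = c / 4" using L(1) by (simp only: mult_divide_mult_cancel_right times_divide_eq_right mult.commute[of "L + 1"])
    ultimately show ?thesis by linarith
  qed
  have ev: "\<forall>\<^sub>F k in sequentially. dist (T (r k + n)) l < h / 2"
    using tendstoD[OF l(3), of "h/2"] h by (simp add: comp_def)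
  have main: "\<exists>\<^sub>\<infinity>N. F N N t > 0" if t: "t \<in> {l - h/2<..<l + h/2}" for t
    unfolding INFM_nat
  proof
    fix m
    obtain k0 where k0: "\<And>k. k \<ge> k0 \<Longrightarrow> dist (T (r k + n)) l < h / 2"
      using ev by (auto simp: eventually_sequentially)
    define k where "k = max k0 (Suc m)"
    define N where "N = r k + n"
    have "r k \<ge> k" using l(2) by (rule seq_suble)
    then have N: "N > m" "N \<ge> n" by (auto simp: N_def k_def)
    have TN: "T N \<in> {\<alpha>'..\<beta>'}" "c \<le> F N N (T N)" using T[OF N(2)] by auto
    have "dist (T N) l < h / 2" unfolding N_def by (rule k0) (simp add: k_def)
    then have "\<bar>T N - l\<bar> < h / 2" by (simp only: dist_real_def)
    then have d: "\<bar>t - T N\<bar> \<le> h" using t unfolding greaterThanLessThan_iff by linarith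
    have tab: "t \<in> {\<alpha>..\<beta>}" "T N \<in> {\<alpha>..\<beta>}" using d TN(1) h ab by auto
    have "\<bar>F N n t - F N n (T N)\<bar> \<le> L * h" 
      using L(2)[OF N(2) tab] mult_left_mono[OF d L(1)] by linarith
    then have "F N N t > 0"
      using tel[OF n(2) N(2) tab(1)] tel[OF n(2) N(2) tab(2)] TN(2) Lh n(1) c by linarith
    then show "\<exists>N>m. F N N t > 0" using N(1) by blast
  qed
  show ?thesis
  proof (intro exI conjI)
    show "l - h/2 < l + h/2" using h by simp
    show "{l - h/2<..<l + h/2} \<subseteq> {\<alpha>..\<beta>}" using l(1) h by auto
    show "\<forall>t\<in>{l - h/2<..<l + h/2}. \<exists>\<^sub>\<infinity>N. F N N t > 0" using main by blast
  qed
qed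

text \<open>Integration of \<open>2 * X * Y * \<bar>f z * g z\<bar> \<le> Y\<^sup>2 * (f z)\<^sup>2
  + X\<^sup>2 * (g z)\<^sup>2\<close>. Positive upper bounds instead of the norms themselves avoid
  division by 0 and are what the estimates provide.\<close>

lemma integral_Cauchy_Schwarz:
  fixes f g :: "real \<times> real \<Rightarrow> real"
  assumes f: "continuous_on (cbox u v) f" and g: "continuous_on (cbox u v) g"
    and X: "integral (cbox u v) (\<lambda>z. (f z)\<^sup>2) \<le> X\<^sup>2" "X > 0" and Y: "integral (cbox u v) (\<lambda>z. (g z)\<^sup>2) \<le> Y\<^sup>2" "Y > 0"
  shows "integral (cbox u v) (\<lambda>z. \<bar>f z * g z\<bar>) \<le> X * Y"
proof -
  note ci = integrable_continuous
  have "integral (cbox u v) (\<lambda>z. \<bar>f z * g z\<bar>) \<le> integral (cbox u v) (\<lambda>z. Y / (2 * X) * (f z)\<^sup>2 + X / (2 * Y) * (g z)\<^sup>2)"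
  proof (rule integral_le)
    show "(\<lambda>z. \<bar>f z * g z\<bar>) integrable_on cbox u v" by (intro ci continuous_intros f g)
    show "(\<lambda>z. Y / (2 * X) * (f z)\<^sup>2 + X / (2 * Y) * (g z)\<^sup>2) integrable_on cbox u v"
      using X Y by (intro ci continuous_intros f g) auto
    fix z
    have "0 \<le> (Y * \<bar>f z\<bar> - X * \<bar>g z\<bar>)\<^sup>2" by simp
    then have "2 * X * Y * \<bar>f z * g z\<bar> \<le> Y\<^sup>2 * (f z)\<^sup>2 + X\<^sup>2 * (g z)\<^sup>2"
      by (simp add: power2_diff power_mult_distrib abs_mult mult_ac)
    then have "(2 * X * Y * \<bar>f z * g z\<bar>) / (2 * X * Y) \<le> (Y\<^sup>2 * (f z)\<^sup>2 + X\<^sup>2 * (g z)\<^sup>2) / (2 * X * Y)"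
      using X Y by (intro divide_right_mono) auto
    then show "\<bar>f z * g z\<bar> \<le> Y / (2 * X) * (f z)\<^sup>2 + X / (2 * Y) * (g z)\<^sup>2"
      using X Y by (simp add: add_divide_distrib power2_eq_square)
  qed
  also have "\<dots> = Y / (2 * X) * integral (cbox u v) (\<lambda>z. (f z)\<^sup>2) + X / (2 * Y) * integral (cbox u v) (\<lambda>z. (g z)\<^sup>2)"
  proof (subst integral_add)
    show "(\<lambda>z. Y / (2 * X) * (f z)\<^sup>2) integrable_on cbox u v" "(\<lambda>z. X / (2 * Y) * (g z)\<^sup>2) integrable_on cbox u v"
      using X Y by (intro ci continuous_intros f g; simp)+
  qed simp
  also have "\<dots> \<le> Y / (2 * X) * X\<^sup>2 + X / (2 * Y) * Y\<^sup>2"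
    using X Y by (intro add_mono mult_left_mono) auto
  also have "\<dots> = X * Y" using X Y by (simp add: power2_eq_square)
  finally show ?thesis .
qed

lemma integral_Minkowski:
  fixes f g :: "real \<times> real \<Rightarrow> real"
  assumes f: "continuous_on (cbox u v) f" and g: "continuous_on (cbox u v) g"
    and X: "integral (cbox u v) (\<lambda>z. (f z)\<^sup>2) \<le> X\<^sup>2" "X > 0" and Y: "integral (cbox u v) (\<lambda>z. (g z)\<^sup>2) \<le> Y\<^sup>2" "Y > 0"
  shows "integral (cbox u v) (\<lambda>z. (f z + g z)\<^sup>2) \<le> (X + Y)\<^sup>2"
proof -
  have i: "(\<lambda>z. (f z)\<^sup>2) integrable_on cbox u v" "(\<lambda>z. (g z)\<^sup>2) integrable_on cbox u v"
    "(\<lambda>z. \<bar>f z * g z\<bar>) integrable_on cbox u v" "(\<lambda>z. (f z + g z)\<^sup>2) integrable_on cbox u v"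
    "(\<lambda>z. 2 * \<bar>f z * g z\<bar>) integrable_on cbox u v"
    "(\<lambda>z. (f z)\<^sup>2 + 2 * \<bar>f z * g z\<bar>) integrable_on cbox u v"
    "(\<lambda>z. (f z)\<^sup>2 + 2 * \<bar>f z * g z\<bar> + (g z)\<^sup>2) integrable_on cbox u v"
    by (intro integrable_continuous continuous_intros f g)+
  have "integral (cbox u v) (\<lambda>z. (f z + g z)\<^sup>2) \<le> integral (cbox u v) (\<lambda>z. (f z)\<^sup>2 + 2 * \<bar>f z * g z\<bar> + (g z)\<^sup>2)"
    by (intro integral_le i) (simp add: power2_sum)
  also have "\<dots> = integral (cbox u v) (\<lambda>z. (f z)\<^sup>2) + 2 * integral (cbox u v) (\<lambda>z. \<bar>f z * g z\<bar>) + integral (cbox u v) (\<lambda>z. (g z)\<^sup>2)"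
    by (simp add: integral_add[OF i(6) i(2)] integral_add[OF i(1) i(5)])
  also have "\<dots> \<le> X\<^sup>2 + 2 * (X * Y) + Y\<^sup>2"
    using integral_Cauchy_Schwarz[OF assms] X Y by (intro add_mono) auto
  also have "\<dots> = (X + Y)\<^sup>2" by (simp add: power2_sum)
  finally show ?thesis .
qed

section \<open>Size and change of scale of a sum of tubes\<close>

text \<open>\<open>z = (a, b)\<close> is a point of the dual plane, and \<open>p\<close> contributes
  a strip of vertical half-width \<delta> about the graph b = y p - g a p.\<close>

definition tube :: "'p set \<Rightarrow> ('p \<Rightarrow> real) \<Rightarrow> ('p \<Rightarrow> real) \<Rightarrow> (real \<Rightarrow> 'p \<Rightarrow> real) \<Rightarrow> real \<Rightarrow> real \<times> real \<Rightarrow> real" where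
  "tube P w y g \<delta> z = (\<Sum>p\<in>P. w p * bump \<delta> (y p - g (fst z) p - snd z))"

text \<open>Differences of two curves are governed by the single number
  \<open>\<bar>x p - x q\<bar>\<close>: it bounds the gap and the second derivative from above and
  the angle of crossing from below. These are the inputs of \<open>tube_pair_bound\<close>.\<close>

definition transversal :: "real \<Rightarrow> real \<Rightarrow> real \<Rightarrow> real \<Rightarrow> 'p set \<Rightarrow> ('p \<Rightarrow> real) \<Rightarrow> (real \<Rightarrow> 'p \<Rightarrow> real) \<Rightarrow> bool" where
  "transversal A B \<kappa> \<Lambda> P x g \<longleftrightarrow> (\<exists>g1 g2.
     (\<forall>a\<in>{A..B}. \<forall>p\<in>P. ((\<lambda>a. g a p) has_real_derivative g1 a p) (at a) \<and> ((\<lambda>a. g1 a p) has_real_derivative g2 a p) (at a)) \<and>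
     (\<forall>a\<in>{A..B}. \<forall>p\<in>P. \<forall>q\<in>P. \<bar>g a p - g a q\<bar> \<le> \<Lambda> * \<bar>x p - x q\<bar> \<and>
        \<kappa> * \<bar>x p - x q\<bar> \<le> \<bar>g1 a p - g1 a q\<bar> \<and> \<bar>g2 a p - g2 a q\<bar> \<le> \<Lambda> * \<bar>x p - x q\<bar>))"

lemma transversal_subset: "transversal A B \<kappa> \<Lambda> F x g \<Longrightarrow> P \<subseteq> F \<Longrightarrow> transversal A B \<kappa> \<Lambda> P x g"
  unfolding transversal_def subset_iff
proof (elim exE)
  fix g1 g2
  assume "\<forall>t. t \<in> P \<longrightarrow> t \<in> F" and "(\<forall>a\<in>{A..B}. \<forall>p\<in>F. ((\<lambda>a. g a p) has_real_derivative g1 a p) (at a) \<and> ((\<lambda>a. g1 a p) has_real_derivative g2 a p) (at a)) \<and>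
     (\<forall>a\<in>{A..B}. \<forall>p\<in>F. \<forall>q\<in>F. \<bar>g a p - g a q\<bar> \<le> \<Lambda> * \<bar>x p - x q\<bar> \<and>
        \<kappa> * \<bar>x p - x q\<bar> \<le> \<bar>g1 a p - g1 a q\<bar> \<and> \<bar>g2 a p - g2 a q\<bar> \<le> \<Lambda> * \<bar>x p - x q\<bar>)"
  then show "\<exists>g1 g2. (\<forall>a\<in>{A..B}. \<forall>p\<in>P. ((\<lambda>a. g a p) has_real_derivative g1 a p) (at a) \<and> ((\<lambda>a. g1 a p) has_real_derivative g2 a p) (at a)) \<and>
     (\<forall>a\<in>{A..B}. \<forall>p\<in>P. \<forall>q\<in>P. \<bar>g a p - g a q\<bar> \<le> \<Lambda> * \<bar>x p - x q\<bar> \<and>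
        \<kappa> * \<bar>x p - x q\<bar> \<le> \<bar>g1 a p - g1 a q\<bar> \<and> \<bar>g2 a p - g2 a q\<bar> \<le> \<Lambda> * \<bar>x p - x q\<bar>)"
    by (intro exI[of _ g1] exI[of _ g2]) simp
qed

lemma transversalE:
  assumes "transversal A B \<kappa> \<Lambda> P x g"
  obtains g1 g2 where "\<And>a p. a \<in> {A..B} \<Longrightarrow> p \<in> P \<Longrightarrow> ((\<lambda>a. g a p) has_real_derivative g1 a p) (at a)"
     "\<And>a p. a \<in> {A..B} \<Longrightarrow> p \<in> P \<Longrightarrow> ((\<lambda>a. g1 a p) has_real_derivative g2 a p) (at a)"
     "\<And>a p q. a \<in> {A..B} \<Longrightarrow> p \<in> P \<Longrightarrow> q \<in> P \<Longrightarrow> \<bar>g a p - g a q\<bar> \<le> \<Lambda> * \<bar>x p - x q\<bar>"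
     "\<And>a p q. a \<in> {A..B} \<Longrightarrow> p \<in> P \<Longrightarrow> q \<in> P \<Longrightarrow> \<kappa> * \<bar>x p - x q\<bar> \<le> \<bar>g1 a p - g1 a q\<bar>"
     "\<And>a p q. a \<in> {A..B} \<Longrightarrow> p \<in> P \<Longrightarrow> q \<in> P \<Longrightarrow> \<bar>g2 a p - g2 a q\<bar> \<le> \<Lambda> * \<bar>x p - x q\<bar>"
  using assms unfolding transversal_def
proof (elim exE)
  fix g1 g2
  assume *: "(\<forall>a\<in>{A..B}. \<forall>p\<in>P. ((\<lambda>a. g a p) has_real_derivative g1 a p) (at a) \<and> ((\<lambda>a. g1 a p) has_real_derivative g2 a p) (at a)) \<and>
     (\<forall>a\<in>{A..B}. \<forall>p\<in>P. \<forall>q\<in>P. \<bar>g a p - g a q\<bar> \<le> \<Lambda> * \<bar>x p - x q\<bar> \<and>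
        \<kappa> * \<bar>x p - x q\<bar> \<le> \<bar>g1 a p - g1 a q\<bar> \<and> \<bar>g2 a p - g2 a q\<bar> \<le> \<Lambda> * \<bar>x p - x q\<bar>)"
  show thesis by (rule that[of g1 g2]) (use * in simp_all)
qed

lemma transversal_continuous:
  assumes "transversal A B \<kappa> \<Lambda> P x g" "p \<in> P"
  shows "continuous_on {A..B} (\<lambda>a. g a p)"
proof -
  obtain g1 where "\<And>a. a \<in> {A..B} \<Longrightarrow> ((\<lambda>a. g a p) has_real_derivative g1 a p) (at a)"
    by (rule transversalE[OF assms(1)]) (use assms(2) in blast)
  then show ?thesis by (intro DERIV_continuous_on) (rule DERIV_subset, auto)
qed

lemma continuous_tube:
  assumes "transversal A B \<kappa> \<Lambda> P x g" "\<delta> > 0" "A \<le> A'" "B' \<le> B"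
  shows "continuous_on (cbox (A', J1) (B', J2)) (tube P w y g \<delta>)"
proof -
  have "cbox (A', J1) (B', J2) \<subseteq> {A..B} \<times> UNIV" using assms(3,4) by (auto simp: cbox_Pair_eq)
  moreover have "continuous_on ({A..B} \<times> UNIV) (tube P w y g \<delta>)"
    unfolding tube_def
    by (intro continuous_intros assms continuous_on_compose2[OF transversal_continuous[OF assms(1)]]) auto
  ultimately show ?thesis using continuous_on_subset by blast
qed

lemma tube_nonneg: "\<delta> > 0 \<Longrightarrow> (\<And>p. p \<in> P \<Longrightarrow> 0 \<le> w p) \<Longrightarrow> 0 \<le> tube P w y g \<delta> z"
  unfolding tube_def by (intro sum_nonneg mult_nonneg_nonneg bump_nonneg)

text \<open>The points whose strip contains (a, b) lie along a curve. Cut by \<open>x\<close> into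
  about \<open>(2 * \<epsilon> + 1) / \<delta>\<close> bins, they fall into squares of half-side
  \<open>(1 + \<Lambda>) * \<delta>\<close>, and each strip has height at most 1/\<delta>; this
  makes \<open>\<delta> powr (s - 2)\<close>.\<close>

lemma tube_sup:
  assumes sp: "spread P w x y s C \<delta>\<^sub>0" and d: "0 < \<delta>" "\<delta>\<^sub>0 \<le> \<delta>" "\<delta> \<le> 1" and \<Lambda>: "0 \<le> \<Lambda>" and \<epsilon>: "0 \<le> \<epsilon>" and C: "0 \<le> C"
    and x: "\<And>p. p \<in> P \<Longrightarrow> \<bar>x p - x\<^sub>0\<bar> \<le> \<epsilon>"
    and g: "\<And>p q. p \<in> P \<Longrightarrow> q \<in> P \<Longrightarrow> \<bar>g a p - g a q\<bar> \<le> \<Lambda> * \<bar>x p - x q\<bar>"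
  shows "tube P w y g \<delta> (a, b) \<le> (2 * \<epsilon> + 1) * (1 + \<Lambda>) powr s * C * \<delta> powr (s - 2)"
proof -
  have fin: "finite P" and w0: "\<And>p. p \<in> P \<Longrightarrow> 0 \<le> w p" using sp by (auto simp: spread_def)
  define Q where "Q = {p\<in>P. \<bar>y p - g a p - b\<bar> \<le> \<delta>}"
  have finQ: "finite Q" using fin by (simp add: Q_def)
  define bin where "bin p = nat \<lfloor>(x p - (x\<^sub>0 - \<epsilon>)) / \<delta>\<rfloor>" for p
  have x': "0 \<le> x p - (x\<^sub>0 - \<epsilon>)" "x p - (x\<^sub>0 - \<epsilon>) \<le> 2 * \<epsilon>" if "p \<in> P" for p using x[OF that] by linarith+
  have close: "\<bar>x p - x q\<bar> \<le> \<delta>" if "p \<in> P" "q \<in> P" "bin p = bin q" for p q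
  proof -
    have n: "(x p - (x\<^sub>0 - \<epsilon>)) / \<delta> \<ge> 0" "(x q - (x\<^sub>0 - \<epsilon>)) / \<delta> \<ge> 0" using x' that d by simp_all
    then have "\<lfloor>(x p - (x\<^sub>0 - \<epsilon>)) / \<delta>\<rfloor> = \<lfloor>(x q - (x\<^sub>0 - \<epsilon>)) / \<delta>\<rfloor>" using that(3) by (simp add: bin_def eq_nat_nat_iff)
    then have "\<bar>(x p - (x\<^sub>0 - \<epsilon>)) / \<delta> - (x q - (x\<^sub>0 - \<epsilon>)) / \<delta>\<bar> \<le> 1" by linarith
    then have "\<bar>(x p - x q) / \<delta>\<bar> \<le> 1" by (simp add: diff_divide_distrib)
    then show ?thesis using d by (simp add: abs_divide)
  qed
  define S where "S = C * ((1 + \<Lambda>) * \<delta>) powr s"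
  have S0: "S \<ge> 0" using C by (simp add: S_def)
  have "\<delta> \<le> (1 + \<Lambda>) * \<delta>" using d \<Lambda> by (simp add: algebra_simps)
  then have \<delta>0: "\<delta>\<^sub>0 \<le> (1 + \<Lambda>) * \<delta>" using d by linarith
  have "sum w Q = (\<Sum>k\<in>bin ` Q. sum w {p\<in>Q. bin p = k})" by (rule sum.image_gen[OF finQ])
  also have "\<dots> \<le> (\<Sum>k\<in>bin ` Q. S)"
  proof (rule sum_mono)
    fix k assume "k \<in> bin ` Q"
    then obtain q where q: "q \<in> Q" "k = bin q" by (elim imageE) (rule that)
    have qP: "q \<in> P" using q by (simp add: Q_def)
    have sub: "\<bar>x p - x q\<bar> \<le> (1 + \<Lambda>) * \<delta> \<and> \<bar>y p - (b + g a q)\<bar> \<le> (1 + \<Lambda>) * \<delta>"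
      if p: "p \<in> P" "\<bar>y p - g a p - b\<bar> \<le> \<delta>" "bin p = k" for p
    proof -
      have c: "\<bar>x p - x q\<bar> \<le> \<delta>" using close[OF p(1) qP] p(3) q(2) by simp
      have "\<bar>g a p - g a q\<bar> \<le> \<Lambda> * \<delta>" using g[OF p(1) qP] mult_left_mono[OF c \<Lambda>] by linarith
      then have "\<bar>y p - (b + g a q)\<bar> \<le> \<delta> + \<Lambda> * \<delta>" using p(2) by linarith
      moreover have "(1 + \<Lambda>) * \<delta> = \<delta> + \<Lambda> * \<delta>" by (simp add: algebra_simps)
      moreover have "0 \<le> \<Lambda> * \<delta>" using \<Lambda> d by simp
      ultimately show ?thesis using c by linarith
    qed
    have "sum w {p\<in>Q. bin p = k} \<le> sum w {p\<in>P. \<bar>x p - x q\<bar> \<le> (1 + \<Lambda>) * \<delta> \<and> \<bar>y p - (b + g a q)\<bar> \<le> (1 + \<Lambda>) * \<delta>}"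
    proof (rule sum_mono2)
      show "{p\<in>Q. bin p = k} \<subseteq> {p\<in>P. \<bar>x p - x q\<bar> \<le> (1 + \<Lambda>) * \<delta> \<and> \<bar>y p - (b + g a q)\<bar> \<le> (1 + \<Lambda>) * \<delta>}"
      proof
        fix p assume "p \<in> {p\<in>Q. bin p = k}"
        then show "p \<in> {p\<in>P. \<bar>x p - x q\<bar> \<le> (1 + \<Lambda>) * \<delta> \<and> \<bar>y p - (b + g a q)\<bar> \<le> (1 + \<Lambda>) * \<delta>}"
          using sub[of p] by (simp add: Q_def)
      qed
    qed (use fin w0 in auto)
    also have "\<dots> \<le> S" unfolding S_def using sp \<delta>0 unfolding spread_def by blast
    finally show "sum w {p\<in>Q. bin p = k} \<le> S" .
  qed
  also have "\<dots> = real (card (bin ` Q)) * S" by simp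
  also have "\<dots> \<le> (2 * \<epsilon> + 1) / \<delta> * S"
  proof (rule mult_right_mono[OF _ S0])
    have "bin ` Q \<subseteq> {..nat \<lfloor>2 * \<epsilon> / \<delta>\<rfloor>}"
      using x' d by (auto simp: bin_def Q_def intro!: nat_mono floor_mono divide_right_mono)
    then have "card (bin ` Q) \<le> card {..nat \<lfloor>2 * \<epsilon> / \<delta>\<rfloor>}" by (intro card_mono) auto
    then have "real (card (bin ` Q)) \<le> real (nat \<lfloor>2 * \<epsilon> / \<delta>\<rfloor>) + 1" by simp
    also have "\<dots> \<le> 2 * \<epsilon> / \<delta> + 1" using d \<epsilon> by simp
    also have "\<dots> \<le> (2 * \<epsilon> + 1) / \<delta>" using d by (simp add: field_simps)
    finally show "real (card (bin ` Q)) \<le> (2 * \<epsilon> + 1) / \<delta>" .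
  qed
  finally have wQ: "sum w Q \<le> (2 * \<epsilon> + 1) / \<delta> * S" .
  have "tube P w y g \<delta> (a, b) = (\<Sum>p\<in>Q. w p * bump \<delta> (y p - g a p - b))"
    unfolding tube_def fst_conv snd_conv
  proof (rule sum.mono_neutral_right[OF fin])
    show "\<forall>p\<in>P - Q. w p * bump \<delta> (y p - g a p - b) = 0"
    proof
      fix p assume "p \<in> P - Q"
      then have "\<not> \<bar>y p - g a p - b\<bar> \<le> \<delta>" by (auto simp: Q_def)
      then have "\<delta> \<le> \<bar>y p - g a p - b\<bar>" by linarith
      then show "w p * bump \<delta> (y p - g a p - b) = 0" by (simp only: bump_zero[OF d(1)] mult_zero_right)
    qed
  qed (simp add: Q_def)
  also have "\<dots> \<le> (\<Sum>p\<in>Q. w p * (1 / \<delta>))"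
    by (intro sum_mono mult_left_mono bump_le d w0) (simp add: Q_def)
  also have "\<dots> = sum w Q / \<delta>" by (simp add: sum_divide_distrib)
  also have "\<dots> \<le> (2 * \<epsilon> + 1) / \<delta> * S / \<delta>" using wQ d by (intro divide_right_mono) auto
  also have "\<dots> = (2 * \<epsilon> + 1) * (1 + \<Lambda>) powr s * C * \<delta> powr (s - 2)"
  proof -
    have "\<delta> powr s = \<delta> powr (s - 2) * \<delta> powr 2" by (simp only: powr_add[symmetric] diff_add_cancel)
    then show ?thesis using d \<Lambda> by (simp add: S_def powr_mult powr_numeral power2_eq_square)
  qed
  finally show ?thesis .
qed

text \<open>Both hats have mass 1, so the primitive of their difference is supported in
  [-\<delta>, \<delta>]; hence \<open>tube_L2_bound\<close> applies with support factor 1, and 2 is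
  a crude bound for primitive and profile.\<close>

lemma tube_scale_diff:
  assumes sp: "spread P w x y s C \<delta>\<^sub>0" and s: "s < 2" and d: "0 < \<delta>" "\<delta>\<^sub>0 \<le> \<delta>" and C: "C \<ge> 0"
    and AB: "A < A'" "A' \<le> B'" "B' < B" and \<kappa>: "0 < \<kappa>" and \<Lambda>: "1 \<le> \<Lambda>" and tr: "transversal A B \<kappa> \<Lambda> P x g"
  shows "integral (cbox (A', J1) (B', J2)) (\<lambda>z. (tube P w y g \<delta> z - tube P w y g (\<delta>/2) z)\<^sup>2)
    \<le> 4 * tube_const (B - A) \<kappa> \<Lambda> 2 1 * C / ((1 - 2 powr (s - 2)) * ((A' - A) * (B - B'))) * sum w P * \<delta> powr (s - 1)"
proof -
  obtain g1 g2 where g: "\<And>a p. a \<in> {A..B} \<Longrightarrow> p \<in> P \<Longrightarrow> ((\<lambda>a. g a p) has_real_derivative g1 a p) (at a)"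
     "\<And>a p. a \<in> {A..B} \<Longrightarrow> p \<in> P \<Longrightarrow> ((\<lambda>a. g1 a p) has_real_derivative g2 a p) (at a)"
     "\<And>a p q. a \<in> {A..B} \<Longrightarrow> p \<in> P \<Longrightarrow> q \<in> P \<Longrightarrow> \<bar>g a p - g a q\<bar> \<le> \<Lambda> * \<bar>x p - x q\<bar>"
     "\<And>a p q. a \<in> {A..B} \<Longrightarrow> p \<in> P \<Longrightarrow> q \<in> P \<Longrightarrow> \<kappa> * \<bar>x p - x q\<bar> \<le> \<bar>g1 a p - g1 a q\<bar>"
     "\<And>a p q. a \<in> {A..B} \<Longrightarrow> p \<in> P \<Longrightarrow> q \<in> P \<Longrightarrow> \<bar>g2 a p - g2 a q\<bar> \<le> \<Lambda> * \<bar>x p - x q\<bar>"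
  proof (rule transversalE[OF tr], goal_cases)
    case (1 g1 g2)
    show ?case using 1(2-6) by (rule 1(1))
  qed
  have d2: "\<delta> / 2 > 0" using d by simp
  have "integral (cbox (A', J1) (B', J2)) (\<lambda>(a, b). (\<Sum>p\<in>P. w p * (bump \<delta> (y p - g a p - b) - bump (\<delta>/2) (y p - g a p - b)))\<^sup>2)
    \<le> 4 * tube_const (B - A) \<kappa> \<Lambda> 2 1 * C / ((1 - 2 powr (s - 2)) * ((A' - A) * (B - B'))) * sum w P * \<delta> powr (s - 1)"
  proof (rule tube_L2_bound[OF sp s d C AB \<kappa> \<Lambda> _ _ g, where \<psi> = "\<lambda>p t. bump \<delta> t - bump (\<delta>/2) t" and \<Psi> = "\<lambda>p t. bump_int \<delta> t - bump_int (\<delta>/2) t"])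
    fix t
    show "((\<lambda>t. bump_int \<delta> t - bump_int (\<delta>/2) t) has_real_derivative bump \<delta> t - bump (\<delta>/2) t) (at t)"
      by (intro DERIV_diff bump_int_deriv d d2)
    show "continuous_on UNIV (\<lambda>t. bump \<delta> t - bump (\<delta>/2) t)" by (intro continuous_intros d d2)
    show "\<bar>bump_int \<delta> t - bump_int (\<delta>/2) t\<bar> \<le> 2"
      using bump_int_eq(3,4)[OF d(1), of t] bump_int_eq(3,4)[OF d2, of t] by linarith
    have "bump (\<delta>/2) t \<le> 2 / \<delta>" using bump_le[OF d2, of t] by simp
    moreover have "1 / \<delta> \<le> 2 / \<delta>" using d by (intro divide_right_mono) auto
    then have "bump \<delta> t \<le> 2 / \<delta>" using bump_le[OF d(1), of t] by (rule order_trans[rotated])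
    moreover have "\<bar>u - v\<bar> \<le> c" if "u \<le> c" "v \<le> c" "0 \<le> u" "0 \<le> v" for u v c :: real using that by linarith
    ultimately show "\<bar>bump \<delta> t - bump (\<delta>/2) t\<bar> \<le> 2 / \<delta>"
      using bump_nonneg[OF d(1), of t] bump_nonneg[OF d2, of t] by blast
    assume t: "1 * \<delta> \<le> \<bar>t\<bar>"
    then show "bump \<delta> t - bump (\<delta>/2) t = 0" using bump_zero[OF d(1), of t] bump_zero[OF d2, of t] d by simp
    show "bump_int \<delta> t - bump_int (\<delta>/2) t = 0"
    proof (cases "t \<ge> 0")
      case True
      then show ?thesis using bump_int_eq(2)[OF d(1), of t] bump_int_eq(2)[OF d2, of t] t d by simp
    next
      case False
      then show ?thesis using bump_int_eq(1)[OF d(1), of t] bump_int_eq(1)[OF d2, of t] t d by simp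
    qed
  qed simp_all
  moreover have "(\<lambda>(a, b). (\<Sum>p\<in>P. w p * (bump \<delta> (y p - g a p - b) - bump (\<delta>/2) (y p - g a p - b)))\<^sup>2)
    = (\<lambda>z. (tube P w y g \<delta> z - tube P w y g (\<delta>/2) z)\<^sup>2)"
    by (simp add: fun_eq_iff tube_def sum_subtractf right_diff_distrib)
  ultimately show ?thesis by simp
qed

lemma half_power_powr: "((1/2) ^ n) powr e = ((1/2 :: real) powr e) ^ n"
  by (simp add: powr_realpow[symmetric] powr_powr mult.commute)

lemma content_cbox_Pair:
  "A \<le> B \<Longrightarrow> c \<le> d \<Longrightarrow> Henstock_Kurzweil_Integration.content (cbox (A :: real, c :: real) (B, d)) = (B - A) * (d - c)"
  by (simp add: content_Pair content_real)

text \<open>One constant for all weights and curves. The sup norm may grow with the scale, but the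
  mean square does not: it is reached from width 1 by adding changes of scale, whose norms form a
  geometric series because \<open>s > 1\<close>.\<close>

lemma tube_estimates:
  fixes A A' B B' :: real
  assumes s: "1 < s" "s < 2" and C: "C \<ge> 0" and W: "W \<ge> 0" and AB: "A < A'" "A' \<le> B'" "B' < B" and J: "J1 \<le> J2"
    and \<kappa>: "0 < \<kappa>" and \<Lambda>: "1 \<le> \<Lambda>" and \<epsilon>: "0 \<le> \<epsilon>"
  shows "\<exists>K\<ge>1. \<forall>(P :: 'p set) w x y g N x\<^sub>0. spread P w x y s C ((1/2) ^ N) \<longrightarrow> sum w P \<le> W \<longrightarrow> (\<forall>p\<in>P. \<bar>x p - x\<^sub>0\<bar> \<le> \<epsilon>) \<longrightarrow>
    transversal A B \<kappa> \<Lambda> P x g \<longrightarrow>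
    (\<forall>n\<le>N. (\<forall>z\<in>cbox (A', J1) (B', J2). tube P w y g ((1/2) ^ n) z \<le> K * ((1/2) ^ n) powr (s - 2)) \<and>
       integral (cbox (A', J1) (B', J2)) (\<lambda>z. (tube P w y g ((1/2) ^ n) z)\<^sup>2) \<le> K\<^sup>2 \<and>
       (n < N \<longrightarrow> integral (cbox (A', J1) (B', J2)) (\<lambda>z. (tube P w y g ((1/2) ^ n) z - tube P w y g ((1/2) ^ Suc n) z)\<^sup>2)
           \<le> (K * ((1/2) ^ n) powr ((s - 1) / 2))\<^sup>2))"
proof -
  define K1 where "K1 = (2 * \<epsilon> + 1) * (1 + \<Lambda>) powr s * C"
  define T where "T = 4 * tube_const (B - A) \<kappa> \<Lambda> 2 1 * C / ((1 - 2 powr (s - 2)) * ((A' - A) * (B - B')))"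
  have "2 powr (s - 2) < (1 :: real)" using s by (simp add: powr_less_one)
  moreover have "tube_const (B - A) \<kappa> \<Lambda> 2 1 \<ge> 0"
    unfolding tube_const_def using AB \<kappa> \<Lambda> by (intro add_nonneg_nonneg mult_nonneg_nonneg) auto
  ultimately have T0: "T \<ge> 0" unfolding T_def using AB C by (intro divide_nonneg_nonneg mult_nonneg_nonneg) auto
  \<comment> \<open>The added 1 makes the bound positive, as the inequalities of Minkowski and
    Cauchy-Schwarz above require.\<close>
  define D where "D = sqrt (T * W + 1)"
  have TW: "T * W + 1 > 0" using T0 W by (simp add: add_nonneg_pos)
  have D: "D > 0" "D\<^sup>2 = T * W + 1" using TW by (auto simp: D_def)
  define q where "q = (1/2 :: real) powr ((s - 1) / 2)"
  have q: "0 < q" "q < 1" using s by (auto simp: q_def powr01_less_one)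
  define area where "area = (B' - A') * (J2 - J1)"
  have ar: "area \<ge> 0" using AB J by (simp add: area_def)
  define X0 where "X0 = (W + 1) * (area + 1)"
  have X0: "X0 > 0" using W ar by (simp add: X0_def)
  define K where "K = 1 + K1 + D + X0 + D / (1 - q)"
  have K10: "K1 \<ge> 0" using \<epsilon> C by (simp add: K1_def)
  have Dq: "D / (1 - q) \<ge> 0" using D q by simp
  have K: "K \<ge> 1" "K1 \<le> K" "D \<le> K" "X0 + D / (1 - q) \<le> K" using K10 D X0 Dq by (auto simp: K_def)
  define \<B> where "\<B> = cbox (A', J1) (B', J2)"
  show ?thesis
  proof (rule exI[of _ K], intro conjI K(1) allI impI)
    fix P :: "'p set" and w x y g N x\<^sub>0 n
    assume sp: "spread P w x y s C ((1/2) ^ N)" and wW: "sum w P \<le> W" and x: "\<forall>p\<in>P. \<bar>x p - x\<^sub>0\<bar> \<le> \<epsilon>"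
      and tr: "transversal A B \<kappa> \<Lambda> P x g" and n: "n \<le> N"
    have w0: "\<And>p. p \<in> P \<Longrightarrow> 0 \<le> w p" using sp by (auto simp: spread_def)
    have pw: "(0::real) < (1/2) ^ m" "(1/2 :: real) ^ m \<le> 1" for m :: nat by (simp_all add: power_le_one)
    have mono: "(1/2 :: real) ^ N \<le> (1/2) ^ m" if "m \<le> N" for m using that by (intro power_decreasing) auto
    have ct: "continuous_on (cbox (A', J1) (B', J2)) (tube P w y g ((1/2) ^ m))" for m
      by (rule continuous_tube[OF tr]) (use AB pw in auto)
    have lip: "\<bar>g a p - g a q\<bar> \<le> \<Lambda> * \<bar>x p - x q\<bar>" if "a \<in> {A..B}" "p \<in> P" "q \<in> P" for a p q
      using tr that unfolding transversal_def by (elim exE) simp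
    show "\<forall>z\<in>cbox (A', J1) (B', J2). tube P w y g ((1/2) ^ n) z \<le> K * ((1/2) ^ n) powr (s - 2)"
    proof
      fix z assume z: "z \<in> cbox (A', J1) (B', J2)"
      obtain a b where ab: "z = (a, b)" by (cases z)
      have a: "a \<in> {A..B}" using z AB by (simp add: ab cbox_Pair_eq)
      have "tube P w y g ((1/2) ^ n) z \<le> K1 * ((1/2) ^ n) powr (s - 2)" unfolding ab K1_def
        by (rule tube_sup[OF sp pw(1) mono[OF n] pw(2) _ \<epsilon> C, where x\<^sub>0 = x\<^sub>0]) (use \<Lambda> x lip[OF a] in auto)
      also have "\<dots> \<le> K * ((1/2) ^ n) powr (s - 2)" using K by (intro mult_right_mono) auto
      finally show "tube P w y g ((1/2) ^ n) z \<le> K * ((1/2) ^ n) powr (s - 2)" .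
    qed
    have diff: "integral (cbox (A', J1) (B', J2)) (\<lambda>z. (tube P w y g ((1/2) ^ m) z - tube P w y g ((1/2) ^ Suc m) z)\<^sup>2)
           \<le> (D * q ^ m)\<^sup>2" if "m \<le> N" for m
    proof -
      have h: "(1/2 :: real) ^ Suc m = (1/2) ^ m / 2" by simp
      have "integral (cbox (A', J1) (B', J2)) (\<lambda>z. (tube P w y g ((1/2) ^ m) z - tube P w y g ((1/2) ^ Suc m) z)\<^sup>2)
        \<le> T * sum w P * ((1/2) ^ m) powr (s - 1)"
        unfolding T_def h by (rule tube_scale_diff[OF sp s(2) pw(1) mono[OF that] C AB \<kappa> \<Lambda> tr])
      also have "\<dots> \<le> (T * W + 1) * ((1/2) ^ m) powr (s - 1)"
        using mult_left_mono[OF wW T0] by (intro mult_right_mono) auto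
      also have "((1/2) ^ m) powr (s - 1) = (q ^ m)\<^sup>2"
        unfolding q_def half_power_powr[symmetric] by (simp add: power2_eq_square flip: powr_add)
      also have "(T * W + 1) * (q ^ m)\<^sup>2 = (D * q ^ m)\<^sup>2" by (simp only: D(2)[symmetric] power_mult_distrib)
      finally show ?thesis .
    qed
    show "integral (cbox (A', J1) (B', J2)) (\<lambda>z. (tube P w y g ((1/2) ^ n) z - tube P w y g ((1/2) ^ Suc n) z)\<^sup>2)
           \<le> (K * ((1/2) ^ n) powr ((s - 1) / 2))\<^sup>2" if "n < N"
    proof -
      have "D * q ^ n \<le> K * ((1/2) ^ n) powr ((s - 1) / 2)"
        unfolding q_def half_power_powr using K by (intro mult_right_mono) auto
      then have "(D * q ^ n)\<^sup>2 \<le> (K * ((1/2) ^ n) powr ((s - 1) / 2))\<^sup>2"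
        using D q by (intro power_mono) auto
      then show ?thesis using diff[OF n] by linarith
    qed
    have norm: "integral (cbox (A', J1) (B', J2)) (\<lambda>z. (tube P w y g ((1/2) ^ m) z)\<^sup>2) \<le> (X0 + (\<Sum>k<m. D * q ^ k))\<^sup>2" if "m \<le> N" for m
      using that
    proof (induction m)
      \<comment> \<open>At width 1 every hat has height at most 1, so the sum is at most the total
        weight.\<close>
      case 0
      have t1: "\<bar>tube P w y g 1 z\<bar> \<le> W" for z
      proof -
        have "tube P w y g 1 z \<le> (\<Sum>p\<in>P. w p * (1 / 1))"
          unfolding tube_def by (intro sum_mono mult_left_mono bump_le w0) auto
        then show ?thesis using tube_nonneg[of 1 P w y g z] w0 wW by simp
      qed
      have "((\<lambda>z. (tube P w y g 1 z)\<^sup>2) has_integral integral (cbox (A', J1) (B', J2)) (\<lambda>z. (tube P w y g 1 z)\<^sup>2)) (cbox (A', J1) (B', J2))"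
        using ct[of 0] by (intro integrable_integral integrable_continuous continuous_intros) simp
      then have "norm (integral (cbox (A', J1) (B', J2)) (\<lambda>z. (tube P w y g 1 z)\<^sup>2)) \<le> W\<^sup>2 * Henstock_Kurzweil_Integration.content (cbox (A', J1) (B', J2))"
      proof (rule has_integral_bound[rotated])
        show "norm ((tube P w y g 1 z)\<^sup>2) \<le> W\<^sup>2" for z using power_mono[OF t1[of z], of 2] by simp
      qed simp
      then have "integral (cbox (A', J1) (B', J2)) (\<lambda>z. (tube P w y g 1 z)\<^sup>2) \<le> W\<^sup>2 * area"
        using AB J by (simp add: content_cbox_Pair area_def)
      also have "\<dots> \<le> (W + 1)\<^sup>2 * (area + 1)\<^sup>2"
      proof (intro mult_mono)
        show "W\<^sup>2 \<le> (W + 1)\<^sup>2" using W by (intro power_mono) auto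
        show "area \<le> (area + 1)\<^sup>2" using ar by (simp add: power2_eq_square algebra_simps)
      qed (use ar in auto)
      finally show ?case by (simp add: X0_def power_mult_distrib)
    next
      case (Suc m)
      have "integral (cbox (A', J1) (B', J2)) (\<lambda>z. (tube P w y g ((1/2) ^ m) z + (tube P w y g ((1/2) ^ Suc m) z - tube P w y g ((1/2) ^ m) z))\<^sup>2)
         \<le> ((X0 + (\<Sum>k<m. D * q ^ k)) + D * q ^ m)\<^sup>2"
      proof (rule integral_Minkowski)
        show "integral (cbox (A', J1) (B', J2)) (\<lambda>z. (tube P w y g ((1/2) ^ Suc m) z - tube P w y g ((1/2) ^ m) z)\<^sup>2) \<le> (D * q ^ m)\<^sup>2"
          using diff[of m] Suc.prems by (simp only: power2_commute Suc_leD)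
        have "0 \<le> (\<Sum>k<m. D * q ^ k)" using D q by (intro sum_nonneg) auto
        then show "0 < X0 + (\<Sum>k<m. D * q ^ k)" using X0 by linarith
      qed (use Suc D q ct in \<open>auto intro!: continuous_intros simp del: power_Suc\<close>)
      then show ?case by (simp add: add.assoc)
    qed
    have "(\<Sum>k<n. q ^ k) \<le> 1 / (1 - q)"
      using q sum_le_suminf[of "\<lambda>k. q ^ k" "{..<n}"] suminf_geometric[of q] by (simp add: summable_geometric)
    then have "D * (\<Sum>k<n. q ^ k) \<le> D * (1 / (1 - q))" using D by (intro mult_left_mono) auto
    then have "X0 + (\<Sum>k<n. D * q ^ k) \<le> K" using K(4) by (simp add: sum_distrib_left[symmetric])
    moreover have "0 \<le> (\<Sum>k<n. D * q ^ k)" using D q by (intro sum_nonneg) auto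
    ultimately have "(X0 + (\<Sum>k<n. D * q ^ k))\<^sup>2 \<le> K\<^sup>2" using X0 by (intro power_mono) auto
    then show "integral (cbox (A', J1) (B', J2)) (\<lambda>z. (tube P w y g ((1/2) ^ n) z)\<^sup>2) \<le> K\<^sup>2" using norm[OF n] by linarith
  qed
qed

lemma integral_le_norm_bound:
  fixes h k :: "real \<times> real \<Rightarrow> real"
  assumes "continuous_on (cbox u v) h" "continuous_on (cbox u v) k" "\<And>z. z \<in> cbox u v \<Longrightarrow> \<bar>h z\<bar> \<le> k z"
  shows "\<bar>integral (cbox u v) h\<bar> \<le> integral (cbox u v) k"
  using integral_norm_bound_integral[of h "cbox u v" k] assms by (simp add: integrable_continuous)

section \<open>Integrals of products of three tube sums\<close>

text \<open>The factors are exchanged one at a time. Each of the three terms contains one difference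
  and one function estimated in mean square, and the third function in sup norm.\<close>

lemma triple_product_L2_close:
  fixes f f' :: "nat \<Rightarrow> real \<times> real \<Rightarrow> real"
  assumes cf: "\<And>i. i < 3 \<Longrightarrow> continuous_on (cbox u v) (f i)" and cf': "\<And>i. i < 3 \<Longrightarrow> continuous_on (cbox u v) (f' i)"
    and S: "\<And>i z. i < 3 \<Longrightarrow> z \<in> cbox u v \<Longrightarrow> \<bar>f i z\<bar> \<le> S" and S': "\<And>i z. i < 3 \<Longrightarrow> z \<in> cbox u v \<Longrightarrow> \<bar>f' i z\<bar> \<le> S"
    and X: "X > 0" "\<And>i. i < 3 \<Longrightarrow> integral (cbox u v) (\<lambda>z. (f i z)\<^sup>2) \<le> X\<^sup>2" "\<And>i. i < 3 \<Longrightarrow> integral (cbox u v) (\<lambda>z. (f' i z)\<^sup>2) \<le> X\<^sup>2"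
    and Y: "Y > 0" "\<And>i. i < 3 \<Longrightarrow> integral (cbox u v) (\<lambda>z. (f i z - f' i z)\<^sup>2) \<le> Y\<^sup>2"
    and S0: "S \<ge> 0"
  shows "\<bar>integral (cbox u v) (\<lambda>z. f 0 z * f 1 z * f 2 z) - integral (cbox u v) (\<lambda>z. f' 0 z * f' 1 z * f' 2 z)\<bar> \<le> 3 * S * (Y * X)"
proof -
  define D where "D i z = f i z - f' i z" for i z
  have cD: "continuous_on (cbox u v) (D i)" if "i < 3" for i unfolding D_def by (intro continuous_intros cf cf' that)
  have c3: "continuous_on (cbox u v) (f 0)" "continuous_on (cbox u v) (f 1)" "continuous_on (cbox u v) (f 2)"
    "continuous_on (cbox u v) (f' 0)" "continuous_on (cbox u v) (f' 1)" "continuous_on (cbox u v) (f' 2)"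
    "continuous_on (cbox u v) (D 0)" "continuous_on (cbox u v) (D 1)" "continuous_on (cbox u v) (D 2)"
    by (simp_all add: cf cf' cD)
  have "integral (cbox u v) (\<lambda>z. f 0 z * f 1 z * f 2 z) - integral (cbox u v) (\<lambda>z. f' 0 z * f' 1 z * f' 2 z)
     = integral (cbox u v) (\<lambda>z. f 0 z * f 1 z * f 2 z - f' 0 z * f' 1 z * f' 2 z)"
    by (rule integral_diff[symmetric]) (intro integrable_continuous continuous_intros c3)+
  also have "\<bar>\<dots>\<bar> \<le> integral (cbox u v) (\<lambda>z. S * \<bar>D 0 z * f 1 z\<bar> + S * \<bar>D 1 z * f 2 z\<bar> + S * \<bar>D 2 z * f' 1 z\<bar>)"
  proof (rule integral_le_norm_bound)
    fix z assume z: "z \<in> cbox u v"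
    have "f 0 z * f 1 z * f 2 z - f' 0 z * f' 1 z * f' 2 z = f 2 z * (D 0 z * f 1 z) + f' 0 z * (D 1 z * f 2 z) + f' 0 z * (D 2 z * f' 1 z)"
      by (simp add: D_def algebra_simps)
    moreover have "\<bar>f 2 z * (D 0 z * f 1 z)\<bar> \<le> S * \<bar>D 0 z * f 1 z\<bar>"
      "\<bar>f' 0 z * (D 1 z * f 2 z)\<bar> \<le> S * \<bar>D 1 z * f 2 z\<bar>" "\<bar>f' 0 z * (D 2 z * f' 1 z)\<bar> \<le> S * \<bar>D 2 z * f' 1 z\<bar>"
      using S[of 2 z] S'[of 0 z] z unfolding abs_mult[of "f 2 z"] abs_mult[of "f' 0 z"] by (auto intro!: mult_right_mono)
    ultimately show "\<bar>f 0 z * f 1 z * f 2 z - f' 0 z * f' 1 z * f' 2 z\<bar> \<le> S * \<bar>D 0 z * f 1 z\<bar> + S * \<bar>D 1 z * f 2 z\<bar> + S * \<bar>D 2 z * f' 1 z\<bar>"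
      by linarith
  qed (intro continuous_intros c3)+
  also have "\<dots> = S * integral (cbox u v) (\<lambda>z. \<bar>D 0 z * f 1 z\<bar>) + S * integral (cbox u v) (\<lambda>z. \<bar>D 1 z * f 2 z\<bar>) + S * integral (cbox u v) (\<lambda>z. \<bar>D 2 z * f' 1 z\<bar>)"
  proof -
    have i: "(\<lambda>z. S * \<bar>D 0 z * f 1 z\<bar>) integrable_on cbox u v" "(\<lambda>z. S * \<bar>D 1 z * f 2 z\<bar>) integrable_on cbox u v"
      "(\<lambda>z. S * \<bar>D 2 z * f' 1 z\<bar>) integrable_on cbox u v" "(\<lambda>z. S * \<bar>D 0 z * f 1 z\<bar> + S * \<bar>D 1 z * f 2 z\<bar>) integrable_on cbox u v"
      by (intro integrable_continuous continuous_intros c3)+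
    show ?thesis by (simp only: integral_add[OF i(4) i(3)] integral_add[OF i(1,2)] integral_mult_right)
  qed
  also have "\<dots> \<le> S * (Y * X) + S * (Y * X) + S * (Y * X)"
    by (intro add_mono mult_left_mono S0 integral_Cauchy_Schwarz c3 X(1) Y(1)) (simp_all add: D_def X Y)
  finally show ?thesis by (simp add: mult_ac)
qed

text \<open>The crude counterpart at a fixed scale: all factors are taken in sup norm, which
  suffices for a Lipschitz constant that is allowed to depend on the scale.\<close>

lemma triple_product_sup_close:
  fixes f f' :: "nat \<Rightarrow> real \<times> real \<Rightarrow> real"
  assumes cf: "\<And>i. i < 3 \<Longrightarrow> continuous_on (cbox u v) (f i)" and cf': "\<And>i. i < 3 \<Longrightarrow> continuous_on (cbox u v) (f' i)"
    and S: "\<And>i z. i < 3 \<Longrightarrow> z \<in> cbox u v \<Longrightarrow> \<bar>f i z\<bar> \<le> S" and S': "\<And>i z. i < 3 \<Longrightarrow> z \<in> cbox u v \<Longrightarrow> \<bar>f' i z\<bar> \<le> S"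
    and D: "\<And>i z. i < 3 \<Longrightarrow> z \<in> cbox u v \<Longrightarrow> \<bar>f i z - f' i z\<bar> \<le> \<eta>"
    and S0: "S \<ge> 0" and \<eta>: "\<eta> \<ge> 0"
  shows "\<bar>integral (cbox u v) (\<lambda>z. f 0 z * f 1 z * f 2 z) - integral (cbox u v) (\<lambda>z. f' 0 z * f' 1 z * f' 2 z)\<bar>
     \<le> 3 * S\<^sup>2 * Henstock_Kurzweil_Integration.content (cbox u v) * \<eta>"
proof -
  have c3: "continuous_on (cbox u v) (f 0)" "continuous_on (cbox u v) (f 1)" "continuous_on (cbox u v) (f 2)"
    "continuous_on (cbox u v) (f' 0)" "continuous_on (cbox u v) (f' 1)" "continuous_on (cbox u v) (f' 2)"
    by (simp_all add: cf cf')
  have "integral (cbox u v) (\<lambda>z. f 0 z * f 1 z * f 2 z) - integral (cbox u v) (\<lambda>z. f' 0 z * f' 1 z * f' 2 z)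
     = integral (cbox u v) (\<lambda>z. f 0 z * f 1 z * f 2 z - f' 0 z * f' 1 z * f' 2 z)"
    by (rule integral_diff[symmetric]) (intro integrable_continuous continuous_intros c3)+
  also have "\<bar>\<dots>\<bar> \<le> integral (cbox u v) (\<lambda>z. 3 * (S * S * \<eta>))"
  proof (rule integral_le_norm_bound)
    fix z assume z: "z \<in> cbox u v"
    have "f 0 z * f 1 z * f 2 z - f' 0 z * f' 1 z * f' 2 z
      = f 1 z * f 2 z * (f 0 z - f' 0 z) + f' 0 z * f 2 z * (f 1 z - f' 1 z) + f' 0 z * f' 1 z * (f 2 z - f' 2 z)"
      by (simp add: algebra_simps)
    moreover have "\<bar>f 1 z * f 2 z * (f 0 z - f' 0 z)\<bar> \<le> S * S * \<eta>" "\<bar>f' 0 z * f 2 z * (f 1 z - f' 1 z)\<bar> \<le> S * S * \<eta>"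
       "\<bar>f' 0 z * f' 1 z * (f 2 z - f' 2 z)\<bar> \<le> S * S * \<eta>"
      unfolding abs_mult by (intro mult_mono S S' D z; simp add: S0)+
    ultimately show "\<bar>f 0 z * f 1 z * f 2 z - f' 0 z * f' 1 z * f' 2 z\<bar> \<le> 3 * (S * S * \<eta>)" by linarith
  qed (intro continuous_intros c3)+
  finally show ?thesis by (simp add: power2_eq_square mult_ac)
qed

lemma integral_lower_bound_subbox:
  fixes h :: "real \<times> real \<Rightarrow> real"
  assumes c: "continuous_on (cbox (A, J1) (B, J2)) h" and h0: "\<And>z. z \<in> cbox (A, J1) (B, J2) \<Longrightarrow> 0 \<le> h z"
    and r: "r > 0" "A \<le> a - r" "a + r \<le> B" "J1 \<le> b - r" "b + r \<le> J2"
    and m: "\<And>z. \<bar>fst z - a\<bar> \<le> r \<Longrightarrow> \<bar>snd z - b\<bar> \<le> r \<Longrightarrow> m \<le> h z"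
  shows "m * (2 * r)\<^sup>2 \<le> integral (cbox (A, J1) (B, J2)) h"
proof -
  have sub: "cbox (a - r, b - r) (a + r, b + r) \<subseteq> cbox (A, J1) (B, J2)" using r by (auto simp: cbox_Pair_eq)
  have "m * (2 * r)\<^sup>2 = integral (cbox (a - r, b - r) (a + r, b + r)) (\<lambda>z. m)"
    using r by (simp add: content_cbox_Pair power2_eq_square)
  also have "\<dots> \<le> integral (cbox (a - r, b - r) (a + r, b + r)) h"
  proof (rule integral_le)
    show "h integrable_on cbox (a - r, b - r) (a + r, b + r)"
      by (rule integrable_continuous[OF continuous_on_subset[OF c sub]])
    fix z assume "z \<in> cbox (a - r, b - r) (a + r, b + r)"
    then have "\<bar>fst z - a\<bar> \<le> r" "\<bar>snd z - b\<bar> \<le> r" by (auto simp: cbox_Pair_eq mem_Times_iff)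
    then show "m \<le> h z" by (rule m)
  qed (rule integrable_const)
  also have "\<dots> \<le> integral (cbox (A, J1) (B, J2)) h"
    by (rule integral_subset_le[OF sub integrable_continuous[OF continuous_on_subset[OF c sub]] integrable_continuous[OF c] ballI[OF h0]])
  finally show ?thesis .
qed

lemma tube_pos_obtains:
  assumes "\<delta> > 0" "tube P w y g \<delta> z \<noteq> 0"
  shows "\<exists>p\<in>P. \<bar>y p - g (fst z) p - snd z\<bar> \<le> \<delta>"
proof (rule ccontr)
  assume "\<not> ?thesis"
  then have "bump \<delta> (y p - g (fst z) p - snd z) = 0" if "p \<in> P" for p
    using that bump_zero[OF assms(1), of "y p - g (fst z) p - snd z"] by force
  then have "tube P w y g \<delta> z = 0" by (simp add: tube_def)
  then show False using assms by simp
qed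

text \<open>Every triple of points has an exact solution (r, a, b). Pigeonhole on \<open>r\<close>
  finds a value shared up to \<open>h\<close> by a fair part of all triples. For each of these the
  three strips at that value overlap in a square of half-side \<open>h\<close> about (a, b), where
  the product is at least \<open>(1 / (2 * \<delta>)) ^ 3\<close>.\<close>

lemma triple_tube_mass:
  fixes P :: "nat \<Rightarrow> 'p set" and w :: "nat \<Rightarrow> 'p \<Rightarrow> real" and x y :: "'p \<Rightarrow> real" and g :: "nat \<Rightarrow> real \<Rightarrow> real \<Rightarrow> 'p \<Rightarrow> real"
  assumes fin: "\<And>i. i < 3 \<Longrightarrow> finite (P i)" and w0: "\<And>i p. i < 3 \<Longrightarrow> p \<in> P i \<Longrightarrow> 0 \<le> w i p"
    and c: "c > 0" "\<And>i. i < 3 \<Longrightarrow> c \<le> sum (w i) (P i)"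
    and AB: "A \<le> A'" "B' \<le> B" and \<Lambda>: "1 \<le> \<Lambda>"
    and tr: "\<And>i r. i < 3 \<Longrightarrow> r \<in> {\<alpha>'..\<beta>'} \<Longrightarrow> transversal A B \<kappa> \<Lambda> (P i) x (g i r)"
    and lip: "\<And>i p r r' a a'. i < 3 \<Longrightarrow> p \<in> P i \<Longrightarrow> r \<in> {\<alpha>'..\<beta>'} \<Longrightarrow> r' \<in> {\<alpha>'..\<beta>'} \<Longrightarrow> a \<in> {A'..B'} \<Longrightarrow> a' \<in> {A'..B'} \<Longrightarrow>
        \<bar>g i r a p - g i r' a' p\<bar> \<le> \<Lambda> * (\<bar>r - r'\<bar> + \<bar>a - a'\<bar>)"
    and sol: "\<And>p. (\<And>i. i < 3 \<Longrightarrow> p i \<in> P i) \<Longrightarrow> \<exists>r a b. r \<in> {\<alpha>'..\<beta>'} \<and> a \<in> {A' + \<eta>..B' - \<eta>} \<and> b \<in> {J1 + \<eta>..J2 - \<eta>} \<and>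
        (\<forall>i<3. y (p i) = g i r a (p i) + b)"
    and d: "0 < \<delta>" "\<delta> \<le> 1" "\<delta> \<le> \<eta>"
  shows "\<exists>r\<in>{\<alpha>'..\<beta>'}. c ^ 3 / (432 * \<Lambda> ^ 3 * (\<beta>' - \<alpha>' + 1)) \<le>
    integral (cbox (A', J1) (B', J2)) (\<lambda>z. tube (P 0) (w 0) y (g 0 r) \<delta> z * tube (P 1) (w 1) y (g 1 r) \<delta> z * tube (P 2) (w 2) y (g 2 r) \<delta> z)"
proof -
  \<comment> \<open>The changes of parameter and of \<open>a\<close> move a curve by at most
    \<open>2 * \<Lambda> * h\<close>, and that of \<open>b\<close> adds \<open>h\<close>; together
    at most \<open>3 * \<Lambda> * h\<close>, which is \<delta>/2, where the hat still has half its
    height.\<close>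
  define h where "h = \<delta> / (6 * \<Lambda>)"
  have "\<delta> / (6 * \<Lambda>) \<le> \<delta> / 1" using d \<Lambda> by (intro divide_left_mono) auto
  then have h: "0 < h" "h \<le> \<delta>" "h \<le> \<eta>" "h \<le> 1" using d \<Lambda> by (auto simp: h_def)
  have h6: "6 * \<Lambda> * h = \<delta>" using \<Lambda> by (simp add: h_def)
  define sel where "sel \<omega> i = (if i = 0 then fst \<omega> else if i = 1 then fst (snd \<omega>) else snd (snd \<omega>))" for \<omega> :: "'p \<times> 'p \<times> 'p" and i :: nat
  have i3: "i = 0 \<or> i = 1 \<or> i = 2" if "i < 3" for i :: nat using that by linarith
  define \<Omega> where "\<Omega> = P 0 \<times> P 1 \<times> P 2"
  have sel: "sel \<omega> i \<in> P i" if "\<omega> \<in> \<Omega>" "i < 3" for \<omega> i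
    using that i3[OF that(2)] by (auto simp: sel_def \<Omega>_def)
  define good where "good \<omega> \<theta> \<longleftrightarrow> fst \<theta> \<in> {\<alpha>'..\<beta>'} \<and> fst (snd \<theta>) \<in> {A' + \<eta>..B' - \<eta>} \<and> snd (snd \<theta>) \<in> {J1 + \<eta>..J2 - \<eta>} \<and>
     (\<forall>i<3. y (sel \<omega> i) = g i (fst \<theta>) (fst (snd \<theta>)) (sel \<omega> i) + snd (snd \<theta>))" for \<omega> and \<theta> :: "real \<times> real \<times> real"
  define \<theta> where "\<theta> \<omega> = (SOME t. good \<omega> t)" for \<omega>
  have good: "good \<omega> (\<theta> \<omega>)" if \<omega>: "\<omega> \<in> \<Omega>" for \<omega>
  proof -
    obtain r a b where "r \<in> {\<alpha>'..\<beta>'} \<and> a \<in> {A' + \<eta>..B' - \<eta>} \<and> b \<in> {J1 + \<eta>..J2 - \<eta>} \<and>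
        (\<forall>i<3. y (sel \<omega> i) = g i r a (sel \<omega> i) + b)" using sol[of "sel \<omega>"] sel[OF \<omega>] by auto
    then have "good \<omega> (r, a, b)" by (simp add: good_def)
    then show ?thesis unfolding \<theta>_def by (rule someI)
  qed
  define t where "t \<omega> = fst (\<theta> \<omega>)" for \<omega>
  have t: "\<alpha>' \<le> t \<omega> \<and> t \<omega> \<le> \<beta>'" if "\<omega> \<in> \<Omega>" for \<omega> using good[OF that] by (simp add: good_def t_def)
  define W where "W \<omega> = w 0 (fst \<omega>) * (w 1 (fst (snd \<omega>)) * w 2 (snd (snd \<omega>)))" for \<omega> :: "'p \<times> 'p \<times> 'p"
  have W0: "0 \<le> W \<omega>" if "\<omega> \<in> \<Omega>" for \<omega> using that w0 by (auto simp: W_def \<Omega>_def)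
  have finO: "finite \<Omega>" using fin by (auto simp: \<Omega>_def)
  have "c ^ 3 \<le> sum W \<Omega>"
  proof -
    have "sum W \<Omega> = sum (w 0) (P 0) * (sum (w 1) (P 1) * sum (w 2) (P 2))"
      unfolding sum_product sum.cartesian_product \<Omega>_def W_def by (simp add: split_beta)
    moreover have "c * (c * c) \<le> sum (w 0) (P 0) * (sum (w 1) (P 1) * sum (w 2) (P 2))"
      using c(1) c(2)[of 0] c(2)[of 1] c(2)[of 2] by (intro mult_mono) auto
    ultimately show ?thesis by (simp add: power3_eq_cube)
  qed
  then have "\<exists>j\<in>\<Omega>. c ^ 3 * h / (\<beta>' - \<alpha>' + h) \<le> sum W {\<omega>\<in>\<Omega>. \<bar>t \<omega> - t j\<bar> \<le> h}"
    using c(1) by (intro weighted_pigeonhole finO t h(1) W0) simp_all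
  then obtain j where j: "j \<in> \<Omega>" "c ^ 3 * h / (\<beta>' - \<alpha>' + h) \<le> sum W {\<omega>\<in>\<Omega>. \<bar>t \<omega> - t j\<bar> \<le> h}"
    by (elim bexE) (rule that)
  define \<Omega>' where "\<Omega>' = {\<omega>\<in>\<Omega>. \<bar>t \<omega> - t j\<bar> \<le> h}"
  have tj: "t j \<in> {\<alpha>'..\<beta>'}" using t[OF j(1)] by simp
  define \<B> where "\<B> = cbox (A', J1) (B', J2)"
  define k where "k \<omega> i z = bump \<delta> (y (sel \<omega> i) - g i (t j) (fst z) (sel \<omega> i) - snd z)" for \<omega> i and z :: "real \<times> real"
  have ck: "continuous_on \<B> (k \<omega> i)" if "\<omega> \<in> \<Omega>" "i < 3" for \<omega> i
  proof -
    have "transversal A B \<kappa> \<Lambda> {sel \<omega> i} x (g i (t j))"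
      by (rule transversal_subset[OF tr[OF that(2) tj]]) (use sel[OF that] in simp)
    from continuous_tube[OF this d(1) AB, of J1 J2 "\<lambda>_. 1" y] show ?thesis by (simp add: \<B>_def tube_def k_def[abs_def])
  qed
  define k3 where "k3 \<omega> z = k \<omega> 0 z * (k \<omega> 1 z * k \<omega> 2 z)" for \<omega> z
  have ck3: "continuous_on \<B> (k3 \<omega>)" if "\<omega> \<in> \<Omega>" for \<omega>
    unfolding k3_def using ck[OF that] by (intro continuous_intros) auto
  have k0: "0 \<le> k \<omega> i z" for \<omega> i z by (simp add: k_def bump_nonneg d)
  have "tube (P 0) (w 0) y (g 0 (t j)) \<delta> z * tube (P 1) (w 1) y (g 1 (t j)) \<delta> z * tube (P 2) (w 2) y (g 2 (t j)) \<delta> z = (\<Sum>\<omega>\<in>\<Omega>. W \<omega> * k3 \<omega> z)" for z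
  proof -
    have "tube (P 0) (w 0) y (g 0 (t j)) \<delta> z * (tube (P 1) (w 1) y (g 1 (t j)) \<delta> z * tube (P 2) (w 2) y (g 2 (t j)) \<delta> z)
      = (\<Sum>\<omega>\<in>\<Omega>. W \<omega> * k3 \<omega> z)"
      unfolding tube_def sum_product sum.cartesian_product \<Omega>_def
      by (intro sum.cong refl) (auto simp: W_def k3_def k_def sel_def)
    then show ?thesis by (simp add: mult.assoc)
  qed
  then have eq: "integral \<B> (\<lambda>z. tube (P 0) (w 0) y (g 0 (t j)) \<delta> z * tube (P 1) (w 1) y (g 1 (t j)) \<delta> z * tube (P 2) (w 2) y (g 2 (t j)) \<delta> z)
     = integral \<B> (\<lambda>z. \<Sum>\<omega>\<in>\<Omega>. W \<omega> * k3 \<omega> z)" by simp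
  also have "\<dots> = (\<Sum>\<omega>\<in>\<Omega>. integral \<B> (\<lambda>z. W \<omega> * k3 \<omega> z))"
    by (rule integral_sum[OF finO]) (use ck3 in \<open>auto simp: \<B>_def intro!: integrable_continuous continuous_intros\<close>)
  also have "\<dots> = (\<Sum>\<omega>\<in>\<Omega>. W \<omega> * integral \<B> (k3 \<omega>))" by simp
  also have "\<dots> \<ge> (\<Sum>\<omega>\<in>\<Omega>'. W \<omega> * ((1 / (2 * \<delta>)) ^ 3 * (2 * h)\<^sup>2))"
  proof -
    have one: "(1 / (2 * \<delta>)) ^ 3 * (2 * h)\<^sup>2 \<le> integral \<B> (k3 \<omega>)" if \<omega>: "\<omega> \<in> \<Omega>'" for \<omega>
    proof -
      have \<omega>O: "\<omega> \<in> \<Omega>" and tt: "\<bar>t \<omega> - t j\<bar> \<le> h" using \<omega> by (auto simp: \<Omega>'_def)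
      obtain r a b where \<theta>: "\<theta> \<omega> = (r, a, b)" by (cases "\<theta> \<omega>")
      have G: "r \<in> {\<alpha>'..\<beta>'}" "a \<in> {A' + \<eta>..B' - \<eta>}" "b \<in> {J1 + \<eta>..J2 - \<eta>}"
        "\<And>i. i < 3 \<Longrightarrow> y (sel \<omega> i) = g i r a (sel \<omega> i) + b" using good[OF \<omega>O] unfolding good_def \<theta> by auto
      have rj: "\<bar>r - t j\<bar> \<le> h" using tt by (simp add: t_def \<theta>)
      show ?thesis unfolding \<B>_def
      proof (rule integral_lower_bound_subbox[where a = a and b = b])
        show "continuous_on (cbox (A', J1) (B', J2)) (k3 \<omega>)" using ck3[OF \<omega>O] by (simp add: \<B>_def)
        show "0 \<le> k3 \<omega> z" for z using k0 by (simp add: k3_def)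
        show "A' \<le> a - h" "a + h \<le> B'" "J1 \<le> b - h" "b + h \<le> J2" "h > 0" using G h by auto
        fix z :: "real \<times> real" assume z: "\<bar>fst z - a\<bar> \<le> h" "\<bar>snd z - b\<bar> \<le> h"
        have az: "fst z \<in> {A'..B'}" "a \<in> {A'..B'}" using z G(2) h d by auto
        have "1 / (2 * \<delta>) \<le> k \<omega> i z" if i: "i < 3" for i
          unfolding k_def
        proof (rule bump_lower[OF d(1)])
          have "\<bar>g i r a (sel \<omega> i) - g i (t j) (fst z) (sel \<omega> i)\<bar> \<le> \<Lambda> * (\<bar>r - t j\<bar> + \<bar>a - fst z\<bar>)"
            by (rule lip[OF i sel[OF \<omega>O i] G(1) tj az(2,1)])
          also have "\<dots> \<le> \<Lambda> * (2 * h)" using rj z \<Lambda> by (intro mult_left_mono) auto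
          finally have 1: "\<bar>g i r a (sel \<omega> i) - g i (t j) (fst z) (sel \<omega> i)\<bar> \<le> 2 * (\<Lambda> * h)" by simp
          have "1 * h \<le> \<Lambda> * h" using \<Lambda> h by (intro mult_right_mono) auto
          then show "\<bar>y (sel \<omega> i) - g i (t j) (fst z) (sel \<omega> i) - snd z\<bar> \<le> \<delta> / 2"
            using 1 z(2) G(4)[OF i] h6 by linarith
        qed
        then have "1 / (2 * \<delta>) * (1 / (2 * \<delta>) * (1 / (2 * \<delta>))) \<le> k3 \<omega> z"
          unfolding k3_def using d k0 by (intro mult_mono) auto
        then show "(1 / (2 * \<delta>)) ^ 3 \<le> k3 \<omega> z" by (simp only: power3_eq_cube mult.assoc)
      qed
    qed
    have "(\<Sum>\<omega>\<in>\<Omega>'. W \<omega> * ((1 / (2 * \<delta>)) ^ 3 * (2 * h)\<^sup>2)) \<le> (\<Sum>\<omega>\<in>\<Omega>'. W \<omega> * integral \<B> (k3 \<omega>))"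
      by (intro sum_mono mult_left_mono one W0) (auto simp: \<Omega>'_def)
    also have "\<dots> \<le> (\<Sum>\<omega>\<in>\<Omega>. W \<omega> * integral \<B> (k3 \<omega>))"
    proof (rule sum_mono2[OF finO])
      show "\<Omega>' \<subseteq> \<Omega>" by (auto simp: \<Omega>'_def)
      fix \<omega> assume "\<omega> \<in> \<Omega> - \<Omega>'"
      then have \<omega>: "\<omega> \<in> \<Omega>" by blast
      have "k3 \<omega> integrable_on \<B>" using ck3[OF \<omega>] unfolding \<B>_def by (rule integrable_continuous)
      then have "0 \<le> integral \<B> (k3 \<omega>)" by (rule integral_nonneg) (simp add: k3_def k0)
      then show "0 \<le> W \<omega> * integral \<B> (k3 \<omega>)" using W0[OF \<omega>] by simp
    qed
    finally show ?thesis .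
  qed
  finally have "(1 / (2 * \<delta>)) ^ 3 * (2 * h)\<^sup>2 * sum W \<Omega>' \<le>
    integral \<B> (\<lambda>z. tube (P 0) (w 0) y (g 0 (t j)) \<delta> z * tube (P 1) (w 1) y (g 1 (t j)) \<delta> z * tube (P 2) (w 2) y (g 2 (t j)) \<delta> z)"
    by (simp only: sum_distrib_right[symmetric] mult.commute)
  moreover have "c ^ 3 / (432 * \<Lambda> ^ 3 * (\<beta>' - \<alpha>' + 1)) \<le> (1 / (2 * \<delta>)) ^ 3 * (2 * h)\<^sup>2 * sum W \<Omega>'"
  proof -
    have ab: "\<beta>' - \<alpha>' \<ge> 0" using tj by simp
    \<comment> \<open>The powers of \<delta> cancel, which is why the lower bound is the same at all
      scales: the expression is \<open>h ^ 3 / (2 * \<delta> ^ 3)\<close>, and 432 is 2 *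
      6^3.\<close>
    have e: "(1 / (2 * \<delta>)) ^ 3 * (2 * h)\<^sup>2 * h = 1 / (432 * \<Lambda> ^ 3)"
      unfolding h_def using d \<Lambda> by (simp add: power3_eq_cube power2_eq_square field_simps)
    have "c ^ 3 / (432 * \<Lambda> ^ 3 * (\<beta>' - \<alpha>' + 1)) \<le> c ^ 3 / (432 * \<Lambda> ^ 3 * (\<beta>' - \<alpha>' + h))"
      using ab h c \<Lambda> by (intro divide_left_mono mult_left_mono) auto
    also have "\<dots> = (1 / (432 * \<Lambda> ^ 3)) * (c ^ 3 / (\<beta>' - \<alpha>' + h))" by simp
    also have "\<dots> = (1 / (2 * \<delta>)) ^ 3 * (2 * h)\<^sup>2 * (c ^ 3 * h / (\<beta>' - \<alpha>' + h))" unfolding e[symmetric] by simp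
    also have "\<dots> \<le> (1 / (2 * \<delta>)) ^ 3 * (2 * h)\<^sup>2 * sum W \<Omega>'"
      unfolding \<Omega>'_def using j(2) d by (intro mult_left_mono) auto
    finally show ?thesis .
  qed
  ultimately show ?thesis unfolding \<B>_def using tj by (intro bexI[of _ "t j"]) linarith+
qed

lemma tube_le_total:
  assumes "\<delta> > 0" "\<And>p. p \<in> P \<Longrightarrow> 0 \<le> w p" "sum w P \<le> W"
  shows "\<bar>tube P w y g \<delta> z\<bar> \<le> W / \<delta>"
proof -
  have "tube P w y g \<delta> z \<le> (\<Sum>p\<in>P. w p * (1 / \<delta>))"
    unfolding tube_def by (intro sum_mono mult_left_mono bump_le assms)
  also have "\<dots> = sum w P / \<delta>" by (simp add: sum_divide_distrib)
  also have "\<dots> \<le> W / \<delta>" using assms by (intro divide_right_mono) auto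
  finally show ?thesis using tube_nonneg[of \<delta> P w y g z] assms by simp
qed

lemma tube_lipschitz:
  assumes "\<delta> > 0" "\<And>p. p \<in> P \<Longrightarrow> 0 \<le> w p" "sum w P \<le> W" "E \<ge> 0"
    and "\<And>p. p \<in> P \<Longrightarrow> \<bar>g (fst z) p - g' (fst z) p\<bar> \<le> E"
  shows "\<bar>tube P w y g \<delta> z - tube P w y g' \<delta> z\<bar> \<le> W * E / \<delta>\<^sup>2"
proof -
  have "\<bar>tube P w y g \<delta> z - tube P w y g' \<delta> z\<bar> =
     \<bar>\<Sum>p\<in>P. w p * (bump \<delta> (y p - g (fst z) p - snd z) - bump \<delta> (y p - g' (fst z) p - snd z))\<bar>"
    by (simp add: tube_def sum_subtractf right_diff_distrib)
  also have "\<dots> \<le> (\<Sum>p\<in>P. \<bar>w p * (bump \<delta> (y p - g (fst z) p - snd z) - bump \<delta> (y p - g' (fst z) p - snd z))\<bar>)"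
    by (rule sum_abs)
  also have "\<dots> \<le> (\<Sum>p\<in>P. w p * (E / \<delta>\<^sup>2))"
  proof (rule sum_mono)
    fix p assume p: "p \<in> P"
    have "\<bar>bump \<delta> (y p - g (fst z) p - snd z) - bump \<delta> (y p - g' (fst z) p - snd z)\<bar>
      \<le> \<bar>(y p - g (fst z) p - snd z) - (y p - g' (fst z) p - snd z)\<bar> / \<delta>\<^sup>2"
      by (rule bump_lipschitz[OF assms(1)])
    also have "\<dots> \<le> E / \<delta>\<^sup>2" using assms(5)[OF p] by (intro divide_right_mono) auto
    finally show "\<bar>w p * (bump \<delta> (y p - g (fst z) p - snd z) - bump \<delta> (y p - g' (fst z) p - snd z))\<bar> \<le> w p * (E / \<delta>\<^sup>2)"
      using assms(2)[OF p] unfolding abs_mult by (intro mult_mono) auto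
  qed
  also have "\<dots> = sum w P * (E / \<delta>\<^sup>2)" by (simp only: sum_distrib_right)
  also have "\<dots> \<le> W * (E / \<delta>\<^sup>2)" using assms by (intro mult_right_mono) auto
  finally show ?thesis by simp
qed

text \<open>The nested ranges serve different steps: [A, B] beyond [A', B'] gives room to the cutoff
  weight, the margin \<eta> keeps the squares about solutions inside the domain of integration, and
  [\<alpha>, \<beta>] beyond [\<alpha>', \<beta>'] contains an interval about the limit
  parameter.\<close>

lemma triple_tube_interval:
  fixes F :: "nat \<Rightarrow> 'p set" and P :: "nat \<Rightarrow> nat \<Rightarrow> 'p set" and w :: "nat \<Rightarrow> nat \<Rightarrow> 'p \<Rightarrow> real"
    and x y :: "'p \<Rightarrow> real" and g :: "nat \<Rightarrow> real \<Rightarrow> real \<Rightarrow> 'p \<Rightarrow> real"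
  assumes s: "5/3 < s" "s < 2" and AB: "A < A'" "A' \<le> B'" "B' < B" and J: "J1 \<le> J2" and \<kappa>: "0 < \<kappa>" and \<Lambda>: "1 \<le> \<Lambda>" and \<epsilon>: "0 \<le> \<epsilon>"
    and C: "0 \<le> C" and c: "0 < c"
    and PF: "\<And>i N. i < 3 \<Longrightarrow> P i N \<subseteq> F i" and sp: "\<And>i N. i < 3 \<Longrightarrow> spread (P i N) (w i N) x y s C ((1/2) ^ N)"
    and cW: "\<And>i N. i < 3 \<Longrightarrow> c \<le> sum (w i N) (P i N)" "\<And>i N. i < 3 \<Longrightarrow> sum (w i N) (P i N) \<le> W"
    and xb: "\<And>i p. i < 3 \<Longrightarrow> p \<in> F i \<Longrightarrow> \<bar>x p - x\<^sub>0 i\<bar> \<le> \<epsilon>"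
    and tr: "\<And>i r. i < 3 \<Longrightarrow> r \<in> {\<alpha>..\<beta>} \<Longrightarrow> transversal A B \<kappa> \<Lambda> (F i) x (g i r)"
    and lip: "\<And>i p r r' a a'. i < 3 \<Longrightarrow> p \<in> F i \<Longrightarrow> r \<in> {\<alpha>..\<beta>} \<Longrightarrow> r' \<in> {\<alpha>..\<beta>} \<Longrightarrow> a \<in> {A'..B'} \<Longrightarrow> a' \<in> {A'..B'} \<Longrightarrow>
        \<bar>g i r a p - g i r' a' p\<bar> \<le> \<Lambda> * (\<bar>r - r'\<bar> + \<bar>a - a'\<bar>)"
    and sol: "\<And>p. (\<And>i. i < 3 \<Longrightarrow> p i \<in> F i) \<Longrightarrow> \<exists>r a b. r \<in> {\<alpha>'..\<beta>'} \<and> a \<in> {A' + \<eta>..B' - \<eta>} \<and> b \<in> {J1 + \<eta>..J2 - \<eta>} \<and>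
        (\<forall>i<3. y (p i) = g i r a (p i) + b)"
    and ab: "\<alpha> < \<alpha>'" "\<beta>' < \<beta>" and \<eta>: "\<eta> > 0"
  shows "\<exists>t1 t2. t1 < t2 \<and> {t1<..<t2} \<subseteq> {\<alpha>..\<beta>} \<and> (\<forall>r\<in>{t1<..<t2}. \<exists>\<^sub>\<infinity>N. \<exists>z\<in>cbox (A', J1) (B', J2). \<forall>i<3.
     \<exists>p\<in>F i. \<bar>y p - g i r (fst z) p - snd z\<bar> \<le> (1/2) ^ N)"
proof -
  define \<B> where "\<B> = cbox (A', J1) (B', J2)"
  define u where "u i N n r = tube (P i N) (w i N) y (g i r) ((1/2) ^ n)" for i N n r
  define Fn where "Fn N n r = integral \<B> (\<lambda>z. u 0 N n r z * u 1 N n r z * u 2 N n r z)" for N n r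
  have w0: "0 \<le> w i N p" if "i < 3" "p \<in> P i N" for i N p using sp[OF that(1)] that(2) by (simp add: spread_def)
  have W: "W > 0" using cW[of 0 0] c by linarith
  have tr': "transversal A B \<kappa> \<Lambda> (P i N) x (g i r)" if "i < 3" "r \<in> {\<alpha>..\<beta>}" for i N r
    by (rule transversal_subset[OF tr[OF that] PF[OF that(1)]])
  have pw: "(0::real) < (1/2) ^ m" for m :: nat by simp
  have cu: "continuous_on \<B> (u i N n r)" if "i < 3" "r \<in> {\<alpha>..\<beta>}" for i N n r
    unfolding u_def \<B>_def by (rule continuous_tube[OF tr'[OF that] pw]) (use AB in auto)
  have u0: "0 \<le> u i N n r z" if "i < 3" for i N n r z
    unfolding u_def by (rule tube_nonneg[OF pw w0[OF that]])
  have s1: "1 < s" using s(1) by simp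
  obtain K where K: "K \<ge> 1" and Kt: "\<forall>(P :: 'p set) w x y g N x\<^sub>0. spread P w x y s C ((1/2) ^ N) \<longrightarrow> sum w P \<le> W \<longrightarrow> (\<forall>p\<in>P. \<bar>x p - x\<^sub>0\<bar> \<le> \<epsilon>) \<longrightarrow>
    transversal A B \<kappa> \<Lambda> P x g \<longrightarrow>
    (\<forall>n\<le>N. (\<forall>z\<in>cbox (A', J1) (B', J2). tube P w y g ((1/2) ^ n) z \<le> K * ((1/2) ^ n) powr (s - 2)) \<and>
       integral (cbox (A', J1) (B', J2)) (\<lambda>z. (tube P w y g ((1/2) ^ n) z)\<^sup>2) \<le> K\<^sup>2 \<and>
       (n < N \<longrightarrow> integral (cbox (A', J1) (B', J2)) (\<lambda>z. (tube P w y g ((1/2) ^ n) z - tube P w y g ((1/2) ^ Suc n) z)\<^sup>2)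
           \<le> (K * ((1/2) ^ n) powr ((s - 1) / 2))\<^sup>2))"
    using tube_estimates[where 'p = 'p, OF s1 s(2) C less_imp_le[OF W] AB J \<kappa> \<Lambda> \<epsilon>]
    by (elim exE conjE) (rule that)
  have est: "(\<forall>z\<in>\<B>. u i N n r z \<le> K * ((1/2) ^ n) powr (s - 2)) \<and> integral \<B> (\<lambda>z. (u i N n r z)\<^sup>2) \<le> K\<^sup>2 \<and>
       (n < N \<longrightarrow> integral \<B> (\<lambda>z. (u i N n r z - u i N (Suc n) r z)\<^sup>2) \<le> (K * ((1/2) ^ n) powr ((s - 1) / 2))\<^sup>2)"
    if "i < 3" "r \<in> {\<alpha>..\<beta>}" "n \<le> N" for i N n r
  proof -
    have "\<forall>p\<in>P i N. \<bar>x p - x\<^sub>0 i\<bar> \<le> \<epsilon>" using xb[OF that(1)] PF[OF that(1), of N] by blast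
    from Kt[rule_format, OF sp[OF that(1)] cW(2)[OF that(1)] this[rule_format] tr'[OF that(1,2)] that(3)]
    show ?thesis unfolding u_def \<B>_def by blast
  qed
  define q where "q = (1/2 :: real) powr ((3 * s - 5) / 2)"
  have q: "0 \<le> q" "q < 1" using s by (auto simp: q_def powr01_less_one)
  \<comment> \<open>Sup norm, difference and mean square each contribute a factor \<open>K\<close>;
    the power of 1/2 appears because the sup norm is taken at the finer of the two scales, where its
    bound is larger.\<close>
  define L where "L = 3 * K ^ 3 * (1/2) powr (s - 2)"
  have step: "\<bar>Fn N n r - Fn N (Suc n) r\<bar> \<le> L * q ^ n" if "n < N" "r \<in> {\<alpha>..\<beta>}" for N n r
  proof -
    define S where "S = K * ((1/2) ^ Suc n) powr (s - 2)"
    define Y where "Y = K * ((1/2) ^ n) powr ((s - 1) / 2)"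
    have S0: "S \<ge> 0" using K by (simp add: S_def)
    have mono: "K * ((1/2) ^ n) powr (s - 2) \<le> S" unfolding S_def
    proof (rule mult_left_mono)
      show "((1/2 :: real) ^ n) powr (s - 2) \<le> ((1/2) ^ Suc n) powr (s - 2)"
        using s by (intro powr_mono2') auto
    qed (use K in simp)
    have "\<bar>Fn N n r - Fn N (Suc n) r\<bar> \<le> 3 * S * (Y * K)"
      unfolding Fn_def \<B>_def
    proof (rule triple_product_L2_close)
      fix i :: nat assume i: "i < 3"
      show "continuous_on (cbox (A', J1) (B', J2)) (u i N n r)" "continuous_on (cbox (A', J1) (B', J2)) (u i N (Suc n) r)"
        using cu[OF i that(2)] by (simp_all add: \<B>_def)
      have e1: "u i N n r z \<le> K * ((1/2) ^ n) powr (s - 2)" if "z \<in> cbox (A', J1) (B', J2)" for z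
        using est[OF i \<open>r \<in> {\<alpha>..\<beta>}\<close>, of n N] \<open>n < N\<close> that by (simp add: \<B>_def)
      show "\<bar>u i N n r z\<bar> \<le> S" if "z \<in> cbox (A', J1) (B', J2)" for z
        using e1[OF that] mono u0[OF i, of N n r z] by simp
      show "\<bar>u i N (Suc n) r z\<bar> \<le> S" if "z \<in> cbox (A', J1) (B', J2)" for z
        using est[OF i \<open>r \<in> {\<alpha>..\<beta>}\<close>, of "Suc n" N] \<open>n < N\<close> that u0[OF i, of N "Suc n" r z] by (simp add: \<B>_def S_def)
      show "integral (cbox (A', J1) (B', J2)) (\<lambda>z. (u i N n r z)\<^sup>2) \<le> K\<^sup>2"
        "integral (cbox (A', J1) (B', J2)) (\<lambda>z. (u i N (Suc n) r z)\<^sup>2) \<le> K\<^sup>2"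
        "integral (cbox (A', J1) (B', J2)) (\<lambda>z. (u i N n r z - u i N (Suc n) r z)\<^sup>2) \<le> Y\<^sup>2"
        using est[OF i that(2), of n N] est[OF i that(2), of "Suc n" N] that(1) by (simp_all add: \<B>_def Y_def)
    qed (use K S0 in \<open>auto simp: Y_def\<close>)
    also have "\<dots> = L * q ^ n"
    proof -
      have "((1/2 :: real) ^ Suc n) powr (s - 2) = (1/2) powr (s - 2) * ((1/2) ^ n) powr (s - 2)"
        by (simp only: half_power_powr) (simp only: power_Suc)
      moreover have "((1/2 :: real) ^ n) powr (s - 2) * ((1/2) ^ n) powr ((s - 1) / 2) = q ^ n"
        unfolding q_def half_power_powr[symmetric] powr_add[symmetric] by (rule arg_cong[where f = "(powr) _"]) (simp add: field_simps)
      ultimately show ?thesis by (simp add: S_def Y_def L_def power3_eq_cube mult_ac)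
    qed
    finally show ?thesis .
  qed
  have lipF: "\<exists>L\<ge>0. \<forall>N\<ge>n. \<forall>r\<in>{\<alpha>..\<beta>}. \<forall>r'\<in>{\<alpha>..\<beta>}. \<bar>Fn N n r - Fn N n r'\<bar> \<le> L * \<bar>r - r'\<bar>" for n
  proof -
    define \<delta> where "\<delta> = (1/2 :: real) ^ n"
    have \<delta>: "\<delta> > 0" by (simp add: \<delta>_def)
    define M where "M = 3 * (W / \<delta>)\<^sup>2 * Henstock_Kurzweil_Integration.content \<B> * (W * \<Lambda> / \<delta>\<^sup>2)"
    have M0: "M \<ge> 0" unfolding M_def using W \<Lambda> by (intro mult_nonneg_nonneg) auto
    have "\<bar>Fn N n r - Fn N n r'\<bar> \<le> M * \<bar>r - r'\<bar>" if r: "r \<in> {\<alpha>..\<beta>}" "r' \<in> {\<alpha>..\<beta>}" for N r r'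
    proof -
      have "\<bar>Fn N n r - Fn N n r'\<bar> \<le> 3 * (W / \<delta>)\<^sup>2 * Henstock_Kurzweil_Integration.content (cbox (A', J1) (B', J2)) * (W * (\<Lambda> * \<bar>r - r'\<bar>) / \<delta>\<^sup>2)"
        unfolding Fn_def \<B>_def
      proof (rule triple_product_sup_close)
        fix i :: nat assume i: "i < 3"
        show "continuous_on (cbox (A', J1) (B', J2)) (u i N n r)" "continuous_on (cbox (A', J1) (B', J2)) (u i N n r')"
          using cu[OF i r(1)] cu[OF i r(2)] by (simp_all add: \<B>_def)
        fix z :: "real \<times> real" assume z: "z \<in> cbox (A', J1) (B', J2)"
        show "\<bar>u i N n r z\<bar> \<le> W / \<delta>" "\<bar>u i N n r' z\<bar> \<le> W / \<delta>"
          unfolding u_def \<delta>_def by (intro tube_le_total pw w0 cW i; assumption)+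
        show "\<bar>u i N n r z - u i N n r' z\<bar> \<le> W * (\<Lambda> * \<bar>r - r'\<bar>) / \<delta>\<^sup>2"
          unfolding u_def \<delta>_def
        proof (rule tube_lipschitz[OF pw w0[OF i] cW(2)[OF i]])
          fix p assume p: "p \<in> P i N"
          then have "p \<in> F i" using PF[OF i] by blast
          moreover have "fst z \<in> {A'..B'}" using z by (cases z) (simp add: cbox_Pair_eq)
          ultimately show "\<bar>g i r (fst z) p - g i r' (fst z) p\<bar> \<le> \<Lambda> * \<bar>r - r'\<bar>"
            using lip[OF i _ r, of p "fst z" "fst z"] by simp
        qed (use \<Lambda> in auto)
      qed (use W \<delta> \<Lambda> in auto)
      then show ?thesis by (simp add: M_def \<B>_def mult_ac)
    qed
    then show ?thesis using M0 by blast
  qed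
  define c' where "c' = c ^ 3 / (432 * \<Lambda> ^ 3 * (\<beta>' - \<alpha>' + 1))"
  \<comment> \<open>From this scale on the tubes are thinner than the margin \<eta>.\<close>
  obtain n0 where n0: "(1/2 :: real) ^ n0 < \<eta>" using real_arch_pow_inv[OF \<eta>, of "1/2"] by auto
  have small: "(1/2 :: real) ^ N \<le> \<eta>" if "n0 \<le> N" for N
    by (rule order_trans[OF power_decreasing[OF that] less_imp_le[OF n0]]) auto
  have pos: "\<exists>r\<in>{\<alpha>'..\<beta>'}. c' \<le> Fn N N r" if "n0 \<le> N" for N
    unfolding c'_def Fn_def u_def \<B>_def
  proof (rule triple_tube_mass[where \<eta> = \<eta> and \<kappa> = \<kappa> and x = x and A = A and B = B and P = "\<lambda>i. P i N" and w = "\<lambda>i. w i N"])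
    fix i :: nat assume i: "i < 3"
    show "finite (P i N)" using sp[OF i] by (simp add: spread_def)
    show "0 \<le> w i N p" if "p \<in> P i N" for p by (rule w0[OF i that])
    show "transversal A B \<kappa> \<Lambda> (P i N) x (g i r)" if "r \<in> {\<alpha>'..\<beta>'}" for r using tr'[OF i, of r] that ab by simp
    show "\<bar>g i r a p - g i r' a' p\<bar> \<le> \<Lambda> * (\<bar>r - r'\<bar> + \<bar>a - a'\<bar>)"
      if "p \<in> P i N" "r \<in> {\<alpha>'..\<beta>'}" "r' \<in> {\<alpha>'..\<beta>'}" "a \<in> {A'..B'}" "a' \<in> {A'..B'}" for p r r' a a'
    proof -
      have "p \<in> F i" using that(1) PF[OF i] by blast
      then show ?thesis using lip[OF i, of p r r' a a'] that ab by simp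
    qed
  next
    fix p :: "nat \<Rightarrow> 'p" assume p: "\<And>i. i < 3 \<Longrightarrow> p i \<in> P i N"
    show "\<exists>r a b. r \<in> {\<alpha>'..\<beta>'} \<and> a \<in> {A' + \<eta>..B' - \<eta>} \<and> b \<in> {J1 + \<eta>..J2 - \<eta>} \<and> (\<forall>i<3. y (p i) = g i r a (p i) + b)"
    proof (rule sol)
      fix i :: nat assume "i < 3"
      then show "p i \<in> F i" using p[of i] PF[of i N] by blast
    qed
  qed (use AB \<Lambda> c cW small[OF that] in \<open>auto simp: power_le_one\<close>)
  obtain r0 where "r0 \<in> {\<alpha>'..\<beta>'}" "c' \<le> Fn n0 n0 r0" using pos[of n0] by blast
  then have c': "c' > 0" using c \<Lambda> by (auto simp: c'_def)
  have L0: "L \<ge> 0" using K by (simp add: L_def)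
  obtain t1 t2 where t: "t1 < t2" "{t1<..<t2} \<subseteq> {\<alpha>..\<beta>}" "\<forall>r\<in>{t1<..<t2}. \<exists>\<^sub>\<infinity>N. Fn N N r > 0"
    using multiscale_positive_interval[where F = Fn and n\<^sub>0 = n0 and \<alpha> = \<alpha> and \<beta> = \<beta> and q = q and K = L, OF q L0 step lipF pos c' ab]
    by blast
  have hit: "\<exists>z\<in>cbox (A', J1) (B', J2). \<forall>i<3. \<exists>p\<in>F i. \<bar>y p - g i r (fst z) p - snd z\<bar> \<le> (1/2) ^ N" if "Fn N N r > 0" for N r
  proof -
    have "\<exists>z\<in>\<B>. u 0 N N r z * u 1 N N r z * u 2 N N r z \<noteq> 0"
    proof (rule ccontr)
      assume "\<not> ?thesis"
      then have "Fn N N r = integral \<B> (\<lambda>z. 0)" unfolding Fn_def by (intro integral_cong) auto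
      then show False using that by simp
    qed
    then obtain z where z: "z \<in> \<B>" "u 0 N N r z * u 1 N N r z * u 2 N N r z \<noteq> 0" by blast
    have "\<exists>p\<in>F i. \<bar>y p - g i r (fst z) p - snd z\<bar> \<le> (1/2) ^ N" if i: "i < 3" for i
    proof -
      have "i = 0 \<or> i = 1 \<or> i = 2" using i by linarith
      then have "u i N N r z \<noteq> 0" using z(2) by auto
      then have "\<exists>p\<in>P i N. \<bar>y p - g i r (fst z) p - snd z\<bar> \<le> (1/2) ^ N"
        unfolding u_def by (rule tube_pos_obtains[OF pw])
      then show ?thesis using PF[OF i, of N] by blast
    qed
    then show ?thesis using z(1) unfolding \<B>_def by blast
  qed
  have "\<exists>\<^sub>\<infinity>N. \<exists>z\<in>cbox (A', J1) (B', J2). \<forall>i<3. \<exists>p\<in>F i. \<bar>y p - g i r (fst z) p - snd z\<bar> \<le> (1/2) ^ N"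
    if "r \<in> {t1<..<t2}" for r
    by (rule INFM_mono[OF t(3)[rule_format, OF that]]) (rule hit)
  then show ?thesis using t(1,2) by (intro exI[of _ t1] exI[of _ t2] conjI ballI)
qed

section \<open>Circles through three points\<close>

definition frostman_weights :: "(real^2) set \<Rightarrow> (real^2 \<Rightarrow> real) \<Rightarrow> real \<Rightarrow> real \<Rightarrow> nat \<Rightarrow> bool" where
  "frostman_weights P w s C N \<longleftrightarrow> finite P \<and> (\<forall>p. 0 \<le> w p) \<and>
     (\<forall>T \<rho>. T \<subseteq> P \<longrightarrow> (1/2) ^ N \<le> \<rho> \<longrightarrow> (\<forall>p\<in>T. \<forall>q\<in>T. dist p q \<le> \<rho>) \<longrightarrow> sum w T \<le> C * \<rho> powr s)"

lemma frostman_sequence: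
  assumes s: "s > 0" and nn: "\<not> hnull s F" and F: "F \<subseteq> cball x\<^sub>0 (1/2)"
  obtains c C P w where "c > 0" "C > 0" "\<And>N. P N \<subseteq> F" "\<And>N. frostman_weights (P N) (w N) s C N"
    "\<And>N. c \<le> sum (w N) (P N)" "\<And>N. sum (w N) (P N) \<le> C"
proof -
  obtain c C where c: "c > 0" "C > 0" and ex:
    "\<And>N :: nat. \<exists>P w. finite P \<and> P \<subseteq> F \<and> (\<forall>p. 0 \<le> w p) \<and> c \<le> sum w P \<and>
       (\<forall>T \<rho>. T \<subseteq> P \<longrightarrow> (1/2) ^ N \<le> \<rho> \<longrightarrow> (\<forall>p\<in>T. \<forall>q\<in>T. dist p q \<le> \<rho>) \<longrightarrow> sum w T \<le> C * \<rho> powr s)"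
  proof (rule discrete_frostman[OF assms], goal_cases)
    case (1 c C)
    show ?case using 1(2-4) by (rule 1(1))
  qed
  have "\<forall>N. \<exists>Pw. fst Pw \<subseteq> F \<and> frostman_weights (fst Pw) (snd Pw) s C N \<and> c \<le> sum (snd Pw) (fst Pw)"
  proof
    fix N
    obtain P w where "finite P \<and> P \<subseteq> F \<and> (\<forall>p. 0 \<le> w p) \<and> c \<le> sum w P \<and>
       (\<forall>T \<rho>. T \<subseteq> P \<longrightarrow> (1/2) ^ N \<le> \<rho> \<longrightarrow> (\<forall>p\<in>T. \<forall>q\<in>T. dist p q \<le> \<rho>) \<longrightarrow> sum w T \<le> C * \<rho> powr s)"
      using ex[of N] by (elim exE) (rule that)
    then have "fst (P, w) \<subseteq> F \<and> frostman_weights (fst (P, w)) (snd (P, w)) s C N \<and> c \<le> sum (snd (P, w)) (fst (P, w))"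
      unfolding frostman_weights_def fst_conv snd_conv by blast
    then show "\<exists>Pw. fst Pw \<subseteq> F \<and> frostman_weights (fst Pw) (snd Pw) s C N \<and> c \<le> sum (snd Pw) (fst Pw)"
      by (rule exI)
  qed
  then have "\<exists>Pw. \<forall>N. fst (Pw N) \<subseteq> F \<and> frostman_weights (fst (Pw N)) (snd (Pw N)) s C N \<and> c \<le> sum (snd (Pw N)) (fst (Pw N))"
    by (rule choice)
  then obtain Pw where Pw: "\<forall>N. fst (Pw N) \<subseteq> F \<and> frostman_weights (fst (Pw N)) (snd (Pw N)) s C N \<and> c \<le> sum (snd (Pw N)) (fst (Pw N))" ..
  have "sum (snd (Pw N)) (fst (Pw N)) \<le> C" for N
  proof -
    \<comment> \<open>The ball condition applied to the whole support, whose diameter is at most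
      1.\<close>
    have "sum (snd (Pw N)) (fst (Pw N)) \<le> C * 1 powr s"
    proof -
      have d: "dist p q \<le> 1" if "p \<in> fst (Pw N)" "q \<in> fst (Pw N)" for p q
      proof -
        have "p \<in> cball x\<^sub>0 (1/2)" "q \<in> cball x\<^sub>0 (1/2)" using that Pw F by blast+
        then show ?thesis using dist_triangle[of p q x\<^sub>0] by (simp add: dist_commute)
      qed
      have "frostman_weights (fst (Pw N)) (snd (Pw N)) s C N" using Pw by blast
      then have FR: "\<forall>T \<rho>. T \<subseteq> fst (Pw N) \<longrightarrow> (1/2) ^ N \<le> \<rho> \<longrightarrow> (\<forall>p\<in>T. \<forall>q\<in>T. dist p q \<le> \<rho>) \<longrightarrow> sum (snd (Pw N)) T \<le> C * \<rho> powr s"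
        unfolding frostman_weights_def by (elim conjE)
      show ?thesis by (rule FR[rule_format]) (use d in \<open>auto simp: power_le_one\<close>)
    qed
    then show ?thesis by simp
  qed
  then show ?thesis using Pw c by (intro that[of c C "\<lambda>N. fst (Pw N)" "\<lambda>N. snd (Pw N)"]) simp_all
qed

text \<open>Of the coordinates only a Lipschitz inverse is asked: a coordinate square of half-side
  \<rho> then has Euclidean diameter at most \<open>2 * L * \<rho>\<close>.\<close>

lemma spread_of_frostman_weights:
  assumes fw: "frostman_weights P w s C N" and L: "L \<ge> 1" and C: "C \<ge> 0"
    and d: "\<And>p q. p \<in> P \<Longrightarrow> q \<in> P \<Longrightarrow> dist p q \<le> L * max \<bar>x p - x q\<bar> \<bar>y p - y q\<bar>"
  shows "spread P w x y s (C * (2 * L) powr s) ((1/2) ^ N)"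
  unfolding spread_def
proof (intro conjI allI impI ballI)
  show "finite P" using fw by (simp add: frostman_weights_def)
  show "0 \<le> w p" for p using fw by (simp add: frostman_weights_def)
  fix \<alpha> \<beta> \<rho> :: real assume \<rho>: "(1/2) ^ N \<le> \<rho>"
  have "0 < (1/2 :: real) ^ N" by simp
  then have \<rho>0: "\<rho> > 0" using \<rho> by linarith
  have "1 * \<rho> \<le> 2 * L * \<rho>" using L \<rho>0 by (intro mult_right_mono) auto
  then have N: "(1/2) ^ N \<le> 2 * L * \<rho>" using \<rho> by linarith
  define T where "T = {p\<in>P. \<bar>x p - \<alpha>\<bar> \<le> \<rho> \<and> \<bar>y p - \<beta>\<bar> \<le> \<rho>}"
  have "dist p q \<le> 2 * L * \<rho>" if "p \<in> T" "q \<in> T" for p q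
  proof -
    have "\<bar>x p - x q\<bar> \<le> 2 * \<rho>" "\<bar>y p - y q\<bar> \<le> 2 * \<rho>" using that unfolding T_def by auto
    then have "L * max \<bar>x p - x q\<bar> \<bar>y p - y q\<bar> \<le> L * (2 * \<rho>)" using L by (intro mult_left_mono) auto
    moreover have "p \<in> P" "q \<in> P" using that by (auto simp: T_def)
    ultimately show ?thesis using d[of p q] by simp
  qed
  moreover have "T \<subseteq> P" by (auto simp: T_def)
  ultimately have "sum w T \<le> C * (2 * L * \<rho>) powr s" using fw N unfolding frostman_weights_def by simp
  also have "\<dots> = C * (2 * L) powr s * \<rho> powr s" using L \<rho>0 by (simp add: powr_mult)
  finally show "sum w {p\<in>P. \<bar>x p - \<alpha>\<bar> \<le> \<rho> \<and> \<bar>y p - \<beta>\<bar> \<le> \<rho>} \<le> C * (2 * L) powr s * \<rho> powr s" unfolding T_def .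
qed

section \<open>Circular arcs as transversal graphs\<close>

lemma abs_MVT:
  fixes f :: "real \<Rightarrow> real"
  assumes "\<And>z. z \<in> {min t t'..max t t'} \<Longrightarrow> (f has_real_derivative f' z) (at z)"
  shows "\<exists>z\<in>{min t t'..max t t'}. \<bar>f t - f t'\<bar> = \<bar>f' z\<bar> * \<bar>t - t'\<bar>"
proof (cases t t' rule: linorder_cases)
  case less
  then obtain z where z: "t < z" "z < t'" "f t' - f t = (t' - t) * f' z" using MVT2[of t t' f f'] assms by auto
  have "\<bar>f t - f t'\<bar> = \<bar>f t' - f t\<bar>" by simp
  also have "\<dots> = \<bar>f' z\<bar> * \<bar>t - t'\<bar>" unfolding z(3) by (simp add: abs_mult abs_minus_commute[of t'])
  finally show ?thesis using z by (intro bexI[of _ z]) auto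
next
  case greater
  then obtain z where z: "t' < z" "z < t" "f t - f t' = (t - t') * f' z" using MVT2[of t' t f f'] assms by auto
  have "\<bar>f t - f t'\<bar> = \<bar>f' z\<bar> * \<bar>t - t'\<bar>" unfolding z(3) by (simp add: abs_mult)
  then show ?thesis using z by (intro bexI[of _ z]) auto
qed auto

text \<open>For equal radii the dual curves are translates of one arc, and its curvature makes their
  slopes differ: the slope \<open>t / S t\<close> has derivative \<open>r\<^sup>2 / S t ^ 3\<close>,
  which is at least 1/r because \<open>S t \<le> r\<close>. The bound \<open>m\<close> keeps away
  from the vertical tangents.\<close>

lemma circle_arc_transversal:
  fixes x :: "'p \<Rightarrow> real"
  assumes m: "0 < m" and r: "0 < r" "r \<le> R" and \<sigma>: "\<bar>\<sigma>\<bar> = 1"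
    and D: "\<And>a p. a \<in> {A..B} \<Longrightarrow> p \<in> F \<Longrightarrow> m\<^sup>2 \<le> r\<^sup>2 - (x p - a)\<^sup>2"
    and \<Lambda>: "R / m \<le> \<Lambda>" "3 * R ^ 3 / m ^ 5 \<le> \<Lambda>"
  shows "transversal A B (1 / R) \<Lambda> F x (\<lambda>a p. \<sigma> * sqrt (r\<^sup>2 - (x p - a)\<^sup>2))"
proof -
  define S where "S t = sqrt (r\<^sup>2 - t\<^sup>2)" for t
  have S: "m \<le> S t" "S t \<le> r" "S t > 0" "\<bar>t\<bar> \<le> r" if "m\<^sup>2 \<le> r\<^sup>2 - t\<^sup>2" for t
  proof -
    have "sqrt (m\<^sup>2) \<le> S t" unfolding S_def by (rule real_sqrt_le_mono[OF that])
    then show "m \<le> S t" "S t > 0" using m by auto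
    have "S t \<le> sqrt (r\<^sup>2)" unfolding S_def by (rule real_sqrt_le_mono) simp
    then show "S t \<le> r" using r by simp
    have "t\<^sup>2 \<le> r\<^sup>2" using that zero_le_power2[of m] by linarith
    then have "\<bar>t\<bar> \<le> \<bar>r\<bar>" by (simp only: abs_le_square_iff)
    then show "\<bar>t\<bar> \<le> r" using r by simp
  qed
  have dS: "(S has_real_derivative - t / S t) (at t)" if "m\<^sup>2 \<le> r\<^sup>2 - t\<^sup>2" for t
  proof -
    have "0 < m\<^sup>2" using m by simp
    then have "0 < r\<^sup>2 - t\<^sup>2" using that by linarith
    then show ?thesis unfolding S_def[abs_def] 
      by (auto intro!: derivative_eq_intros simp: field_simps)
  qed
  define h where "h t = t / S t" for t
  define h1 where "h1 t = r\<^sup>2 / S t ^ 3" for t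
  define h2 where "h2 t = 3 * r\<^sup>2 * t / S t ^ 5" for t
  have S2: "(S t)\<^sup>2 = r\<^sup>2 - t\<^sup>2" if "m\<^sup>2 \<le> r\<^sup>2 - t\<^sup>2" for t
    unfolding S_def using that by (intro real_sqrt_pow2) (meson order_trans zero_le_power2)
  have dh: "(h has_real_derivative h1 t) (at t)" if t: "m\<^sup>2 \<le> r\<^sup>2 - t\<^sup>2" for t
  proof -
    have "(h has_real_derivative (1 * S t - t * (- t / S t)) / (S t * S t)) (at t)"
      unfolding h_def[abs_def] using S[OF t] by (intro DERIV_divide DERIV_ident dS t) auto
    moreover have "(1 * S t - t * (- t / S t)) / (S t * S t) = ((S t)\<^sup>2 + t\<^sup>2) / S t ^ 3"
      using S[OF t] by (simp add: field_simps power2_eq_square power3_eq_cube)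
    ultimately show ?thesis by (simp add: h1_def S2[OF t])
  qed
  have dh1: "(h1 has_real_derivative h2 t) (at t)" if t: "m\<^sup>2 \<le> r\<^sup>2 - t\<^sup>2" for t
  proof -
    have "((\<lambda>t. S t ^ 3) has_real_derivative of_nat 3 * (- t / S t * S t ^ (3 - Suc 0))) (at t)"
      by (rule DERIV_power[OF dS[OF t]])
    then have "(h1 has_real_derivative (0 * S t ^ 3 - r\<^sup>2 * (of_nat 3 * (- t / S t * S t ^ (3 - Suc 0)))) / (S t ^ 3 * S t ^ 3)) (at t)"
      unfolding h1_def[abs_def] using S[OF t] by (intro DERIV_divide DERIV_const) auto
    moreover have "(0 * S t ^ 3 - r\<^sup>2 * (of_nat 3 * (- t / S t * S t ^ (3 - Suc 0)))) / (S t ^ 3 * S t ^ 3) = h2 t"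
      unfolding h2_def using S[OF t] by (simp add: field_simps eval_nat_numeral)
    ultimately show ?thesis by simp
  qed
  have seg: "m\<^sup>2 \<le> r\<^sup>2 - z\<^sup>2" if "m\<^sup>2 \<le> r\<^sup>2 - t\<^sup>2" "m\<^sup>2 \<le> r\<^sup>2 - t'\<^sup>2" "z \<in> {min t t'..max t t'}" for z t t'
  proof -
    have "\<bar>z\<bar> \<le> \<bar>t\<bar> \<or> \<bar>z\<bar> \<le> \<bar>t'\<bar>" using that(3) by auto
    then have "z\<^sup>2 \<le> t\<^sup>2 \<or> z\<^sup>2 \<le> t'\<^sup>2" by (simp add: abs_le_square_iff)
    then show ?thesis using that by linarith
  qed
  have b1: "\<bar>S t - S t'\<bar> \<le> \<Lambda> * \<bar>t - t'\<bar>" if tt: "m\<^sup>2 \<le> r\<^sup>2 - t\<^sup>2" "m\<^sup>2 \<le> r\<^sup>2 - t'\<^sup>2" for t t'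
  proof -
    obtain z where z: "z \<in> {min t t'..max t t'}" "\<bar>S t - S t'\<bar> = \<bar>- z / S z\<bar> * \<bar>t - t'\<bar>"
      using abs_MVT[of t t' S "\<lambda>z. - z / S z"] dS[OF seg[OF tt]] by blast
    note zz = seg[OF tt z(1)]
    have "\<bar>- z / S z\<bar> \<le> R / m" unfolding abs_divide using S[OF zz] m r by (intro frac_le) auto
    then have "\<bar>- z / S z\<bar> \<le> \<Lambda>" using \<Lambda> by linarith
    then show ?thesis unfolding z(2) by (rule mult_right_mono) simp
  qed
  have b2: "1 / R * \<bar>t - t'\<bar> \<le> \<bar>h t - h t'\<bar>" if tt: "m\<^sup>2 \<le> r\<^sup>2 - t\<^sup>2" "m\<^sup>2 \<le> r\<^sup>2 - t'\<^sup>2" for t t'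
  proof -
    obtain z where z: "z \<in> {min t t'..max t t'}" "\<bar>h t - h t'\<bar> = \<bar>h1 z\<bar> * \<bar>t - t'\<bar>"
      using abs_MVT[of t t' h h1] dh[OF seg[OF tt]] by blast
    note zz = seg[OF tt z(1)]
    have "S z ^ 3 \<le> r ^ 3" using S[OF zz] by (intro power_mono) auto
    then have "r\<^sup>2 / r ^ 3 \<le> h1 z" unfolding h1_def using S[OF zz] r by (intro divide_left_mono) auto
    moreover have "r\<^sup>2 / r ^ 3 = 1 / r" using r by (simp add: power2_eq_square power3_eq_cube)
    moreover have "1 / R \<le> 1 / r" using r by (intro divide_left_mono) auto
    ultimately have "1 / R \<le> \<bar>h1 z\<bar>" by linarith
    then show ?thesis unfolding z(2) by (rule mult_right_mono) simp
  qed
  have b3: "\<bar>h1 t - h1 t'\<bar> \<le> \<Lambda> * \<bar>t - t'\<bar>" if tt: "m\<^sup>2 \<le> r\<^sup>2 - t\<^sup>2" "m\<^sup>2 \<le> r\<^sup>2 - t'\<^sup>2" for t t'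
  proof -
    obtain z where z: "z \<in> {min t t'..max t t'}" "\<bar>h1 t - h1 t'\<bar> = \<bar>h2 z\<bar> * \<bar>t - t'\<bar>"
      using abs_MVT[of t t' h1 h2] dh1[OF seg[OF tt]] by blast
    note zz = seg[OF tt z(1)]
    have "\<bar>3 * r\<^sup>2 * z\<bar> \<le> 3 * R\<^sup>2 * R" unfolding abs_mult using S[OF zz] r by (intro mult_mono) auto
    then have "\<bar>h2 z\<bar> \<le> (3 * R\<^sup>2 * R) / m ^ 5"
      unfolding h2_def abs_divide power_abs[symmetric] using S[OF zz] m r by (intro frac_le power_mono) auto
    also have "3 * R\<^sup>2 * R = 3 * R ^ 3" by (simp add: power2_eq_square power3_eq_cube)
    finally have "\<bar>h2 z\<bar> \<le> \<Lambda>" using \<Lambda>(2) by (rule order_trans)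
    then show ?thesis unfolding z(2) by (rule mult_right_mono) simp
  qed
  show ?thesis unfolding transversal_def
  proof (rule exI[of _ "\<lambda>a p. \<sigma> * h (x p - a)"], rule exI[of _ "\<lambda>a p. \<sigma> * - h1 (x p - a)"], intro conjI ballI)
    fix a p assume ap: "a \<in> {A..B}" "p \<in> F"
    note t = D[OF ap]
    have i: "((\<lambda>a. x p - a) has_real_derivative - 1) (at a)" by (auto intro!: derivative_eq_intros)
    have "((\<lambda>a. S (x p - a)) has_real_derivative (- (x p - a) / S (x p - a)) * - 1) (at a)"
      by (rule DERIV_chain2[OF dS[OF t] i])
    moreover have "(- (x p - a) / S (x p - a)) * - 1 = h (x p - a)" by (simp add: h_def minus_divide_left)
    ultimately have "((\<lambda>a. S (x p - a)) has_real_derivative h (x p - a)) (at a)" by (simp only:)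
    then show "((\<lambda>a. \<sigma> * sqrt (r\<^sup>2 - (x p - a)\<^sup>2)) has_real_derivative \<sigma> * h (x p - a)) (at a)"
      unfolding S_def[symmetric] by (rule DERIV_cmult)
    have "((\<lambda>a. h (x p - a)) has_real_derivative h1 (x p - a) * - 1) (at a)"
      by (rule DERIV_chain2[OF dh[OF t] i])
    then show "((\<lambda>a. \<sigma> * h (x p - a)) has_real_derivative \<sigma> * - h1 (x p - a)) (at a)"
      by (intro DERIV_cmult) simp
    fix q assume q: "q \<in> F"
    note t' = D[OF ap(1) q]
    have e: "\<bar>(x p - a) - (x q - a)\<bar> = \<bar>x p - x q\<bar>" by simp
    have f: "\<bar>\<sigma> * u - \<sigma> * v\<bar> = \<bar>u - v\<bar>" for u v using \<sigma> by (simp add: abs_mult flip: right_diff_distrib)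
    show "\<bar>\<sigma> * sqrt (r\<^sup>2 - (x p - a)\<^sup>2) - \<sigma> * sqrt (r\<^sup>2 - (x q - a)\<^sup>2)\<bar> \<le> \<Lambda> * \<bar>x p - x q\<bar>"
      unfolding f S_def[symmetric] using b1[OF t t'] by (simp only: e)
    show "1 / R * \<bar>x p - x q\<bar> \<le> \<bar>\<sigma> * h (x p - a) - \<sigma> * h (x q - a)\<bar>"
      unfolding f using b2[OF t t'] by (simp only: e)
    show "\<bar>\<sigma> * - h1 (x p - a) - \<sigma> * - h1 (x q - a)\<bar> \<le> \<Lambda> * \<bar>x p - x q\<bar>"
      unfolding f using b3[OF t t'] by (simp add: abs_minus_commute)
  qed
qed

text \<open>The difference of the two roots is the difference of their squares divided by their sum,
  which is at least \<open>2 * m\<close>; the squares depend polynomially on radius and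
  centre.\<close>

lemma circle_arc_lipschitz:
  assumes m: "0 < m" and X: "m\<^sup>2 \<le> r\<^sup>2 - (x - a)\<^sup>2" and X': "m\<^sup>2 \<le> r'\<^sup>2 - (x - a')\<^sup>2"
    and r: "0 < r" "r \<le> R" "0 < r'" "r' \<le> R" and \<sigma>: "\<bar>\<sigma>\<bar> = 1" and \<Lambda>: "R / m \<le> \<Lambda>"
  shows "\<bar>\<sigma> * sqrt (r\<^sup>2 - (x - a)\<^sup>2) - \<sigma> * sqrt (r'\<^sup>2 - (x - a')\<^sup>2)\<bar> \<le> \<Lambda> * (\<bar>r - r'\<bar> + \<bar>a - a'\<bar>)"
proof -
  define u v where "u = sqrt (r\<^sup>2 - (x - a)\<^sup>2)" and "v = sqrt (r'\<^sup>2 - (x - a')\<^sup>2)"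
  have "0 < m\<^sup>2" using m by simp
  have uv: "m \<le> u" "m \<le> v" "u\<^sup>2 = r\<^sup>2 - (x - a)\<^sup>2" "v\<^sup>2 = r'\<^sup>2 - (x - a')\<^sup>2"
  proof -
    have nn: "0 \<le> r\<^sup>2 - (x - a)\<^sup>2" "0 \<le> r'\<^sup>2 - (x - a')\<^sup>2" using X X' \<open>0 < m\<^sup>2\<close> by linarith+
    show "m \<le> u" "m \<le> v" using real_sqrt_le_mono[OF X] real_sqrt_le_mono[OF X'] m by (simp_all add: u_def v_def)
    show "u\<^sup>2 = r\<^sup>2 - (x - a)\<^sup>2" "v\<^sup>2 = r'\<^sup>2 - (x - a')\<^sup>2" unfolding u_def v_def using nn by (simp_all only: real_sqrt_pow2)
  qed
  have ax: "\<bar>x - a\<bar> \<le> R" "\<bar>x - a'\<bar> \<le> R"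
  proof -
    have "(x - a)\<^sup>2 \<le> r\<^sup>2" "(x - a')\<^sup>2 \<le> r'\<^sup>2" using X X' \<open>0 < m\<^sup>2\<close> by linarith+
    then have "\<bar>x - a\<bar> \<le> \<bar>r\<bar>" "\<bar>x - a'\<bar> \<le> \<bar>r'\<bar>" by (simp_all add: abs_le_square_iff)
    then show "\<bar>x - a\<bar> \<le> R" "\<bar>x - a'\<bar> \<le> R" using r by linarith+
  qed
  have "2 * m * \<bar>u - v\<bar> \<le> \<bar>u + v\<bar> * \<bar>u - v\<bar>" using uv m by (intro mult_right_mono) auto
  also have "\<dots> = \<bar>u\<^sup>2 - v\<^sup>2\<bar>" by (simp add: power2_eq_square algebra_simps flip: abs_mult)
  also have "u\<^sup>2 - v\<^sup>2 = (r - r') * (r + r') + (a - a') * ((x - a) + (x - a'))"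
    unfolding uv by (simp add: power2_eq_square algebra_simps)
  also have "\<bar>\<dots>\<bar> \<le> \<bar>r - r'\<bar> * \<bar>r + r'\<bar> + \<bar>a - a'\<bar> * \<bar>(x - a) + (x - a')\<bar>"
    unfolding abs_mult[symmetric] by (rule abs_triangle_ineq)
  also have "\<dots> \<le> \<bar>r - r'\<bar> * (2 * R) + \<bar>a - a'\<bar> * (2 * R)"
    using r ax by (intro add_mono mult_left_mono) auto
  finally have "m * \<bar>u - v\<bar> \<le> R * (\<bar>r - r'\<bar> + \<bar>a - a'\<bar>)" by (simp add: algebra_simps)
  then have "\<bar>u - v\<bar> \<le> R / m * (\<bar>r - r'\<bar> + \<bar>a - a'\<bar>)" using m by (simp add: field_simps)
  also have "\<dots> \<le> \<Lambda> * (\<bar>r - r'\<bar> + \<bar>a - a'\<bar>)" using \<Lambda> by (intro mult_right_mono) auto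
  finally show ?thesis using \<sigma> unfolding u_def[symmetric] v_def[symmetric] right_diff_distrib[symmetric] abs_mult by simp
qed

section \<open>Circumcentres and their stability\<close>

lemma collinear_real2_iff:
  fixes x y z :: "real^2"
  shows "collinear {x, y, z} \<longleftrightarrow> (y $ 1 - x $ 1) * (z $ 2 - x $ 2) = (z $ 1 - x $ 1) * (y $ 2 - x $ 2)"
proof -
  define u v where "u = y - x" and "v = z - x"
  have "collinear {x, y, z} \<longleftrightarrow> collinear {0, u, v}"
    using collinear_3[of y x z] by (simp add: u_def v_def insert_commute)
  also have "\<dots> \<longleftrightarrow> u = 0 \<or> v = 0 \<or> (\<exists>c. v = c *\<^sub>R u)" by (rule collinear_lemma)
  also have "\<dots> \<longleftrightarrow> u $ 1 * v $ 2 = v $ 1 * u $ 2"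
  proof
    assume "u = 0 \<or> v = 0 \<or> (\<exists>c. v = c *\<^sub>R u)"
    then show "u $ 1 * v $ 2 = v $ 1 * u $ 2" by auto
  next
    assume e: "u $ 1 * v $ 2 = v $ 1 * u $ 2"
    show "u = 0 \<or> v = 0 \<or> (\<exists>c. v = c *\<^sub>R u)"
    proof (cases "u = 0")
      case False
      then consider "u $ 1 \<noteq> 0" | "u $ 2 \<noteq> 0" by (auto simp: vec_eq_iff forall_2)
      then show ?thesis
      proof cases
        case 1
        then have "v = (v $ 1 / u $ 1) *\<^sub>R u" using e by (simp add: vec_eq_iff forall_2 field_simps)
        then show ?thesis by blast
      next
        case 2
        then have "v = (v $ 2 / u $ 2) *\<^sub>R u" using e by (simp add: vec_eq_iff forall_2 field_simps)
        then show ?thesis by blast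
      qed
    qed simp
  qed
  finally show ?thesis by (simp add: u_def v_def)
qed

text \<open>On the line through \<open>x\<close> and \<open>y\<close> a point with parameter
  \<open>k\<close> is on the circle only if k = k * k, which leaves just \<open>x\<close> and
  \<open>y\<close>.\<close>

lemma concyclic_not_collinear:
  fixes x y z c :: "real^2"
  assumes "dist c x = r" "dist c y = r" "dist c z = r" "x \<noteq> y" "x \<noteq> z" "y \<noteq> z"
  shows "\<not> collinear {x, y, z}"
proof
  assume "collinear {x, y, z}"
  then have "collinear {0, y - x, z - x}" using collinear_3[of y x z] by (simp add: insert_commute)
  then obtain k where k: "z - x = k *\<^sub>R (y - x)" using assms unfolding collinear_lemma by auto
  define u w where "u = y - x" and "w = c - x"
  have uu: "u \<bullet> u > 0" using assms by (simp add: u_def)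
  have "(norm w)\<^sup>2 = (norm (w - u))\<^sup>2" "(norm w)\<^sup>2 = (norm (w - k *\<^sub>R u))\<^sup>2"
    using assms k by (simp_all add: u_def w_def dist_norm flip: k)
  then have e: "2 * (w \<bullet> u) = u \<bullet> u" "2 * (k * (w \<bullet> u)) = k * (k * (u \<bullet> u))"
    by (simp_all add: power2_norm_eq_inner inner_diff inner_commute)
  then have "k * (u \<bullet> u) = k * (k * (u \<bullet> u))" by (metis mult.left_commute)
  then have "k = 0 \<or> k = 1" using uu by auto
  then show False using k assms by auto
qed

text \<open>Cramer's rule for the equations of two perpendicular bisectors, which become linear once
  the common squares cancel.\<close>

lemma circumcenter_formula:
  fixes x\<^sub>0 y\<^sub>0 x\<^sub>1 y\<^sub>1 x\<^sub>2 y\<^sub>2 :: real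
  defines "d \<equiv> 2 * ((x\<^sub>1 - x\<^sub>0) * (y\<^sub>2 - y\<^sub>0) - (x\<^sub>2 - x\<^sub>0) * (y\<^sub>1 - y\<^sub>0))"
    and "u \<equiv> x\<^sub>1\<^sup>2 + y\<^sub>1\<^sup>2 - x\<^sub>0\<^sup>2 - y\<^sub>0\<^sup>2" and "v \<equiv> x\<^sub>2\<^sup>2 + y\<^sub>2\<^sup>2 - x\<^sub>0\<^sup>2 - y\<^sub>0\<^sup>2"
  assumes d: "d \<noteq> 0"
  defines "a \<equiv> (u * (y\<^sub>2 - y\<^sub>0) - v * (y\<^sub>1 - y\<^sub>0)) / d" and "b \<equiv> ((x\<^sub>1 - x\<^sub>0) * v - (x\<^sub>2 - x\<^sub>0) * u) / d"
  shows "(x\<^sub>1 - a)\<^sup>2 + (y\<^sub>1 - b)\<^sup>2 = (x\<^sub>0 - a)\<^sup>2 + (y\<^sub>0 - b)\<^sup>2"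
    "(x\<^sub>2 - a)\<^sup>2 + (y\<^sub>2 - b)\<^sup>2 = (x\<^sub>0 - a)\<^sup>2 + (y\<^sub>0 - b)\<^sup>2"
proof -
  have ab: "d * a = u * (y\<^sub>2 - y\<^sub>0) - v * (y\<^sub>1 - y\<^sub>0)" "d * b = (x\<^sub>1 - x\<^sub>0) * v - (x\<^sub>2 - x\<^sub>0) * u"
    using d by (simp_all add: a_def b_def)
  have "d * (2 * a * (x\<^sub>1 - x\<^sub>0) + 2 * b * (y\<^sub>1 - y\<^sub>0)) = 2 * (d * a) * (x\<^sub>1 - x\<^sub>0) + 2 * (d * b) * (y\<^sub>1 - y\<^sub>0)"
    by (simp add: algebra_simps)
  also have "\<dots> = d * u" unfolding ab by (simp add: d_def algebra_simps)
  finally have 1: "2 * a * (x\<^sub>1 - x\<^sub>0) + 2 * b * (y\<^sub>1 - y\<^sub>0) = u" using d by simp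
  have "d * (2 * a * (x\<^sub>2 - x\<^sub>0) + 2 * b * (y\<^sub>2 - y\<^sub>0)) = 2 * (d * a) * (x\<^sub>2 - x\<^sub>0) + 2 * (d * b) * (y\<^sub>2 - y\<^sub>0)"
    by (simp add: algebra_simps)
  also have "\<dots> = d * v" unfolding ab by (simp add: d_def algebra_simps)
  finally have 2: "2 * a * (x\<^sub>2 - x\<^sub>0) + 2 * b * (y\<^sub>2 - y\<^sub>0) = v" using d by simp
  show "(x\<^sub>1 - a)\<^sup>2 + (y\<^sub>1 - b)\<^sup>2 = (x\<^sub>0 - a)\<^sup>2 + (y\<^sub>0 - b)\<^sup>2"
    using 1 unfolding u_def power2_eq_square by (simp add: algebra_simps)
  show "(x\<^sub>2 - a)\<^sup>2 + (y\<^sub>2 - b)\<^sup>2 = (x\<^sub>0 - a)\<^sup>2 + (y\<^sub>0 - b)\<^sup>2"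
    using 2 unfolding v_def power2_eq_square by (simp add: algebra_simps)
qed

text \<open>The explicit formula is continuous where its determinant does not vanish, that is, at
  noncollinear triples. Hence all nearby triples have a circumcentre and a radius close to the given
  ones.\<close>

lemma circumcenter_stable:
  fixes z :: "nat \<Rightarrow> real^2"
  assumes nc: "\<not> collinear {z 0, z 1, z 2}"
  obtains c r where "\<And>i. i < 3 \<Longrightarrow> dist c (z i) = r"
    "\<And>\<epsilon>. \<epsilon> > 0 \<Longrightarrow> \<exists>\<rho>>0. \<forall>p :: nat \<Rightarrow> real^2. (\<forall>i<3. dist (p i) (z i) < \<rho>) \<longrightarrow>
       (\<exists>c' r'. dist c' c < \<epsilon> \<and> \<bar>r' - r\<bar> < \<epsilon> \<and> (\<forall>i<3. dist c' (p i) = r'))"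
proof -
  define dd where "dd p = 2 * ((fst (snd p) $ 1 - fst p $ 1) * (snd (snd p) $ 2 - fst p $ 2) - (snd (snd p) $ 1 - fst p $ 1) * (fst (snd p) $ 2 - fst p $ 2))"
    for p :: "(real^2) \<times> (real^2) \<times> (real^2)"
  define uu where "uu p = (fst (snd p) $ 1)\<^sup>2 + (fst (snd p) $ 2)\<^sup>2 - (fst p $ 1)\<^sup>2 - (fst p $ 2)\<^sup>2" for p :: "(real^2) \<times> (real^2) \<times> (real^2)"
  define vv where "vv p = (snd (snd p) $ 1)\<^sup>2 + (snd (snd p) $ 2)\<^sup>2 - (fst p $ 1)\<^sup>2 - (fst p $ 2)\<^sup>2" for p :: "(real^2) \<times> (real^2) \<times> (real^2)"
  define aa where "aa p = (uu p * (snd (snd p) $ 2 - fst p $ 2) - vv p * (fst (snd p) $ 2 - fst p $ 2)) / dd p" for p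
  define bb where "bb p = ((fst (snd p) $ 1 - fst p $ 1) * vv p - (snd (snd p) $ 1 - fst p $ 1) * uu p) / dd p" for p
  define cc where "cc p = (vector [aa p, bb p] :: real^2)" for p
  define rr where "rr p = dist (cc p) (fst p)" for p
  have eqd: "dist (cc p) (fst (snd p)) = rr p" "dist (cc p) (snd (snd p)) = rr p" if "dd p \<noteq> 0" for p
    using circumcenter_formula[of "fst (snd p) $ 1" "fst p $ 1" "snd (snd p) $ 2" "fst p $ 2" "snd (snd p) $ 1" "fst (snd p) $ 2"] that
    by (simp_all add: rr_def cc_def dist_real2 aa_def bb_def dd_def uu_def vv_def power2_commute)
  define Z where "Z = (z 0, z 1, z 2)"
  have dZ: "dd Z \<noteq> 0" using nc unfolding collinear_real2_iff by (simp add: dd_def Z_def)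
  have cd: "isCont dd Z" unfolding dd_def by (intro continuous_intros)
  have cu: "isCont uu Z" "isCont vv Z" unfolding uu_def vv_def by (intro continuous_intros)+
  have ca: "isCont aa Z" "isCont bb Z" unfolding aa_def bb_def by (intro continuous_intros cd cu dZ)+
  \<comment> \<open>A combination of fixed axis vectors, for which the continuity rules are
    available.\<close>
  have cont_v: "cc p = aa p *\<^sub>R axis 1 1 + bb p *\<^sub>R axis 2 1" for p
    by (simp add: cc_def vec_eq_iff forall_2 axis_def)
  have ccc: "isCont cc Z" unfolding cont_v[abs_def] by (intro continuous_intros ca)
  have cr: "isCont rr Z" unfolding rr_def by (intro continuous_intros ccc)
  have i3: "i = 0 \<or> i = 1 \<or> i = 2" if "i < 3" for i :: nat using that by linarith
  show ?thesis
  proof (rule that[of "cc Z" "rr Z"])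
    fix i :: nat assume i: "i < 3"
    show "dist (cc Z) (z i) = rr Z" using i3[OF i] eqd[OF dZ] by (auto simp: Z_def rr_def)
  next
    fix \<epsilon> :: real assume \<epsilon>: "\<epsilon> > 0"
    have e1: "\<forall>\<^sub>F p in nhds Z. dist (cc p) (cc Z) < \<epsilon>" using tendstoD[OF ccc[unfolded isCont_def tendsto_at_iff_tendsto_nhds] \<epsilon>] .
    have e2: "\<forall>\<^sub>F p in nhds Z. dist (rr p) (rr Z) < \<epsilon>" using tendstoD[OF cr[unfolded isCont_def tendsto_at_iff_tendsto_nhds] \<epsilon>] .
    have "\<bar>dd Z\<bar> > 0" using dZ by simp
    then have e3: "\<forall>\<^sub>F p in nhds Z. dist (dd p) (dd Z) < \<bar>dd Z\<bar>" using tendstoD[OF cd[unfolded isCont_def tendsto_at_iff_tendsto_nhds]] by blast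
    have "\<forall>\<^sub>F p in nhds Z. dist (cc p) (cc Z) < \<epsilon> \<and> dist (rr p) (rr Z) < \<epsilon> \<and> dist (dd p) (dd Z) < \<bar>dd Z\<bar>"
      by (intro eventually_conj e1 e2 e3)
    then obtain \<rho> where \<rho>: "\<rho> > 0" "\<And>p. dist p Z < \<rho> \<Longrightarrow> dist (cc p) (cc Z) < \<epsilon> \<and> dist (rr p) (rr Z) < \<epsilon> \<and> dist (dd p) (dd Z) < \<bar>dd Z\<bar>"
      unfolding eventually_nhds_metric by blast
    have "\<exists>c' r'. dist c' (cc Z) < \<epsilon> \<and> \<bar>r' - rr Z\<bar> < \<epsilon> \<and> (\<forall>i<3. dist c' (p i) = r')"
      if p: "\<forall>i<3. dist (p i) (z i) < \<rho> / 3" for p :: "nat \<Rightarrow> real^2"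
    proof -
      define Q where "Q = (p 0, p 1, p 2)"
      have pp: "dist (p 0) (z 0) < \<rho> / 3" "dist (p 1) (z 1) < \<rho> / 3" "dist (p 2) (z 2) < \<rho> / 3" using p by simp_all
      have "dist (p 1, p 2) (z 1, z 2) \<le> dist (p 1) (z 1) + dist (p 2) (z 2)"
        unfolding dist_Pair_Pair by (rule sqrt_sum_squares_le_sum) auto
      moreover have "dist Q Z \<le> dist (p 0) (z 0) + dist (p 1, p 2) (z 1, z 2)"
        unfolding Q_def Z_def dist_Pair_Pair[of "p 0"] by (rule sqrt_sum_squares_le_sum) auto
      ultimately have "dist Q Z < \<rho>" using pp by linarith
      from \<rho>(2)[OF this] have n: "dist (cc Q) (cc Z) < \<epsilon>" "dist (rr Q) (rr Z) < \<epsilon>" "dist (dd Q) (dd Z) < \<bar>dd Z\<bar>" by auto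
      have dQ: "dd Q \<noteq> 0" using n(3) by (auto simp: dist_real_def)
      have "dist (cc Q) (p i) = rr Q" if i: "i < 3" for i
        using i3[OF i] eqd[OF dQ] by (auto simp: Q_def rr_def)
      then show ?thesis using n by (intro exI[of _ "cc Q"] exI[of _ "rr Q"]) (simp add: dist_real_def)
    qed
    then show "\<exists>\<rho>>0. \<forall>p :: nat \<Rightarrow> real^2. (\<forall>i<3. dist (p i) (z i) < \<rho>) \<longrightarrow>
       (\<exists>c' r'. dist c' (cc Z) < \<epsilon> \<and> \<bar>r' - rr Z\<bar> < \<epsilon> \<and> (\<forall>i<3. dist c' (p i) = r'))"
      using \<rho>(1) by (intro exI[of _ "\<rho> / 3"]) simp
  qed
qed

text \<open>After the rotation no point is level with the centre, so each circle is locally a graph over the first axis.\<close>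
lemma ex_rotation_avoiding:
  fixes d :: "nat \<Rightarrow> real^2"
  assumes "\<And>i. i < 3 \<Longrightarrow> d i \<noteq> 0"
  obtains e f :: real where "e\<^sup>2 + f\<^sup>2 = 1" "\<And>i. i < 3 \<Longrightarrow> e * d i $ 2 - f * d i $ 1 \<noteq> 0"
proof -
  \<comment> \<open>Rotations are parametrised by a slope \<open>k\<close>; each of the three
    directions excludes at most one value.\<close>
  have "finite {k :: real. d i $ 2 = k * d i $ 1}" if "i < 3" for i
  proof (cases "d i $ 1 = 0")
    case True
    then have "d i $ 2 \<noteq> 0" using assms[OF that] by (auto simp: vec_eq_iff forall_2)
    then show ?thesis using True by simp
  next
    case False
    then have "{k :: real. d i $ 2 = k * d i $ 1} \<subseteq> {d i $ 2 / d i $ 1}" by (auto simp: field_simps)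
    then show ?thesis by (rule finite_subset) simp
  qed
  then have "finite (\<Union>i\<in>{..<3}. {k :: real. d i $ 2 = k * d i $ 1})" by simp
  then obtain k :: real where k: "k \<notin> (\<Union>i\<in>{..<3}. {k :: real. d i $ 2 = k * d i $ 1})"
    using ex_new_if_finite[OF infinite_UNIV_char_0] by blast
  define l where "l = sqrt (1 + k\<^sup>2)"
  have "0 < 1 + k\<^sup>2" by (simp add: add_pos_nonneg)
  then have l: "l > 0" "l\<^sup>2 = 1 + k\<^sup>2" by (auto simp: l_def)
  show ?thesis
  proof (rule that[of "1 / l" "k / l"])
    have "(1 / l)\<^sup>2 + (k / l)\<^sup>2 = (1 + k\<^sup>2) / l\<^sup>2" by (simp add: power_divide add_divide_distrib)
    then show "(1 / l)\<^sup>2 + (k / l)\<^sup>2 = 1" unfolding l(2)[symmetric] using l(1) by simp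
    fix i :: nat assume i: "i < 3"
    have "d i $ 2 \<noteq> k * d i $ 1" using k i by auto
    moreover have "1 / l * d i $ 2 - k / l * d i $ 1 = (d i $ 2 - k * d i $ 1) / l" by (simp add: diff_divide_distrib)
    ultimately show "1 / l * d i $ 2 - k / l * d i $ 1 \<noteq> 0" using l by simp
  qed
qed

text \<open>A positive minimum would contradict values of order 2^-N for arbitrarily large
  \<open>N\<close>. This turns approximate incidences for infinitely many weights into an exact
  one.\<close>

lemma compact_approximate_zero:
  fixes f :: "'a::topological_space \<Rightarrow> real"
  assumes K: "compact K" and f: "continuous_on K f" and f0: "\<And>x. x \<in> K \<Longrightarrow> 0 \<le> f x"
    and ap: "\<exists>\<^sub>\<infinity>N. \<exists>x\<in>K. f x \<le> c * (1/2) ^ N"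
  shows "\<exists>x\<in>K. f x = 0"
proof -
  have "K \<noteq> {}" using ap by (auto dest!: INFM_EX)
  then obtain x where x: "x \<in> K" "\<And>y. y \<in> K \<Longrightarrow> f x \<le> f y"
    using continuous_attains_inf[OF K _ f] by blast
  have "\<not> f x > 0"
  proof
    assume "f x > 0"
    have "(\<lambda>N. c * (1/2 :: real) ^ N) \<longlonglongrightarrow> c * 0"
      by (intro tendsto_mult tendsto_const LIMSEQ_power_zero) auto
    then have "\<forall>\<^sub>F N in sequentially. c * (1/2) ^ N < f x" using \<open>f x > 0\<close> by (intro order_tendstoD) auto
    then obtain M where M: "\<And>N. M \<le> N \<Longrightarrow> c * (1/2) ^ N < f x" by (auto simp: eventually_sequentially)
    obtain N y where "N > M" "y \<in> K" "f y \<le> c * (1/2) ^ N" using ap unfolding INFM_nat by blast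
    then show False using M[of N] x(2)[of y] by simp
  qed
  then show ?thesis using x(1) f0[OF x(1)] by (intro bexI[of _ x]) auto
qed

lemma abs_le_of_sq_le: "(u::real)\<^sup>2 \<le> v\<^sup>2 \<Longrightarrow> 0 \<le> v \<Longrightarrow> \<bar>u\<bar> \<le> v"
  by (metis abs_le_square_iff abs_of_nonneg)

text \<open>The radicand loses at most \<open>6 * r0 * \<epsilon> + 5 * \<epsilon>\<^sup>2\<close>,
  hence at most \<open>8 * r0 * \<epsilon>\<close>; this is three quarters of
  \<open>m\<^sup>2\<close> by the assumption on \<epsilon>.\<close>

lemma radicand_stable:
  fixes r r0 t t0 \<epsilon> m :: real
  assumes r0: "0 < r0" and \<epsilon>: "0 < \<epsilon>" "\<epsilon> \<le> r0 / 4" "32 * r0 * \<epsilon> \<le> 3 * m\<^sup>2"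
    and t0: "m\<^sup>2 \<le> r0\<^sup>2 - t0\<^sup>2" and r: "\<bar>r - r0\<bar> \<le> \<epsilon>" and t: "\<bar>t - t0\<bar> \<le> 2 * \<epsilon>"
  shows "(m / 2)\<^sup>2 \<le> r\<^sup>2 - t\<^sup>2"
proof -
  have "t0\<^sup>2 \<le> r0\<^sup>2" using t0 zero_le_power2[of m] by linarith
  then have at0: "\<bar>t0\<bar> \<le> r0" using r0 by (intro abs_le_of_sq_le) auto
  have "(r\<^sup>2 - t\<^sup>2) - (r0\<^sup>2 - t0\<^sup>2) = (r - r0) * (r + r0) - (t - t0) * (t + t0)"
    by (simp add: power2_eq_square algebra_simps)
  moreover have "\<bar>(r - r0) * (r + r0)\<bar> \<le> \<epsilon> * (2 * r0 + \<epsilon>)"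
    unfolding abs_mult using r r0 \<epsilon> by (intro mult_mono) auto
  moreover have "\<bar>(t - t0) * (t + t0)\<bar> \<le> (2 * \<epsilon>) * (2 * r0 + 2 * \<epsilon>)"
    unfolding abs_mult using t at0 \<epsilon> r0 by (intro mult_mono) auto
  ultimately have "(r0\<^sup>2 - t0\<^sup>2) - (\<epsilon> * (2 * r0 + \<epsilon>) + (2 * \<epsilon>) * (2 * r0 + 2 * \<epsilon>)) \<le> r\<^sup>2 - t\<^sup>2" by linarith
  moreover have "\<epsilon> * (2 * r0 + \<epsilon>) + (2 * \<epsilon>) * (2 * r0 + 2 * \<epsilon>) = 6 * (r0 * \<epsilon>) + 5 * (\<epsilon> * \<epsilon>)" by (simp add: algebra_simps)
  moreover have "\<epsilon> * \<epsilon> \<le> r0 / 4 * \<epsilon>" using \<epsilon> by (intro mult_right_mono) auto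
  moreover have "r0 / 4 * \<epsilon> = (r0 * \<epsilon>) / 4" "0 \<le> r0 * \<epsilon>" using r0 \<epsilon> by simp_all
  ultimately have "m\<^sup>2 - 8 * (r0 * \<epsilon>) \<le> r\<^sup>2 - t\<^sup>2" using t0 by linarith
  then show ?thesis using \<epsilon>(3) by (simp add: power_divide)
qed

lemma frostman_weights_mono:
  assumes "frostman_weights P w s C N" "C \<le> C'"
  shows "frostman_weights P w s C' N"
proof -
  note fw0 = assms(1)[unfolded frostman_weights_def]
  note fw = fw0[THEN conjunct1] fw0[THEN conjunct2, THEN conjunct1] fw0[THEN conjunct2, THEN conjunct2]
  have le: "C * \<rho> powr s \<le> C' * \<rho> powr s" for \<rho> using assms(2) by (intro mult_right_mono) auto
  show ?thesis unfolding frostman_weights_def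
  proof (intro conjI fw(1,2) allI impI)
    fix T \<rho> assume "T \<subseteq> P" "(1/2) ^ N \<le> \<rho>" "\<forall>p\<in>T. \<forall>q\<in>T. dist p q \<le> \<rho>"
    then have "sum w T \<le> C * \<rho> powr s" using fw(3) by simp
    then show "sum w T \<le> C' * \<rho> powr s" using le[of \<rho>] by linarith
  qed
qed

lemma frostman_family:
  fixes F :: "nat \<Rightarrow> (real^2) set"
  assumes s: "s > 0" and n: "n > 0" and nn: "\<And>i. i < n \<Longrightarrow> \<not> hnull s (F i)" and F: "\<And>i. i < n \<Longrightarrow> F i \<subseteq> cball (z i) (1/2)"
  obtains c C P w where "c > 0" "C > 0" "\<And>i N. i < n \<Longrightarrow> P i N \<subseteq> F i" "\<And>i N. i < n \<Longrightarrow> frostman_weights (P i N) (w i N) s C N"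
    "\<And>i N. i < n \<Longrightarrow> c \<le> sum (w i N) (P i N)" "\<And>i N. i < n \<Longrightarrow> sum (w i N) (P i N) \<le> C"
proof -
  define G where "G i t \<longleftrightarrow> fst t > 0 \<and> fst (snd t) > 0 \<and> (\<forall>N. fst (snd (snd t)) N \<subseteq> F i \<and>
     frostman_weights (fst (snd (snd t)) N) (snd (snd (snd t)) N) s (fst (snd t)) N \<and>
     fst t \<le> sum (snd (snd (snd t)) N) (fst (snd (snd t)) N) \<and> sum (snd (snd (snd t)) N) (fst (snd (snd t)) N) \<le> fst (snd t))"
    for i and t :: "real \<times> real \<times> (nat \<Rightarrow> (real^2) set) \<times> (nat \<Rightarrow> real^2 \<Rightarrow> real)"
  have "\<forall>i\<in>{..<n}. \<exists>t. G i t"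
  proof
    fix i assume "i \<in> {..<n}"
    then have i: "i < n" by simp
    show "\<exists>t. G i t"
    proof (rule frostman_sequence[OF s nn[OF i] F[OF i]])
      fix c C :: real and P w
      assume "c > 0" "C > 0" "\<And>N. P N \<subseteq> F i" "\<And>N. frostman_weights (P N) (w N) s C N"
        "\<And>N. c \<le> sum (w N) (P N)" "\<And>N. sum (w N) (P N) \<le> C"
      then have "G i (c, C, P, w)" by (simp add: G_def)
      then show ?thesis by (rule exI)
    qed
  qed
  from bchoice[OF this] obtain T where T: "\<forall>i\<in>{..<n}. G i (T i)" ..
  define c where "c = Min ((\<lambda>i. fst (T i)) ` {..<n})"
  define C where "C = Max ((\<lambda>i. fst (snd (T i))) ` {..<n})"
  have ne: "{..<n} \<noteq> {}" using n by (metis empty_iff lessThan_iff)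
  have le: "c \<le> fst (T i)" "fst (snd (T i)) \<le> C" if "i < n" for i
    unfolding c_def C_def using that by (auto intro: Min_le Max_ge)
  have "c > 0" unfolding c_def using T ne by (subst Min_gr_iff) (auto simp: G_def)
  moreover have "C > 0" using T le(2)[of 0] n by (force simp: G_def)
  ultimately show ?thesis
  proof (rule that[where P = "\<lambda>i. fst (snd (snd (T i)))" and w = "\<lambda>i. snd (snd (snd (T i)))"])
    fix i N assume i: "i < n"
    have G: "G i (T i)" using T i by simp
    show "fst (snd (snd (T i))) N \<subseteq> F i" using G by (simp add: G_def)
    show "frostman_weights (fst (snd (snd (T i))) N) (snd (snd (snd (T i))) N) s C N"
      using G le(2)[OF i] unfolding G_def by (blast intro: frostman_weights_mono)
    show "c \<le> sum (snd (snd (snd (T i))) N) (fst (snd (snd (T i))) N)"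
      using G le(1)[OF i] unfolding G_def by (blast intro: order_trans)
    show "sum (snd (snd (snd (T i))) N) (fst (snd (snd (T i))) N) \<le> C"
      using G le(2)[OF i] unfolding G_def by (blast intro: order_trans)
  qed
qed

text \<open>In rotated coordinates the centre (a, b) of a circle of radius \<open>r\<close> through
  \<open>p\<close> satisfies y p = g i r a p + b, with the sign of the root fixed for each vertex. A
  common point of three such curves is a circumcentre, so \<open>triple_tube_interval\<close>
  applies with \<open>r\<close> as parameter.\<close>

lemma circumradii_interval:
  fixes E :: "(real^2) set" and z :: "nat \<Rightarrow> real^2"
  assumes E: "compact E" and s: "5/3 < s" "s < 2" and nc: "\<not> collinear {z 0, z 1, z 2}"
    and fat: "\<And>i \<eta>. i < 3 \<Longrightarrow> \<eta> > 0 \<Longrightarrow> \<not> hnull s (E \<inter> ball (z i) \<eta>)"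
  shows "\<exists>a b. a < b \<and> {a<..<b} \<subseteq>
            {r. \<exists>x y z c. x \<in> E \<and> y \<in> E \<and> z \<in> E \<and> \<not> collinear {x, y, z} \<and>
                 dist c x = r \<and> dist c y = r \<and> dist c z = r}"
proof -
  obtain c r0 where cz: "\<And>i. i < 3 \<Longrightarrow> dist c (z i) = r0"
    and stable: "\<And>\<epsilon>. \<epsilon> > 0 \<Longrightarrow> \<exists>\<rho>>0. \<forall>p :: nat \<Rightarrow> real^2. (\<forall>i<3. dist (p i) (z i) < \<rho>) \<longrightarrow>
       (\<exists>c' r'. dist c' c < \<epsilon> \<and> \<bar>r' - r0\<bar> < \<epsilon> \<and> (\<forall>i<3. dist c' (p i) = r'))"
  proof (rule circumcenter_stable[of z, OF nc], goal_cases)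
    case (1 c r)
    show ?case using 1(2-3) by (rule 1(1))
  qed
  have i3: "i = 0 \<or> i = 1 \<or> i = 2" if "i < 3" for i :: nat using that by linarith
  have zz: "z 0 \<noteq> z 1" "z 0 \<noteq> z 2" "z 1 \<noteq> z 2" using nc by (auto simp: insert_commute)
  have r0: "r0 > 0"
  proof -
    have "r0 \<ge> 0" using cz[of 0] zero_le_dist[of c "z 0"] by simp
    moreover have "r0 \<noteq> 0" using cz[of 0] cz[of 1] zz by auto
    ultimately show ?thesis by simp
  qed
  have "z i - c \<noteq> 0" if "i < 3" for i using cz[OF that] r0 by auto
  then obtain e f where ef: "e\<^sup>2 + f\<^sup>2 = 1" and nz: "\<And>i. i < 3 \<Longrightarrow> e * (z i - c) $ 2 - f * (z i - c) $ 1 \<noteq> 0"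
    using ex_rotation_avoiding[of "\<lambda>i. z i - c"] by (metis (no_types, lifting))
  define x where "x p = e * p $ 1 + f * p $ 2" for p :: "real^2"
  define y where "y p = e * p $ 2 - f * p $ 1" for p :: "real^2"
  have iso: "(dist p q)\<^sup>2 = (x p - x q)\<^sup>2 + (y p - y q)\<^sup>2" for p q
  proof -
    have "(x p - x q)\<^sup>2 + (y p - y q)\<^sup>2 = (e\<^sup>2 + f\<^sup>2) * ((p $ 1 - q $ 1)\<^sup>2 + (p $ 2 - q $ 2)\<^sup>2)"
      by (simp add: x_def y_def power2_eq_square algebra_simps)
    then show ?thesis by (simp add: ef dist_real2)
  qed
  have xle: "\<bar>x p - x q\<bar> \<le> dist p q" "\<bar>y p - y q\<bar> \<le> dist p q" for p q
    using iso[of p q] by (auto intro!: abs_le_of_sq_le)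
  have cx: "continuous_on S x" "continuous_on S y" for S unfolding x_def y_def by (intro continuous_intros)+
  \<comment> \<open>Least height difference between a vertex and the centre; it is positive by the
    choice of rotation and bounds the roots in \<open>g\<close> away from 0.\<close>
  define \<mu> where "\<mu> = Min ((\<lambda>i. \<bar>y (z i) - y c\<bar>) ` {..<3})"
  have \<mu>le: "\<mu> \<le> \<bar>y (z i) - y c\<bar>" if "i < 3" for i unfolding \<mu>_def by (rule Min_le) (use that in auto)
  have ynz: "y (z i) - y c \<noteq> 0" if "i < 3" for i using nz[OF that] by (simp add: y_def algebra_simps)
  have ne3: "{..<3::nat} \<noteq> {}" by (metis empty_iff lessThan_iff zero_less_numeral)
  have \<mu>: "\<mu> > 0" unfolding \<mu>_def using ynz ne3 by (subst Min_gr_iff) auto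
  \<comment> \<open>The first two entries are the hypotheses of \<open>radicand_stable\<close>;
    \<mu>/4 ensures that perturbed points stay on the same side of the perturbed centre.\<close>
  define \<epsilon> where "\<epsilon> = Min {r0 / 4, 3 * \<mu>\<^sup>2 / (32 * r0), \<mu> / 4, 1}"
  have \<epsilon>: "0 < \<epsilon>" "\<epsilon> \<le> r0 / 4" "\<epsilon> \<le> 3 * \<mu>\<^sup>2 / (32 * r0)" "\<epsilon> \<le> \<mu> / 4" "\<epsilon> \<le> 1"
    using r0 \<mu> by (auto simp: \<epsilon>_def)
  have \<epsilon>32: "32 * r0 * \<epsilon> \<le> 3 * \<mu>\<^sup>2" using \<epsilon>(3) r0 by (simp add: field_simps)
  have "\<epsilon> / 4 > 0" using \<epsilon> by simp
  from stable[OF this] obtain \<rho> where \<rho>: "\<rho> > 0" and near: "\<And>p :: nat \<Rightarrow> real^2. (\<forall>i<3. dist (p i) (z i) < \<rho>) \<Longrightarrow>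
       (\<exists>c' r'. dist c' c < \<epsilon> / 4 \<and> \<bar>r' - r0\<bar> < \<epsilon> / 4 \<and> (\<forall>i<3. dist c' (p i) = r'))" by blast
  \<comment> \<open>Below \<rho> for the existence of nearby circumcentres; the thirds of the
    distances keep the three pieces of \<open>E\<close> disjoint, so that points taken from them are
    distinct.\<close>
  define \<eta> where "\<eta> = Min {\<rho> / 2, \<epsilon>, 1/2, dist (z 0) (z 1) / 3, dist (z 0) (z 2) / 3, dist (z 1) (z 2) / 3}"
  have \<eta>: "0 < \<eta>" "\<eta> < \<rho>" "\<eta> \<le> \<epsilon>" "\<eta> \<le> 1/2" "2 * \<eta> < dist (z 0) (z 1)" "2 * \<eta> < dist (z 0) (z 2)" "2 * \<eta> < dist (z 1) (z 2)"
  proof -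
    have d: "dist (z 0) (z 1) > 0" "dist (z 0) (z 2) > 0" "dist (z 1) (z 2) > 0" using zz by simp_all
    show p: "0 < \<eta>" using d \<rho> \<epsilon> by (auto simp: \<eta>_def)
    have le: "\<eta> \<le> \<rho> / 2" "\<eta> \<le> \<epsilon>" "\<eta> \<le> 1/2" "\<eta> \<le> dist (z 0) (z 1) / 3" "\<eta> \<le> dist (z 0) (z 2) / 3" "\<eta> \<le> dist (z 1) (z 2) / 3"
      unfolding \<eta>_def by (rule Min_le; simp)+
    show "\<eta> < \<rho>" "\<eta> \<le> \<epsilon>" "\<eta> \<le> 1/2" "2 * \<eta> < dist (z 0) (z 1)" "2 * \<eta> < dist (z 0) (z 2)" "2 * \<eta> < dist (z 1) (z 2)"
      using le d p \<rho> by linarith+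
  qed
  define F where "F i = E \<inter> cball (z i) \<eta>" for i
  have Fd: "dist p (z i) \<le> \<eta>" if "p \<in> F i" for p i using that by (simp add: F_def dist_commute)
  have F_nn: "\<not> hnull s (F i)" if i: "i < 3" for i
  proof
    assume "hnull s (F i)"
    then have "hnull s (E \<inter> ball (z i) \<eta>)" by (rule hnull_subset) (auto simp: F_def)
    then show False using fat[OF i \<eta>(1)] by contradiction
  qed
  have F_sub: "F i \<subseteq> cball (z i) (1/2)" if "i < 3" for i using \<eta>(4) by (auto simp: F_def)
  have s0: "0 < s" using s by simp
  obtain c1 C1 P w where c1: "c1 > 0" "C1 > 0" and PF: "\<And>i N. i < 3 \<Longrightarrow> P i N \<subseteq> F i"
    and fw: "\<And>i N. i < 3 \<Longrightarrow> frostman_weights (P i N) (w i N) s C1 N"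
    and cW: "\<And>i N. i < 3 \<Longrightarrow> c1 \<le> sum (w i N) (P i N)" "\<And>i N. i < 3 \<Longrightarrow> sum (w i N) (P i N) \<le> C1"
  proof (rule frostman_family[where n = 3 and F = F and z = z, OF s0 zero_less_numeral F_nn F_sub], goal_cases)
    case (3 c C P w)
    show ?case using 3(2-7) by (rule 3(1))
  qed simp_all
  have C1: "C1 \<ge> 0" using c1 by simp
  \<comment> \<open>Tells whether the vertex lies above or below the centre, that is, which half of
    the circle is used.\<close>
  define \<sigma> where "\<sigma> i = sgn (y (z i) - y c)" for i
  have \<sigma>: "\<bar>\<sigma> i\<bar> = 1" if "i < 3" for i using ynz[OF that] by (simp add: \<sigma>_def abs_sgn_eq)
  define g where "g i r a p = \<sigma> i * sqrt (r\<^sup>2 - (x p - a)\<^sup>2)" for i r a p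
  define R where "R = 2 * r0"
  define m where "m = \<mu> / 2"
  have m: "m > 0" using \<mu> by (simp add: m_def)
  define \<Lambda> where "\<Lambda> = Max {1, R / m, 3 * R ^ 3 / m ^ 5}"
  have \<Lambda>: "1 \<le> \<Lambda>" "R / m \<le> \<Lambda>" "3 * R ^ 3 / m ^ 5 \<le> \<Lambda>" by (auto simp: \<Lambda>_def)
  have rr: "0 < r" "r \<le> R" "\<bar>r - r0\<bar> \<le> \<epsilon>" if "r \<in> {r0 - \<epsilon>..r0 + \<epsilon>}" for r using that \<epsilon> r0 by (auto simp: R_def)
  have rad: "m\<^sup>2 \<le> r\<^sup>2 - (x p - a)\<^sup>2"
    if i: "i < 3" and p: "p \<in> F i" and r: "r \<in> {r0 - \<epsilon>..r0 + \<epsilon>}" and a: "a \<in> {x c - \<epsilon>..x c + \<epsilon>}" for i p r a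
    unfolding m_def
  proof (rule radicand_stable[OF r0 \<epsilon>(1,2) \<epsilon>32 _ rr(3)[OF r]])
    have "\<mu>\<^sup>2 \<le> (y (z i) - y c)\<^sup>2" using \<mu>le[OF i] \<mu> by (simp add: abs_le_square_iff[symmetric])
    moreover have "r0\<^sup>2 = (x (z i) - x c)\<^sup>2 + (y (z i) - y c)\<^sup>2" using iso[of "z i" c] cz[OF i] by (simp add: dist_commute)
    ultimately show "\<mu>\<^sup>2 \<le> r0\<^sup>2 - (x (z i) - x c)\<^sup>2" by linarith
    have "\<bar>x p - x (z i)\<bar> \<le> \<epsilon>" using xle(1)[of p "z i"] Fd[OF p] \<eta>(3) by linarith
    then show "\<bar>(x p - a) - (x (z i) - x c)\<bar> \<le> 2 * \<epsilon>" using a by auto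
  qed
  have main: "\<exists>t1 t2. t1 < t2 \<and> {t1<..<t2} \<subseteq> {r0 - \<epsilon>..r0 + \<epsilon>} \<and> (\<forall>r\<in>{t1<..<t2}. \<exists>\<^sub>\<infinity>N.
     \<exists>Z\<in>cbox (x c - \<epsilon>/2, y c - \<epsilon>/2) (x c + \<epsilon>/2, y c + \<epsilon>/2). \<forall>i<3. \<exists>p\<in>F i. \<bar>y p - g i r (fst Z) p - snd Z\<bar> \<le> (1/2) ^ N)"
  proof (rule triple_tube_interval[where A = "x c - \<epsilon>" and B = "x c + \<epsilon>" and s = s and \<kappa> = "1 / R" and \<Lambda> = \<Lambda> and \<epsilon> = \<epsilon> and x = x
      and P = P and w = w and c = c1 and W = C1 and C = "C1 * (2 * 2) powr s" and x\<^sub>0 = "\<lambda>i. x (z i)" and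
      \<alpha>' = "r0 - \<epsilon>/2" and \<beta>' = "r0 + \<epsilon>/2" and \<eta> = "\<epsilon>/4"])
    fix i :: nat assume i: "i < 3"
    show "P i N \<subseteq> F i" "c1 \<le> sum (w i N) (P i N)" "sum (w i N) (P i N) \<le> C1" for N by (rule PF[OF i] cW[OF i])+
    show "spread (P i N) (w i N) x y s (C1 * (2 * 2) powr s) ((1/2) ^ N)" for N
    proof (rule spread_of_frostman_weights[OF fw[OF i] _ C1])
      fix p q
      have "dist p q \<le> \<bar>x p - x q\<bar> + \<bar>y p - y q\<bar>"
        using iso[of p q] sqrt_sum_squares_le_sum_abs[of "x p - x q" "y p - y q"] by (metis real_sqrt_unique zero_le_dist)
      moreover have "u + v \<le> 2 * max u v" for u v :: real by simp
      ultimately show "dist p q \<le> 2 * max \<bar>x p - x q\<bar> \<bar>y p - y q\<bar>" by (rule order_trans)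
    qed simp
    show "\<bar>x p - x (z i)\<bar> \<le> \<epsilon>" if "p \<in> F i" for p using xle(1)[of p "z i"] Fd[OF that] \<eta>(3) by linarith
    show "transversal (x c - \<epsilon>) (x c + \<epsilon>) (1 / R) \<Lambda> (F i) x (g i r)" if r: "r \<in> {r0 - \<epsilon>..r0 + \<epsilon>}" for r
      unfolding g_def[abs_def] by (rule circle_arc_transversal[OF m rr(1,2)[OF r] \<sigma>[OF i] rad[OF i _ r] \<Lambda>(2,3)])
    show "\<bar>g i r a p - g i r' a' p\<bar> \<le> \<Lambda> * (\<bar>r - r'\<bar> + \<bar>a - a'\<bar>)"
      if p: "p \<in> F i" and r: "r \<in> {r0 - \<epsilon>..r0 + \<epsilon>}" "r' \<in> {r0 - \<epsilon>..r0 + \<epsilon>}"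
        and a: "a \<in> {x c - \<epsilon>/2..x c + \<epsilon>/2}" "a' \<in> {x c - \<epsilon>/2..x c + \<epsilon>/2}" for p r r' a a'
    proof -
      have a2: "a \<in> {x c - \<epsilon>..x c + \<epsilon>}" "a' \<in> {x c - \<epsilon>..x c + \<epsilon>}" using a \<epsilon>(1) by auto
      show ?thesis unfolding g_def
        by (rule circle_arc_lipschitz[OF m rad[OF i p r(1) a2(1)] rad[OF i p r(2) a2(2)] rr(1,2)[OF r(1)] rr(1,2)[OF r(2)] \<sigma>[OF i] \<Lambda>(2)])
    qed
  next
    fix p :: "nat \<Rightarrow> real^2" assume p: "\<And>i. i < 3 \<Longrightarrow> p i \<in> F i"
    have "\<forall>i<3. dist (p i) (z i) < \<rho>" using Fd[OF p] \<eta>(2) by (auto intro: le_less_trans)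
    from near[OF this] obtain c' r' where c': "dist c' c < \<epsilon> / 4" "\<bar>r' - r0\<bar> < \<epsilon> / 4" "\<And>i. i < 3 \<Longrightarrow> dist c' (p i) = r'" by blast
    have xc: "\<bar>x c' - x c\<bar> < \<epsilon> / 4" "\<bar>y c' - y c\<bar> < \<epsilon> / 4" using xle[of c' c] c'(1) by linarith+
    have "y (p i) = g i r' (x c') (p i) + y c'" if i: "i < 3" for i
    proof -
      have "r'\<^sup>2 = (x (p i) - x c')\<^sup>2 + (y (p i) - y c')\<^sup>2" using iso[of "p i" c'] c'(3)[OF i] by (simp add: dist_commute)
      then have sq: "sqrt (r'\<^sup>2 - (x (p i) - x c')\<^sup>2) = \<bar>y (p i) - y c'\<bar>" by simp
      \<comment> \<open>The point moves by at most \<mu>/4 and the centre by less than \<mu>/16, too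
        little to change the sign of a number of size at least \<mu>.\<close>
      have "\<bar>(y (p i) - y c') - (y (z i) - y c)\<bar> < \<bar>y (z i) - y c\<bar>"
        using xle(2)[of "p i" "z i"] Fd[OF p[OF i]] \<eta>(3) xc \<epsilon>(1,4) \<mu>le[OF i] \<mu> by linarith
      then have "sgn (y (p i) - y c') = \<sigma> i" unfolding \<sigma>_def by (auto simp: sgn_if abs_if split: if_splits)
      then show ?thesis unfolding g_def sq by (metis add_diff_cancel_left' diff_add_cancel mult.commute abs_mult_sgn)
    qed
    moreover have "r' \<in> {r0 - \<epsilon>/2..r0 + \<epsilon>/2}" using c'(2) \<epsilon>(1) unfolding atLeastAtMost_iff by linarith
    moreover have "x c' \<in> {x c - \<epsilon>/2 + \<epsilon>/4..x c + \<epsilon>/2 - \<epsilon>/4}" "y c' \<in> {y c - \<epsilon>/2 + \<epsilon>/4..y c + \<epsilon>/2 - \<epsilon>/4}"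
      using xc unfolding atLeastAtMost_iff by linarith+
    ultimately show "\<exists>r a b. r \<in> {r0 - \<epsilon>/2..r0 + \<epsilon>/2} \<and> a \<in> {x c - \<epsilon>/2 + \<epsilon>/4..x c + \<epsilon>/2 - \<epsilon>/4} \<and>
       b \<in> {y c - \<epsilon>/2 + \<epsilon>/4..y c + \<epsilon>/2 - \<epsilon>/4} \<and> (\<forall>i<3. y (p i) = g i r a (p i) + b)"
      by blast
  qed (use s \<epsilon> r0 \<Lambda> c1 C1 in \<open>auto simp: R_def\<close>)
  then obtain t1 t2 where t: "t1 < t2" "{t1<..<t2} \<subseteq> {r0 - \<epsilon>..r0 + \<epsilon>}" and
    hit: "\<And>r. r \<in> {t1<..<t2} \<Longrightarrow> \<exists>\<^sub>\<infinity>N.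
     \<exists>Z\<in>cbox (x c - \<epsilon>/2, y c - \<epsilon>/2) (x c + \<epsilon>/2, y c + \<epsilon>/2). \<forall>i<3. \<exists>p\<in>F i. \<bar>y p - g i r (fst Z) p - snd Z\<bar> \<le> (1/2) ^ N"
    by blast
  have "\<exists>X Y Z c. X \<in> E \<and> Y \<in> E \<and> Z \<in> E \<and> \<not> collinear {X, Y, Z} \<and> dist c X = r \<and> dist c Y = r \<and> dist c Z = r"
    if r: "r \<in> {t1<..<t2}" for r
  proof -
    have r': "r \<in> {r0 - \<epsilon>..r0 + \<epsilon>}" using r t(2) by blast
    define \<B> where "\<B> = cbox (x c - \<epsilon>/2, y c - \<epsilon>/2) (x c + \<epsilon>/2, y c + \<epsilon>/2)"
    define K where "K = \<B> \<times> F 0 \<times> F 1 \<times> F 2"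
    define \<phi> where "\<phi> i Z p = \<bar>y p - g i r (fst Z) p - snd Z\<bar>" for i and Z :: "real \<times> real" and p
    define \<Phi> where "\<Phi> q = \<phi> 0 (fst q) (fst (snd q)) + \<phi> 1 (fst q) (fst (snd (snd q))) + \<phi> 2 (fst q) (snd (snd (snd q)))" for q
    have cF: "compact (F i)" for i unfolding F_def by (intro compact_Int_closed E closed_cball)
    have K: "compact K" unfolding K_def \<B>_def by (intro compact_Times compact_cbox cF)
    have cf: "continuous_on K \<Phi>" unfolding \<Phi>_def \<phi>_def g_def x_def y_def by (intro continuous_intros)
    have "\<exists>q\<in>K. \<Phi> q = 0"
    proof (rule compact_approximate_zero[OF K cf])
      show "0 \<le> \<Phi> q" for q by (simp add: \<Phi>_def \<phi>_def)
      show "\<exists>\<^sub>\<infinity>N. \<exists>q\<in>K. \<Phi> q \<le> 3 * (1/2) ^ N"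
      proof (rule INFM_mono[OF hit[OF r]])
        fix N assume "\<exists>Z\<in>cbox (x c - \<epsilon>/2, y c - \<epsilon>/2) (x c + \<epsilon>/2, y c + \<epsilon>/2). \<forall>i<3. \<exists>p\<in>F i. \<bar>y p - g i r (fst Z) p - snd Z\<bar> \<le> (1/2) ^ N"
        then obtain Z where Z: "Z \<in> \<B>" "\<forall>i<3. \<exists>p\<in>F i. \<phi> i Z p \<le> (1/2) ^ N" unfolding \<B>_def \<phi>_def by blast
        obtain p0 where p0: "p0 \<in> F 0" "\<phi> 0 Z p0 \<le> (1/2) ^ N" using Z(2)[rule_format, of 0] by auto
        obtain p1 where p1: "p1 \<in> F 1" "\<phi> 1 Z p1 \<le> (1/2) ^ N" using Z(2)[rule_format, of 1] by auto
        obtain p2 where p2: "p2 \<in> F 2" "\<phi> 2 Z p2 \<le> (1/2) ^ N" using Z(2)[rule_format, of 2] by auto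
        have "(Z, p0, p1, p2) \<in> K" using Z(1) p0(1) p1(1) p2(1) by (simp add: K_def)
        moreover have "\<Phi> (Z, p0, p1, p2) \<le> 3 * (1/2) ^ N" using p0(2) p1(2) p2(2) unfolding \<Phi>_def fst_conv snd_conv by linarith
        ultimately show "\<exists>q\<in>K. \<Phi> q \<le> 3 * (1/2) ^ N" by blast
      qed
    qed
    then obtain q where q: "q \<in> K" "\<Phi> q = 0" by blast
    obtain a b p0 p1 p2 where qe: "q = ((a, b), p0, p1, p2)" by (metis surj_pair)
    have pF: "p0 \<in> F 0" "p1 \<in> F 1" "p2 \<in> F 2" and abB: "(a, b) \<in> \<B>" using q(1) by (simp_all add: K_def qe)
    have nn: "0 \<le> \<phi> i Z p" for i Z p by (simp add: \<phi>_def)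
    have ph: "\<phi> 0 (a, b) p0 = 0" "\<phi> 1 (a, b) p1 = 0" "\<phi> 2 (a, b) p2 = 0"
      using q(2) nn[of 0 "(a, b)" p0] nn[of 1 "(a, b)" p1] nn[of 2 "(a, b)" p2] unfolding \<Phi>_def qe fst_conv snd_conv by linarith+
    have ac: "a \<in> {x c - \<epsilon>..x c + \<epsilon>}" using abB \<epsilon>(1) by (simp add: \<B>_def cbox_Pair_eq)
    \<comment> \<open>The inverse rotation, returning from the coordinates (a, b) to a point of the
      plane.\<close>
    define c' where "c' = (vector [e * a - f * b, f * a + e * b] :: real^2)"
    have xyc: "x c' = a" "y c' = b"
    proof -
      have "x c' = (e\<^sup>2 + f\<^sup>2) * a" "y c' = (e\<^sup>2 + f\<^sup>2) * b"
        by (simp_all add: x_def y_def c'_def power2_eq_square algebra_simps)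
      then show "x c' = a" "y c' = b" by (simp_all add: ef)
    qed
    have on: "dist c' p = r" if i: "i < 3" and p: "p \<in> F i" "\<phi> i (a, b) p = 0" for i p
    proof -
      have "0 \<le> m\<^sup>2" by simp
      then have nn: "0 \<le> r\<^sup>2 - (x p - a)\<^sup>2" using rad[OF i p(1) r' ac] by linarith
      have "y p - b = \<sigma> i * sqrt (r\<^sup>2 - (x p - a)\<^sup>2)" using p(2) by (simp add: \<phi>_def g_def)
      then have "(y p - b)\<^sup>2 = (\<sigma> i)\<^sup>2 * (sqrt (r\<^sup>2 - (x p - a)\<^sup>2))\<^sup>2" by (simp only: power_mult_distrib)
      also have "(\<sigma> i)\<^sup>2 = 1" using \<sigma>[OF i] by (metis power2_abs one_power2)
      also have "(sqrt (r\<^sup>2 - (x p - a)\<^sup>2))\<^sup>2 = r\<^sup>2 - (x p - a)\<^sup>2" by (rule real_sqrt_pow2[OF nn])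
      finally have "(dist p c')\<^sup>2 = r\<^sup>2" unfolding iso xyc by simp
      then have "dist p c' = r" using rr(1)[OF r'] by (simp add: power2_eq_iff_nonneg)
      then show ?thesis by (simp add: dist_commute)
    qed
    have sep: "p \<noteq> q" if "p \<in> F i" "q \<in> F j" "2 * \<eta> < dist (z i) (z j)" for i j p q
    proof
      assume "p = q"
      then show False using Fd[OF that(1)] Fd[OF that(2)] dist_triangle3[of "z i" "z j" p] that(3) by simp
    qed
    have d: "dist c' p0 = r" "dist c' p1 = r" "dist c' p2 = r" using on[OF _ pF(1) ph(1)] on[OF _ pF(2) ph(2)] on[OF _ pF(3) ph(3)] by simp_all
    have "\<not> collinear {p0, p1, p2}"
      by (rule concyclic_not_collinear[OF d sep[OF pF(1,2) \<eta>(5)] sep[OF pF(1,3) \<eta>(6)] sep[OF pF(2,3) \<eta>(7)]])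
    moreover have "p0 \<in> E" "p1 \<in> E" "p2 \<in> E" using pF by (simp_all add: F_def)
    ultimately show ?thesis using d by blast
  qed
  then show ?thesis using t(1) by (intro exI[of _ t1] exI[of _ t2] conjI) blast+
qed

section \<open>Areas of triangles with a fixed vertex\<close>

text \<open>The dual counterpart of \<open>tube\<close> for a family of points: each
  \<open>p\<close> contributes a product of two hats at the dual point (x p, y p).\<close>

definition spots :: "'p set \<Rightarrow> ('p \<Rightarrow> real) \<Rightarrow> ('p \<Rightarrow> real) \<Rightarrow> ('p \<Rightarrow> real) \<Rightarrow> real \<Rightarrow> real \<times> real \<Rightarrow> real" where
  "spots P w x y \<delta> z = (\<Sum>p\<in>P. w p * (bump \<delta> (x p - fst z) * bump \<delta> (y p - snd z)))"

lemma continuous_spots: "\<delta> > 0 \<Longrightarrow> continuous_on S (spots P w x y \<delta>)"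
  unfolding spots_def by (intro continuous_intros)

lemma spots_nonneg: "\<delta> > 0 \<Longrightarrow> (\<And>p. p \<in> P \<Longrightarrow> 0 \<le> w p) \<Longrightarrow> 0 \<le> spots P w x y \<delta> z"
  unfolding spots_def by (intro sum_nonneg mult_nonneg_nonneg bump_nonneg)

lemma spots_sup:
  assumes sp: "spread P w x y s C \<delta>\<^sub>0" and d: "0 < \<delta>" "\<delta>\<^sub>0 \<le> \<delta>"
  shows "spots P w x y \<delta> z \<le> C * \<delta> powr (s - 2)"
proof -
  have fin: "finite P" and w0: "\<And>p. p \<in> P \<Longrightarrow> 0 \<le> w p" using sp by (auto simp: spread_def)
  define Q where "Q = {p\<in>P. \<bar>x p - fst z\<bar> \<le> \<delta> \<and> \<bar>y p - snd z\<bar> \<le> \<delta>}"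
  have "spots P w x y \<delta> z = (\<Sum>p\<in>Q. w p * (bump \<delta> (x p - fst z) * bump \<delta> (y p - snd z)))"
    unfolding spots_def
  proof (rule sum.mono_neutral_right[OF fin])
    show "\<forall>p\<in>P - Q. w p * (bump \<delta> (x p - fst z) * bump \<delta> (y p - snd z)) = 0"
    proof
      fix p assume "p \<in> P - Q"
      then have "\<delta> \<le> \<bar>x p - fst z\<bar> \<or> \<delta> \<le> \<bar>y p - snd z\<bar>" by (auto simp: Q_def)
      then have "bump \<delta> (x p - fst z) = 0 \<or> bump \<delta> (y p - snd z) = 0" using bump_zero[OF d(1)] by blast
      then show "w p * (bump \<delta> (x p - fst z) * bump \<delta> (y p - snd z)) = 0" by auto
    qed
  qed (simp add: Q_def)
  also have "\<dots> \<le> (\<Sum>p\<in>Q. w p * (1 / \<delta> * (1 / \<delta>)))"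
    using d by (intro sum_mono mult_left_mono mult_mono bump_le bump_nonneg w0) (auto simp: Q_def)
  also have "\<dots> = sum w Q * (1 / \<delta> * (1 / \<delta>))" by (simp only: sum_distrib_right)
  also have "\<dots> \<le> C * \<delta> powr s * (1 / \<delta> * (1 / \<delta>))"
    using sp d unfolding spread_def Q_def by (intro mult_right_mono) auto
  also have "\<dots> = C * \<delta> powr (s - 2)"
  proof -
    have "\<delta> powr s = \<delta> powr (s - 2) * \<delta> powr 2" by (simp only: powr_add[symmetric] diff_add_cancel)
    then show ?thesis using d by (simp add: powr_numeral power2_eq_square)
  qed
  finally show ?thesis .
qed

lemma integral_upper_bound_subbox:
  fixes h :: "real \<times> real \<Rightarrow> real"
  assumes c: "continuous_on (cbox (A, J1) (B, J2)) h"
    and r: "r > 0" "A \<le> a - r" "a + r \<le> B" "J1 \<le> b - r" "b + r \<le> J2" and m: "0 \<le> m" "\<And>z. \<bar>h z\<bar> \<le> m"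
    and z: "\<And>z. r \<le> \<bar>a - fst z\<bar> \<or> r \<le> \<bar>b - snd z\<bar> \<Longrightarrow> h z = 0"
  shows "integral (cbox (A, J1) (B, J2)) h \<le> m * (2 * r)\<^sup>2"
proof -
  define Q where "Q = cbox (a - r, b - r) (a + r, b + r)"
  have sub: "Q \<subseteq> cbox (A, J1) (B, J2)" using r by (auto simp: cbox_Pair_eq Q_def)
  have I: "(h has_integral integral Q h) Q"
    unfolding Q_def by (intro integrable_integral integrable_continuous continuous_on_subset[OF c]) (use sub in \<open>simp add: Q_def\<close>)
  then have "(h has_integral integral Q h) (cbox (A, J1) (B, J2))"
  proof (rule has_integral_on_superset[OF _ _ sub])
    fix v assume "v \<notin> Q"
    then have "r \<le> \<bar>a - fst v\<bar> \<or> r \<le> \<bar>b - snd v\<bar>"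
      by (cases v) (auto simp: Q_def cbox_Pair_eq)
    then show "h v = 0" by (rule z)
  qed
  then have "integral (cbox (A, J1) (B, J2)) h = integral Q h" by (rule integral_unique)
  also have "norm \<dots> \<le> m * Henstock_Kurzweil_Integration.content Q"
    unfolding Q_def using I m by (intro has_integral_bound[where f = h]) (auto simp: Q_def)
  then have "integral Q h \<le> m * Henstock_Kurzweil_Integration.content Q" by simp
  also have "Henstock_Kurzweil_Integration.content Q = (2 * r)\<^sup>2"
    unfolding Q_def using r by (simp add: content_cbox_Pair power2_eq_square)
  finally show ?thesis .
qed

text \<open>No cancellation is used: the square is bounded by the supremum times the function, and
  each spot has integral at most 4, its height \<open>1 / \<delta>\<^sup>2\<close> times the area
  \<open>(2 * \<delta>)\<^sup>2\<close> of its square.\<close>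

lemma spots_L2:
  assumes sp: "spread P w x y s C \<delta>\<^sub>0" and d: "0 < \<delta>" "\<delta>\<^sub>0 \<le> \<delta>" and W: "sum w P \<le> W" and C: "C \<ge> 0"
    and H: "\<And>p. p \<in> P \<Longrightarrow> \<bar>x p\<bar> + \<delta> \<le> H \<and> \<bar>y p\<bar> + \<delta> \<le> H"
  shows "integral (cbox (-H, -H) (H, H)) (\<lambda>z. (spots P w x y \<delta> z)\<^sup>2) \<le> 4 * C * W * \<delta> powr (s - 2)"
proof -
  have fin: "finite P" and w0: "\<And>p. p \<in> P \<Longrightarrow> 0 \<le> w p" using sp by (auto simp: spread_def)
  have one: "integral (cbox (-H, -H) (H, H)) (\<lambda>z. bump \<delta> (x p - fst z) * bump \<delta> (y p - snd z)) \<le> 4" if p: "p \<in> P" for p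
  proof -
    have "integral (cbox (-H, -H) (H, H)) (\<lambda>z. bump \<delta> (x p - fst z) * bump \<delta> (y p - snd z)) \<le> (1 / \<delta> * (1 / \<delta>)) * (2 * \<delta>)\<^sup>2"
    proof (rule integral_upper_bound_subbox[where a = "x p" and b = "y p"])
      show "continuous_on (cbox (-H, -H) (H, H)) (\<lambda>z. bump \<delta> (x p - fst z) * bump \<delta> (y p - snd z))" by (intro continuous_intros d)
      show "\<bar>bump \<delta> (x p - fst z) * bump \<delta> (y p - snd z)\<bar> \<le> 1 / \<delta> * (1 / \<delta>)" for z
        unfolding abs_mult using d bump_nonneg[OF d(1)] bump_le[OF d(1)] by (intro mult_mono) auto
      fix z :: "real \<times> real" assume "\<delta> \<le> \<bar>x p - fst z\<bar> \<or> \<delta> \<le> \<bar>y p - snd z\<bar>"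
      then show "bump \<delta> (x p - fst z) * bump \<delta> (y p - snd z) = 0" using bump_zero[OF d(1)] by auto
    next
      have "\<bar>x p\<bar> + \<delta> \<le> H" "\<bar>y p\<bar> + \<delta> \<le> H" using H[OF p] by auto
      then show "- H \<le> x p - \<delta>" "x p + \<delta> \<le> H" "- H \<le> y p - \<delta>" "y p + \<delta> \<le> H" by linarith+
    qed (use d in auto)
    also have "\<dots> = 4" using d by (simp add: power2_eq_square)
    finally show ?thesis .
  qed
  have S: "0 \<le> spots P w x y \<delta> z" "spots P w x y \<delta> z \<le> C * \<delta> powr (s - 2)" for z
    by (rule spots_nonneg[OF d(1) w0], assumption) (rule spots_sup[OF sp d])
  have "integral (cbox (-H, -H) (H, H)) (\<lambda>z. (spots P w x y \<delta> z)\<^sup>2) \<le> integral (cbox (-H, -H) (H, H)) (\<lambda>z. C * \<delta> powr (s - 2) * spots P w x y \<delta> z)"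
    by (rule integral_le) (use S d in \<open>auto intro!: integrable_continuous continuous_intros continuous_spots mult_right_mono simp: power2_eq_square\<close>)
  also have "\<dots> = C * \<delta> powr (s - 2) * integral (cbox (-H, -H) (H, H)) (spots P w x y \<delta>)" by simp
  also have "\<dots> \<le> C * \<delta> powr (s - 2) * (4 * W)"
  proof (rule mult_left_mono)
    have "integral (cbox (-H, -H) (H, H)) (spots P w x y \<delta>) = 
      (\<Sum>p\<in>P. integral (cbox (-H, -H) (H, H)) (\<lambda>z. w p * (bump \<delta> (x p - fst z) * bump \<delta> (y p - snd z))))"
      unfolding spots_def[abs_def] by (rule integral_sum[OF fin]) (intro integrable_continuous continuous_intros d)
    also have "\<dots> = (\<Sum>p\<in>P. w p * integral (cbox (-H, -H) (H, H)) (\<lambda>z. bump \<delta> (x p - fst z) * bump \<delta> (y p - snd z)))" by simp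
    also have "\<dots> \<le> (\<Sum>p\<in>P. w p * 4)" by (intro sum_mono mult_left_mono one w0)
    also have "\<dots> = 4 * sum w P" by (simp add: sum_distrib_right[symmetric])
    finally show "integral (cbox (-H, -H) (H, H)) (spots P w x y \<delta>) \<le> 4 * W" using W by linarith
  qed (use C in auto)
  finally show ?thesis by (simp add: mult_ac)
qed

lemma integral_cbox_shift:
  fixes f :: "real \<times> real \<Rightarrow> real"
  assumes c: "continuous_on UNIV f" and z: "\<And>z. z \<notin> cbox (-R, -R) (R, R) \<Longrightarrow> f z = 0"
    and h: "\<bar>fst h\<bar> \<le> 1" "\<bar>snd h\<bar> \<le> 1" and H: "R + 1 \<le> H"
  shows "integral (cbox (-H, -H) (H, H)) (\<lambda>z. f (z - h)) = integral (cbox (-H, -H) (H, H)) f"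
proof -
  define I where "I = integral (cbox (-R, -R) (R, R)) f"
  have I: "(f has_integral I) (cbox (-R, -R) (R, R))"
    unfolding I_def by (intro integrable_integral integrable_continuous continuous_on_subset[OF c]) auto
  have "cbox (-R, -R) (R, R) \<subseteq> cbox (-H, -H) (H, H)" using H by (auto simp: cbox_Pair_eq)
  then have 1: "(f has_integral I) (cbox (-H, -H) (H, H))" using has_integral_on_superset[OF I z] by blast
  have "((\<lambda>x. f (1 *\<^sub>R x + (- h))) has_integral ((1 / (\<bar>1\<bar> ^ DIM(real \<times> real))) *\<^sub>R I))
     ((\<lambda>x. (1 / 1) *\<^sub>R x + - ((1 / 1) *\<^sub>R (- h))) ` cbox (-R, -R) (R, R))"
    by (rule has_integral_affinity[OF I]) simp
  then have "((\<lambda>x. f (x - h)) has_integral I) ((\<lambda>x. x + h) ` cbox (-R, -R) (R, R))" by simp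
  then have "((\<lambda>x. f (x - h)) has_integral I) (cbox (-H, -H) (H, H))"
  proof (rule has_integral_on_superset)
    show "(\<lambda>x. x + h) ` cbox (-R, -R) (R, R) \<subseteq> cbox (-H, -H) (H, H)"
    proof
      fix v assume "v \<in> (\<lambda>x. x + h) ` cbox (-R, -R) (R, R)"
      then obtain a b where "v = (a, b) + h" "-R \<le> a" "a \<le> R" "-R \<le> b" "b \<le> R" by (auto simp: cbox_Pair_eq)
      then show "v \<in> cbox (-H, -H) (H, H)" using h H by (cases h) (auto simp: cbox_Pair_eq)
    qed
    fix v assume "v \<notin> (\<lambda>x. x + h) ` cbox (-R, -R) (R, R)"
    then have "v - h \<notin> cbox (-R, -R) (R, R)" by (metis diff_add_cancel image_eqI)
    then show "f (v - h) = 0" by (rule z)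
  qed
  then show ?thesis using 1 by (simp add: integral_unique)
qed

lemma integral_double_sum:
  fixes f :: "int \<Rightarrow> int \<Rightarrow> real \<times> real \<Rightarrow> real"
  assumes "finite J" "\<And>j k. continuous_on (cbox u v) (f j k)"
  shows "integral (cbox u v) (\<lambda>z. \<Sum>j\<in>J. \<Sum>k\<in>J. c j k * f j k z) = (\<Sum>j\<in>J. \<Sum>k\<in>J. c j k * integral (cbox u v) (f j k))"
proof -
  have i: "(\<lambda>z. c j k * f j k z) integrable_on cbox u v" for j k by (intro integrable_continuous continuous_intros assms)
  have "integral (cbox u v) (\<lambda>z. \<Sum>j\<in>J. \<Sum>k\<in>J. c j k * f j k z) = (\<Sum>j\<in>J. integral (cbox u v) (\<lambda>z. \<Sum>k\<in>J. c j k * f j k z))"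
    by (rule integral_sum[OF assms(1)]) (intro integrable_sum[OF assms(1)] i)
  also have "\<dots> = (\<Sum>j\<in>J. \<Sum>k\<in>J. integral (cbox u v) (\<lambda>z. c j k * f j k z))"
    by (intro sum.cong refl integral_sum[OF assms(1)] i)
  finally show ?thesis by simp
qed

section \<open>Moving the change of scale from spots to tubes\<close>

definition hat_mask :: "int \<Rightarrow> real" where
  "hat_mask j = (if j = 0 then 1/2 else 1/4)"

lemma bump_refine_sum:
  assumes "\<delta> > 0"
  shows "bump \<delta> t = (\<Sum>j\<in>{-1, 0, 1}. hat_mask j * bump (\<delta>/2) (t + of_int j * (\<delta>/2)))"
  using bump_refine[OF assms, of t] by (simp add: hat_mask_def)

lemma hat_mask_nonneg: "0 \<le> hat_mask j"
  by (simp add: hat_mask_def)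

text \<open>A spot of width \<open>\<delta>\<close> is an average of shifted spots of width \<open>\<delta>/2\<close>; the shifts are moved onto the
  tube through a point with first coordinate \<open>\<xi>\<close>, and this is the profile of the difference.\<close>
definition coarse_kernel :: "real \<Rightarrow> real \<Rightarrow> real \<Rightarrow> real" where
  "coarse_kernel \<delta> \<xi> t = (\<Sum>j\<in>{-1, 0, 1}. \<Sum>k\<in>{-1, 0, 1}. hat_mask j * hat_mask k * bump \<delta> (t - (of_int j * \<xi> + of_int k) * (\<delta>/2))) - bump (\<delta>/2) t"

definition coarse_kernel_int :: "real \<Rightarrow> real \<Rightarrow> real \<Rightarrow> real" where
  "coarse_kernel_int \<delta> \<xi> t = (\<Sum>j\<in>{-1, 0, 1}. \<Sum>k\<in>{-1, 0, 1}. hat_mask j * hat_mask k * bump_int \<delta> (t - (of_int j * \<xi> + of_int k) * (\<delta>/2))) - bump_int (\<delta>/2) t"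

lemma mask_average_const: "(\<Sum>j\<in>{-1, 0, 1}. \<Sum>k\<in>{-1, 0, 1}. hat_mask j * hat_mask k * c) = c"
  by (simp add: hat_mask_def)

lemma mask_average_ge:
  assumes "\<And>j k. l \<le> \<phi> j k"
  shows "l \<le> (\<Sum>j\<in>{-1, 0, 1}. \<Sum>k\<in>{-1, 0, 1}. hat_mask j * hat_mask k * \<phi> j k)"
  by (subst mask_average_const[of l, symmetric]) (intro sum_mono mult_left_mono assms mult_nonneg_nonneg hat_mask_nonneg)

lemma mask_average_le:
  assumes "\<And>j k. \<phi> j k \<le> u"
  shows "(\<Sum>j\<in>{-1, 0, 1}. \<Sum>k\<in>{-1, 0, 1}. hat_mask j * hat_mask k * \<phi> j k) \<le> u"
proof -
  have "(\<Sum>j\<in>{-1, 0, 1}. \<Sum>k\<in>{-1, 0, 1}. hat_mask j * hat_mask k * \<phi> j k) \<le> (\<Sum>j\<in>{-1, 0, 1}. \<Sum>k\<in>{-1, 0, 1}. hat_mask j * hat_mask k * u)"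
    by (intro sum_mono mult_left_mono assms mult_nonneg_nonneg hat_mask_nonneg)
  then show ?thesis by (simp only: mask_average_const)
qed

text \<open>The mask coefficients sum to 1, so the averaged hats and the fine hat have equal mass
  and the primitive of their difference has compact support. The shifts are at most
  \<open>(M + 1) * \<delta> / 2\<close>, whence the radius \<open>(M + 2) * \<delta>\<close>. Thus
  the kernel is an admissible profile for \<open>tube_L2_bound\<close>.\<close>

lemma coarse_kernel_properties:
  assumes d: "\<delta> > 0" and M: "\<bar>\<xi>\<bar> \<le> M"
  shows "(coarse_kernel_int \<delta> \<xi> has_real_derivative coarse_kernel \<delta> \<xi> t) (at t)"
    and "continuous_on UNIV (coarse_kernel \<delta> \<xi>)"
    and "\<bar>coarse_kernel_int \<delta> \<xi> t\<bar> \<le> 2" and "\<bar>coarse_kernel \<delta> \<xi> t\<bar> \<le> 2 / \<delta>"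
    and "(M + 2) * \<delta> \<le> \<bar>t\<bar> \<Longrightarrow> coarse_kernel_int \<delta> \<xi> t = 0" and "(M + 2) * \<delta> \<le> \<bar>t\<bar> \<Longrightarrow> coarse_kernel \<delta> \<xi> t = 0"
proof -
  have d2: "\<delta> / 2 > 0" using d by simp
  have b: "(bump_int \<delta> has_real_derivative bump \<delta> t) (at t)" for t by (rule bump_int_deriv[OF d])
  have sh: "((\<lambda>t. bump_int \<delta> (t - v)) has_real_derivative bump \<delta> (t - v)) (at t)" for t v
    using b[of "t - v"] DERIV_shift[of "bump_int \<delta>" "bump \<delta> (t - v)" t "- v"] by simp
  show "(coarse_kernel_int \<delta> \<xi> has_real_derivative coarse_kernel \<delta> \<xi> t) (at t)"
    unfolding coarse_kernel_int_def[abs_def] coarse_kernel_def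
    by (intro DERIV_diff DERIV_sum DERIV_cmult sh bump_int_deriv d2)
  show "continuous_on UNIV (coarse_kernel \<delta> \<xi>)"
    unfolding coarse_kernel_def[abs_def] by (intro continuous_intros d d2)
  have A: "\<bar>p - q\<bar> \<le> c" if "0 \<le> p" "p \<le> c" "0 \<le> q" "q \<le> c" for p q c :: real using that by linarith
  show "\<bar>coarse_kernel_int \<delta> \<xi> t\<bar> \<le> 2"
    unfolding coarse_kernel_int_def
  proof (rule A)
    show "0 \<le> (\<Sum>j\<in>{-1, 0, 1}. \<Sum>k\<in>{-1, 0, 1}. hat_mask j * hat_mask k * bump_int \<delta> (t - (of_int j * \<xi> + of_int k) * (\<delta>/2)))"
      by (rule mask_average_ge) (rule bump_int_eq(3)[OF d])
    have "(\<Sum>j\<in>{-1, 0, 1}. \<Sum>k\<in>{-1, 0, 1}. hat_mask j * hat_mask k * bump_int \<delta> (t - (of_int j * \<xi> + of_int k) * (\<delta>/2))) \<le> 1"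
      by (rule mask_average_le) (rule bump_int_eq(4)[OF d])
    then show "(\<Sum>j\<in>{-1, 0, 1}. \<Sum>k\<in>{-1, 0, 1}. hat_mask j * hat_mask k * bump_int \<delta> (t - (of_int j * \<xi> + of_int k) * (\<delta>/2))) \<le> 2"
      by linarith
    show "0 \<le> bump_int (\<delta>/2) t" by (rule bump_int_eq(3)[OF d2])
    show "bump_int (\<delta>/2) t \<le> 2" using bump_int_eq(4)[OF d2, of t] by linarith
  qed
  have le: "1 / \<delta> \<le> 2 / \<delta>" using d by (intro divide_right_mono) auto
  show "\<bar>coarse_kernel \<delta> \<xi> t\<bar> \<le> 2 / \<delta>"
    unfolding coarse_kernel_def
  proof (rule A)
    show "0 \<le> (\<Sum>j\<in>{-1, 0, 1}. \<Sum>k\<in>{-1, 0, 1}. hat_mask j * hat_mask k * bump \<delta> (t - (of_int j * \<xi> + of_int k) * (\<delta>/2)))"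
      by (rule mask_average_ge) (rule bump_nonneg[OF d])
    show "(\<Sum>j\<in>{-1, 0, 1}. \<Sum>k\<in>{-1, 0, 1}. hat_mask j * hat_mask k * bump \<delta> (t - (of_int j * \<xi> + of_int k) * (\<delta>/2))) \<le> 2 / \<delta>"
      by (rule mask_average_le) (rule order_trans[OF bump_le[OF d] le])
    show "0 \<le> bump (\<delta>/2) t" by (rule bump_nonneg[OF d2])
    show "bump (\<delta>/2) t \<le> 2 / \<delta>" using bump_le[OF d2, of t] by simp
  qed
  have far: "\<delta> \<le> \<bar>t - (of_int j * \<xi> + of_int k) * (\<delta>/2)\<bar> \<and> (0 \<le> t \<longleftrightarrow> 0 \<le> t - (of_int j * \<xi> + of_int k) * (\<delta>/2)) \<and> \<delta> \<le> \<bar>t\<bar>"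
    if t: "(M + 2) * \<delta> \<le> \<bar>t\<bar>" and jk: "j \<in> {-1, 0, 1}" "k \<in> {-1, 0, 1}" for j k :: int
  proof -
    have "\<bar>of_int j * \<xi> + of_int k\<bar> \<le> M + 1" using jk M by auto
    then have "\<bar>(of_int j * \<xi> + of_int k) * (\<delta>/2)\<bar> \<le> (M + 1) * (\<delta>/2)" unfolding abs_mult using d by (intro mult_mono) auto
    moreover have "(M + 1) * (\<delta>/2) \<le> (M + 1) * \<delta>" using d M by (intro mult_left_mono) auto
    moreover have "(M + 2) * \<delta> = (M + 1) * \<delta> + \<delta>" by (simp add: algebra_simps)
    moreover have "0 \<le> (M + 1) * \<delta>" using d M by simp
    ultimately show ?thesis using t d by linarith
  qed
  show "coarse_kernel_int \<delta> \<xi> t = 0" if t: "(M + 2) * \<delta> \<le> \<bar>t\<bar>"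
  proof (cases "0 \<le> t")
    case True
    have "bump_int \<delta> (t - (of_int j * \<xi> + of_int k) * (\<delta>/2)) = 1" if "j \<in> {-1, 0, 1}" "k \<in> {-1, 0, 1}" for j k :: int
      using far[OF t that] True by (intro bump_int_eq(2) d) linarith
    then have "(\<Sum>j\<in>{-1, 0, 1}. \<Sum>k\<in>{-1, 0, 1}. hat_mask j * hat_mask k * bump_int \<delta> (t - (of_int j * \<xi> + of_int k) * (\<delta>/2))) = 1"
      by (simp add: hat_mask_def)
    moreover have "bump_int (\<delta>/2) t = 1" using far[OF t, of 0 0] True d by (intro bump_int_eq(2) d2) auto
    ultimately show ?thesis by (simp add: coarse_kernel_int_def)
  next
    case False
    have "bump_int \<delta> (t - (of_int j * \<xi> + of_int k) * (\<delta>/2)) = 0" if "j \<in> {-1, 0, 1}" "k \<in> {-1, 0, 1}" for j k :: int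
      using far[OF t that] False by (intro bump_int_eq(1) d) linarith
    then have "(\<Sum>j\<in>{-1, 0, 1}. \<Sum>k\<in>{-1, 0, 1}. hat_mask j * hat_mask k * bump_int \<delta> (t - (of_int j * \<xi> + of_int k) * (\<delta>/2))) = 0"
      by simp
    moreover have "bump_int (\<delta>/2) t = 0" using far[OF t, of 0 0] False d by (intro bump_int_eq(1) d2) auto
    ultimately show ?thesis by (simp add: coarse_kernel_int_def)
  qed
  show "coarse_kernel \<delta> \<xi> t = 0" if t: "(M + 2) * \<delta> \<le> \<bar>t\<bar>"
  proof -
    have "bump \<delta> (t - (of_int j * \<xi> + of_int k) * (\<delta>/2)) = 0" if "j \<in> {-1, 0, 1}" "k \<in> {-1, 0, 1}" for j k :: int
      using far[OF t that] by (intro bump_zero d) linarith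
    moreover have "bump (\<delta>/2) t = 0" using far[OF t, of 0 0] d by (intro bump_zero d2) auto
    ultimately show ?thesis by (simp add: coarse_kernel_def)
  qed
qed

text \<open>Each wide spot is an average of translated narrow ones, and a change of variables
  translates the tubes instead. For a line, a translation by (j, k) times \<delta>/2 shifts the
  argument of its profile by \<open>(j * x q + k) * (\<delta>/2)\<close>, independently of the dual
  point. So a common spot sum factors out, and only tubes are left to be subtracted.\<close>

lemma spots_tube_scale_diff:
  assumes d: "0 < \<delta>" "\<delta> \<le> 1" and w: "\<And>p. p \<in> P \<Longrightarrow> \<bar>\<alpha> p\<bar> \<le> R - 1 \<and> \<bar>\<gamma> p\<bar> \<le> R - 1" and H: "R + 1 \<le> H"
  shows "integral (cbox (-H, -H) (H, H)) (\<lambda>z. spots P w \<alpha> \<gamma> \<delta> z * tube Q v y (\<lambda>a q. a * x q) \<delta> z)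
     - integral (cbox (-H, -H) (H, H)) (\<lambda>z. spots P w \<alpha> \<gamma> (\<delta>/2) z * tube Q v y (\<lambda>a q. a * x q) (\<delta>/2) z)
   = integral (cbox (-H, -H) (H, H)) (\<lambda>z. spots P w \<alpha> \<gamma> (\<delta>/2) z * (\<Sum>q\<in>Q. v q * coarse_kernel \<delta> (x q) (y q - fst z * x q - snd z)))"
proof -
  define J where "J = {-1, 0, 1 :: int}"
  have J: "finite J" by (simp add: J_def)
  define h where "h j k = (of_int j * (\<delta>/2), of_int k * (\<delta>/2))" for j k :: int
  define T where "T = tube Q v y (\<lambda>a q. a * x q) \<delta>"
  define T2 where "T2 = tube Q v y (\<lambda>a q. a * x q) (\<delta>/2)"
  define S2 where "S2 = spots P w \<alpha> \<gamma> (\<delta>/2)"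
  have d2: "\<delta>/2 > 0" using d by simp
  have cS2: "continuous_on S S2" for S unfolding S2_def by (rule continuous_spots[OF d2])
  have cT: "continuous_on S T" "continuous_on S T2" for S unfolding T_def T2_def tube_def by (intro continuous_intros d d2)+
  have S: "spots P w \<alpha> \<gamma> \<delta> z = (\<Sum>j\<in>J. \<Sum>k\<in>J. hat_mask j * hat_mask k * S2 (z - h j k))" for z
  proof -
    have "bump \<delta> (\<alpha> p - fst z) * bump \<delta> (\<gamma> p - snd z) =
      (\<Sum>j\<in>J. \<Sum>k\<in>J. hat_mask j * hat_mask k * (bump (\<delta>/2) (\<alpha> p - fst (z - h j k)) * bump (\<delta>/2) (\<gamma> p - snd (z - h j k))))" for p
      unfolding bump_refine_sum[OF d(1)] sum_product J_def[symmetric] by (intro sum.cong refl) (simp add: h_def algebra_simps)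
    then have "spots P w \<alpha> \<gamma> \<delta> z = (\<Sum>p\<in>P. \<Sum>j\<in>J. \<Sum>k\<in>J. hat_mask j * hat_mask k * (w p * (bump (\<delta>/2) (\<alpha> p - fst (z - h j k)) * bump (\<delta>/2) (\<gamma> p - snd (z - h j k)))))"
      unfolding spots_def by (simp only: sum_distrib_left mult.left_commute)
    also have "\<dots> = (\<Sum>j\<in>J. \<Sum>p\<in>P. \<Sum>k\<in>J. hat_mask j * hat_mask k * (w p * (bump (\<delta>/2) (\<alpha> p - fst (z - h j k)) * bump (\<delta>/2) (\<gamma> p - snd (z - h j k)))))"
      by (rule sum.swap)
    also have "\<dots> = (\<Sum>j\<in>J. \<Sum>k\<in>J. \<Sum>p\<in>P. hat_mask j * hat_mask k * (w p * (bump (\<delta>/2) (\<alpha> p - fst (z - h j k)) * bump (\<delta>/2) (\<gamma> p - snd (z - h j k)))))"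
      by (intro sum.cong refl sum.swap)
    finally show ?thesis unfolding S2_def spots_def sum_distrib_left .
  qed
  have hb: "\<bar>fst (h j k)\<bar> \<le> 1" "\<bar>snd (h j k)\<bar> \<le> 1" if "j \<in> J" "k \<in> J" for j k
    using that d by (auto simp: h_def J_def)
  \<comment> \<open>The narrow spots stay inside the box of half-side \<open>R\<close>; as
    translations have size at most 1 and \<open>R + 1 \<le> H\<close>, no mass leaves the domain of
    integration.\<close>
  have S2z: "S2 z = 0" if "z \<notin> cbox (-R, -R) (R, R)" for z
  proof -
    have "bump (\<delta>/2) (\<alpha> p - fst z) = 0 \<or> bump (\<delta>/2) (\<gamma> p - snd z) = 0" if p: "p \<in> P" for p
    proof -
      have "\<not> \<bar>fst z\<bar> \<le> R \<or> \<not> \<bar>snd z\<bar> \<le> R" using \<open>z \<notin> cbox (-R, -R) (R, R)\<close> by (cases z) (auto simp: cbox_Pair_eq)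
      then have "\<delta>/2 \<le> \<bar>\<alpha> p - fst z\<bar> \<or> \<delta>/2 \<le> \<bar>\<gamma> p - snd z\<bar>" using w[OF p] d by linarith
      then show ?thesis using bump_zero[OF d2] by blast
    qed
    then show ?thesis unfolding S2_def spots_def by (intro sum.neutral ballI) auto
  qed
  have sh: "integral (cbox (-H, -H) (H, H)) (\<lambda>z. S2 (z - h j k) * T z) = integral (cbox (-H, -H) (H, H)) (\<lambda>z. S2 z * T (z + h j k))"
    if jk: "j \<in> J" "k \<in> J" for j k
  proof -
    have "continuous_on UNIV (\<lambda>z. S2 z * T (z + h j k))"
      by (intro continuous_intros cS2 continuous_on_compose2[OF cT(1)[of UNIV]]) auto
    from integral_cbox_shift[OF this _ hb[OF jk] H] show ?thesis using S2z by simp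
  qed
  have cm: "continuous_on (cbox (-H, -H) (H, H)) (\<lambda>z. S2 (z - h j k) * T z)"
    "continuous_on (cbox (-H, -H) (H, H)) (\<lambda>z. S2 z * T (z + h j k))" for j k
    by (intro continuous_intros cS2 cT continuous_on_compose2[OF cT(1)[of UNIV]] continuous_on_compose2[OF cS2[of UNIV]]; simp)+
  have "integral (cbox (-H, -H) (H, H)) (\<lambda>z. spots P w \<alpha> \<gamma> \<delta> z * T z) = 
     integral (cbox (-H, -H) (H, H)) (\<lambda>z. \<Sum>j\<in>J. \<Sum>k\<in>J. hat_mask j * hat_mask k * (S2 (z - h j k) * T z))"
    unfolding S sum_distrib_right by (simp only: mult.assoc)
  also have "\<dots> = (\<Sum>j\<in>J. \<Sum>k\<in>J. hat_mask j * hat_mask k * integral (cbox (-H, -H) (H, H)) (\<lambda>z. S2 (z - h j k) * T z))"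
    by (rule integral_double_sum[OF J cm(1)])
  also have "\<dots> = (\<Sum>j\<in>J. \<Sum>k\<in>J. hat_mask j * hat_mask k * integral (cbox (-H, -H) (H, H)) (\<lambda>z. S2 z * T (z + h j k)))"
    by (intro sum.cong refl arg_cong2[where f = times] sh)
  also have "\<dots> = integral (cbox (-H, -H) (H, H)) (\<lambda>z. \<Sum>j\<in>J. \<Sum>k\<in>J. hat_mask j * hat_mask k * (S2 z * T (z + h j k)))"
    by (rule integral_double_sum[OF J cm(2), symmetric])
  finally have e: "integral (cbox (-H, -H) (H, H)) (\<lambda>z. spots P w \<alpha> \<gamma> \<delta> z * T z) - integral (cbox (-H, -H) (H, H)) (\<lambda>z. S2 z * T2 z)
    = integral (cbox (-H, -H) (H, H)) (\<lambda>z. (\<Sum>j\<in>J. \<Sum>k\<in>J. hat_mask j * hat_mask k * (S2 z * T (z + h j k))) - S2 z * T2 z)"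
    by (simp only:) (rule integral_diff[symmetric]; intro integrable_continuous continuous_intros cm cS2 cT)
  have V: "(\<Sum>j\<in>J. \<Sum>k\<in>J. hat_mask j * hat_mask k * (S2 z * T (z + h j k))) - S2 z * T2 z
     = S2 z * (\<Sum>q\<in>Q. v q * coarse_kernel \<delta> (x q) (y q - fst z * x q - snd z))" for z
  proof -
    have "(\<Sum>j\<in>J. \<Sum>k\<in>J. hat_mask j * hat_mask k * (S2 z * T (z + h j k))) = S2 z * (\<Sum>j\<in>J. \<Sum>k\<in>J. hat_mask j * hat_mask k * T (z + h j k))"
      by (simp only: sum_distrib_left mult.left_commute)
    also have "(\<Sum>j\<in>J. \<Sum>k\<in>J. hat_mask j * hat_mask k * T (z + h j k)) =
      (\<Sum>j\<in>J. \<Sum>k\<in>J. \<Sum>q\<in>Q. v q * (hat_mask j * hat_mask k * bump \<delta> (y q - fst z * x q - snd z - (of_int j * x q + of_int k) * (\<delta>/2))))"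
      unfolding T_def tube_def sum_distrib_left by (intro sum.cong refl) (simp add: h_def algebra_simps)
    also have "\<dots> = (\<Sum>j\<in>J. \<Sum>q\<in>Q. \<Sum>k\<in>J. v q * (hat_mask j * hat_mask k * bump \<delta> (y q - fst z * x q - snd z - (of_int j * x q + of_int k) * (\<delta>/2))))"
      by (intro sum.cong refl sum.swap)
    also have "\<dots> = (\<Sum>q\<in>Q. \<Sum>j\<in>J. \<Sum>k\<in>J. v q * (hat_mask j * hat_mask k * bump \<delta> (y q - fst z * x q - snd z - (of_int j * x q + of_int k) * (\<delta>/2))))"
      by (rule sum.swap)
    finally show ?thesis
      unfolding T2_def tube_def coarse_kernel_def J_def[symmetric] right_diff_distrib sum_subtractf sum_distrib_left by simp
  qed
  show ?thesis using e[unfolded V] unfolding T_def T2_def S2_def .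
qed

text \<open>The analogue of \<open>triple_tube_mass\<close> for a point and a line. Each pair has an
  exact value \<open>t\<close>, pigeonhole selects one for many pairs, and near the dual point of
  \<open>p\<close> all three hats are at least half their height.\<close>

lemma spots_tube_mass:
  assumes fin: "finite P" "finite Q" and w0: "\<And>p. p \<in> P \<Longrightarrow> 0 \<le> w p" "\<And>q. q \<in> Q \<Longrightarrow> 0 \<le> v q"
    and c: "c > 0" "c \<le> sum w P" "c \<le> sum v Q"
    and bd: "\<And>p. p \<in> P \<Longrightarrow> \<bar>\<alpha> p\<bar> \<le> M \<and> \<bar>\<beta> p\<bar> \<le> M" "\<And>q. q \<in> Q \<Longrightarrow> \<bar>x q\<bar> \<le> M"
    and tM: "\<And>t. t \<in> {\<tau>\<^sub>1..\<tau>\<^sub>2} \<Longrightarrow> \<bar>t\<bar> \<le> M" and H: "M\<^sup>2 + M + 1 \<le> H"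
    and sol: "\<And>p q. p \<in> P \<Longrightarrow> q \<in> Q \<Longrightarrow> \<exists>t\<in>{\<tau>\<^sub>1..\<tau>\<^sub>2}. y q = \<alpha> p * x q + t * \<beta> p"
    and d: "0 < \<delta>" "\<delta> \<le> 1"
  shows "\<exists>t\<in>{\<tau>\<^sub>1..\<tau>\<^sub>2}. c\<^sup>2 / (16 * (2 * M + 1) ^ 3 * (\<tau>\<^sub>2 - \<tau>\<^sub>1 + 1)) \<le>
    integral (cbox (-H, -H) (H, H)) (\<lambda>z. spots P w \<alpha> (\<lambda>p. t * \<beta> p) \<delta> z * tube Q v y (\<lambda>a q. a * x q) \<delta> z)"
proof -
  have "P \<noteq> {}" using c by auto
  then have M0: "M \<ge> 0" using bd(1) by fastforce
  \<comment> \<open>The errors in slope, in \<open>t\<close> and in the second coordinate are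
    \<open>h * M\<close>, \<open>h * M\<close> and \<open>h\<close>; they add up to
    \<delta>/2.\<close>
  define h where "h = \<delta> / (2 * (2 * M + 1))"
  have "\<delta> / (2 * (2 * M + 1)) \<le> \<delta> / 2" using d M0 by (intro divide_left_mono) auto
  then have h: "0 < h" "h \<le> \<delta> / 2" "h \<le> 1" using d M0 by (auto simp: h_def)
  have "2 * M + 1 \<noteq> 0" using M0 by linarith
  then have hM: "(2 * M + 1) * h = \<delta> / 2" unfolding h_def by (metis mult.commute nonzero_mult_divide_mult_cancel_right times_divide_eq_right)
  define \<Omega> where "\<Omega> = P \<times> Q"
  define t where "t \<omega> = (SOME t. t \<in> {\<tau>\<^sub>1..\<tau>\<^sub>2} \<and> y (snd \<omega>) = \<alpha> (fst \<omega>) * x (snd \<omega>) + t * \<beta> (fst \<omega>))" for \<omega>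
  have t: "t \<omega> \<in> {\<tau>\<^sub>1..\<tau>\<^sub>2} \<and> y (snd \<omega>) = \<alpha> (fst \<omega>) * x (snd \<omega>) + t \<omega> * \<beta> (fst \<omega>)" if "\<omega> \<in> \<Omega>" for \<omega>
  proof -
    have "\<exists>t. t \<in> {\<tau>\<^sub>1..\<tau>\<^sub>2} \<and> y (snd \<omega>) = \<alpha> (fst \<omega>) * x (snd \<omega>) + t * \<beta> (fst \<omega>)"
      using sol[unfolded Bex_def, of "fst \<omega>" "snd \<omega>"] that unfolding \<Omega>_def mem_Times_iff by (elim conjE)
    then show ?thesis unfolding t_def by (rule someI_ex)
  qed
  have t': "\<tau>\<^sub>1 \<le> t \<omega> \<and> t \<omega> \<le> \<tau>\<^sub>2" if "\<omega> \<in> \<Omega>" for \<omega> using t[OF that] by simp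
  define W where "W \<omega> = w (fst \<omega>) * v (snd \<omega>)" for \<omega>
  have W0: "0 \<le> W \<omega>" if "\<omega> \<in> \<Omega>" for \<omega> using that w0 by (auto simp: W_def \<Omega>_def)
  have finO: "finite \<Omega>" using fin by (simp add: \<Omega>_def)
  have "c\<^sup>2 \<le> sum W \<Omega>"
  proof -
    have "sum W \<Omega> = sum w P * sum v Q" unfolding sum_product sum.cartesian_product \<Omega>_def W_def by (simp add: split_beta)
    moreover have "c * c \<le> sum w P * sum v Q" using c by (intro mult_mono) auto
    ultimately show ?thesis by (simp add: power2_eq_square)
  qed
  then have "\<exists>j\<in>\<Omega>. c\<^sup>2 * h / (\<tau>\<^sub>2 - \<tau>\<^sub>1 + h) \<le> sum W {\<omega>\<in>\<Omega>. \<bar>t \<omega> - t j\<bar> \<le> h}"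
    using c(1) by (intro weighted_pigeonhole finO t' h(1) W0) simp_all
  then obtain j where j: "j \<in> \<Omega>" "c\<^sup>2 * h / (\<tau>\<^sub>2 - \<tau>\<^sub>1 + h) \<le> sum W {\<omega>\<in>\<Omega>. \<bar>t \<omega> - t j\<bar> \<le> h}"
    by (elim bexE) (rule that)
  define \<Omega>' where "\<Omega>' = {\<omega>\<in>\<Omega>. \<bar>t \<omega> - t j\<bar> \<le> h}"
  have tj: "t j \<in> {\<tau>\<^sub>1..\<tau>\<^sub>2}" using t[OF j(1)] by simp
  define k where "k \<omega> z = bump \<delta> (\<alpha> (fst \<omega>) - fst z) * bump \<delta> (t j * \<beta> (fst \<omega>) - snd z) * bump \<delta> (y (snd \<omega>) - fst z * x (snd \<omega>) - snd z)"
    for \<omega> and z :: "real \<times> real"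
  have ck: "continuous_on S (k \<omega>)" for S \<omega> unfolding k_def[abs_def] by (intro continuous_intros d)
  have k0: "0 \<le> k \<omega> z" for \<omega> z unfolding k_def by (intro mult_nonneg_nonneg bump_nonneg d)
  have "spots P w \<alpha> (\<lambda>p. t j * \<beta> p) \<delta> z * tube Q v y (\<lambda>a q. a * x q) \<delta> z = (\<Sum>\<omega>\<in>\<Omega>. W \<omega> * k \<omega> z)" for z
    unfolding tube_def spots_def sum_product sum.cartesian_product \<Omega>_def by (intro sum.cong refl) (auto simp: W_def k_def)
  then have "integral (cbox (-H, -H) (H, H)) (\<lambda>z. spots P w \<alpha> (\<lambda>p. t j * \<beta> p) \<delta> z * tube Q v y (\<lambda>a q. a * x q) \<delta> z)
    = integral (cbox (-H, -H) (H, H)) (\<lambda>z. \<Sum>\<omega>\<in>\<Omega>. W \<omega> * k \<omega> z)" by simp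
  also have "\<dots> = (\<Sum>\<omega>\<in>\<Omega>. integral (cbox (-H, -H) (H, H)) (\<lambda>z. W \<omega> * k \<omega> z))"
    by (rule integral_sum[OF finO]) (intro integrable_continuous continuous_intros ck)
  also have "\<dots> = (\<Sum>\<omega>\<in>\<Omega>. W \<omega> * integral (cbox (-H, -H) (H, H)) (k \<omega>))" by simp
  also have "\<dots> \<ge> (\<Sum>\<omega>\<in>\<Omega>'. W \<omega> * ((1 / (2 * \<delta>)) ^ 3 * (2 * h)\<^sup>2))"
  proof -
    have one: "(1 / (2 * \<delta>)) ^ 3 * (2 * h)\<^sup>2 \<le> integral (cbox (-H, -H) (H, H)) (k \<omega>)" if \<omega>: "\<omega> \<in> \<Omega>'" for \<omega>
    proof -
      have \<omega>O: "\<omega> \<in> \<Omega>" and tt: "\<bar>t \<omega> - t j\<bar> \<le> h" using \<omega> by (auto simp: \<Omega>'_def)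
      have b: "\<bar>\<alpha> (fst \<omega>)\<bar> \<le> M" "\<bar>\<beta> (fst \<omega>)\<bar> \<le> M" "\<bar>x (snd \<omega>)\<bar> \<le> M"
        using bd(1)[of "fst \<omega>"] bd(2)[of "snd \<omega>"] \<omega>O by (auto simp: \<Omega>_def)
      have tb: "\<bar>t j * \<beta> (fst \<omega>)\<bar> \<le> M\<^sup>2" unfolding abs_mult power2_eq_square using tM[OF tj] b M0 by (intro mult_mono) auto
      have M2: "0 \<le> M\<^sup>2" by simp
      show ?thesis
      proof (rule integral_lower_bound_subbox[where a = "\<alpha> (fst \<omega>)" and b = "t j * \<beta> (fst \<omega>)"])
        show "- H \<le> \<alpha> (fst \<omega>) - h" "\<alpha> (fst \<omega>) + h \<le> H" using b(1) h(3) H M2 by linarith+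
        show "- H \<le> t j * \<beta> (fst \<omega>) - h" "t j * \<beta> (fst \<omega>) + h \<le> H" using tb h(3) H M0 by linarith+
        fix z :: "real \<times> real" assume z: "\<bar>fst z - \<alpha> (fst \<omega>)\<bar> \<le> h" "\<bar>snd z - t j * \<beta> (fst \<omega>)\<bar> \<le> h"
        have 1: "1 / (2 * \<delta>) \<le> bump \<delta> (\<alpha> (fst \<omega>) - fst z)" using z(1) h(2) by (intro bump_lower d) linarith
        have 2: "1 / (2 * \<delta>) \<le> bump \<delta> (t j * \<beta> (fst \<omega>) - snd z)" using z(2) h(2) by (intro bump_lower d) linarith
        have "y (snd \<omega>) - fst z * x (snd \<omega>) - snd z = (\<alpha> (fst \<omega>) - fst z) * x (snd \<omega>) + (t \<omega> - t j) * \<beta> (fst \<omega>) + (t j * \<beta> (fst \<omega>) - snd z)"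
          using t[OF \<omega>O] by (simp add: algebra_simps)
        moreover have "\<bar>(\<alpha> (fst \<omega>) - fst z) * x (snd \<omega>)\<bar> \<le> h * M" unfolding abs_mult using z(1) b(3) h M0 by (intro mult_mono) auto
        moreover have "\<bar>(t \<omega> - t j) * \<beta> (fst \<omega>)\<bar> \<le> h * M" unfolding abs_mult using tt b(2) h M0 by (intro mult_mono) auto
        moreover have "(2 * M + 1) * h = h * M + h * M + h" by (simp add: algebra_simps)
        ultimately have "\<bar>y (snd \<omega>) - fst z * x (snd \<omega>) - snd z\<bar> \<le> \<delta> / 2" using z(2) hM by linarith
        then have 3: "1 / (2 * \<delta>) \<le> bump \<delta> (y (snd \<omega>) - fst z * x (snd \<omega>) - snd z)" by (intro bump_lower d)
        have "1 / (2 * \<delta>) * (1 / (2 * \<delta>)) * (1 / (2 * \<delta>)) \<le> k \<omega> z"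
          unfolding k_def using d by (intro mult_mono 1 2 3 mult_nonneg_nonneg bump_nonneg) auto
        then show "(1 / (2 * \<delta>)) ^ 3 \<le> k \<omega> z" by (simp only: power3_eq_cube)
      qed (use ck k0 h in auto)
    qed
    have "(\<Sum>\<omega>\<in>\<Omega>'. W \<omega> * ((1 / (2 * \<delta>)) ^ 3 * (2 * h)\<^sup>2)) \<le> (\<Sum>\<omega>\<in>\<Omega>'. W \<omega> * integral (cbox (-H, -H) (H, H)) (k \<omega>))"
      by (intro sum_mono mult_left_mono one W0) (auto simp: \<Omega>'_def)
    also have "\<dots> \<le> (\<Sum>\<omega>\<in>\<Omega>. W \<omega> * integral (cbox (-H, -H) (H, H)) (k \<omega>))"
    proof (rule sum_mono2[OF finO])
      show "\<Omega>' \<subseteq> \<Omega>" by (auto simp: \<Omega>'_def)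
      fix \<omega> assume "\<omega> \<in> \<Omega> - \<Omega>'"
      then have "0 \<le> W \<omega>" using W0 by blast
      moreover have "0 \<le> integral (cbox (-H, -H) (H, H)) (k \<omega>)"
        by (rule integral_nonneg[OF integrable_continuous[OF ck] k0])
      ultimately show "0 \<le> W \<omega> * integral (cbox (-H, -H) (H, H)) (k \<omega>)" by simp
    qed
    finally show ?thesis .
  qed
  finally have "(1 / (2 * \<delta>)) ^ 3 * (2 * h)\<^sup>2 * sum W \<Omega>' \<le>
    integral (cbox (-H, -H) (H, H)) (\<lambda>z. spots P w \<alpha> (\<lambda>p. t j * \<beta> p) \<delta> z * tube Q v y (\<lambda>a q. a * x q) \<delta> z)"
    by (simp only: sum_distrib_right[symmetric] mult.commute)
  moreover have "c\<^sup>2 / (16 * (2 * M + 1) ^ 3 * (\<tau>\<^sub>2 - \<tau>\<^sub>1 + 1)) \<le> (1 / (2 * \<delta>)) ^ 3 * (2 * h)\<^sup>2 * sum W \<Omega>'"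
  proof -
    have ab: "\<tau>\<^sub>2 - \<tau>\<^sub>1 \<ge> 0" using tj by simp
    define D where "D = 2 * M + 1"
    have D: "D > 0" using M0 by (simp add: D_def)
    \<comment> \<open>Again \<open>h ^ 3 / (2 * \<delta> ^ 3)\<close>, free of \<delta>; here 16 is
      2 * 2^3.\<close>
    have e: "(1 / (2 * \<delta>)) ^ 3 * (2 * h)\<^sup>2 * h = 1 / (16 * D ^ 3)"
      unfolding h_def D_def[symmetric] using d D by (simp add: power3_eq_cube power2_eq_square field_simps)
    have "c\<^sup>2 / (16 * D ^ 3 * (\<tau>\<^sub>2 - \<tau>\<^sub>1 + 1)) \<le> c\<^sup>2 / (16 * D ^ 3 * (\<tau>\<^sub>2 - \<tau>\<^sub>1 + h))"
      using ab h c D by (intro divide_left_mono mult_left_mono) auto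
    also have "\<dots> = (1 / (16 * D ^ 3)) * (c\<^sup>2 / (\<tau>\<^sub>2 - \<tau>\<^sub>1 + h))" by simp
    also have "\<dots> = (1 / (2 * \<delta>)) ^ 3 * (2 * h)\<^sup>2 * (c\<^sup>2 * h / (\<tau>\<^sub>2 - \<tau>\<^sub>1 + h))" unfolding e[symmetric] by simp
    also have "\<dots> \<le> (1 / (2 * \<delta>)) ^ 3 * (2 * h)\<^sup>2 * sum W \<Omega>'"
      unfolding \<Omega>'_def using j(2) d by (intro mult_left_mono) auto
    finally show ?thesis by (simp only: D_def)
  qed
  ultimately show ?thesis using tj by (intro bexI[of _ "t j"]) linarith+
qed

lemma spots_lipschitz:
  assumes d: "\<delta> > 0" and w: "\<And>p. p \<in> P \<Longrightarrow> 0 \<le> w p" "sum w P \<le> W" and E: "E \<ge> 0"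
    and y: "\<And>p. p \<in> P \<Longrightarrow> \<bar>y p - y' p\<bar> \<le> E"
  shows "\<bar>spots P w x y \<delta> z - spots P w x y' \<delta> z\<bar> \<le> W * E / \<delta> ^ 3"
proof -
  have "\<bar>spots P w x y \<delta> z - spots P w x y' \<delta> z\<bar> =
     \<bar>\<Sum>p\<in>P. w p * (bump \<delta> (x p - fst z) * (bump \<delta> (y p - snd z) - bump \<delta> (y' p - snd z)))\<bar>"
    by (simp add: spots_def sum_subtractf right_diff_distrib)
  also have "\<dots> \<le> (\<Sum>p\<in>P. \<bar>w p * (bump \<delta> (x p - fst z) * (bump \<delta> (y p - snd z) - bump \<delta> (y' p - snd z)))\<bar>)"
    by (rule sum_abs)
  also have "\<dots> \<le> (\<Sum>p\<in>P. w p * (1 / \<delta> * (E / \<delta>\<^sup>2)))"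
  proof (rule sum_mono)
    fix p assume p: "p \<in> P"
    have "\<bar>bump \<delta> (y p - snd z) - bump \<delta> (y' p - snd z)\<bar> \<le> \<bar>(y p - snd z) - (y' p - snd z)\<bar> / \<delta>\<^sup>2"
      by (rule bump_lipschitz[OF d])
    also have "\<dots> \<le> E / \<delta>\<^sup>2" using y[OF p] by (intro divide_right_mono) auto
    finally have 1: "\<bar>bump \<delta> (y p - snd z) - bump \<delta> (y' p - snd z)\<bar> \<le> E / \<delta>\<^sup>2" .
    have 2: "\<bar>bump \<delta> (x p - fst z)\<bar> \<le> 1 / \<delta>" using bump_nonneg[OF d] bump_le[OF d] by simp
    show "\<bar>w p * (bump \<delta> (x p - fst z) * (bump \<delta> (y p - snd z) - bump \<delta> (y' p - snd z)))\<bar> \<le> w p * (1 / \<delta> * (E / \<delta>\<^sup>2))"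
      unfolding abs_mult using w(1)[OF p] d E by (intro mult_mono 1 2) auto
  qed
  also have "\<dots> = sum w P * (1 / \<delta> * (E / \<delta>\<^sup>2))" by (simp only: sum_distrib_right)
  also have "\<dots> \<le> W * (1 / \<delta> * (E / \<delta>\<^sup>2))" using w d E by (intro mult_right_mono) auto
  finally show ?thesis by (simp add: power2_eq_square power3_eq_cube)
qed

text \<open>The derivative of a line in \<open>a\<close> is \<open>x p\<close> itself, so the angle
  constant is 1 and the second derivatives vanish; \<Lambda> only has to bound the first dual
  coordinate.\<close>

lemma linear_transversal:
  assumes "\<And>a. a \<in> {A..B} \<Longrightarrow> \<bar>a\<bar> \<le> \<Lambda>" "0 \<le> \<Lambda>"
  shows "transversal A B 1 \<Lambda> P x (\<lambda>a p. a * x p)"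
  unfolding transversal_def
proof (rule exI[of _ "\<lambda>a. x"], rule exI[of _ "\<lambda>a p. 0"], intro conjI ballI)
  fix a p q assume a: "a \<in> {A..B}"
  show "((\<lambda>a. a * x p) has_real_derivative x p) (at a)" by (auto intro!: derivative_eq_intros)
  show "((\<lambda>a. x p) has_real_derivative 0) (at a)" by simp
  have "\<bar>a * x p - a * x q\<bar> = \<bar>a\<bar> * \<bar>x p - x q\<bar>" by (simp add: abs_mult flip: right_diff_distrib)
  also have "\<dots> \<le> \<Lambda> * \<bar>x p - x q\<bar>" using assms(1)[OF a] by (intro mult_right_mono) auto
  finally show "\<bar>a * x p - a * x q\<bar> \<le> \<Lambda> * \<bar>x p - x q\<bar>" .
qed (use assms(2) in auto)

text \<open>The parameter \<open>t\<close> moves only the spots. The spots lose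
  \<open>\<delta> powr ((s - 2) / 2)\<close> in mean square and the mean-zero tube sum gains
  \<open>\<delta> powr ((s - 1) / 2)\<close>, so their product is summable over scales exactly when
  \<open>s > 3/2\<close>.\<close>

lemma spots_tube_interval:
  fixes P Q :: "nat \<Rightarrow> 'p set" and w v :: "nat \<Rightarrow> 'p \<Rightarrow> real" and \<alpha> \<beta> x y :: "'p \<Rightarrow> real"
  assumes s: "3/2 < s" "s < 2" and C: "0 \<le> C" and c: "0 < c"
    and PF: "\<And>N. P N \<subseteq> F" "\<And>N. Q N \<subseteq> G"
    and spP: "\<And>N t. t \<in> {\<tau>\<^sub>1..\<tau>\<^sub>2} \<Longrightarrow> spread (P N) (w N) \<alpha> (\<lambda>p. t * \<beta> p) s C ((1/2) ^ N)"
    and spQ: "\<And>N. spread (Q N) (v N) x y s C ((1/2) ^ N)"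
    and cW: "\<And>N. c \<le> sum (w N) (P N)" "\<And>N. sum (w N) (P N) \<le> W" "\<And>N. c \<le> sum (v N) (Q N)" "\<And>N. sum (v N) (Q N) \<le> W"
    and bd: "\<And>p. p \<in> F \<Longrightarrow> \<bar>\<alpha> p\<bar> \<le> M \<and> \<bar>\<beta> p\<bar> \<le> M" "\<And>q. q \<in> G \<Longrightarrow> \<bar>x q\<bar> \<le> M"
    and tM: "\<And>t. t \<in> {\<tau>\<^sub>1..\<tau>\<^sub>2} \<Longrightarrow> \<bar>t\<bar> \<le> M"
    and sol: "\<And>p q. p \<in> F \<Longrightarrow> q \<in> G \<Longrightarrow> \<exists>t\<in>{\<tau>'..\<tau>''}. y q = \<alpha> p * x q + t * \<beta> p"
    and \<tau>: "\<tau>\<^sub>1 < \<tau>'" "\<tau>' \<le> \<tau>''" "\<tau>'' < \<tau>\<^sub>2"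
  shows "\<exists>t1 t2. t1 < t2 \<and> {t1<..<t2} \<subseteq> {\<tau>\<^sub>1..\<tau>\<^sub>2} \<and> (\<forall>t\<in>{t1<..<t2}. \<exists>\<^sub>\<infinity>N. \<exists>p\<in>F. \<exists>q\<in>G.
     \<bar>y q - \<alpha> p * x q - t * \<beta> p\<bar> \<le> (M + 2) * (1/2) ^ N)"
proof -
  have W: "W > 0" using cW(1)[of 0] cW(2)[of 0] c by linarith
  have "P 0 \<noteq> {}" using cW(1)[of 0] c by auto
  then obtain p where "p \<in> F" using PF(1)[of 0] by blast
  then have M0: "M \<ge> 0" using bd(1)[of p] by (meson abs_ge_zero order_trans)
  \<comment> \<open>Large enough for \<open>\<bar>\<alpha> p\<bar> \<le> M\<close> and
    \<open>\<bar>t * \<beta> p\<bar> \<le> M\<^sup>2\<close> to stay one unit inside.\<close>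
  define R where "R = M\<^sup>2 + M + 2"
  define H where "H = R + 1"
  have M2: "M\<^sup>2 \<ge> 0" by simp
  have RM: "M \<le> R - 1" "M\<^sup>2 \<le> R - 1" using M0 M2 by (auto simp: R_def)
  define \<B> where "\<B> = cbox (-H, -H) (H, H)"
  define S where "S N n t = spots (P N) (w N) \<alpha> (\<lambda>p. t * \<beta> p) ((1/2) ^ n)" for N n t
  define T where "T N n = tube (Q N) (v N) y (\<lambda>a q. a * x q) ((1/2) ^ n)" for N n
  define Fn where "Fn N n t = integral \<B> (\<lambda>z. S N n t z * T N n z)" for N n t
  have pw: "(0::real) < (1/2) ^ m" "(1/2 :: real) ^ m \<le> 1" for m :: nat by (simp_all add: power_le_one)
  have w0: "0 \<le> w N p" if "p \<in> P N" for N p using spP[of \<tau>' N] that \<tau> by (simp add: spread_def)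
  have v0: "0 \<le> v N q" if "q \<in> Q N" for N q using spQ[of N] that by (simp add: spread_def)
  have finP: "finite (P N)" for N using spP[of \<tau>' N] \<tau> by (simp add: spread_def)
  have finQ: "finite (Q N)" for N using spQ[of N] by (simp add: spread_def)
  have cS: "continuous_on X (S N n t)" for X N n t unfolding S_def by (rule continuous_spots[OF pw(1)])
  have cT: "continuous_on X (T N n)" for X N n unfolding T_def tube_def by (intro continuous_intros pw)
  have bP: "\<bar>\<alpha> p\<bar> \<le> R - 1 \<and> \<bar>t * \<beta> p\<bar> \<le> R - 1" if "p \<in> P N" "t \<in> {\<tau>\<^sub>1..\<tau>\<^sub>2}" for p t N
  proof -
    have "p \<in> F" using PF(1)[of N] that(1) by blast
    then have b: "\<bar>\<alpha> p\<bar> \<le> M" "\<bar>\<beta> p\<bar> \<le> M" using bd(1) by auto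
    have "\<bar>t * \<beta> p\<bar> \<le> M\<^sup>2" unfolding abs_mult power2_eq_square using b tM[OF that(2)] M0 by (intro mult_mono) auto
    then show ?thesis using b RM by linarith
  qed
  \<comment> \<open>A double role: the cutoff interval [-\<Lambda>, \<Lambda>] exceeds the box by
    one unit on each side, and \<Lambda> bounds \<open>\<bar>a\<bar>\<close> on it, as the
    transversality of lines needs.\<close>
  define \<Lambda> where "\<Lambda> = H + 1"
  have \<Lambda>: "1 \<le> \<Lambda>" using M0 M2 by (simp add: \<Lambda>_def H_def R_def)
  have H0: "-\<Lambda> < -H" "-H \<le> H" "H < \<Lambda>" using M0 M2 by (auto simp: \<Lambda>_def H_def R_def)
  define T0 where "T0 = 4 * tube_const (\<Lambda> - - \<Lambda>) 1 \<Lambda> 2 (M + 2) * C / ((1 - 2 powr (s - 2)) * ((- H - - \<Lambda>) * (\<Lambda> - H)))"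
  have "2 powr (s - 2) < (1 :: real)" using s by (simp add: powr_less_one)
  moreover have "tube_const (\<Lambda> - - \<Lambda>) 1 \<Lambda> 2 (M + 2) \<ge> 0"
    unfolding tube_const_def using \<Lambda> M0 by (intro add_nonneg_nonneg mult_nonneg_nonneg) auto
  ultimately have T0: "T0 \<ge> 0" unfolding T0_def using H0 C by (intro divide_nonneg_nonneg mult_nonneg_nonneg) auto
  define X0 where "X0 = sqrt (4 * C * W * (1/2) powr (s - 2) + 1)"
  define Y0 where "Y0 = sqrt (T0 * W + 1)"
  have X0: "X0 > 0" "X0\<^sup>2 = 4 * C * W * (1/2) powr (s - 2) + 1"
  proof -
    have "4 * C * W * (1/2) powr (s - 2) + 1 > 0" using C W by (intro add_nonneg_pos mult_nonneg_nonneg) auto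
    then show "X0 > 0" "X0\<^sup>2 = 4 * C * W * (1/2) powr (s - 2) + 1" by (auto simp: X0_def)
  qed
  have Y0: "Y0 > 0" "Y0\<^sup>2 = T0 * W + 1"
  proof -
    have "T0 * W + 1 > 0" using T0 W by (intro add_nonneg_pos mult_nonneg_nonneg) auto
    then show "Y0 > 0" "Y0\<^sup>2 = T0 * W + 1" by (auto simp: Y0_def)
  qed
  define q where "q = (1/2 :: real) powr ((2 * s - 3) / 2)"
  have q: "0 \<le> q" "q < 1" using s by (auto simp: q_def powr01_less_one)
  have step: "\<bar>Fn N n t - Fn N (Suc n) t\<bar> \<le> X0 * Y0 * q ^ n" if n: "n < N" and t: "t \<in> {\<tau>\<^sub>1..\<tau>\<^sub>2}" for N n t
  proof -
    define \<delta> where "\<delta> = (1/2 :: real) ^ n"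
    have d: "0 < \<delta>" "\<delta> \<le> 1" using pw[of n] by (simp_all add: \<delta>_def)
    have dS: "(1/2 :: real) ^ Suc n = \<delta> / 2" by (simp add: \<delta>_def)
    have dN: "(1/2 :: real) ^ N \<le> \<delta> / 2" "(1/2 :: real) ^ N \<le> \<delta>"
    proof -
      have "(1/2 :: real) ^ N \<le> (1/2) ^ Suc n" using n by (intro power_decreasing) auto
      then show "(1/2 :: real) ^ N \<le> \<delta> / 2" unfolding dS .
      then show "(1/2 :: real) ^ N \<le> \<delta>" using d by linarith
    qed
    define U where "U z = (\<Sum>q\<in>Q N. v N q * coarse_kernel \<delta> (x q) (y q - fst z * x q - snd z))" for z :: "real \<times> real"
    have xM: "\<bar>x q\<bar> \<le> M" if "q \<in> Q N" for q using bd(2)[of q] PF(2)[of N] that by blast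
    have cU: "continuous_on \<B> U" unfolding U_def
      by (intro continuous_intros continuous_on_compose2[OF coarse_kernel_properties(2)[OF d(1) xM]]) auto
    have eq: "Fn N n t - Fn N (Suc n) t = integral \<B> (\<lambda>z. S N (Suc n) t z * U z)"
      unfolding Fn_def S_def T_def dS U_def \<delta>_def[symmetric] \<B>_def
      by (rule spots_tube_scale_diff[OF d bP[OF _ t]]) (simp_all add: H_def)
    define Xn where "Xn = X0 * \<delta> powr ((s - 2) / 2)"
    define Yn where "Yn = Y0 * \<delta> powr ((s - 1) / 2)"
    have XY: "Xn > 0" "Yn > 0" using X0 Y0 d by (simp_all add: Xn_def Yn_def)
    have sq: "(\<delta> powr (e / 2))\<^sup>2 = \<delta> powr e" for e by (simp add: power2_eq_square flip: powr_add)
    have "integral \<B> (\<lambda>z. \<bar>S N (Suc n) t z * U z\<bar>) \<le> Xn * Yn"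
      unfolding \<B>_def
    proof (rule integral_Cauchy_Schwarz[OF cS cU[unfolded \<B>_def] _ XY(1) _ XY(2)])
      have "integral (cbox (-H, -H) (H, H)) (\<lambda>z. (S N (Suc n) t z)\<^sup>2) \<le> 4 * C * W * (\<delta>/2) powr (s - 2)"
        unfolding S_def dS
      proof (rule spots_L2[OF spP[OF t] _ dN(1) cW(2) C])
        fix p assume "p \<in> P N"
        from bP[OF this t] show "\<bar>\<alpha> p\<bar> + \<delta> / 2 \<le> H \<and> \<bar>t * \<beta> p\<bar> + \<delta> / 2 \<le> H" using d unfolding H_def by linarith
      qed (use d in simp)
      also have "(\<delta>/2) powr (s - 2) = (1/2) powr (s - 2) * \<delta> powr (s - 2)"
        using d by (simp add: powr_mult[symmetric])
      also have "4 * C * W * ((1/2) powr (s - 2) * \<delta> powr (s - 2)) \<le> (4 * C * W * (1/2) powr (s - 2) + 1) * \<delta> powr (s - 2)"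
        by (simp add: algebra_simps)
      also have "\<dots> = Xn\<^sup>2" by (simp add: Xn_def power_mult_distrib X0 sq)
      finally show "integral (cbox (-H, -H) (H, H)) (\<lambda>z. (S N (Suc n) t z)\<^sup>2) \<le> Xn\<^sup>2" .
      obtain g1 g2 where gg: "\<And>a p. a \<in> {-\<Lambda>..\<Lambda>} \<Longrightarrow> p \<in> Q N \<Longrightarrow> ((\<lambda>a. a * x p) has_real_derivative g1 a p) (at a)"
         "\<And>a p. a \<in> {-\<Lambda>..\<Lambda>} \<Longrightarrow> p \<in> Q N \<Longrightarrow> ((\<lambda>a. g1 a p) has_real_derivative g2 a p) (at a)"
         "\<And>a p q. a \<in> {-\<Lambda>..\<Lambda>} \<Longrightarrow> p \<in> Q N \<Longrightarrow> q \<in> Q N \<Longrightarrow> \<bar>a * x p - a * x q\<bar> \<le> \<Lambda> * \<bar>x p - x q\<bar>"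
         "\<And>a p q. a \<in> {-\<Lambda>..\<Lambda>} \<Longrightarrow> p \<in> Q N \<Longrightarrow> q \<in> Q N \<Longrightarrow> 1 * \<bar>x p - x q\<bar> \<le> \<bar>g1 a p - g1 a q\<bar>"
         "\<And>a p q. a \<in> {-\<Lambda>..\<Lambda>} \<Longrightarrow> p \<in> Q N \<Longrightarrow> q \<in> Q N \<Longrightarrow> \<bar>g2 a p - g2 a q\<bar> \<le> \<Lambda> * \<bar>x p - x q\<bar>"
      proof (rule transversalE[OF linear_transversal[of "-\<Lambda>" \<Lambda> \<Lambda> "Q N" x]], goal_cases)
        case (3 g1 g2)
        show ?case using 3(2-6) by (rule 3(1))
      qed (use \<Lambda> in auto)
      have "integral (cbox (-H, -H) (H, H)) (\<lambda>(a, b). (\<Sum>p\<in>Q N. v N p * coarse_kernel \<delta> (x p) (y p - a * x p - b))\<^sup>2)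
        \<le> T0 * sum (v N) (Q N) * \<delta> powr (s - 1)"
        unfolding T0_def
      proof (rule tube_L2_bound[OF spQ s(2) d(1) dN(2) C H0 zero_less_one \<Lambda> _ _ gg, where \<Psi> = "\<lambda>p. coarse_kernel_int \<delta> (x p)"])
        fix q r assume q: "q \<in> Q N"
        note ck = coarse_kernel_properties[OF d(1) xM[OF q]]
        show "(coarse_kernel_int \<delta> (x q) has_real_derivative coarse_kernel \<delta> (x q) r) (at r)" by (rule ck(1))
        show "continuous_on UNIV (coarse_kernel \<delta> (x q))" by (rule ck(2))
        show "\<bar>coarse_kernel_int \<delta> (x q) r\<bar> \<le> 2" "\<bar>coarse_kernel \<delta> (x q) r\<bar> \<le> 2 / \<delta>" by (rule ck)+
        assume "(M + 2) * \<delta> \<le> \<bar>r\<bar>"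
        then show "coarse_kernel_int \<delta> (x q) r = 0" "coarse_kernel \<delta> (x q) r = 0" by (rule ck)+
      qed (use M0 in auto)
      also have "\<dots> \<le> (T0 * W + 1) * \<delta> powr (s - 1)"
        using mult_left_mono[OF cW(4)[of N] T0] by (intro mult_right_mono) auto
      also have "\<dots> = Yn\<^sup>2" by (simp add: Yn_def power_mult_distrib Y0 sq)
      also have "(\<lambda>(a, b). (\<Sum>p\<in>Q N. v N p * coarse_kernel \<delta> (x p) (y p - a * x p - b))\<^sup>2) = (\<lambda>z. (U z)\<^sup>2)"
        by (simp add: fun_eq_iff U_def)
      finally show "integral (cbox (-H, -H) (H, H)) (\<lambda>z. (U z)\<^sup>2) \<le> Yn\<^sup>2" .
    qed
    moreover have "\<bar>integral \<B> (\<lambda>z. S N (Suc n) t z * U z)\<bar> \<le> integral \<B> (\<lambda>z. \<bar>S N (Suc n) t z * U z\<bar>)"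
      unfolding \<B>_def by (rule integral_le_norm_bound; (intro continuous_intros cS cU[unfolded \<B>_def])?) simp
    moreover have "Xn * Yn = X0 * Y0 * q ^ n"
    proof -
      have "\<delta> powr ((s - 2) / 2) * \<delta> powr ((s - 1) / 2) = q ^ n"
        unfolding q_def half_power_powr[symmetric] \<delta>_def powr_add[symmetric] by (rule arg_cong[where f = "(powr) _"]) (simp add: field_simps)
      then show ?thesis by (simp add: Xn_def Yn_def mult_ac)
    qed
    ultimately show ?thesis unfolding eq by linarith
  qed
  have lipF: "\<exists>L\<ge>0. \<forall>N\<ge>n. \<forall>t\<in>{\<tau>\<^sub>1..\<tau>\<^sub>2}. \<forall>t'\<in>{\<tau>\<^sub>1..\<tau>\<^sub>2}. \<bar>Fn N n t - Fn N n t'\<bar> \<le> L * \<bar>t - t'\<bar>" for n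
  proof -
    define \<delta> where "\<delta> = (1/2 :: real) ^ n"
    have \<delta>: "\<delta> > 0" by (simp add: \<delta>_def)
    define L where "L = (W * M / \<delta> ^ 3) * (W / \<delta>) * Henstock_Kurzweil_Integration.content \<B>"
    have L0: "L \<ge> 0" unfolding L_def using W M0 \<delta> by (intro mult_nonneg_nonneg) auto
    have "\<bar>Fn N n t - Fn N n t'\<bar> \<le> L * \<bar>t - t'\<bar>" for N t t'
    proof -
      have "Fn N n t - Fn N n t' = integral \<B> (\<lambda>z. S N n t z * T N n z - S N n t' z * T N n z)"
        unfolding Fn_def \<B>_def by (rule integral_diff[symmetric]) (intro integrable_continuous continuous_intros cS cT)+
      also have "\<bar>\<dots>\<bar> \<le> integral \<B> (\<lambda>z. (W * (\<bar>t - t'\<bar> * M) / \<delta> ^ 3) * (W / \<delta>))"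
        unfolding \<B>_def
      proof (rule integral_le_norm_bound)
        fix z
        have "\<bar>S N n t z - S N n t' z\<bar> \<le> W * (\<bar>t - t'\<bar> * M) / \<delta> ^ 3"
          unfolding S_def \<delta>_def
        proof (rule spots_lipschitz[OF pw(1) w0 cW(2)])
          fix p assume "p \<in> P N"
          then have "\<bar>\<beta> p\<bar> \<le> M" using bd(1) PF(1)[of N] by blast
          then show "\<bar>t * \<beta> p - t' * \<beta> p\<bar> \<le> \<bar>t - t'\<bar> * M"
            by (simp add: abs_mult mult_left_mono flip: left_diff_distrib)
        qed (use M0 in auto)
        moreover have "\<bar>T N n z\<bar> \<le> W / \<delta>" unfolding T_def \<delta>_def by (rule tube_le_total[OF pw(1) v0 cW(4)])
        ultimately have "\<bar>S N n t z - S N n t' z\<bar> * \<bar>T N n z\<bar> \<le> (W * (\<bar>t - t'\<bar> * M) / \<delta> ^ 3) * (W / \<delta>)"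
          using W M0 \<delta> by (intro mult_mono) auto
        then show "\<bar>S N n t z * T N n z - S N n t' z * T N n z\<bar> \<le> (W * (\<bar>t - t'\<bar> * M) / \<delta> ^ 3) * (W / \<delta>)"
          by (simp add: abs_mult flip: left_diff_distrib)
      qed (intro continuous_intros cS cT)+
      also have "\<dots> = L * \<bar>t - t'\<bar>" by (simp add: L_def \<B>_def)
      finally show ?thesis .
    qed
    then show ?thesis using L0 by blast
  qed
  define c' where "c' = c\<^sup>2 / (16 * (2 * M + 1) ^ 3 * (\<tau>'' - \<tau>' + 1))"
  have c': "c' > 0" using c M0 \<tau> by (simp add: c'_def)
  have pos: "\<exists>t\<in>{\<tau>'..\<tau>''}. c' \<le> Fn N N t" for N
    unfolding c'_def Fn_def S_def T_def \<B>_def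
  proof (rule spots_tube_mass[OF finP finQ w0 v0 c cW(1) cW(3)])
    show "\<bar>\<alpha> p\<bar> \<le> M \<and> \<bar>\<beta> p\<bar> \<le> M" if "p \<in> P N" for p using that bd(1) PF(1)[of N] by blast
    show "\<bar>x q\<bar> \<le> M" if "q \<in> Q N" for q using that bd(2) PF(2)[of N] by blast
    show "\<bar>t\<bar> \<le> M" if "t \<in> {\<tau>'..\<tau>''}" for t using that tM[of t] \<tau> by simp
    show "\<exists>t\<in>{\<tau>'..\<tau>''}. y q = \<alpha> p * x q + t * \<beta> p" if "p \<in> P N" "q \<in> Q N" for p q
      using sol[of p q] that PF(1)[of N] PF(2)[of N] by blast
  qed (use pw in \<open>auto simp: H_def R_def\<close>)
  have XY0: "X0 * Y0 \<ge> 0" using X0 Y0 by simp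
  obtain t1 t2 where t: "t1 < t2" "{t1<..<t2} \<subseteq> {\<tau>\<^sub>1..\<tau>\<^sub>2}" "\<forall>t\<in>{t1<..<t2}. \<exists>\<^sub>\<infinity>N. Fn N N t > 0"
    using multiscale_positive_interval[where F = Fn and n\<^sub>0 = 0 and \<alpha> = \<tau>\<^sub>1 and \<beta> = \<tau>\<^sub>2 and q = q and K = "X0 * Y0", OF q XY0 step lipF pos c' \<tau>(1,3)]
    by blast
  have hit: "\<exists>p\<in>F. \<exists>q\<in>G. \<bar>y q - \<alpha> p * x q - t * \<beta> p\<bar> \<le> (M + 2) * (1/2) ^ N" if "Fn N N t > 0" for N t
  proof -
    define \<delta> where "\<delta> = (1/2 :: real) ^ N"
    have \<delta>: "\<delta> > 0" by (simp add: \<delta>_def)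
    have "\<exists>z. S N N t z * T N N z \<noteq> 0"
    proof (rule ccontr)
      assume "\<not> ?thesis"
      then have "Fn N N t = integral \<B> (\<lambda>z. 0)" unfolding Fn_def by (intro integral_cong) auto
      then show False using that by simp
    qed
    then obtain z where z: "S N N t z \<noteq> 0" "T N N z \<noteq> 0" by auto
    obtain q where qQ: "q \<in> Q N" "\<bar>y q - fst z * x q - snd z\<bar> \<le> \<delta>"
      using tube_pos_obtains[OF pw(1) z(2)[unfolded T_def]] unfolding \<delta>_def by blast
    have "\<exists>p\<in>P N. bump \<delta> (\<alpha> p - fst z) \<noteq> 0 \<and> bump \<delta> (t * \<beta> p - snd z) \<noteq> 0"
    proof (rule ccontr)
      assume "\<not> ?thesis"
      then have "S N N t z = 0" unfolding S_def spots_def \<delta>_def[symmetric] by (intro sum.neutral ballI) auto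
      then show False using z by simp
    qed
    then obtain p where p: "p \<in> P N" "bump \<delta> (\<alpha> p - fst z) \<noteq> 0" "bump \<delta> (t * \<beta> p - snd z) \<noteq> 0" by blast
    have pb: "\<bar>\<alpha> p - fst z\<bar> \<le> \<delta>" "\<bar>t * \<beta> p - snd z\<bar> \<le> \<delta>" using p bump_zero[OF \<delta>] by (meson linear)+
    have pF: "p \<in> F" "q \<in> G" using PF(1)[of N] PF(2)[of N] p(1) qQ(1) by blast+
    \<comment> \<open>The dual point of \<open>p\<close> and the line of \<open>q\<close> are both
      \<delta>-close to \<open>z\<close>; replacing \<open>z\<close> by the dual point costs
      \<open>\<delta> * M\<close> in slope and \<delta> in height, hence the factor
      \<open>M + 2\<close>.\<close>
    have "y q - \<alpha> p * x q - t * \<beta> p = (y q - fst z * x q - snd z) - (\<alpha> p - fst z) * x q - (t * \<beta> p - snd z)"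
      by (simp add: algebra_simps)
    moreover have "\<bar>(\<alpha> p - fst z) * x q\<bar> \<le> \<delta> * M" unfolding abs_mult using pb(1) bd(2)[OF pF(2)] \<delta> by (intro mult_mono) auto
    moreover have "(M + 2) * \<delta> = \<delta> * M + \<delta> + \<delta>" by (simp add: algebra_simps)
    ultimately have "\<bar>y q - \<alpha> p * x q - t * \<beta> p\<bar> \<le> (M + 2) * \<delta>" using pb(2) qQ(2) by linarith
    then show ?thesis using pF unfolding \<delta>_def by blast
  qed
  have "\<exists>\<^sub>\<infinity>N. \<exists>p\<in>F. \<exists>q\<in>G. \<bar>y q - \<alpha> p * x q - t * \<beta> p\<bar> \<le> (M + 2) * (1/2) ^ N" if "t \<in> {t1<..<t2}" for t
    by (rule INFM_mono[OF t(3)[rule_format, OF that]]) (rule hit)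
  then show ?thesis using t(1,2) by (intro exI[of _ t1] exI[of _ t2] conjI ballI)
qed

section \<open>Determinants as incidences of points and lines\<close>

lemma det2_eq: "det2 u v = u $ 1 * v $ 2 - v $ 1 * u $ 2"
  by (simp add: det2_def det_2)

text \<open>Where the first coordinate of \<open>p - z2\<close> does not vanish, a determinant equal
  to \<open>t\<close> is the linear relation Y q = \<alpha> p * X q + t * \<beta> p. Thus the point
  (\<alpha> p, t * \<beta> p) lies on the line b = Y q - a * X q. The third vertex can remain at
  \<open>z2\<close> throughout.\<close>

lemma pinned_area_interval:
  fixes E :: "(real^2) set"
  assumes E: "compact E" and s: "3/2 < s" "s < 2" and z2: "z2 \<in> E"
    and fat: "\<And>\<eta>. \<eta> > 0 \<Longrightarrow> \<not> hnull s (E \<inter> ball z0 \<eta>)" "\<And>\<eta>. \<eta> > 0 \<Longrightarrow> \<not> hnull s (E \<inter> ball z1 \<eta>)"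
    and nz: "(z0 - z2) $ 1 \<noteq> 0" "det2 (z0 - z2) (z1 - z2) \<noteq> 0"
  shows "\<exists>a b. a < b \<and> (\<forall>t\<in>{a<..<b}. \<exists>x\<in>E. \<exists>y\<in>E. det2 (x - z2) (y - z2) = t)"
proof -
  define X where "X p = (p - z2) $ 1" for p
  define Y where "Y p = (p - z2) $ 2" for p
  define D where "D p q = X p * Y q - X q * Y p" for p q
  have D: "det2 (p - z2) (q - z2) = D p q" for p q by (simp add: det2_eq D_def X_def Y_def)
  define t\<^sub>0 where "t\<^sub>0 = D z0 z1"
  \<comment> \<open>A quarter of the central value: parameters within \<open>2 * \<tau>\<close> of
    \<open>t\<^sub>0\<close> then satisfy \<open>\<bar>t\<bar> \<ge> 2 * \<tau>\<close>, so the
    second dual coordinate does not degenerate.\<close>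
  define \<tau> where "\<tau> = \<bar>t\<^sub>0\<bar> / 4"
  have \<tau>: "\<tau> > 0" "4 * \<tau> = \<bar>t\<^sub>0\<bar>" using nz(2) by (simp_all add: \<tau>_def t\<^sub>0_def D)
  define \<kappa> where "\<kappa> = \<bar>X z0\<bar> / 2"
  have \<kappa>: "\<kappa> > 0" "2 * \<kappa> = \<bar>X z0\<bar>" using nz(1) by (simp_all add: \<kappa>_def X_def)
  define R where "R = 1 + \<bar>X z0\<bar> + \<bar>Y z0\<bar> + \<bar>X z1\<bar> + \<bar>Y z1\<bar>"
  have R: "R \<ge> 1" by (simp add: R_def)
  \<comment> \<open>\<kappa> keeps the first coordinate of points near \<open>z0\<close> away from
    0; the last entry bounds the variation of the determinant, four terms of size
    \<open>R * \<eta>\<close>, by \<tau>.\<close>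
  define \<eta> where "\<eta> = Min {1/2, \<kappa>, \<tau> / (4 * R)}"
  have \<eta>: "0 < \<eta>" "\<eta> \<le> 1/2" "\<eta> \<le> \<kappa>" "\<eta> \<le> \<tau> / (4 * R)" using \<tau> \<kappa> R by (auto simp: \<eta>_def)
  have \<eta>R: "4 * (R * \<eta>) \<le> \<tau>" using \<eta>(4) R by (simp add: field_simps)
  have Xd: "\<bar>X p - X q\<bar> \<le> dist p q" and Yd: "\<bar>Y p - Y q\<bar> \<le> dist p q" for p q
    using component_le_norm_cart[of "p - q"] by (simp_all add: X_def Y_def dist_norm)
  have dXY: "dist p q \<le> \<bar>X p - X q\<bar> + \<bar>Y p - Y q\<bar>" for p q
    using dist_real2_le[of p q] by (simp add: X_def Y_def)
  define F where "F = E \<inter> cball z0 \<eta>"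
  define G where "G = E \<inter> cball z1 \<eta>"
  have Fb: "\<bar>X p\<bar> \<le> R" "\<bar>Y p\<bar> \<le> R" "\<kappa> \<le> \<bar>X p\<bar>" "\<bar>X p - X z0\<bar> \<le> \<eta>" "\<bar>Y p - Y z0\<bar> \<le> \<eta>" if "p \<in> F" for p
  proof -
    have "dist p z0 \<le> \<eta>" using that by (simp add: F_def dist_commute)
    then show a: "\<bar>X p - X z0\<bar> \<le> \<eta>" "\<bar>Y p - Y z0\<bar> \<le> \<eta>" using Xd[of p z0] Yd[of p z0] by linarith+
    show "\<bar>X p\<bar> \<le> R" "\<bar>Y p\<bar> \<le> R" "\<kappa> \<le> \<bar>X p\<bar>" using a \<eta> \<kappa>(2) unfolding R_def by linarith+
  qed
  have Gb: "\<bar>X p\<bar> \<le> R" "\<bar>Y p\<bar> \<le> R" "\<bar>X p - X z1\<bar> \<le> \<eta>" "\<bar>Y p - Y z1\<bar> \<le> \<eta>" if "p \<in> G" for p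
  proof -
    have "dist p z1 \<le> \<eta>" using that by (simp add: G_def dist_commute)
    then show a: "\<bar>X p - X z1\<bar> \<le> \<eta>" "\<bar>Y p - Y z1\<bar> \<le> \<eta>" using Xd[of p z1] Yd[of p z1] by linarith+
    show "\<bar>X p\<bar> \<le> R" "\<bar>Y p\<bar> \<le> R" using a \<eta> unfolding R_def by linarith+
  qed
  have X0: "X p \<noteq> 0" if "p \<in> F" for p using Fb(3)[OF that] \<kappa> by auto
  have Dr: "\<bar>D p q - t\<^sub>0\<bar> \<le> \<tau>" if p: "p \<in> F" and q: "q \<in> G" for p q
  proof -
    have "D p q - t\<^sub>0 = X p * (Y q - Y z1) + (X p - X z0) * Y z1 - (X q * (Y p - Y z0) + (X q - X z1) * Y z0)"
      by (simp add: D_def t\<^sub>0_def algebra_simps)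
    moreover have "\<bar>X p * (Y q - Y z1)\<bar> \<le> R * \<eta>" "\<bar>X q * (Y p - Y z0)\<bar> \<le> R * \<eta>"
      unfolding abs_mult by (rule mult_mono[OF Fb(1)[OF p] Gb(4)[OF q]] mult_mono[OF Gb(1)[OF q] Fb(5)[OF p]]; use R in simp)+
    moreover have "\<bar>Y z1\<bar> \<le> R" "\<bar>Y z0\<bar> \<le> R" unfolding R_def by linarith+
    then have "\<bar>(X p - X z0) * Y z1\<bar> \<le> \<eta> * R" "\<bar>(X q - X z1) * Y z0\<bar> \<le> \<eta> * R"
      unfolding abs_mult by (intro mult_mono[OF Fb(4)[OF p]] mult_mono[OF Gb(3)[OF q]]; use \<eta>(1) in simp)+
    ultimately show ?thesis using \<eta>R by (simp add: mult.commute[of \<eta>])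
  qed
  define \<alpha> where "\<alpha> p = Y p / X p" for p
  define \<beta> where "\<beta> p = 1 / X p" for p
  have lin: "Y q = \<alpha> p * X q + D p q * \<beta> p" if "p \<in> F" for p q
    using X0[OF that] by (simp add: \<alpha>_def \<beta>_def D_def field_simps)
  \<comment> \<open>A common bound for the dual coordinates, the slopes and the parameters;
    \<open>6 * \<tau>\<close> is \<open>\<bar>t\<^sub>0\<bar> + 2 * \<tau>\<close>.\<close>
  define M where "M = R / \<kappa> + 1 / \<kappa> + R + 6 * \<tau>"
  have M: "R / \<kappa> \<le> M" "1 / \<kappa> \<le> M" "R \<le> M" "6 * \<tau> \<le> M" "0 \<le> M"
    using R \<kappa> \<tau> unfolding M_def by auto
  have bd: "\<bar>\<alpha> p\<bar> \<le> M" "\<bar>\<beta> p\<bar> \<le> M" if p: "p \<in> F" for p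
  proof -
    have "\<bar>\<alpha> p\<bar> \<le> R / \<kappa>" unfolding \<alpha>_def abs_divide using Fb[OF p] \<kappa> R by (intro frac_le) auto
    moreover have "\<bar>\<beta> p\<bar> \<le> 1 / \<kappa>" unfolding \<beta>_def abs_divide using Fb[OF p] \<kappa> by (intro frac_le) auto
    ultimately show "\<bar>\<alpha> p\<bar> \<le> M" "\<bar>\<beta> p\<bar> \<le> M" using M by linarith+
  qed
  have tt: "2 * \<tau> \<le> \<bar>t\<bar>" "\<bar>t\<bar> \<le> M" if "t \<in> {t\<^sub>0 - 2 * \<tau>..t\<^sub>0 + 2 * \<tau>}" for t
    using that \<tau> M by auto
  define K where "K = R\<^sup>2 / (2 * \<tau>)"
  have K: "K \<ge> 0" using \<tau> by (simp add: K_def)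
  define L where "L = K + M * K + R + 2"
  have L: "L \<ge> 2" using K M R by (simp add: L_def)
  \<comment> \<open>A Lipschitz inverse of p -> (\<alpha> p, t * \<beta> p), uniform in
    \<open>t\<close>: the second coordinate determines \<open>X p\<close>, as
    \<open>\<bar>t\<bar>\<close> is bounded below and \<open>X\<close> above, and then Y p =
    \<alpha> p * X p.\<close>
  have LP: "dist p q \<le> L * max \<bar>\<alpha> p - \<alpha> q\<bar> \<bar>t * \<beta> p - t * \<beta> q\<bar>"
    if p: "p \<in> F" and q: "q \<in> F" and t: "t \<in> {t\<^sub>0 - 2 * \<tau>..t\<^sub>0 + 2 * \<tau>}" for p q t
  proof -
    define m where "m = max \<bar>\<alpha> p - \<alpha> q\<bar> \<bar>t * \<beta> p - t * \<beta> q\<bar>"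
    have m: "\<bar>\<alpha> p - \<alpha> q\<bar> \<le> m" "\<bar>t * \<beta> p - t * \<beta> q\<bar> \<le> m" "m \<ge> 0" by (auto simp: m_def)
    have "(2 * \<tau>) * \<bar>X p - X q\<bar> \<le> \<bar>t\<bar> * \<bar>X p - X q\<bar>" using tt[OF t] by (intro mult_right_mono) auto
    also have "\<dots> = \<bar>X p\<bar> * \<bar>X q\<bar> * \<bar>t * \<beta> p - t * \<beta> q\<bar>"
    proof -
      have "X p * X q * (t * \<beta> p - t * \<beta> q) = - (t * (X p - X q))"
        using X0[OF p] X0[OF q] by (simp add: \<beta>_def field_simps)
      then show ?thesis by (metis abs_minus_cancel abs_mult)
    qed
    also have "\<dots> \<le> R * R * m"
    proof (rule mult_mono)
      show "\<bar>X p\<bar> * \<bar>X q\<bar> \<le> R * R" using R by (intro mult_mono Fb(1) p q) auto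
    qed (use m R in simp_all)
    finally have dX: "\<bar>X p - X q\<bar> \<le> K * m" using \<tau> by (simp add: K_def field_simps power2_eq_square)
    have "Y p - Y q = \<alpha> p * (X p - X q) + (\<alpha> p - \<alpha> q) * X q"
      using X0[OF p] X0[OF q] by (simp add: \<alpha>_def field_simps)
    moreover have "\<bar>\<alpha> p * (X p - X q)\<bar> \<le> M * (K * m)" unfolding abs_mult using bd[OF p] dX M by (intro mult_mono) auto
    moreover have "\<bar>(\<alpha> p - \<alpha> q) * X q\<bar> \<le> m * R" unfolding abs_mult using m Fb[OF q] by (intro mult_mono) auto
    ultimately have "\<bar>Y p - Y q\<bar> \<le> M * (K * m) + m * R" by linarith
    then have "dist p q \<le> K * m + (M * (K * m) + m * R)" using dX dXY[of p q] by linarith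
    also have "\<dots> \<le> L * m" using m by (simp add: L_def algebra_simps)
    finally show ?thesis by (simp add: m_def)
  qed
  have LQ: "dist p q \<le> L * max \<bar>X p - X q\<bar> \<bar>Y p - Y q\<bar>" for p q
  proof -
    have "dist p q \<le> 2 * max \<bar>X p - X q\<bar> \<bar>Y p - Y q\<bar>" 
      using dXY[of p q] max.cobounded1[of "\<bar>X p - X q\<bar>" "\<bar>Y p - Y q\<bar>"] max.cobounded2[of "\<bar>Y p - Y q\<bar>" "\<bar>X p - X q\<bar>"] by linarith
    also have "\<dots> \<le> L * max \<bar>X p - X q\<bar> \<bar>Y p - Y q\<bar>" using L by (intro mult_right_mono) auto
    finally show ?thesis .
  qed
  define S where "S i = (if i = 0 then F else G)" for i :: nat
  have nn: "\<not> hnull s (S i)" for i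
  proof
    assume "hnull s (S i)"
    moreover have "E \<inter> ball (if i = 0 then z0 else z1) \<eta> \<subseteq> S i" by (auto simp: S_def F_def G_def)
    ultimately have "hnull s (E \<inter> ball (if i = 0 then z0 else z1) \<eta>)" by (rule hnull_subset)
    then show False using fat[OF \<eta>(1)] by (simp split: if_splits)
  qed
  have sub: "S i \<subseteq> cball (if i = 0 then z0 else z1) (1/2)" for i
    using \<eta>(2) by (auto simp: S_def F_def G_def)
  have s0: "s > 0" using s by simp
  obtain c C P w where c: "c > 0" "C > 0" and PS: "\<And>i N. i < 2 \<Longrightarrow> P i N \<subseteq> S i"
    and fw: "\<And>i N. i < 2 \<Longrightarrow> frostman_weights (P i N) (w i N) s C N"
    and cW: "\<And>i N. i < 2 \<Longrightarrow> c \<le> sum (w i N) (P i N)" "\<And>i N. i < 2 \<Longrightarrow> sum (w i N) (P i N) \<le> C"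
  proof (rule frostman_family[where n = 2 and F = S, OF s0 _ nn sub], goal_cases)
    case (2 c C P w)
    show ?case using 2(2-7) by (rule 2(1))
  qed simp
  have PF: "P 0 N \<subseteq> F" "P 1 N \<subseteq> G" for N using PS[of 0 N] PS[of 1 N] by (simp_all add: S_def)
  have "\<exists>a b. a < b \<and> {a<..<b} \<subseteq> {t\<^sub>0 - 2 * \<tau>..t\<^sub>0 + 2 * \<tau>} \<and> (\<forall>t\<in>{a<..<b}. \<exists>\<^sub>\<infinity>N. \<exists>p\<in>F. \<exists>q\<in>G.
     \<bar>Y q - \<alpha> p * X q - t * \<beta> p\<bar> \<le> (M + 2) * (1/2) ^ N)"
  proof (rule spots_tube_interval[where P = "P 0" and Q = "P 1" and w = "w 0" and v = "w 1" and c = c and W = C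
        and C = "C * (2 * L) powr s" and \<tau>' = "t\<^sub>0 - \<tau>" and \<tau>'' = "t\<^sub>0 + \<tau>"])
    show "spread (P 0 N) (w 0 N) \<alpha> (\<lambda>p. t * \<beta> p) s (C * (2 * L) powr s) ((1/2) ^ N)"
      if "t \<in> {t\<^sub>0 - 2 * \<tau>..t\<^sub>0 + 2 * \<tau>}" for N t
    proof (rule spread_of_frostman_weights[OF fw])
      fix p q assume "p \<in> P 0 N" "q \<in> P 0 N"
      then have "p \<in> F" "q \<in> F" using PF(1)[of N] by blast+
      then show "dist p q \<le> L * max \<bar>\<alpha> p - \<alpha> q\<bar> \<bar>t * \<beta> p - t * \<beta> q\<bar>" using that by (rule LP)
    qed (use L c in auto)
    show "spread (P 1 N) (w 1 N) X Y s (C * (2 * L) powr s) ((1/2) ^ N)" for N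
      by (rule spread_of_frostman_weights[OF fw _ _ LQ]) (use L c in auto)
    show "\<exists>t\<in>{t\<^sub>0 - \<tau>..t\<^sub>0 + \<tau>}. Y q = \<alpha> p * X q + t * \<beta> p" if "p \<in> F" "q \<in> G" for p q
    proof (rule bexI[of _ "D p q"])
      show "D p q \<in> {t\<^sub>0 - \<tau>..t\<^sub>0 + \<tau>}" using Dr[OF that] by auto
    qed (rule lin[OF that(1)])
    show "\<bar>X q\<bar> \<le> M" if "q \<in> G" for q using Gb(1)[OF that] M(3) by linarith
    show "\<bar>\<alpha> p\<bar> \<le> M \<and> \<bar>\<beta> p\<bar> \<le> M" if "p \<in> F" for p using bd[OF that] by simp
    show "0 \<le> C * (2 * L) powr s" using c by simp
    show "c \<le> sum (w 0 N) (P 0 N)" "sum (w 0 N) (P 0 N) \<le> C" "c \<le> sum (w 1 N) (P 1 N)" "sum (w 1 N) (P 1 N) \<le> C" for N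
      by (rule cW; simp)+
  qed (fact s c PF tt(2) | use \<tau> in simp)+
  then obtain a b where ab: "a < b" and hit: "\<And>t. t \<in> {a<..<b} \<Longrightarrow> \<exists>\<^sub>\<infinity>N. \<exists>p\<in>F. \<exists>q\<in>G.
     \<bar>Y q - \<alpha> p * X q - t * \<beta> p\<bar> \<le> (M + 2) * (1/2) ^ N" by (elim exE conjE) (rule that, assumption, erule bspec)
  have "\<exists>x\<in>E. \<exists>y\<in>E. det2 (x - z2) (y - z2) = t" if t: "t \<in> {a<..<b}" for t
  proof -
    have "\<exists>pq\<in>F \<times> G. \<bar>Y (snd pq) - \<alpha> (fst pq) * X (snd pq) - t * \<beta> (fst pq)\<bar> = 0"
    proof (rule compact_approximate_zero)
      show "compact (F \<times> G)" unfolding F_def G_def by (intro compact_Times compact_Int_closed E closed_cball)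
      show "continuous_on (F \<times> G) (\<lambda>pq. \<bar>Y (snd pq) - \<alpha> (fst pq) * X (snd pq) - t * \<beta> (fst pq)\<bar>)"
        unfolding \<alpha>_def \<beta>_def using X0 unfolding X_def Y_def by (intro continuous_intros) auto
      show "\<exists>\<^sub>\<infinity>N. \<exists>pq\<in>F \<times> G. \<bar>Y (snd pq) - \<alpha> (fst pq) * X (snd pq) - t * \<beta> (fst pq)\<bar> \<le> (M + 2) * (1/2) ^ N"
        using hit[OF t] by (rule INFM_mono) force
    qed simp
    then obtain p q where pq: "p \<in> F" "q \<in> G" "Y q = \<alpha> p * X q + t * \<beta> p" by auto
    have "D p q * \<beta> p = t * \<beta> p" using lin[OF pq(1), of q] pq(3) by linarith
    then have "D p q = t" using X0[OF pq(1)] by (simp add: \<beta>_def)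
    then show ?thesis using pq(1,2) D by (auto simp: F_def G_def)
  qed
  then show ?thesis using ab by blast
qed

text \<open>The determinant is nonzero, so \<open>x - z\<close> and \<open>y - z\<close> cannot both
  have first coordinate 0; the roles of \<open>x\<close> and \<open>y\<close> are exchanged if
  needed.\<close>

lemma signed_area_interval:
  fixes E :: "(real^2) set"
  assumes E: "compact E" "3/2 < s" "s < 2" and z: "x \<in> E" "y \<in> E" "z \<in> E" "\<not> collinear {x, y, z}"
    and fat: "\<And>u \<eta>. u \<in> {x, y, z} \<Longrightarrow> \<eta> > 0 \<Longrightarrow> \<not> hnull s (E \<inter> ball u \<eta>)"
  shows "\<exists>a b. a < b \<and> (\<forall>t\<in>{a<..<b}. \<exists>u\<in>E. \<exists>v\<in>E. det2 (u - z) (v - z) = t)"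
proof -
  have "collinear {x, y, z} \<longleftrightarrow> collinear {z, x, y}" by (simp add: insert_commute)
  then have nz: "det2 (x - z) (y - z) \<noteq> 0" using z(4) unfolding collinear_real2_iff by (simp add: det2_eq)
  show ?thesis
  proof (cases "(x - z) $ 1 = 0")
    case False
    show ?thesis by (rule pinned_area_interval[OF E z(3) fat fat False nz]) auto
  next
    case True
    then have "(y - z) $ 1 \<noteq> 0" "det2 (y - z) (x - z) \<noteq> 0" using nz by (auto simp: det2_eq)
    then show ?thesis by (rule pinned_area_interval[OF E z(3) fat fat, rotated 4]) auto
  qed
qed

section \<open>From Hausdorff dimension to the two intervals\<close>

lemma not_hnull_of_hausdorff_dim:
  assumes "0 < s" "s < hausdorff_dim E"
  shows "\<not> hnull s E"
proof
  assume "hnull s E"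
  then have "hausdorff_measure s E = 0" by (rule hnull_imp_hausdorff_measure_0[OF assms(1)])
  then have "hausdorff_dim E \<le> s" unfolding hausdorff_dim_def using assms(1)
    by (intro cInf_lower) (auto intro: bdd_belowI[of _ 0])
  then show False using assms(2) by simp
qed

theorem theorem1p1:
  fixes E :: "(real^2) set"
  assumes "compact E"
    and "hausdorff_dim E > 5/3"
  shows "(\<exists>a b. a < b \<and> {a<..<b} \<subseteq>
            {\<bar>det2 (x - z) (y - z)\<bar> / 2 | x y z. x \<in> E \<and> y \<in> E \<and> z \<in> E})
       \<and> (\<exists>a b. a < b \<and> {a<..<b} \<subseteq>
            {r. \<exists>x y z c. x \<in> E \<and> y \<in> E \<and> z \<in> E \<and> \<not> collinear {x, y, z} \<and>
                 dist c x = r \<and> dist c y = r \<and> dist c z = r})"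
proof
  \<comment> \<open>The exponent must also stay below 2, where the geometric series over dyadic
    shells converges.\<close>
  have "5/3 < min 2 (hausdorff_dim E)" using assms(2) by simp
  then obtain s where "5/3 < s" "s < min 2 (hausdorff_dim E)" using dense by blast
  then have s: "5/3 < s" "s < 2" "3/2 < s" "1 < s" and nn: "\<not> hnull s E"
    using not_hnull_of_hausdorff_dim[of s E] by simp_all
  obtain x y z where xyz: "x \<in> E" "y \<in> E" "z \<in> E" "\<not> collinear {x, y, z}"
    and fat: "\<And>u \<eta>. u \<in> {x, y, z} \<Longrightarrow> \<eta> > 0 \<Longrightarrow> \<not> hnull s (E \<inter> ball u \<eta>)"
  proof (rule noncollinear_fat_points[OF s(4) compact_imp_bounded[OF assms(1)] nn], goal_cases)
    case (1 x y z)
    show ?case using 1(2-6) by (rule 1(1))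
  qed
  show "\<exists>a b. a < b \<and> {a<..<b} \<subseteq>
            {r. \<exists>x y z c. x \<in> E \<and> y \<in> E \<and> z \<in> E \<and> \<not> collinear {x, y, z} \<and>
                 dist c x = r \<and> dist c y = r \<and> dist c z = r}"
  proof (rule circumradii_interval[OF assms(1) s(1,2), where z = "(!) [x, y, z]"])
    show "\<not> hnull s (E \<inter> ball ([x, y, z] ! i) \<eta>)" if "i < 3" "\<eta> > 0" for i \<eta>
    proof -
      have "[x, y, z] ! i \<in> set [x, y, z]" using that(1) by (intro nth_mem) simp
      then show ?thesis using that(2) by (intro fat) auto
    qed
  qed (use xyz(4) in simp)
  have "\<exists>a b. a < b \<and> (\<forall>t\<in>{a<..<b}. \<exists>u\<in>E. \<exists>v\<in>E. det2 (u - z) (v - z) = t)"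
    by (rule signed_area_interval[OF assms(1) s(3,2) xyz fat])
  then obtain a b where ab: "a < b" "\<And>t. t \<in> {a<..<b} \<Longrightarrow> \<exists>u\<in>E. \<exists>v\<in>E. det2 (u - z) (v - z) = t"
    by (elim exE conjE) (rule that, assumption, erule bspec)
  have area: "\<exists>x y z. r = \<bar>det2 (x - z) (y - z)\<bar> / 2 \<and> x \<in> E \<and> y \<in> E \<and> z \<in> E"
    if t: "t \<in> {a<..<b}" "\<bar>t\<bar> = 2 * r" for r t
  proof -
    obtain u v where "u \<in> E" "v \<in> E" "det2 (u - z) (v - z) = t" using ab(2)[OF t(1)] by blast
    then show ?thesis using t(2) xyz(3) by (intro exI[of _ u] exI[of _ v] exI[of _ z]) auto
  qed
  show "\<exists>a b. a < b \<and> {a<..<b} \<subseteq> {\<bar>det2 (x - z) (y - z)\<bar> / 2 | x y z. x \<in> E \<and> y \<in> E \<and> z \<in> E}"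
  \<comment> \<open>The interval of signed determinants may contain 0 or be negative: if it has a
    positive part, that part is halved, otherwise its reflection is.\<close>
  proof (cases "b > 0")
    case True
    have "{max a 0 / 2<..<b / 2} \<subseteq> {\<bar>det2 (x - z) (y - z)\<bar> / 2 | x y z. x \<in> E \<and> y \<in> E \<and> z \<in> E}"
    proof
      fix r assume "r \<in> {max a 0 / 2<..<b / 2}"
      then show "r \<in> {\<bar>det2 (x - z) (y - z)\<bar> / 2 | x y z. x \<in> E \<and> y \<in> E \<and> z \<in> E}"
        unfolding mem_Collect_eq by (intro area[of "2 * r"]) auto
    qed
    moreover have "max a 0 / 2 < b / 2" using True ab(1) by simp
    ultimately show ?thesis by blast
  next
    case False
    have "{- b / 2<..<- a / 2} \<subseteq> {\<bar>det2 (x - z) (y - z)\<bar> / 2 | x y z. x \<in> E \<and> y \<in> E \<and> z \<in> E}"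
    proof
      fix r assume "r \<in> {- b / 2<..<- a / 2}"
      then show "r \<in> {\<bar>det2 (x - z) (y - z)\<bar> / 2 | x y z. x \<in> E \<and> y \<in> E \<and> z \<in> E}"
        unfolding mem_Collect_eq using False by (intro area[of "- 2 * r"]) auto
    qed
    moreover have "- b / 2 < - a / 2" using ab(1) by simp
    ultimately show ?thesis by blast
  qed
qed

end
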